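(* Let $K$ be a Noetherian ring, let $B$ be a reduced and nice $\mathbf{FI}$-algebra that is finitely generated in width $\le 1$ over $K$, assume that $1\ne 0$ in $B_0$, and set $X:=\mathrm{Spec}(B)$. Let $S_0$ be a finite set and $h\in B(S_0)$ a nonzero element such that, with $B':=(\mathrm{Sh}_{S_0}B)[1/h]$ and $X':=\mathrm{Spec}(B')=(\mathrm{Sh}_{S_0}X)[1/h]$, the $\mathbf{FI}^{\mathrm{op}}$-scheme $X'$ is isomorphic to $S\mapsto Z^S$, where $Z=X'([1])$ and where the product is over $B'_0=B(S_0)[1/h]$. Then there exists a nonzero $h'\in B'_0$ such that $B'':=B'[1/h']$ and $X'':=\mathrm{Spec}(B'')$ have the following properties: 1. $X''$ is isomorphic to $S\mapsto V^S$, where $V:=X''([1])$ and where the product is over $B''_0$; 2. $B''_0$ is a domain; and 3. for each finite set $S$, every irreducible component of $V^S$ maps dominantly into $\mathrm{Spec}(B''_0)$.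
   Context: Rings and algebras are commutative with $1$; $[n]=\{1,\dots,n\}$. $\mathbf{FI}$ is the category of finite sets with injections as morphisms. An $\mathbf{FI}$-algebra $B$ over a ring $K$ is a covariant functor from $\mathbf{FI}$ to $K$-algebras; write $B_n:=B([n])$, $B_0=B(\emptyset)$. Each $B(S)$ is a $B_0$-algebra via $\emptyset\to S$, so $B$ is also an $\mathbf{FI}$-algebra over $B_0$. An affine $\mathbf{FI}^{\mathrm{op}}$-scheme over $K$ is a contravariant functor from $\mathbf{FI}$ to affine $K$-schemes; $\mathrm{Spec}(B)$ is $S\mapsto\mathrm{Spec}(B(S))$. Morphisms are natural transformations. The width of $b\in B(S)$ is the minimal $n$ such that $b\in B(\pi)(B([n]))$ for some injection $\pi:[n]\to S$. $B$ is finitely generated in width $\le 1$ if there is a finite collection of elements $b_i\in B(S_i)$ of width $\le 1$ such that, for every finite set $S$, the $K$-algebra $B(S)$ is generated by all $B(\pi)(b_i)$ with $\pi:S_i\to S$ injective. $B$ is nice if $B(\pi)$ is injective for every injection $\pi$ of finite sets. $B$ is reduced if every $B(S)$ has no nonzero nilpotents. Shift: for a finite set $S_0$, $(\mathrm{Sh}_{S_0}B)(S)=B(S_0\sqcup S)$ and $(\mathrm{Sh}_{S_0}B)(\pi)=B(\mathrm{id}_{S_0}\sqcup\pi)$; $\mathrm{Sh}_{S_0}\mathrm{Spec}(B)=\mathrm{Spec}(\mathrm{Sh}_{S_0}B)$. This is an $\mathbf{FI}$-algebra over $B(S_0)$. For an $\mathbf{FI}$-algebra $B$ over a ring $R$ and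 $h\in R$, $B[1/h]$ is the $\mathbf{FI}$-algebra $S\mapsto B(S)[1/h]$ over $R[1/h]$; thus $(\mathrm{Sh}_{S_0}B)[1/h]$, for $h\in B(S_0)$, is $S\mapsto B(S_0\sqcup S)[1/h]$, and $B'[1/h']$, for $h'\in B'_0$, is $S\mapsto B'(S)[1/h']$. The same notation is used for spectra. For a scheme $Z$ over $\mathrm{Spec}(R)$, the $\mathbf{FI}^{\mathrm{op}}$-scheme $S\mapsto Z^S$ sends $S$ to the fibre product over $\mathrm{Spec}(R)$ of copies of $Z$ indexed by $S$, and an injection $\pi:S\to T$ to the map $Z^T\to Z^S$ given by $(z_t)_{t\in T}\mapsto(z_{\pi(s)})_{s\in S}$. *)

theory Defs
  imports
    "HOL-Algebra.Ring_Divisibility"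
    "HOL-Algebra.Generated_Rings"
    "HOL-Algebra.Product_Groups"
    "HOL-Analysis.Abstract_Topology"
    "HOL-Library.Nat_Bijection"
begin

section \<open>Localisation\<close>

text \<open>The fraction \<open>a/s\<close> in the localisation of \<open>A\<close> at a multiplicative set \<open>M\<close> is the set of all
  pairs \<open>(b, t)\<close> with \<open>u(at - bs) = 0\<close> for some \<open>u\<close> in \<open>M\<close>.\<close>

definition loc_frac :: "'a ring \<Rightarrow> 'a set \<Rightarrow> 'a \<Rightarrow> 'a \<Rightarrow> ('a \<times> 'a) set" where
  "loc_frac A M a s =
     {(b, t). b \<in> carrier A \<and> t \<in> M \<and>
        (\<exists>u\<in>M. u \<otimes>\<^bsub>A\<^esub> (a \<otimes>\<^bsub>A\<^esub> t \<ominus>\<^bsub>A\<^esub> b \<otimes>\<^bsub>A\<^esub> s) = \<zero>\<^bsub>A\<^esub>)}"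

text \<open>The operations are taken over all representatives; the unions are unions of equal sets.\<close>

definition localisation :: "'a ring \<Rightarrow> 'a set \<Rightarrow> ('a \<times> 'a) set ring" where
  "localisation A M =
     \<lparr>carrier = {loc_frac A M a s | a s. a \<in> carrier A \<and> s \<in> M},
      mult = (\<lambda>X Y. \<Union>(a, s)\<in>X. \<Union>(b, t)\<in>Y. loc_frac A M (a \<otimes>\<^bsub>A\<^esub> b) (s \<otimes>\<^bsub>A\<^esub> t)),
      one = loc_frac A M \<one>\<^bsub>A\<^esub> \<one>\<^bsub>A\<^esub>,
      zero = loc_frac A M \<zero>\<^bsub>A\<^esub> \<one>\<^bsub>A\<^esub>,
      add = (\<lambda>X Y. \<Union>(a, s)\<in>X. \<Union>(b, t)\<in>Y.
               loc_frac A M (a \<otimes>\<^bsub>A\<^esub> t \<oplus>\<^bsub>A\<^esub> b \<otimes>\<^bsub>A\<^esub> s) (s \<otimes>\<^bsub>A\<^esub> t))\<rparr>"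

text \<open>The map \<open>a/s \<mapsto> f(a)/f(s)\<close> into the localisation of \<open>B\<close> at \<open>N\<close>.\<close>

definition localisation_map ::
  "'b ring \<Rightarrow> 'b set \<Rightarrow> ('a \<Rightarrow> 'b) \<Rightarrow> ('a \<times> 'a) set \<Rightarrow> ('b \<times> 'b) set" where
  "localisation_map B N f X = (\<Union>(a, s)\<in>X. loc_frac B N (f a) (f s))"

definition powers :: "'a ring \<Rightarrow> 'a \<Rightarrow> 'a set" where
  "powers A x = {x [^]\<^bsub>A\<^esub> n | n :: nat. True}"


section \<open>FI-algebras\<close>

text \<open>The category FI is represented by its equivalent full subcategory on the finite sets of
  natural numbers. A morphism is an injection extended by \<^const>\<open>undefined\<close> outside its source.\<close>

definition fi_hom :: "nat set \<Rightarrow> nat set \<Rightarrow> (nat \<Rightarrow> nat) set" where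
  "fi_hom S T = {\<pi> \<in> S \<rightarrow>\<^sub>E T. inj_on \<pi> S}"

abbreviation fi_init :: "nat \<Rightarrow> nat" where
  "fi_init \<equiv> (\<lambda>i\<in>{}. i)"

text \<open>\<open>fi_map B S T\<close> is the action on the morphisms from \<open>S\<close> to \<open>T\<close>, and \<open>fi_str B S\<close> is the
  structure homomorphism from \<open>fi_base B\<close> which makes \<open>fi_obj B S\<close> an algebra.\<close>

record ('k, 'a) fi_algebra =
  fi_base :: "'k ring"
  fi_obj :: "nat set \<Rightarrow> 'a ring"
  fi_map :: "nat set \<Rightarrow> nat set \<Rightarrow> (nat \<Rightarrow> nat) \<Rightarrow> 'a \<Rightarrow> 'a"
  fi_str :: "nat set \<Rightarrow> 'k \<Rightarrow> 'a"

definition is_fi_algebra :: "'k ring \<Rightarrow> ('k, 'a) fi_algebra \<Rightarrow> bool" where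
  "is_fi_algebra K B \<longleftrightarrow>
     cring K \<and> fi_base B = K \<and>
     (\<forall>S. finite S \<longrightarrow> cring (fi_obj B S)) \<and>
     (\<forall>S. finite S \<longrightarrow> fi_str B S \<in> ring_hom K (fi_obj B S)) \<and>
     (\<forall>S T. finite S \<and> finite T \<longrightarrow>
        (\<forall>\<pi>\<in>fi_hom S T. fi_map B S T \<pi> \<in> ring_hom (fi_obj B S) (fi_obj B T) \<and>
           (\<forall>k\<in>carrier K. fi_map B S T \<pi> (fi_str B S k) = fi_str B T k))) \<and>
     (\<forall>S. finite S \<longrightarrow> (\<forall>b\<in>carrier (fi_obj B S). fi_map B S S (\<lambda>i\<in>S. i) b = b)) \<and>
     (\<forall>S T U. finite S \<and> finite T \<and> finite U \<longrightarrow>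
        (\<forall>\<pi>\<in>fi_hom S T. \<forall>\<rho>\<in>fi_hom T U. \<forall>b\<in>carrier (fi_obj B S).
           fi_map B S U (compose S \<rho> \<pi>) b = fi_map B T U \<rho> (fi_map B S T \<pi> b)))"

definition fi_width :: "('k, 'a) fi_algebra \<Rightarrow> nat set \<Rightarrow> 'a \<Rightarrow> nat" where
  "fi_width B S b =
     (LEAST n. \<exists>\<pi>\<in>fi_hom {1..n} S. b \<in> fi_map B {1..n} S \<pi> ` carrier (fi_obj B {1..n}))"

text \<open>The subalgebra generated by a set of elements is the subring generated by these elements
  and the image of the base ring.\<close>

definition fi_fin_gen_width_le :: "nat \<Rightarrow> ('k, 'a) fi_algebra \<Rightarrow> bool" where
  "fi_fin_gen_width_le d B \<longleftrightarrow>
     (\<exists>G :: (nat set \<times> 'a) set. finite G \<and>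
        (\<forall>(T, b)\<in>G. finite T \<and> b \<in> carrier (fi_obj B T) \<and> fi_width B T b \<le> d) \<and>
        (\<forall>S. finite S \<longrightarrow>
           generate_ring (fi_obj B S)
             (fi_str B S ` carrier (fi_base B) \<union>
              {fi_map B T S \<pi> b | T b \<pi>. (T, b) \<in> G \<and> \<pi> \<in> fi_hom T S})
           = carrier (fi_obj B S)))"

definition fi_nice :: "('k, 'a) fi_algebra \<Rightarrow> bool" where
  "fi_nice B \<longleftrightarrow>
     (\<forall>S T. finite S \<and> finite T \<longrightarrow>
        (\<forall>\<pi>\<in>fi_hom S T. inj_on (fi_map B S T \<pi>) (carrier (fi_obj B S))))"

definition reduced_ring :: "'a ring \<Rightarrow> bool" where
  "reduced_ring A \<longleftrightarrow>
     (\<forall>a\<in>carrier A. (\<exists>n :: nat. a [^]\<^bsub>A\<^esub> n = \<zero>\<^bsub>A\<^esub>) \<longrightarrow> a = \<zero>\<^bsub>A\<^esub>)"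

definition fi_reduced :: "('k, 'a) fi_algebra \<Rightarrow> bool" where
  "fi_reduced B \<longleftrightarrow> (\<forall>S. finite S \<longrightarrow> reduced_ring (fi_obj B S))"

text \<open>Regard an FI-algebra \<open>B\<close> as an FI-algebra over \<open>B(\<emptyset>)\<close>.\<close>

definition fi_over_init :: "('k, 'a) fi_algebra \<Rightarrow> ('a, 'a) fi_algebra" where
  "fi_over_init B =
     \<lparr>fi_base = fi_obj B {}, fi_obj = fi_obj B, fi_map = fi_map B,
      fi_str = (\<lambda>S. fi_map B {} S fi_init)\<rparr>"

text \<open>Disjoint unions are formed inside the natural numbers through the bijection
  \<^const>\<open>sum_encode\<close> of \<open>nat + nat\<close> with \<open>nat\<close>.\<close>

definition dunion :: "nat set \<Rightarrow> nat set \<Rightarrow> nat set" where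
  "dunion S0 S = sum_encode ` (S0 <+> S)"

definition dunion_map :: "nat set \<Rightarrow> nat set \<Rightarrow> (nat \<Rightarrow> nat) \<Rightarrow> nat \<Rightarrow> nat" where
  "dunion_map S0 S \<pi> = (\<lambda>k\<in>dunion S0 S. sum_encode (map_sum id \<pi> (sum_decode k)))"

text \<open>The shift, as an FI-algebra over \<open>B(S0)\<close>.\<close>

definition fi_shift :: "nat set \<Rightarrow> ('k, 'a) fi_algebra \<Rightarrow> ('a, 'a) fi_algebra" where
  "fi_shift S0 B =
     \<lparr>fi_base = fi_obj B S0,
      fi_obj = (\<lambda>S. fi_obj B (dunion S0 S)),
      fi_map = (\<lambda>S T \<pi>. fi_map B (dunion S0 S) (dunion S0 T) (dunion_map S0 S \<pi>)),
      fi_str = (\<lambda>S. fi_map B S0 (dunion S0 S) (\<lambda>i\<in>S0. sum_encode (Inl i)))\<rparr>"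

text \<open>\<open>B[1/h]\<close> for an FI-algebra \<open>B\<close> over \<open>R\<close> and an element \<open>h\<close> of \<open>R\<close>, as an FI-algebra
  over \<open>R[1/h]\<close>.\<close>

definition fi_invert ::
  "('r, 'a) fi_algebra \<Rightarrow> 'r \<Rightarrow> (('r \<times> 'r) set, ('a \<times> 'a) set) fi_algebra" where
  "fi_invert B h =
     (let P = (\<lambda>S. powers (fi_obj B S) (fi_str B S h)) in
      \<lparr>fi_base = localisation (fi_base B) (powers (fi_base B) h),
       fi_obj = (\<lambda>S. localisation (fi_obj B S) (P S)),
       fi_map = (\<lambda>S T \<pi>. localisation_map (fi_obj B T) (P T) (fi_map B S T \<pi>)),
       fi_str = (\<lambda>S. localisation_map (fi_obj B S) (P S) (fi_str B S))\<rparr>)"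


section \<open>Tensor powers\<close>

text \<open>The monoid algebra \<open>R[M]\<close>: finitely supported functions on \<open>M\<close> with convolution.\<close>

definition monoid_algebra :: "'r ring \<Rightarrow> 'm monoid \<Rightarrow> ('m \<Rightarrow> 'r) ring" where
  "monoid_algebra R M =
     \<lparr>carrier = {F. (\<forall>m. F m \<in> carrier R) \<and> finite {m. F m \<noteq> \<zero>\<^bsub>R\<^esub>} \<and>
                    {m. F m \<noteq> \<zero>\<^bsub>R\<^esub>} \<subseteq> carrier M},
      mult = (\<lambda>F G m. \<Oplus>\<^bsub>R\<^esub>x\<in>{(a, b). F a \<noteq> \<zero>\<^bsub>R\<^esub> \<and> G b \<noteq> \<zero>\<^bsub>R\<^esub> \<and> a \<otimes>\<^bsub>M\<^esub> b = m}.
                        F (fst x) \<otimes>\<^bsub>R\<^esub> G (snd x)),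
      one = (\<lambda>m. if m = \<one>\<^bsub>M\<^esub> then \<one>\<^bsub>R\<^esub> else \<zero>\<^bsub>R\<^esub>),
      zero = (\<lambda>m. \<zero>\<^bsub>R\<^esub>),
      add = (\<lambda>F G m. F m \<oplus>\<^bsub>R\<^esub> G m)\<rparr>"

definition ma_single :: "'r ring \<Rightarrow> 'r \<Rightarrow> 'm \<Rightarrow> 'm \<Rightarrow> 'r" where
  "ma_single R r m = (\<lambda>m'. if m' = m then r else \<zero>\<^bsub>R\<^esub>)"

text \<open>For an \<open>R\<close>-algebra \<open>A\<close> with structure homomorphism \<open>\<iota>\<close> and a finite set \<open>S\<close>, the tensor power
  of \<open>A\<close> over \<open>R\<close> indexed by \<open>S\<close> is the free \<open>R\<close>-module on the families in \<open>A\<^sup>S\<close>, multiplied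
  componentwise, modulo the relations of multilinearity. For empty \<open>S\<close> it is \<open>R\<close>.\<close>

definition tensor_free :: "'r ring \<Rightarrow> 'a ring \<Rightarrow> nat set \<Rightarrow> ((nat \<Rightarrow> 'a) \<Rightarrow> 'r) ring" where
  "tensor_free R A S = monoid_algebra R (product_group S (\<lambda>_. A))"

definition tensor_relations ::
  "'r ring \<Rightarrow> 'a ring \<Rightarrow> ('r \<Rightarrow> 'a) \<Rightarrow> nat set \<Rightarrow> ((nat \<Rightarrow> 'a) \<Rightarrow> 'r) set" where
  "tensor_relations R A \<iota> S =
     {ma_single R \<one>\<^bsub>R\<^esub> (f(s := a \<oplus>\<^bsub>A\<^esub> b)) \<ominus>\<^bsub>tensor_free R A S\<^esub>
        (ma_single R \<one>\<^bsub>R\<^esub> (f(s := a)) \<oplus>\<^bsub>tensor_free R A S\<^esub> ma_single R \<one>\<^bsub>R\<^esub> (f(s := b)))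
      | f s a b. f \<in> S \<rightarrow>\<^sub>E carrier A \<and> s \<in> S \<and> a \<in> carrier A \<and> b \<in> carrier A} \<union>
     {ma_single R \<one>\<^bsub>R\<^esub> (f(s := \<iota> r \<otimes>\<^bsub>A\<^esub> a)) \<ominus>\<^bsub>tensor_free R A S\<^esub> ma_single R r (f(s := a))
      | f s a r. f \<in> S \<rightarrow>\<^sub>E carrier A \<and> s \<in> S \<and> a \<in> carrier A \<and> r \<in> carrier R}"

definition tensor_ideal ::
  "'r ring \<Rightarrow> 'a ring \<Rightarrow> ('r \<Rightarrow> 'a) \<Rightarrow> nat set \<Rightarrow> ((nat \<Rightarrow> 'a) \<Rightarrow> 'r) set" where
  "tensor_ideal R A \<iota> S = Idl\<^bsub>tensor_free R A S\<^esub> (tensor_relations R A \<iota> S)"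

definition tensor_power ::
  "'r ring \<Rightarrow> 'a ring \<Rightarrow> ('r \<Rightarrow> 'a) \<Rightarrow> nat set \<Rightarrow> ((nat \<Rightarrow> 'a) \<Rightarrow> 'r) set ring" where
  "tensor_power R A \<iota> S = tensor_free R A S Quot tensor_ideal R A \<iota> S"

definition tensor_str ::
  "'r ring \<Rightarrow> 'a ring \<Rightarrow> ('r \<Rightarrow> 'a) \<Rightarrow> nat set \<Rightarrow> 'r \<Rightarrow> ((nat \<Rightarrow> 'a) \<Rightarrow> 'r) set" where
  "tensor_str R A \<iota> S r =
     tensor_ideal R A \<iota> S +>\<^bsub>tensor_free R A S\<^esub> ma_single R r (\<lambda>s\<in>S. \<one>\<^bsub>A\<^esub>)"

text \<open>An injection \<open>\<pi>\<close> from \<open>S\<close> to \<open>T\<close> sends the pure tensor of \<open>(a\<^sub>s)\<close> to the one with entry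
  \<open>a\<^sub>s\<close> at \<open>\<pi>(s)\<close> and \<open>1\<close> outside the image of \<open>\<pi>\<close>. On points of the spectra, this is
  \<open>(z\<^sub>t) \<mapsto> (z\<^bsub>\<pi>(s)\<^esub>)\<close>.\<close>

definition tensor_extend ::
  "'a ring \<Rightarrow> nat set \<Rightarrow> nat set \<Rightarrow> (nat \<Rightarrow> nat) \<Rightarrow> (nat \<Rightarrow> 'a) \<Rightarrow> nat \<Rightarrow> 'a" where
  "tensor_extend A S T \<pi> f = (\<lambda>t\<in>T. if t \<in> \<pi> ` S then f (inv_into S \<pi> t) else \<one>\<^bsub>A\<^esub>)"

definition tensor_map ::
  "'r ring \<Rightarrow> 'a ring \<Rightarrow> ('r \<Rightarrow> 'a) \<Rightarrow> nat set \<Rightarrow> nat set \<Rightarrow> (nat \<Rightarrow> nat) \<Rightarrow>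
   ((nat \<Rightarrow> 'a) \<Rightarrow> 'r) set \<Rightarrow> ((nat \<Rightarrow> 'a) \<Rightarrow> 'r) set" where
  "tensor_map R A \<iota> S T \<pi> X =
     (\<Union>F\<in>X. tensor_ideal R A \<iota> T +>\<^bsub>tensor_free R A T\<^esub>
        (\<lambda>g. \<Oplus>\<^bsub>R\<^esub>f\<in>{f. F f \<noteq> \<zero>\<^bsub>R\<^esub> \<and> tensor_extend A S T \<pi> f = g}. F f))"

definition fi_tensor ::
  "'r ring \<Rightarrow> 'a ring \<Rightarrow> ('r \<Rightarrow> 'a) \<Rightarrow> ('r, ((nat \<Rightarrow> 'a) \<Rightarrow> 'r) set) fi_algebra" where
  "fi_tensor R A \<iota> =
     \<lparr>fi_base = R, fi_obj = tensor_power R A \<iota>, fi_map = tensor_map R A \<iota>,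
      fi_str = tensor_str R A \<iota>\<rparr>"


section \<open>Affine schemes\<close>

text \<open>Ringed spaces: \<open>rs_res X U V\<close> is the restriction of sections from \<open>U\<close> to \<open>V\<close>.\<close>

record ('x, 's) ringed_space =
  rs_top :: "'x topology"
  rs_sec :: "'x set \<Rightarrow> 's ring"
  rs_res :: "'x set \<Rightarrow> 'x set \<Rightarrow> 's \<Rightarrow> 's"

record ('x, 's, 'y, 't) ringed_space_map =
  rm_pt :: "'x \<Rightarrow> 'y"
  rm_sec :: "'y set \<Rightarrow> 't \<Rightarrow> 's"

definition rm_preimage ::
  "('x, 's) ringed_space \<Rightarrow> ('x, 's, 'y, 't) ringed_space_map \<Rightarrow> 'y set \<Rightarrow> 'x set" where
  "rm_preimage X f V = {x \<in> topspace (rs_top X). rm_pt f x \<in> V}"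

text \<open>The germ at \<open>x\<close> of the section \<open>s\<close> over \<open>U\<close> is a unit of the stalk at \<open>x\<close>.\<close>

definition germ_unit :: "('x, 's) ringed_space \<Rightarrow> 'x \<Rightarrow> 'x set \<Rightarrow> 's \<Rightarrow> bool" where
  "germ_unit X x U s \<longleftrightarrow>
     (\<exists>W. openin (rs_top X) W \<and> x \<in> W \<and> W \<subseteq> U \<and> rs_res X U W s \<in> Units (rs_sec X W))"

text \<open>Morphisms of locally ringed spaces. The last conjunct says that the induced maps of stalks
  are local homomorphisms, that is, reflect units.\<close>

definition lrs_morphism ::
  "('x, 's) ringed_space \<Rightarrow> ('y, 't) ringed_space \<Rightarrow> ('x, 's, 'y, 't) ringed_space_map \<Rightarrow> bool"
  where
  "lrs_morphism X Y f \<longleftrightarrow>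
     continuous_map (rs_top X) (rs_top Y) (rm_pt f) \<and>
     (\<forall>V. openin (rs_top Y) V \<longrightarrow>
        rm_sec f V \<in> ring_hom (rs_sec Y V) (rs_sec X (rm_preimage X f V))) \<and>
     (\<forall>V V'. openin (rs_top Y) V \<and> openin (rs_top Y) V' \<and> V' \<subseteq> V \<longrightarrow>
        (\<forall>s\<in>carrier (rs_sec Y V).
           rm_sec f V' (rs_res Y V V' s) =
           rs_res X (rm_preimage X f V) (rm_preimage X f V') (rm_sec f V s))) \<and>
     (\<forall>V x s. openin (rs_top Y) V \<and> x \<in> rm_preimage X f V \<and> s \<in> carrier (rs_sec Y V) \<and>
        germ_unit X x (rm_preimage X f V) (rm_sec f V s) \<longrightarrow> germ_unit Y (rm_pt f x) V s)"

text \<open>Equality of morphisms from \<open>X\<close> to \<open>Y\<close> only concerns points of \<open>X\<close> and sections over open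
  subsets of \<open>Y\<close>.\<close>

definition rm_eq ::
  "('x, 's) ringed_space \<Rightarrow> ('y, 't) ringed_space \<Rightarrow>
   ('x, 's, 'y, 't) ringed_space_map \<Rightarrow> ('x, 's, 'y, 't) ringed_space_map \<Rightarrow> bool" where
  "rm_eq X Y f g \<longleftrightarrow>
     (\<forall>x\<in>topspace (rs_top X). rm_pt f x = rm_pt g x) \<and>
     (\<forall>V. openin (rs_top Y) V \<longrightarrow> (\<forall>s\<in>carrier (rs_sec Y V). rm_sec f V s = rm_sec g V s))"

definition rm_id :: "('x, 's, 'x, 's) ringed_space_map" where
  "rm_id = \<lparr>rm_pt = (\<lambda>x. x), rm_sec = (\<lambda>V s. s)\<rparr>"

text \<open>The composite of \<open>f\<close> from \<open>X\<close> to \<open>Y\<close> with \<open>g\<close> from \<open>Y\<close> to \<open>Z\<close>.\<close>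

definition rm_comp ::
  "('y, 't) ringed_space \<Rightarrow> ('y, 't, 'z, 'u) ringed_space_map \<Rightarrow>
   ('x, 's, 'y, 't) ringed_space_map \<Rightarrow> ('x, 's, 'z, 'u) ringed_space_map" where
  "rm_comp Y g f =
     \<lparr>rm_pt = (\<lambda>x. rm_pt g (rm_pt f x)),
      rm_sec = (\<lambda>V s. rm_sec f (rm_preimage Y g V) (rm_sec g V s))\<rparr>"

definition lrs_iso ::
  "('x, 's) ringed_space \<Rightarrow> ('y, 't) ringed_space \<Rightarrow> ('x, 's, 'y, 't) ringed_space_map \<Rightarrow> bool"
  where
  "lrs_iso X Y f \<longleftrightarrow>
     lrs_morphism X Y f \<and>
     (\<exists>g. lrs_morphism Y X g \<and>
        rm_eq X X (rm_comp Y g f) rm_id \<and> rm_eq Y Y (rm_comp X f g) rm_id)"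

definition zariski :: "'a ring \<Rightarrow> 'a set topology" where
  "zariski A =
     topology (\<lambda>U. \<exists>E\<subseteq>carrier A. U = {p. primeideal p A \<and> \<not> E \<subseteq> p})"

lemma istopology_zariski:
  "istopology (\<lambda>U. \<exists>E\<subseteq>carrier A. U = {p. primeideal p A \<and> \<not> E \<subseteq> p})" (is "istopology ?P")
  unfolding istopology_def
proof (intro conjI allI impI)
  fix U V assume "?P U" "?P V"
  then obtain E F where E: "E \<subseteq> carrier A" "U = {p. primeideal p A \<and> \<not> E \<subseteq> p}"
    and F: "F \<subseteq> carrier A" "V = {p. primeideal p A \<and> \<not> F \<subseteq> p}" by blast
  let ?G = "if cring A then {e \<otimes>\<^bsub>A\<^esub> f | e f. e \<in> E \<and> f \<in> F} else {}"
  have "?G \<subseteq> carrier A"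
    using E(1) F(1) by (auto simp: subset_iff intro!: monoid.m_closed[OF ring.is_monoid] cring.axioms(1))
  moreover have "U \<inter> V = {p. primeideal p A \<and> \<not> ?G \<subseteq> p}"
  proof (intro equalityI subsetI)
    fix p assume "p \<in> U \<inter> V"
    then obtain e f where p: "primeideal p A" "e \<in> E" "e \<notin> p" "f \<in> F" "f \<notin> p"
      using E(2) F(2) by auto
    then have "e \<otimes>\<^bsub>A\<^esub> f \<notin> p" using primeideal.I_prime[OF p(1)] E(1) F(1) by blast
    then show "p \<in> {p. primeideal p A \<and> \<not> ?G \<subseteq> p}"
      using p primeideal.axioms(2)[OF p(1)] by auto
  next
    fix p assume "p \<in> {p. primeideal p A \<and> \<not> ?G \<subseteq> p}"
    then obtain e f where p: "primeideal p A" "e \<in> E" "f \<in> F" "e \<otimes>\<^bsub>A\<^esub> f \<notin> p"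
      by (auto split: if_splits)
    then have "e \<notin> p" "f \<notin> p"
      using ideal.I_r_closed[OF primeideal.axioms(1)[OF p(1)]]
        ideal.I_l_closed[OF primeideal.axioms(1)[OF p(1)]] E(1) F(1) by blast+
    then show "p \<in> U \<inter> V" using p E F by auto
  qed
  ultimately show "?P (U \<inter> V)" by blast
next
  fix \<U> assume "\<forall>U\<in>\<U>. ?P U"
  then obtain E where E: "\<And>U. U \<in> \<U> \<Longrightarrow> E U \<subseteq> carrier A"
    "\<And>U. U \<in> \<U> \<Longrightarrow> U = {p. primeideal p A \<and> \<not> E U \<subseteq> p}" by metis
  have "(\<Union>U\<in>\<U>. E U) \<subseteq> carrier A" using E(1) by blast
  moreover have "\<Union>\<U> = {p. primeideal p A \<and> \<not> (\<Union>U\<in>\<U>. E U) \<subseteq> p}"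
    using E(2) by blast
  ultimately show "?P (\<Union>\<U>)" by blast
qed

lemma openin_zariski:
  "openin (zariski A) U \<longleftrightarrow> (\<exists>E\<subseteq>carrier A. U = {p. primeideal p A \<and> \<not> E \<subseteq> p})"
  unfolding zariski_def by (simp add: topology_inverse'[OF istopology_zariski])

lemma topspace_zariski:
  "topspace (zariski A) = {p. primeideal p A}"
proof -
  have "\<not> carrier A \<subseteq> p" if "primeideal p A" for p
    using that primeideal.I_notcarr[OF that] ideal.Icarr[OF primeideal.axioms(1)[OF that]] by blast
  then have "openin (zariski A) {p. primeideal p A}"
    unfolding openin_zariski by blast
  from openin_subset[OF this] show ?thesis
    unfolding topspace_def by (auto simp: openin_zariski)
qed

abbreviation local_ring_at :: "'a ring \<Rightarrow> 'a set \<Rightarrow> ('a \<times> 'a) set ring" where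
  "local_ring_at A p \<equiv> localisation A (carrier A - p)"

text \<open>The structure sheaf of \<open>Spec A\<close>: functions with values in the local rings which are locally
  given by a fraction.\<close>

definition spec_sections :: "'a ring \<Rightarrow> 'a set set \<Rightarrow> ('a set \<Rightarrow> ('a \<times> 'a) set) ring" where
  "spec_sections A U =
     \<lparr>carrier = {\<sigma> \<in> (\<Pi>\<^sub>E p\<in>U. carrier (local_ring_at A p)).
        \<forall>p\<in>U. \<exists>W a g. openin (zariski A) W \<and> p \<in> W \<and> W \<subseteq> U \<and>
          a \<in> carrier A \<and> g \<in> carrier A \<and>
          (\<forall>q\<in>W. g \<notin> q \<and> \<sigma> q = loc_frac A (carrier A - q) a g)},
      mult = (\<lambda>\<sigma> \<tau>. \<lambda>p\<in>U. \<sigma> p \<otimes>\<^bsub>local_ring_at A p\<^esub> \<tau> p),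
      one = (\<lambda>p\<in>U. \<one>\<^bsub>local_ring_at A p\<^esub>),
      zero = (\<lambda>p\<in>U. \<zero>\<^bsub>local_ring_at A p\<^esub>),
      add = (\<lambda>\<sigma> \<tau>. \<lambda>p\<in>U. \<sigma> p \<oplus>\<^bsub>local_ring_at A p\<^esub> \<tau> p)\<rparr>"

type_synonym 'a affine_scheme = "('a set, 'a set \<Rightarrow> ('a \<times> 'a) set) ringed_space"

type_synonym ('a, 'b) affine_map =
  "('a set, 'a set \<Rightarrow> ('a \<times> 'a) set, 'b set, 'b set \<Rightarrow> ('b \<times> 'b) set) ringed_space_map"

definition Spec :: "'a ring \<Rightarrow> 'a affine_scheme" where
  "Spec A = \<lparr>rs_top = zariski A, rs_sec = spec_sections A, rs_res = (\<lambda>U V \<sigma>. restrict \<sigma> V)\<rparr>"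

text \<open>The morphism from \<open>Spec B\<close> to \<open>Spec A\<close> induced by a homomorphism \<open>\<phi>\<close> from \<open>A\<close> to \<open>B\<close>.\<close>

definition Spec_map :: "'a ring \<Rightarrow> 'b ring \<Rightarrow> ('a \<Rightarrow> 'b) \<Rightarrow> ('b, 'a) affine_map" where
  "Spec_map A B \<phi> =
     (let contr = (\<lambda>q. {a \<in> carrier A. \<phi> a \<in> q}) in
      \<lparr>rm_pt = contr,
       rm_sec = (\<lambda>V \<sigma>. \<lambda>q\<in>{q. primeideal q B \<and> contr q \<in> V}.
                  localisation_map B (carrier B - q) \<phi> (\<sigma> (contr q)))\<rparr>)"


section \<open>Affine schemes over FI-opposite\<close>

text \<open>A contravariant functor from FI to schemes over \<open>fs_base X\<close>: \<open>fs_map X S T \<pi>\<close> is the morphism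
  from \<open>fs_obj X T\<close> to \<open>fs_obj X S\<close> attached to an injection \<open>\<pi>\<close> from \<open>S\<close> to \<open>T\<close>, and
  \<open>fs_str X S\<close> is the structure morphism from \<open>fs_obj X S\<close> to \<open>fs_base X\<close>.\<close>

record ('r, 'a) fi_scheme =
  fs_base :: "'r affine_scheme"
  fs_obj :: "nat set \<Rightarrow> 'a affine_scheme"
  fs_map :: "nat set \<Rightarrow> nat set \<Rightarrow> (nat \<Rightarrow> nat) \<Rightarrow> ('a, 'a) affine_map"
  fs_str :: "nat set \<Rightarrow> ('a, 'r) affine_map"

definition fi_Spec :: "('r, 'a) fi_algebra \<Rightarrow> ('r, 'a) fi_scheme" where
  "fi_Spec B =
     \<lparr>fs_base = Spec (fi_base B),
      fs_obj = (\<lambda>S. Spec (fi_obj B S)),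
      fs_map = (\<lambda>S T \<pi>. Spec_map (fi_obj B S) (fi_obj B T) (fi_map B S T \<pi>)),
      fs_str = (\<lambda>S. Spec_map (fi_base B) (fi_obj B S) (fi_str B S))\<rparr>"

text \<open>Isomorphisms are natural families of isomorphisms of schemes over the common base. For
  \<open>S \<mapsto> Z\<^sup>S\<close> with \<open>Z = X([1])\<close> over \<open>X(\<emptyset>)\<close>, compatibility with the base loses no generality: an
  isomorphism which induces an automorphism of the base can be corrected by the powers of its
  component at \<open>[1]\<close>.\<close>

definition fi_scheme_iso :: "('r, 'a) fi_scheme \<Rightarrow> ('r, 'b) fi_scheme \<Rightarrow> bool" where
  "fi_scheme_iso X Y \<longleftrightarrow>
     fs_base X = fs_base Y \<and>
     (\<exists>\<theta> :: nat set \<Rightarrow> ('a, 'b) affine_map.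
        (\<forall>S. finite S \<longrightarrow>
           lrs_iso (fs_obj X S) (fs_obj Y S) (\<theta> S) \<and>
           rm_eq (fs_obj X S) (fs_base X) (rm_comp (fs_obj Y S) (fs_str Y S) (\<theta> S)) (fs_str X S)) \<and>
        (\<forall>S T. finite S \<and> finite T \<longrightarrow>
           (\<forall>\<pi>\<in>fi_hom S T.
              rm_eq (fs_obj X T) (fs_obj Y S)
                (rm_comp (fs_obj X S) (\<theta> S) (fs_map X S T \<pi>))
                (rm_comp (fs_obj Y T) (fs_map Y S T \<pi>) (\<theta> T)))))"

text \<open>The functor \<open>S \<mapsto> Z\<^sup>S\<close> for the affine scheme \<open>Z = Spec A\<close> over \<open>Spec R\<close>: the fibre power of
  \<open>Z\<close> over \<open>Spec R\<close> indexed by \<open>S\<close> is the spectrum of the tensor power of \<open>A\<close> over \<open>R\<close>.\<close>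

definition fibre_powers ::
  "'r ring \<Rightarrow> 'a ring \<Rightarrow> ('r \<Rightarrow> 'a) \<Rightarrow> ('r, ((nat \<Rightarrow> 'a) \<Rightarrow> 'r) set) fi_scheme" where
  "fibre_powers R A \<iota> = fi_Spec (fi_tensor R A \<iota>)"


section \<open>Irreducible components and dominance\<close>

definition irreducible_in :: "'x topology \<Rightarrow> 'x set \<Rightarrow> bool" where
  "irreducible_in X C \<longleftrightarrow>
     C \<subseteq> topspace X \<and> C \<noteq> {} \<and>
     (\<forall>D E. closedin X D \<and> closedin X E \<and> C \<subseteq> D \<union> E \<longrightarrow> C \<subseteq> D \<or> C \<subseteq> E)"

definition irreducible_components :: "'x topology \<Rightarrow> 'x set set" where
  "irreducible_components X =
     {C. irreducible_in X C \<and> (\<forall>D. irreducible_in X D \<and> C \<subseteq> D \<longrightarrow> D = C)}"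

definition maps_dominantly ::
  "('y, 't) ringed_space \<Rightarrow> ('x, 's, 'y, 't) ringed_space_map \<Rightarrow> 'x set \<Rightarrow> bool" where
  "maps_dominantly Y f C \<longleftrightarrow> rs_top Y closure_of (rm_pt f ` C) = topspace (rs_top Y)"

end

theory Submission imports Defs "HOL-Computational_Algebra.Primes" begin

text \<open>A ring is recovered from the global sections of its spectrum, so the isomorphism of \<open>X'\<close> with the
  fibre powers of \<open>Z\<close> presents every \<open>B'(S)\<close> as the tensor power of \<open>A = B'([1])\<close> over \<open>R = B'\<^sub>0\<close>,
  naturally in \<open>S\<close>. Such a presentation survives the inversion of any \<open>h'\<close> in \<open>R\<close>.

  \<open>R\<close> is a nonzero, reduced, finitely generated algebra over a Noetherian ring, so some nonzero \<open>g\<close>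
  has maximal, hence prime, annihilator, and \<open>g\<^sup>2 \<noteq> 0\<close>: the localisation \<open>R[1/g]\<close> is a domain. As \<open>A\<close> is
  finitely generated over \<open>R\<close>, the argument of generic freeness by leading monomials gives an \<open>f\<close> with
  \<open>f g \<noteq> 0\<close> such that for \<open>h' = f g\<close> the monomials that are not leading ones form a basis of \<open>A[1/h']\<close>
  over \<open>R[1/h']\<close>. The tensor powers of a free module are torsion free, so the nonzero elements of the
  domain \<open>R[1/h']\<close> are nonzerodivisors on them; as the elements of a minimal prime are zero divisors,
  every minimal prime contracts to \<open>0\<close>.\<close>

section \<open>Localisation\<close>

text \<open>Because the annihilator of g is prime and does not contain g, an element c of R vanishes
  in R[1/g] exactly when c g = 0. Conditions over R[1/g] are therefore written over R, with c g
  nonzero in place of c nonzero; f is found before anything is inverted, and one localisation at f g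
  suffices. One setting, a multiplicative family of monomials that spans an algebra, serves twice:
  over K it gives the ascending chain condition for R by leading coefficients, as in Hilbert's basis
  theorem, and over R it gives generic freeness of A. No polynomial ring appears; the monomials are
  elements of the algebra, possibly dependent, and a leading term is expressed by the span of the
  smaller monomials. Reducedness of B enters through g^2 and, together with niceness, through R
  being nonzero. The obstacle in the tensor powers is that a quotient of a monoid algebra has no
  visible test for vanishing. For localisation, the images of the factors and the kernel of the map
  from the free algebra are recorded instead; for torsion freeness, functionals built from
  coordinates read off the coefficients.\<close>

locale localised = cring A for A :: "'a ring" (structure) +
  fixes M
  assumes submonoid: "submonoid M A"
begin

abbreviation frac where "frac \<equiv> loc_frac A M"
abbreviation L where "L \<equiv> localisation A M"

lemma M_carr [simp, intro]: "s \<in> M \<Longrightarrow> s \<in> carrier A"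
  using submonoid.subset[OF submonoid] by blast

lemma M_mult [simp, intro]: "s \<in> M \<Longrightarrow> t \<in> M \<Longrightarrow> s \<otimes> t \<in> M"
  using submonoid.m_closed[OF submonoid] by blast

lemma M_one [simp, intro]: "\<one> \<in> M"
  using submonoid.one_closed[OF submonoid] .

lemma M_pow [simp, intro]: "s \<in> M \<Longrightarrow> s [^] (n::nat) \<in> M"
  by (induction n) auto

lemma diff_zero_iff: "\<lbrakk>u \<in> carrier A; x \<in> carrier A; y \<in> carrier A\<rbrakk> \<Longrightarrow>
    u \<otimes> (x \<ominus> y) = \<zero> \<longleftrightarrow> u \<otimes> x = u \<otimes> y"
  using r_right_minus_eq[of "u \<otimes> x" "u \<otimes> y"] by (simp add: minus_eq r_distr r_minus)

lemma mem_frac_iff: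
  assumes "a \<in> carrier A" "s \<in> M"
  shows "(b, t) \<in> frac a s \<longleftrightarrow> b \<in> carrier A \<and> t \<in> M \<and> (\<exists>u\<in>M. u \<otimes> (a \<otimes> t) = u \<otimes> (b \<otimes> s))"
  unfolding loc_frac_def using assms by (auto simp: diff_zero_iff)

lemma frac_self: "a \<in> carrier A \<Longrightarrow> s \<in> M \<Longrightarrow> (a, s) \<in> frac a s"
  by (auto simp: mem_frac_iff)

text \<open>Cross multiplication leaves the middle denominator behind, which is why the multiplier
  contains \<open>t\<close> besides the two given ones.\<close>

lemma frac_trans:
  assumes c: "a \<in> carrier A" "b \<in> carrier A" "c \<in> carrier A" "s \<in> M" "t \<in> M" "r \<in> M" "u \<in> M" "v \<in> M"
    and u: "u \<otimes> (a \<otimes> t) = u \<otimes> (b \<otimes> s)" and v: "v \<otimes> (b \<otimes> r) = v \<otimes> (c \<otimes> t)"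
  shows "(u \<otimes> v \<otimes> t) \<otimes> (a \<otimes> r) = (u \<otimes> v \<otimes> t) \<otimes> (c \<otimes> s)"
proof -
  have "(u \<otimes> v \<otimes> t) \<otimes> (a \<otimes> r) = (v \<otimes> r) \<otimes> (u \<otimes> (a \<otimes> t))" using c by (simp add: m_ac)
  also have "\<dots> = (u \<otimes> s) \<otimes> (v \<otimes> (b \<otimes> r))" using c u by (simp add: m_ac)
  also have "\<dots> = (u \<otimes> v \<otimes> t) \<otimes> (c \<otimes> s)" unfolding v using c by (simp add: m_ac)
  finally show ?thesis .
qed

lemma frac_eq_iff:
  assumes a: "a \<in> carrier A" "s \<in> M" and b: "b \<in> carrier A" "t \<in> M"
  shows "frac a s = frac b t \<longleftrightarrow> (\<exists>u\<in>M. u \<otimes> (a \<otimes> t) = u \<otimes> (b \<otimes> s))"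
proof
  assume "frac a s = frac b t"
  then have "(b, t) \<in> frac a s" using frac_self b by simp
  then show "\<exists>u\<in>M. u \<otimes> (a \<otimes> t) = u \<otimes> (b \<otimes> s)" unfolding mem_frac_iff[OF a] by blast
next
  assume "\<exists>u\<in>M. u \<otimes> (a \<otimes> t) = u \<otimes> (b \<otimes> s)"
  then obtain u where u: "u \<in> M" "u \<otimes> (a \<otimes> t) = u \<otimes> (b \<otimes> s)" by blast
  have "(c, r) \<in> frac a s \<longleftrightarrow> (c, r) \<in> frac b t" for c r
  proof
    assume "(c, r) \<in> frac a s"
    then obtain v where v: "c \<in> carrier A" "r \<in> M" "v \<in> M" "v \<otimes> (a \<otimes> r) = v \<otimes> (c \<otimes> s)"
      unfolding mem_frac_iff[OF a] by blast
    from frac_trans[OF b(1) a(1) v(1) b(2) a(2) v(2) u(1) v(3) u(2)[symmetric] v(4)]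
    show "(c, r) \<in> frac b t" unfolding mem_frac_iff[OF b] using a v(1-3) u(1) by blast
  next
    assume "(c, r) \<in> frac b t"
    then obtain v where v: "c \<in> carrier A" "r \<in> M" "v \<in> M" "v \<otimes> (b \<otimes> r) = v \<otimes> (c \<otimes> t)"
      unfolding mem_frac_iff[OF b] by blast
    from frac_trans[OF a(1) b(1) v(1) a(2) b(2) v(2) u(1) v(3) u(2) v(4)]
    show "(c, r) \<in> frac a s" unfolding mem_frac_iff[OF a] using b v(1-3) u(1) by blast
  qed
  then show "frac a s = frac b t" by auto
qed

lemma frac_eqI:
  "\<lbrakk>a \<in> carrier A; s \<in> M; b \<in> carrier A; t \<in> M; a \<otimes> t = b \<otimes> s\<rbrakk> \<Longrightarrow> frac a s = frac b t"
  by (auto simp: frac_eq_iff)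

lemma frac_memD:
  assumes "a \<in> carrier A" "s \<in> M" "(b, t) \<in> frac a s"
  shows "b \<in> carrier A" "t \<in> M" "frac b t = frac a s"
  using assms by (auto simp: mem_frac_iff frac_eq_iff)
    (metis)

lemma frac_carr [simp, intro]: "a \<in> carrier A \<Longrightarrow> s \<in> M \<Longrightarrow> frac a s \<in> carrier L"
  by (auto simp: localisation_def)

lemma carr_fracE:
  assumes "x \<in> carrier L"
  obtains a s where "a \<in> carrier A" "s \<in> M" "x = frac a s"
  using assms by (auto simp: localisation_def)

text \<open>The ring operations and \<open>localisation_map\<close> are unions over all
  representatives. If the inner value is constant on the class, the union over the nonempty class is
  that constant, so each use only has to show independence of the representatives.\<close>

lemma UN_frac:
  assumes "a \<in> carrier A" "s \<in> M"
    and "\<And>b t. b \<in> carrier A \<Longrightarrow> t \<in> M \<Longrightarrow> frac b t = frac a s \<Longrightarrow> g b t = c"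
  shows "(\<Union>(b, t)\<in>frac a s. g b t) = c"
proof -
  have "case x of (b, t) \<Rightarrow> g b t = c" if "x \<in> frac a s" for x
  proof (cases x)
    case (Pair b t)
    with that have "(b, t) \<in> frac a s" by simp
    from assms(3)[OF frac_memD[OF assms(1,2) this]] Pair show ?thesis by simp
  qed
  then have "(\<Union>x\<in>frac a s. case x of (b, t) \<Rightarrow> g b t) = (\<Union>x\<in>frac a s. c)" by (intro SUP_cong refl) blast
  also have "\<dots> = c" using frac_self[OF assms(1,2)] by auto
  finally show ?thesis .
qed

lemma frac_mult [simp]:
  assumes a: "a \<in> carrier A" "s \<in> M" and b: "b \<in> carrier A" "t \<in> M"
  shows "frac a s \<otimes>\<^bsub>L\<^esub> frac b t = frac (a \<otimes> b) (s \<otimes> t)"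
proof -
  have "frac (a' \<otimes> b') (s' \<otimes> t') = frac (a \<otimes> b) (s \<otimes> t)"
    if c: "a' \<in> carrier A" "s' \<in> M" "b' \<in> carrier A" "t' \<in> M"
      and e: "frac a' s' = frac a s" "frac b' t' = frac b t" for a' b' s' t'
  proof -
    from e obtain u v where u: "u \<in> M" "u \<otimes> (a' \<otimes> s) = u \<otimes> (a \<otimes> s')"
      and v: "v \<in> M" "v \<otimes> (b' \<otimes> t) = v \<otimes> (b \<otimes> t')" using a b c by (auto simp: frac_eq_iff)
    have "(u \<otimes> v) \<otimes> (a' \<otimes> b' \<otimes> (s \<otimes> t)) = (u \<otimes> (a' \<otimes> s)) \<otimes> (v \<otimes> (b' \<otimes> t))"
      using a b c u(1) v(1) by (simp add: m_ac)
    also have "\<dots> = (u \<otimes> v) \<otimes> (a \<otimes> b \<otimes> (s' \<otimes> t'))"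
      unfolding u v using a b c u(1) v(1) by (simp add: m_ac)
    finally show ?thesis using a b c u(1) v(1) by (subst frac_eq_iff) auto
  qed
  note wd = this
  have "frac a s \<otimes>\<^bsub>L\<^esub> frac b t =
      (\<Union>(a', s')\<in>frac a s. \<Union>(b', t')\<in>frac b t. frac (a' \<otimes> b') (s' \<otimes> t'))"
    by (simp add: localisation_def)
  also have "\<dots> = frac (a \<otimes> b) (s \<otimes> t)"
    by (intro UN_frac a b wd) assumption+
  finally show ?thesis .
qed

lemma frac_add [simp]:
  assumes a: "a \<in> carrier A" "s \<in> M" and b: "b \<in> carrier A" "t \<in> M"
  shows "frac a s \<oplus>\<^bsub>L\<^esub> frac b t = frac (a \<otimes> t \<oplus> b \<otimes> s) (s \<otimes> t)"
proof -
  have "frac (a' \<otimes> t' \<oplus> b' \<otimes> s') (s' \<otimes> t') = frac (a \<otimes> t \<oplus> b \<otimes> s) (s \<otimes> t)"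
    if c: "a' \<in> carrier A" "s' \<in> M" "b' \<in> carrier A" "t' \<in> M"
      and e: "frac a' s' = frac a s" "frac b' t' = frac b t" for a' b' s' t'
  proof -
    from e obtain u v where u: "u \<in> M" "u \<otimes> (a' \<otimes> s) = u \<otimes> (a \<otimes> s')"
      and v: "v \<in> M" "v \<otimes> (b' \<otimes> t) = v \<otimes> (b \<otimes> t')" using a b c by (auto simp: frac_eq_iff)
    have "(u \<otimes> v) \<otimes> ((a' \<otimes> t' \<oplus> b' \<otimes> s') \<otimes> (s \<otimes> t)) =
        (v \<otimes> t' \<otimes> t) \<otimes> (u \<otimes> (a' \<otimes> s)) \<oplus> (u \<otimes> s \<otimes> s') \<otimes> (v \<otimes> (b' \<otimes> t))"
      using a b c u(1) v(1) by (simp add: m_ac l_distr r_distr)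
    also have "\<dots> = (u \<otimes> v) \<otimes> ((a \<otimes> t \<oplus> b \<otimes> s) \<otimes> (s' \<otimes> t'))"
      unfolding u v using a b c u(1) v(1) by (simp add: m_ac l_distr r_distr)
    finally show ?thesis using a b c u(1) v(1) by (subst frac_eq_iff) auto
  qed
  note wd = this
  have "frac a s \<oplus>\<^bsub>L\<^esub> frac b t =
      (\<Union>(a', s')\<in>frac a s. \<Union>(b', t')\<in>frac b t. frac (a' \<otimes> t' \<oplus> b' \<otimes> s') (s' \<otimes> t'))"
    by (simp add: localisation_def)
  also have "\<dots> = frac (a \<otimes> t \<oplus> b \<otimes> s) (s \<otimes> t)"
    by (intro UN_frac a b wd) assumption+
  finally show ?thesis .
qed

lemma L_one: "\<one>\<^bsub>L\<^esub> = frac \<one> \<one>" and L_zero: "\<zero>\<^bsub>L\<^esub> = frac \<zero> \<one>"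
  by (simp_all add: localisation_def)

sublocale L: cring L
proof (rule cringI)
  show "abelian_group L"
  proof (rule abelian_groupI)
    fix x y assume x: "x \<in> carrier L" and y: "y \<in> carrier L"
    show "x \<oplus>\<^bsub>L\<^esub> y \<in> carrier L" using x y by (auto elim!: carr_fracE)
    show "x \<oplus>\<^bsub>L\<^esub> y = y \<oplus>\<^bsub>L\<^esub> x" using x y by (auto elim!: carr_fracE simp: a_comm m_comm)
  next
    fix x y z assume "x \<in> carrier L" "y \<in> carrier L" "z \<in> carrier L"
    then show "x \<oplus>\<^bsub>L\<^esub> y \<oplus>\<^bsub>L\<^esub> z = x \<oplus>\<^bsub>L\<^esub> (y \<oplus>\<^bsub>L\<^esub> z)"
      by (elim carr_fracE) (simp add: m_ac l_distr r_distr a_ac)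
  next
    fix x assume "x \<in> carrier L"
    then obtain a s where x: "a \<in> carrier A" "s \<in> M" "x = frac a s" by (rule carr_fracE)
    show "\<zero>\<^bsub>L\<^esub> \<oplus>\<^bsub>L\<^esub> x = x" using x by (simp add: L_zero)
    have "frac (\<ominus> a) s \<oplus>\<^bsub>L\<^esub> x = \<zero>\<^bsub>L\<^esub>"
      using x by (simp add: L_zero l_minus l_neg, intro frac_eqI) auto
    then show "\<exists>y\<in>carrier L. y \<oplus>\<^bsub>L\<^esub> x = \<zero>\<^bsub>L\<^esub>" using x by blast
  qed (auto simp: L_zero)
  show "comm_monoid L"
  proof (rule comm_monoidI)
    fix x y assume x: "x \<in> carrier L" and y: "y \<in> carrier L"
    show "x \<otimes>\<^bsub>L\<^esub> y \<in> carrier L" using x y by (auto elim!: carr_fracE)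
    show "x \<otimes>\<^bsub>L\<^esub> y = y \<otimes>\<^bsub>L\<^esub> x" using x y by (auto elim!: carr_fracE simp: m_comm)
  next
    fix x y z assume "x \<in> carrier L" "y \<in> carrier L" "z \<in> carrier L"
    then show "x \<otimes>\<^bsub>L\<^esub> y \<otimes>\<^bsub>L\<^esub> z = x \<otimes>\<^bsub>L\<^esub> (y \<otimes>\<^bsub>L\<^esub> z)"
      by (auto elim!: carr_fracE simp: m_ac)
  next
    fix x assume "x \<in> carrier L"
    then show "\<one>\<^bsub>L\<^esub> \<otimes>\<^bsub>L\<^esub> x = x" by (auto elim!: carr_fracE simp: L_one)
  qed (auto simp: L_one)
  fix x y z assume "x \<in> carrier L" "y \<in> carrier L" "z \<in> carrier L"
  then show "(x \<oplus>\<^bsub>L\<^esub> y) \<otimes>\<^bsub>L\<^esub> z = x \<otimes>\<^bsub>L\<^esub> z \<oplus>\<^bsub>L\<^esub> y \<otimes>\<^bsub>L\<^esub> z"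
    by (elim carr_fracE, simp, intro frac_eqI) (auto simp: m_ac l_distr r_distr)
qed

lemma frac_zero_iff:
  "a \<in> carrier A \<Longrightarrow> s \<in> M \<Longrightarrow> frac a s = \<zero>\<^bsub>L\<^esub> \<longleftrightarrow> (\<exists>u\<in>M. u \<otimes> a = \<zero>)"
  unfolding L_zero by (auto simp: frac_eq_iff)

lemma frac_hom: "(\<lambda>a. frac a \<one>) \<in> ring_hom A L"
  by (rule ring_hom_memI) (auto simp: L_one)

lemma frac_add_same:
  "\<lbrakk>a \<in> carrier A; b \<in> carrier A; s \<in> M\<rbrakk> \<Longrightarrow> frac a s \<oplus>\<^bsub>L\<^esub> frac b s = frac (a \<oplus> b) s"
  by (simp, intro frac_eqI) (auto simp: m_ac l_distr r_distr)

lemma frac_self_one: "s \<in> M \<Longrightarrow> frac s s = \<one>\<^bsub>L\<^esub>"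
  unfolding L_one by (rule frac_eqI) auto

lemma frac_pow: "a \<in> carrier A \<Longrightarrow> s \<in> M \<Longrightarrow> frac a s [^]\<^bsub>L\<^esub> (n::nat) = frac (a [^] n) (s [^] n)"
  by (induction n) (auto simp: L_one)

end

text \<open>A relation between two fractions with multiplier u is carried by \<phi> to one with
  multiplier \<phi> u, which is admissible because \<phi> maps M into N.\<close>

lemma localisation_map_frac:
  assumes "localised A M" "localised B N" "\<phi> \<in> ring_hom A B" "\<phi> ` M \<subseteq> N" "a \<in> carrier A" "s \<in> M"
  shows "localisation_map B N \<phi> (loc_frac A M a s) = loc_frac B N (\<phi> a) (\<phi> s)"
proof -
  interpret A: localised A M by fact
  interpret B: localised B N by fact
  have "loc_frac B N (\<phi> b) (\<phi> t) = loc_frac B N (\<phi> a) (\<phi> s)"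
    if b: "b \<in> carrier A" "t \<in> M" "A.frac b t = A.frac a s" for b t
  proof -
    from b obtain u where u: "u \<in> M" "u \<otimes>\<^bsub>A\<^esub> (b \<otimes>\<^bsub>A\<^esub> s) = u \<otimes>\<^bsub>A\<^esub> (a \<otimes>\<^bsub>A\<^esub> t)"
      using assms by (auto simp: A.frac_eq_iff)
    have "\<phi> u \<otimes>\<^bsub>B\<^esub> (\<phi> b \<otimes>\<^bsub>B\<^esub> \<phi> s) = \<phi> (u \<otimes>\<^bsub>A\<^esub> (b \<otimes>\<^bsub>A\<^esub> s))"
      using assms(6) b u(1) by (simp add: ring_hom_mult[OF assms(3)])
    also have "\<dots> = \<phi> u \<otimes>\<^bsub>B\<^esub> (\<phi> a \<otimes>\<^bsub>B\<^esub> \<phi> t)"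
      unfolding u(2) using assms(5) b u(1) by (simp add: ring_hom_mult[OF assms(3)])
    finally have eq: "\<phi> u \<otimes>\<^bsub>B\<^esub> (\<phi> b \<otimes>\<^bsub>B\<^esub> \<phi> s) = \<phi> u \<otimes>\<^bsub>B\<^esub> (\<phi> a \<otimes>\<^bsub>B\<^esub> \<phi> t)" .
    have "\<phi> u \<in> N" "\<phi> t \<in> N" "\<phi> s \<in> N" "\<phi> a \<in> carrier B" "\<phi> b \<in> carrier B"
      using assms(4-6) b u(1) by (auto intro: ring_hom_closed[OF assms(3)])
    then show ?thesis using eq by (subst B.frac_eq_iff) blast+
  qed
  then show ?thesis unfolding localisation_map_def by (intro A.UN_frac assms) assumption+
qed

lemma localisation_map_hom:
  assumes "localised A M" "localised B N" "\<phi> \<in> ring_hom A B" "\<phi> ` M \<subseteq> N"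
  shows "localisation_map B N \<phi> \<in> ring_hom (localisation A M) (localisation B N)"
proof -
  interpret A: localised A M by fact
  interpret B: localised B N by fact
  note [simp] = localisation_map_frac[OF assms] ring_hom_mult[OF assms(3)] ring_hom_add[OF assms(3)]
  have [simp]: "s \<in> M \<Longrightarrow> \<phi> s \<in> N" for s using assms by auto
  have [simp]: "a \<in> carrier A \<Longrightarrow> \<phi> a \<in> carrier B" for a by (rule ring_hom_closed[OF assms(3)])
  show ?thesis
    by (rule ring_hom_memI) (auto elim!: A.carr_fracE simp: A.L_one B.L_one ring_hom_one[OF assms(3)])
qed

section \<open>Multiplicative sets: powers of an element, complements of primes\<close>

lemma localised_powers:
  assumes "cring A" "x \<in> carrier A"
  shows "localised A (powers A x)"
proof -
  interpret cring A by fact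
  have "submonoid (powers A x) A"
  proof (rule submonoid.intro)
    show "powers A x \<subseteq> carrier A" using assms(2) by (auto simp: powers_def)
    have "\<one>\<^bsub>A\<^esub> = x [^]\<^bsub>A\<^esub> (0::nat)" by simp
    then show "\<one>\<^bsub>A\<^esub> \<in> powers A x" unfolding powers_def by blast
    fix y z assume "y \<in> powers A x" "z \<in> powers A x"
    then obtain n m :: nat where "y = x [^]\<^bsub>A\<^esub> n" "z = x [^]\<^bsub>A\<^esub> m" unfolding powers_def by blast
    then have "y \<otimes>\<^bsub>A\<^esub> z = x [^]\<^bsub>A\<^esub> (n + m)" using nat_pow_mult[OF assms(2)] by simp
    then show "y \<otimes>\<^bsub>A\<^esub> z \<in> powers A x" unfolding powers_def by blast
  qed
  then show ?thesis by (intro localised.intro localised_axioms.intro assms(1))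
qed

lemma ring_hom_nat_pow:
  assumes "ring A" "ring B" "\<phi> \<in> ring_hom A B" "x \<in> carrier A"
  shows "\<phi> (x [^]\<^bsub>A\<^esub> (n::nat)) = \<phi> x [^]\<^bsub>B\<^esub> n"
proof -
  interpret A: ring A by fact
  interpret B: ring B by fact
  show ?thesis
    by (induction n)
      (simp_all add: assms ring_hom_one[OF assms(3)] ring_hom_mult[OF assms(3)] )
qed

lemma powers_image:
  assumes "cring A" "cring B" "\<phi> \<in> ring_hom A B" "x \<in> carrier A"
  shows "\<phi> ` powers A x = powers B (\<phi> x)"
proof -
  have "\<phi> (x [^]\<^bsub>A\<^esub> (n::nat)) = \<phi> x [^]\<^bsub>B\<^esub> n" for n
    using assms by (simp add: ring_hom_nat_pow cring.axioms)
  then show ?thesis unfolding powers_def by (auto simp: image_iff) metis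
qed

lemma localised_prime:
  assumes "primeideal p A"
  shows "localised A (carrier A - p)"
proof -
  interpret primeideal p A by fact
  have "submonoid (carrier A - p) A"
    by (rule submonoid.intro) (use I_prime I_notcarr one_imp_carrier in auto)
  then show ?thesis by (intro localised.intro localised_axioms.intro is_cring)
qed

section \<open>Prime ideals\<close>

text \<open>The elements of I + (a) are kept in the form i + r a, because the proof that an ideal
  maximal among those avoiding a multiplicative set is prime multiplies two such elements.\<close>

lemma (in cring) ideal_add_principal:
  assumes "ideal I R" "a \<in> carrier R"
  defines "J \<equiv> {i \<oplus> r \<otimes> a | i r. i \<in> I \<and> r \<in> carrier R}"
  shows "ideal J R" and "I \<subseteq> J" and "a \<in> J"
proof -
  let ?J = "{i \<oplus> r \<otimes> a | i r. i \<in> I \<and> r \<in> carrier R}"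
  have J: "J = ?J" by (simp add: J_def)
  interpret I: ideal I R by fact
  note [simp] = I.Icarr I.zero_closed assms(2)
  show "I \<subseteq> J" unfolding J
  proof
    fix i assume "i \<in> I"
    then have "i = i \<oplus> \<zero> \<otimes> a" by simp
    then show "i \<in> ?J" using \<open>i \<in> I\<close> zero_closed by blast
  qed
  have "a = \<zero> \<oplus> \<one> \<otimes> a" by simp
  then have a: "a \<in> ?J" using I.zero_closed one_closed by blast
  then show "a \<in> J" unfolding J .
  show "ideal J R" unfolding J
  proof (rule idealI)
    show "subgroup ?J (add_monoid R)"
    proof (rule add.subgroupI)
      show "?J \<subseteq> carrier R" by auto
      show "?J \<noteq> {}" using a by blast
      fix x assume "x \<in> ?J"
      then obtain i r where x: "x = i \<oplus> r \<otimes> a" "i \<in> I" "r \<in> carrier R" by blast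
      then have "\<ominus> x = (\<ominus> i) \<oplus> (\<ominus> r) \<otimes> a" by (simp add: minus_add l_minus)
      then show "\<ominus> x \<in> ?J" using x I.a_inv_closed by blast
      fix y assume "y \<in> ?J"
      then obtain j s where y: "y = j \<oplus> s \<otimes> a" "j \<in> I" "s \<in> carrier R" by blast
      then have "x \<oplus> y = (i \<oplus> j) \<oplus> (r \<oplus> s) \<otimes> a" using x by (simp add: l_distr a_ac)
      then show "x \<oplus> y \<in> ?J" using x y I.a_closed a_closed by blast
    qed
    fix x b assume "x \<in> ?J" and b: "b \<in> carrier R"
    then obtain i r where x: "x = i \<oplus> r \<otimes> a" "i \<in> I" "r \<in> carrier R" by blast
    have "b \<otimes> x = b \<otimes> i \<oplus> (b \<otimes> r) \<otimes> a" using x b by (simp add: r_distr m_ac)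
    then show "b \<otimes> x \<in> ?J" using x b I.I_l_closed by blast
    then show "x \<otimes> b \<in> ?J" using x b by (simp add: m_comm)
  qed (rule ring_axioms)
qed

text \<open>An ideal which is maximal among those containing \<open>I\<close> and avoiding \<open>M\<close> is prime.\<close>

lemma (in localised) prime_avoiding:
  assumes I: "ideal I A" "I \<inter> M = {}"
  obtains q where "primeideal q A" "I \<subseteq> q" "q \<inter> M = {}"
proof -
  let ?F = "{J. ideal J A \<and> I \<subseteq> J \<and> J \<inter> M = {}}"
  have "\<exists>Q\<in>?F. \<forall>X\<in>?F. Q \<subseteq> X \<longrightarrow> X = Q"
  proof (rule subset_Zorn)
    fix C assume C: "subset.chain ?F C"
    show "\<exists>U\<in>?F. \<forall>X\<in>C. X \<subseteq> U"
    proof (cases "C = {}")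
      case True then show ?thesis using I by auto
    next
      case False
      have "subset.chain {J. ideal J A} C" using C unfolding subset_chain_def by blast
      then have "ideal (\<Union>C) A" using chain_Union_is_ideal[of C] False by simp
      moreover have "I \<subseteq> \<Union>C" "\<Union>C \<inter> M = {}" using C False unfolding subset_chain_def by blast+
      ultimately show ?thesis by blast
    qed
  qed
  then obtain q where q': "q \<in> ?F" and max': "\<forall>X\<in>?F. q \<subseteq> X \<longrightarrow> X = q" by (rule bexE)
  have q: "ideal q A" "I \<subseteq> q" "q \<inter> M = {}" using q' by simp_all
  have max: "J = q" if "ideal J A" "I \<subseteq> J" "J \<inter> M = {}" "q \<subseteq> J" for J using max' that by simp
  interpret q: ideal q A by fact
  \<comment> \<open>By maximality of q, the strictly larger ideal q + (a) has to meet M.\<close>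
  have meet: "\<exists>i r. i \<in> q \<and> r \<in> carrier A \<and> i \<oplus> r \<otimes> a \<in> M" if a: "a \<in> carrier A" "a \<notin> q" for a
  proof (rule ccontr)
    assume no: "\<not> ?thesis"
    let ?J = "{i \<oplus> r \<otimes> a | i r. i \<in> q \<and> r \<in> carrier A}"
    note J = ideal_add_principal[OF q(1) a(1)]
    have "?J \<inter> M = {}" using no by blast
    then have "?J = q" using max[OF J(1)] J(2) q(2) by blast
    then show False using J(3) a(2) by blast
  qed
  have "primeideal q A"
  proof (rule primeidealI)
    show "carrier A \<noteq> q" using q(3) by auto
    fix a b assume ab: "a \<in> carrier A" "b \<in> carrier A" "a \<otimes> b \<in> q"
    show "a \<in> q \<or> b \<in> q"
    proof (rule ccontr)
      assume "\<not> (a \<in> q \<or> b \<in> q)"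
      then have "a \<notin> q" "b \<notin> q" by simp_all
      from meet[OF ab(1) this(1)] obtain i r where ir: "i \<in> q" "r \<in> carrier A" "i \<oplus> r \<otimes> a \<in> M" by blast
      from meet[OF ab(2) \<open>b \<notin> q\<close>] obtain j s where js: "j \<in> q" "s \<in> carrier A" "j \<oplus> s \<otimes> b \<in> M" by blast
      \<comment> \<open>Every term of the expanded product contains i, j or a b, all of which lie in
        q, whereas the product of two elements of M lies in M.\<close>
      have "(i \<oplus> r \<otimes> a) \<otimes> (j \<oplus> s \<otimes> b) = i \<otimes> (j \<oplus> s \<otimes> b) \<oplus> ((r \<otimes> a) \<otimes> j \<oplus> (r \<otimes> s) \<otimes> (a \<otimes> b))"
        using ir(1,2) js(1,2) ab q.Icarr by (simp add: l_distr r_distr m_ac a_ac)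
      also have "\<dots> \<in> q"
        using ir(1,2) js(1,2) ab(1,2) q.Icarr[OF js(1)]
          q.I_r_closed[OF ir(1), of "j \<oplus> s \<otimes> b"] q.I_l_closed[OF js(1), of "r \<otimes> a"]
          q.I_l_closed[OF ab(3), of "r \<otimes> s"] by simp
      finally show False using q(3) ir js M_mult by blast
    qed
  qed (use q is_cring in auto)
  then show ?thesis using that q by blast
qed

text \<open>For the submonoid consisting of 1 alone, avoiding it means being proper.\<close>

lemma proper_ideal_in_prime:
  fixes A :: "'a ring"
  assumes "cring A" "ideal I A" "\<one>\<^bsub>A\<^esub> \<notin> I"
  obtains q where "primeideal q A" "I \<subseteq> q"
proof -
  interpret cring A by fact
  have "submonoid {\<one>\<^bsub>A\<^esub>} A" by (rule submonoid.intro) auto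
  then have "localised A {\<one>\<^bsub>A\<^esub>}" by (intro localised.intro localised_axioms.intro assms(1))
  moreover have "I \<inter> {\<one>\<^bsub>A\<^esub>} = {}" using assms(3) by simp
  ultimately obtain q where "primeideal q A" "I \<subseteq> q" using localised.prime_avoiding[OF _ assms(2)] by metis
  then show ?thesis by (rule that)
qed

section \<open>Linear spans in algebras\<close>

text \<open>Linear combinations are built one term at a time, with repetitions allowed, so that
  closure properties follow by rule induction instead of through finite sums. For K = A and the
  identity map this is the ideal generated by X.\<close>

inductive_set lspan :: "'k ring \<Rightarrow> 'a ring \<Rightarrow> ('k \<Rightarrow> 'a) \<Rightarrow> 'a set \<Rightarrow> 'a set"
  for K A \<iota> X where
  zero: "\<zero>\<^bsub>A\<^esub> \<in> lspan K A \<iota> X"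
| step: "\<lbrakk>k \<in> carrier K; x \<in> X; y \<in> lspan K A \<iota> X\<rbrakk> \<Longrightarrow> \<iota> k \<otimes>\<^bsub>A\<^esub> x \<oplus>\<^bsub>A\<^esub> y \<in> lspan K A \<iota> X"

lemma lspan_mono: "y \<in> lspan K A \<iota> X \<Longrightarrow> X \<subseteq> Y \<Longrightarrow> y \<in> lspan K A \<iota> Y"
  by (induction rule: lspan.induct) (auto intro: lspan.intros)

text \<open>A derivation uses finitely many generators. This is the source of the quasi-compactness
  of spectra and of the bounds on the monomials in a linear relation.\<close>

lemma lspan_finite:
  "y \<in> lspan K A \<iota> X \<Longrightarrow> \<exists>X'\<subseteq>X. finite X' \<and> y \<in> lspan K A \<iota> X'"
proof (induction rule: lspan.induct)
  case zero
  then show ?case by (intro exI[of _ "{}"]) (auto intro: lspan.zero)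
next
  case (step k x y)
  then obtain X' where "X' \<subseteq> X" "finite X'" "y \<in> lspan K A \<iota> X'" by blast
  then show ?case using step
    by (intro exI[of _ "insert x X'"]) (auto intro!: lspan.step intro: lspan_mono)
qed

locale ring_extension = K: cring K + A: cring A
  for K :: "'k ring" and A :: "'a ring" and \<iota> :: "'k \<Rightarrow> 'a" +
  assumes hom: "\<iota> \<in> ring_hom K A"
begin

abbreviation span where "span \<equiv> lspan K A \<iota>"

lemma \<iota>_closed: "k \<in> carrier K \<Longrightarrow> \<iota> k \<in> carrier A"
  by (rule ring_hom_closed[OF hom])

lemma \<iota>_simps:
  "k \<in> carrier K \<Longrightarrow> l \<in> carrier K \<Longrightarrow> \<iota> (k \<otimes>\<^bsub>K\<^esub> l) = \<iota> k \<otimes>\<^bsub>A\<^esub> \<iota> l"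
  "k \<in> carrier K \<Longrightarrow> l \<in> carrier K \<Longrightarrow> \<iota> (k \<oplus>\<^bsub>K\<^esub> l) = \<iota> k \<oplus>\<^bsub>A\<^esub> \<iota> l"
  "\<iota> \<one>\<^bsub>K\<^esub> = \<one>\<^bsub>A\<^esub>" "\<iota> \<zero>\<^bsub>K\<^esub> = \<zero>\<^bsub>A\<^esub>"
  "k \<in> carrier K \<Longrightarrow> \<iota> (\<ominus>\<^bsub>K\<^esub> k) = \<ominus>\<^bsub>A\<^esub> \<iota> k"
proof -
  interpret ring_hom_cring K A \<iota>
    by (intro ring_hom_cringI ring_hom_cring.intro ring_hom_cring_axioms.intro K.is_cring A.is_cring hom)
  show "k \<in> carrier K \<Longrightarrow> l \<in> carrier K \<Longrightarrow> \<iota> (k \<otimes>\<^bsub>K\<^esub> l) = \<iota> k \<otimes>\<^bsub>A\<^esub> \<iota> l"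
    "k \<in> carrier K \<Longrightarrow> l \<in> carrier K \<Longrightarrow> \<iota> (k \<oplus>\<^bsub>K\<^esub> l) = \<iota> k \<oplus>\<^bsub>A\<^esub> \<iota> l"
    "\<iota> \<one>\<^bsub>K\<^esub> = \<one>\<^bsub>A\<^esub>" "\<iota> \<zero>\<^bsub>K\<^esub> = \<zero>\<^bsub>A\<^esub>"
    "k \<in> carrier K \<Longrightarrow> \<iota> (\<ominus>\<^bsub>K\<^esub> k) = \<ominus>\<^bsub>A\<^esub> \<iota> k"
    by simp_all
qed

lemma span_carr: "y \<in> span X \<Longrightarrow> X \<subseteq> carrier A \<Longrightarrow> y \<in> carrier A"
  by (induction rule: lspan.induct) (auto simp: \<iota>_closed)

lemma span_add:
  notes [simp] = \<iota>_simps \<iota>_closed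
  assumes "y \<in> span X" "z \<in> span X" "X \<subseteq> carrier A"
  shows "y \<oplus>\<^bsub>A\<^esub> z \<in> span X"
  using assms
proof (induction rule: lspan.induct)
  case zero
  then show ?case using span_carr by simp
next
  case (step k x y)
  then have "\<iota> k \<otimes>\<^bsub>A\<^esub> x \<oplus>\<^bsub>A\<^esub> y \<oplus>\<^bsub>A\<^esub> z = \<iota> k \<otimes>\<^bsub>A\<^esub> x \<oplus>\<^bsub>A\<^esub> (y \<oplus>\<^bsub>A\<^esub> z)"
    using span_carr by (intro A.a_assoc) auto
  then show ?case using step by (auto intro: lspan.step)
qed

lemma span_incl: "x \<in> X \<Longrightarrow> X \<subseteq> carrier A \<Longrightarrow> x \<in> span X"
  using lspan.step[of "\<one>\<^bsub>K\<^esub>" K x X "\<zero>\<^bsub>A\<^esub>" A \<iota>] lspan.zero[of A K \<iota> X] by (auto simp: subset_iff \<iota>_simps)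

text \<open>Multiplication by m is linear and may be tested on generators. The target set Y is kept
  separate from X because multiplication by a monomial changes the bound on the monomials
  involved.\<close>

lemma span_mult:
  notes [simp] = \<iota>_simps \<iota>_closed
  assumes "y \<in> span X" "X \<subseteq> carrier A" "m \<in> carrier A" "\<And>x. x \<in> X \<Longrightarrow> m \<otimes>\<^bsub>A\<^esub> x \<in> span Y" "Y \<subseteq> carrier A"
  shows "m \<otimes>\<^bsub>A\<^esub> y \<in> span Y"
  using assms(1)
proof (induction rule: lspan.induct)
  case zero
  then show ?case using assms by (auto intro: lspan.zero)
next
  case (step k x y)
  \<comment> \<open>The step needs closure of the target under scalars, which
    \<open>span_scale\<close> will derive from this very lemma; hence the separate
    induction.\<close>
  have scal: "\<iota> k \<otimes>\<^bsub>A\<^esub> z \<in> span Y" if "z \<in> span Y" "k \<in> carrier K" for z k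
    using that
  proof (induction rule: lspan.induct)
    case zero
    then show ?case by (auto intro: lspan.zero)
  next
    case (step l x y)
    have "\<iota> k \<otimes>\<^bsub>A\<^esub> (\<iota> l \<otimes>\<^bsub>A\<^esub> x \<oplus>\<^bsub>A\<^esub> y) = \<iota> (k \<otimes>\<^bsub>K\<^esub> l) \<otimes>\<^bsub>A\<^esub> x \<oplus>\<^bsub>A\<^esub> \<iota> k \<otimes>\<^bsub>A\<^esub> y"
      using step assms span_carr[OF step(3)] by (auto simp: A.r_distr A.m_assoc subset_iff)
    moreover have "\<iota> (k \<otimes>\<^bsub>K\<^esub> l) \<otimes>\<^bsub>A\<^esub> x \<oplus>\<^bsub>A\<^esub> \<iota> k \<otimes>\<^bsub>A\<^esub> y \<in> span Y"
      using step by (intro lspan.step) auto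
    ultimately show ?case by simp
  qed
  have "m \<otimes>\<^bsub>A\<^esub> (\<iota> k \<otimes>\<^bsub>A\<^esub> x \<oplus>\<^bsub>A\<^esub> y) = \<iota> k \<otimes>\<^bsub>A\<^esub> (m \<otimes>\<^bsub>A\<^esub> x) \<oplus>\<^bsub>A\<^esub> m \<otimes>\<^bsub>A\<^esub> y"
    using step assms(2,3) span_carr[OF step(3) assms(2)] by (auto simp: A.r_distr A.m_ac subset_iff)
  then show ?case using span_add[OF scal[OF assms(4)[OF step(2)] step(1)] step(4) assms(5)] by simp
qed

lemma span_scale:
  notes [simp] = \<iota>_simps \<iota>_closed
  assumes "y \<in> span X" "X \<subseteq> carrier A" "k \<in> carrier K"
  shows "\<iota> k \<otimes>\<^bsub>A\<^esub> y \<in> span X"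
proof (rule span_mult[OF assms(1,2) _ _ assms(2)])
  fix x assume "x \<in> X"
  then have "\<iota> k \<otimes>\<^bsub>A\<^esub> x \<oplus>\<^bsub>A\<^esub> \<zero>\<^bsub>A\<^esub> \<in> span X" using assms(3) by (intro lspan.intros)
  then show "\<iota> k \<otimes>\<^bsub>A\<^esub> x \<in> span X" using assms \<open>x \<in> X\<close> by (auto simp: subset_iff)
qed (use assms in auto)

lemma span_minus:
  notes [simp] = \<iota>_simps \<iota>_closed
  assumes "y \<in> span X" "X \<subseteq> carrier A"
  shows "\<ominus>\<^bsub>A\<^esub> y \<in> span X"
proof -
  have "\<iota> (\<ominus>\<^bsub>K\<^esub> \<one>\<^bsub>K\<^esub>) \<otimes>\<^bsub>A\<^esub> y \<in> span X" by (rule span_scale[OF assms]) simp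
  then show ?thesis using span_carr[OF assms] by (simp add: A.l_minus)
qed

lemma span_subset:
  assumes "y \<in> span X" "X \<subseteq> span Y" "Y \<subseteq> carrier A"
  shows "y \<in> span Y"
  using assms(1)
proof (induction rule: lspan.induct)
  case (step k x y)
  then show ?case using assms span_scale span_add by blast
qed (rule lspan.zero)

text \<open>Bilinearity in two applications of linearity: first with y fixed, then with a generator
  of Y fixed.\<close>

lemma span_prod:
  notes [simp] = \<iota>_simps \<iota>_closed
  assumes "y \<in> span X" "z \<in> span Y" "X \<subseteq> carrier A" "Y \<subseteq> carrier A" "Z \<subseteq> carrier A"
    and "\<And>x y. x \<in> X \<Longrightarrow> y \<in> Y \<Longrightarrow> x \<otimes>\<^bsub>A\<^esub> y \<in> span Z"
  shows "y \<otimes>\<^bsub>A\<^esub> z \<in> span Z"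
proof -
  have yc: "y \<in> carrier A" using span_carr assms by blast
  show ?thesis
  proof (rule span_mult[OF assms(2,4) yc _ assms(5)])
    fix b assume b: "b \<in> Y"
    have "b \<otimes>\<^bsub>A\<^esub> y \<in> span Z"
    proof (rule span_mult[OF assms(1,3) _ _ assms(5)])
      fix x assume "x \<in> X"
      then show "b \<otimes>\<^bsub>A\<^esub> x \<in> span Z" using assms(6)[OF _ b] assms(3,4) b
        by (metis A.m_comm subsetD)
    qed (use b assms(4) in auto)
    then show "y \<otimes>\<^bsub>A\<^esub> b \<in> span Z" using b yc assms(4) by (metis A.m_comm subsetD)
  qed
qed

end

lemma span_ideal:
  fixes A :: "'a ring"
  assumes "cring A" "X \<subseteq> carrier A"
  shows "ideal (lspan A A (\<lambda>x. x) X) A"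
proof -
  interpret A: cring A by fact
  interpret ring_extension A A "\<lambda>x. x"
    by unfold_locales (auto simp: ring_hom_def)
  show ?thesis
  proof (rule idealI)
    show "subgroup (span X) (add_monoid A)"
    proof (rule A.add.subgroupI)
      show "span X \<subseteq> carrier A" using span_carr assms(2) by (intro subsetI)
      show "span X \<noteq> {}" using lspan.zero[of A A "\<lambda>x. x" X] by auto
      show "\<ominus>\<^bsub>A\<^esub> x \<in> span X" if "x \<in> span X" for x by (rule span_minus[OF that assms(2)])
      show "x \<oplus>\<^bsub>A\<^esub> y \<in> span X" if "x \<in> span X" "y \<in> span X" for x y
        by (rule span_add[OF that assms(2)])
    qed
    fix a x assume a: "a \<in> span X" and x: "x \<in> carrier A"
    show "x \<otimes>\<^bsub>A\<^esub> a \<in> span X" by (rule span_scale[OF a assms(2) x])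
    then show "a \<otimes>\<^bsub>A\<^esub> x \<in> span X" using span_carr[OF a assms(2)] x by (simp add: A.m_comm)
  qed (rule A.ring_axioms)
qed

section \<open>The spectrum of a ring\<close>

abbreviation primes :: "'a ring \<Rightarrow> 'a set set" where
  "primes A \<equiv> {p. primeideal p A}"

lemma openin_primes: "openin (zariski A) U \<Longrightarrow> U \<subseteq> primes A"
  using openin_subset topspace_zariski by blast

lemma openin_all [simp]: "openin (zariski A) (primes A)"
  using openin_topspace[of "zariski A"] topspace_zariski[of A] by simp

lemma open_contains_basic:
  assumes "openin (zariski A) W" "p \<in> W"
  obtains e where "e \<in> carrier A" "e \<notin> p" "\<And>q. primeideal q A \<Longrightarrow> e \<notin> q \<Longrightarrow> q \<in> W"
proof -
  obtain E where E: "E \<subseteq> carrier A" "W = {p. primeideal p A \<and> \<not> E \<subseteq> p}"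
    using assms(1) unfolding openin_zariski by blast
  then obtain e where "e \<in> E" "e \<notin> p" using assms(2) by blast
  then show thesis using E by (intro that[of e]) blast+
qed

lemma prime_one_notin [simp]: "primeideal p A \<Longrightarrow> \<one>\<^bsub>A\<^esub> \<notin> p"
  using ideal.one_imp_carrier[OF primeideal.axioms(1)] primeideal.I_notcarr by blast

lemma prime_mult_mem [simp]:
  "primeideal p A \<Longrightarrow> a \<in> carrier A \<Longrightarrow> b \<in> carrier A \<Longrightarrow> a \<otimes>\<^bsub>A\<^esub> b \<in> p \<longleftrightarrow> a \<in> p \<or> b \<in> p"
  using primeideal.I_prime ideal.I_l_closed[OF primeideal.axioms(1)] ideal.I_r_closed[OF primeideal.axioms(1)]
  by metis

lemma sections_iff:
  "\<sigma> \<in> carrier (spec_sections A U) \<longleftrightarrow>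
    \<sigma> \<in> (\<Pi>\<^sub>E p\<in>U. carrier (local_ring_at A p)) \<and>
        (\<forall>p\<in>U. \<exists>W a g. openin (zariski A) W \<and> p \<in> W \<and> W \<subseteq> U \<and>
          a \<in> carrier A \<and> g \<in> carrier A \<and>
          (\<forall>q\<in>W. g \<notin> q \<and> \<sigma> q = loc_frac A (carrier A - q) a g))"
  unfolding spec_sections_def by simp

lemma sections_simps:
  "\<sigma> \<otimes>\<^bsub>spec_sections A U\<^esub> \<tau> = (\<lambda>p\<in>U. \<sigma> p \<otimes>\<^bsub>local_ring_at A p\<^esub> \<tau> p)"
  "\<sigma> \<oplus>\<^bsub>spec_sections A U\<^esub> \<tau> = (\<lambda>p\<in>U. \<sigma> p \<oplus>\<^bsub>local_ring_at A p\<^esub> \<tau> p)"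
  "\<one>\<^bsub>spec_sections A U\<^esub> = (\<lambda>p\<in>U. \<one>\<^bsub>local_ring_at A p\<^esub>)"
  unfolding spec_sections_def by simp_all

definition global_section :: "'a ring \<Rightarrow> 'a \<Rightarrow> 'a set \<Rightarrow> ('a \<times> 'a) set" where
  "global_section A a = (\<lambda>p\<in>primes A. loc_frac A (carrier A - p) a \<one>\<^bsub>A\<^esub>)"

lemma global_section_hom:
  assumes "cring A"
  shows "global_section A \<in> ring_hom A (spec_sections A (primes A))"
proof -
  interpret cring A by fact
  have fr: "loc_frac A (carrier A - p) a \<one>\<^bsub>A\<^esub> \<in> carrier (local_ring_at A p)"
    if "primeideal p A" "a \<in> carrier A" for p a
  proof -
    interpret localised A "carrier A - p" by (rule localised_prime[OF that(1)])
    show ?thesis using that by (simp add: frac_carr)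
  qed
  show ?thesis
  proof (rule ring_hom_memI)
    fix a assume a: "a \<in> carrier A"
    show "global_section A a \<in> carrier (spec_sections A (primes A))"
      unfolding sections_iff
    proof (intro conjI ballI)
      show "global_section A a \<in> (\<Pi>\<^sub>E p\<in>primes A. carrier (local_ring_at A p))"
        unfolding global_section_def using fr a by auto
      fix p assume "p \<in> primes A"
      then show "\<exists>W b g. openin (zariski A) W \<and> p \<in> W \<and> W \<subseteq> primes A \<and>
          b \<in> carrier A \<and> g \<in> carrier A \<and>
          (\<forall>q\<in>W. g \<notin> q \<and> global_section A a q = loc_frac A (carrier A - q) b g)"
        using a prime_one_notin
        by (intro exI[of _ "primes A"] exI[of _ a] exI[of _ "\<one>\<^bsub>A\<^esub>"]) (auto simp: global_section_def)
    qed
    fix b assume b: "b \<in> carrier A"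
    show "global_section A (a \<otimes>\<^bsub>A\<^esub> b) =
        global_section A a \<otimes>\<^bsub>spec_sections A (primes A)\<^esub> global_section A b"
      unfolding sections_simps global_section_def
    proof (intro restrict_ext)
      fix p assume p: "p \<in> primes A"
      then interpret localised A "carrier A - p" by (intro localised_prime) simp
      show "frac (a \<otimes>\<^bsub>A\<^esub> b) \<one>\<^bsub>A\<^esub> = (\<lambda>p\<in>primes A. loc_frac A (carrier A - p) a \<one>\<^bsub>A\<^esub>) p \<otimes>\<^bsub>L\<^esub>
          (\<lambda>p\<in>primes A. loc_frac A (carrier A - p) b \<one>\<^bsub>A\<^esub>) p"
        using a b p by simp
    qed
    show "global_section A (a \<oplus>\<^bsub>A\<^esub> b) =
        global_section A a \<oplus>\<^bsub>spec_sections A (primes A)\<^esub> global_section A b"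
      unfolding sections_simps global_section_def
    proof (intro restrict_ext)
      fix p assume p: "p \<in> primes A"
      then interpret localised A "carrier A - p" by (intro localised_prime) simp
      show "frac (a \<oplus>\<^bsub>A\<^esub> b) \<one>\<^bsub>A\<^esub> = (\<lambda>p\<in>primes A. loc_frac A (carrier A - p) a \<one>\<^bsub>A\<^esub>) p \<oplus>\<^bsub>L\<^esub>
          (\<lambda>p\<in>primes A. loc_frac A (carrier A - p) b \<one>\<^bsub>A\<^esub>) p"
        using a b p by simp
    qed
  next
    show "global_section A \<one>\<^bsub>A\<^esub> = \<one>\<^bsub>spec_sections A (primes A)\<^esub>"
      unfolding sections_simps global_section_def
      by (intro restrict_ext) (simp add: localisation_def)
  qed
qed

text \<open>The u with u a = u b form an ideal. Equality of all germs says that no prime contains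
  this ideal, so it contains 1.\<close>

lemma global_section_inj:
  assumes "cring A"
  shows "inj_on (global_section A) (carrier A)"
proof (rule inj_onI)
  interpret cring A by fact
  fix a b assume a: "a \<in> carrier A" and b: "b \<in> carrier A" and eq: "global_section A a = global_section A b"
  let ?I = "{u \<in> carrier A. u \<otimes>\<^bsub>A\<^esub> a = u \<otimes>\<^bsub>A\<^esub> b}"
  have I: "ideal ?I A"
  proof (rule idealI)
    show "subgroup ?I (add_monoid A)"
      using a b by (intro add.subgroupI) (auto simp: l_distr l_minus intro: exI[of _ "\<zero>\<^bsub>A\<^esub>"])
    fix u x assume u: "u \<in> ?I" and x: "x \<in> carrier A"
    then show "x \<otimes>\<^bsub>A\<^esub> u \<in> ?I" using a b by (simp add: m_assoc)
    then show "u \<otimes>\<^bsub>A\<^esub> x \<in> ?I" using u x by (simp add: m_comm)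
  qed (rule ring_axioms)
  have "\<one>\<^bsub>A\<^esub> \<in> ?I"
  proof (rule ccontr)
    assume "\<one>\<^bsub>A\<^esub> \<notin> ?I"
    then obtain q where q: "primeideal q A" "?I \<subseteq> q" using proper_ideal_in_prime[OF assms I] by blast
    interpret localised A "carrier A - q" by (rule localised_prime[OF q(1)])
    have "frac a \<one>\<^bsub>A\<^esub> = frac b \<one>\<^bsub>A\<^esub>" using fun_cong[OF eq, of q] q(1) by (simp add: global_section_def)
    then obtain u where "u \<in> carrier A - q" "u \<otimes>\<^bsub>A\<^esub> a = u \<otimes>\<^bsub>A\<^esub> b"
      using a b frac_eq_iff[of a "\<one>\<^bsub>A\<^esub>" b "\<one>\<^bsub>A\<^esub>"] M_one by (auto simp del: Diff_iff)
    then show False using q(2) by blast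
  qed
  then show "a = b" using a b by simp
qed

text \<open>The ideal of all u with u x = u y meets the powers of f: otherwise some prime contains
  it and avoids f, contrary to the local agreement at that prime.\<close>

lemma fractions_agree:
  fixes A :: "'a ring"
  assumes "cring A" "f \<in> carrier A" "x \<in> carrier A" "y \<in> carrier A"
    and loc: "\<And>q. primeideal q A \<Longrightarrow> f \<notin> q \<Longrightarrow> \<exists>u\<in>carrier A - q. u \<otimes>\<^bsub>A\<^esub> x = u \<otimes>\<^bsub>A\<^esub> y"
  obtains n :: nat where "f [^]\<^bsub>A\<^esub> n \<otimes>\<^bsub>A\<^esub> x = f [^]\<^bsub>A\<^esub> n \<otimes>\<^bsub>A\<^esub> y"
proof -
  interpret localised A "powers A f" by (rule localised_powers[OF assms(1,2)])
  let ?I = "{u \<in> carrier A. u \<otimes>\<^bsub>A\<^esub> x = u \<otimes>\<^bsub>A\<^esub> y}"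
  have I: "ideal ?I A"
  proof (rule idealI)
    show "subgroup ?I (add_monoid A)"
      using assms(3,4) by (intro add.subgroupI) (auto simp: l_distr l_minus intro: exI[of _ "\<zero>\<^bsub>A\<^esub>"])
    fix u z assume u: "u \<in> ?I" and z: "z \<in> carrier A"
    then show "z \<otimes>\<^bsub>A\<^esub> u \<in> ?I" using assms(3,4) by (simp add: m_assoc)
    then show "u \<otimes>\<^bsub>A\<^esub> z \<in> ?I" using u z by (simp add: m_comm)
  qed (rule ring_axioms)
  have "?I \<inter> powers A f \<noteq> {}"
  proof
    assume "?I \<inter> powers A f = {}"
    then obtain q where q: "primeideal q A" "?I \<subseteq> q" "q \<inter> powers A f = {}"
      using prime_avoiding[OF I] by blast
    have "f = f [^]\<^bsub>A\<^esub> (1::nat)" using assms(2) by simp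
    then have "f \<in> powers A f" unfolding powers_def by blast
    then have "f \<notin> q" using q(3) by blast
    then show False using loc[OF q(1)] q(2) by blast
  qed
  then show thesis using that unfolding powers_def by blast
qed

text \<open>Partition of unity. The section is b/f on finitely many sets D(f) that cover the
  spectrum; with one exponent N good for all overlaps, writing 1 as a sum of terms k f^(N+1) yields
  the global element a as the sum of the k b f^N.\<close>

lemma global_section_surj:
  assumes A: "cring A" and \<sigma>: "\<sigma> \<in> carrier (spec_sections A (primes A))"
  shows "\<exists>a\<in>carrier A. \<sigma> = global_section A a"
proof -
  interpret cring A by fact
  let ?fr = "\<lambda>q. loc_frac A (carrier A - q)"
  \<comment> \<open>Pairs representing the section as b/f on the whole of D(f), not only near one
    point.\<close>
  define good where "good = {(b, f). b \<in> carrier A \<and> f \<in> carrier A \<and>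
    (\<forall>q. primeideal q A \<and> f \<notin> q \<longrightarrow> \<sigma> q = ?fr q b f)}"
  have good_carr: "b \<in> carrier A" "f \<in> carrier A" if "(b, f) \<in> good" for b f
    using that unfolding good_def by auto
  have cover: "\<exists>(b, f)\<in>good. f \<notin> p" if p: "primeideal p A" for p
  proof -
    obtain W a g where W: "openin (zariski A) W" "p \<in> W" "a \<in> carrier A" "g \<in> carrier A"
      and eq: "\<And>q. q \<in> W \<Longrightarrow> g \<notin> q \<and> \<sigma> q = ?fr q a g"
      using \<sigma> p unfolding sections_iff by (metis (no_types, lifting) mem_Collect_eq)
    obtain e where e: "e \<in> carrier A" "e \<notin> p" "\<And>q. primeideal q A \<Longrightarrow> e \<notin> q \<Longrightarrow> q \<in> W"
      using open_contains_basic[OF W(1,2)] by metis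
    \<comment> \<open>The given neighbourhood W need not be a basic open set. It contains D(e), so
      expanding a/g by e gives a fraction valid on all of D(g e).\<close>
    have "\<sigma> q = ?fr q (a \<otimes>\<^bsub>A\<^esub> e) (g \<otimes>\<^bsub>A\<^esub> e)" if q: "primeideal q A" "g \<otimes>\<^bsub>A\<^esub> e \<notin> q" for q
    proof -
      interpret L: localised A "carrier A - q" by (rule localised_prime[OF q(1)])
      have eq': "e \<notin> q" using q W(4) e(1) ideal.I_l_closed[OF primeideal.axioms(1)[OF q(1)]] by blast
      then have "g \<notin> q" "\<sigma> q = ?fr q a g" using eq e(3) q(1) by blast+
      moreover have "?fr q a g = ?fr q (a \<otimes>\<^bsub>A\<^esub> e) (g \<otimes>\<^bsub>A\<^esub> e)"
        using W e(1) eq' q(2) calculation(1) by (intro L.frac_eqI) (auto simp: m_ac)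
      ultimately show ?thesis by simp
    qed
    moreover have "g \<otimes>\<^bsub>A\<^esub> e \<notin> p"
      using primeideal.I_prime[OF p W(4) e(1)] e(2) eq[OF W(2)] by blast
    ultimately show ?thesis using W e(1) unfolding good_def by blast
  qed
  interpret E: ring_extension A A "\<lambda>x. x" by unfold_locales (auto simp: ring_hom_def)
  \<comment> \<open>Elements without a common zero generate the unit ideal. This is used for the
    denominators f and again for their powers.\<close>
  have unit: "\<one>\<^bsub>A\<^esub> \<in> E.span F"
    if F: "F \<subseteq> carrier A" "\<And>p. primeideal p A \<Longrightarrow> \<exists>f\<in>F. f \<notin> p" for F
  proof (rule ccontr)
    assume "\<one>\<^bsub>A\<^esub> \<notin> E.span F"
    then obtain p where "primeideal p A" "E.span F \<subseteq> p"
      using proper_ideal_in_prime[OF A span_ideal[OF A F(1)]] by metis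
    then show False using F E.span_incl by blast
  qed
  have "\<one>\<^bsub>A\<^esub> \<in> E.span (snd ` good)"
  proof (rule unit)
    show "snd ` good \<subseteq> carrier A" using good_carr by auto
    fix p assume "primeideal p A"
    then obtain b f where "(b, f) \<in> good" "f \<notin> p" using cover by blast
    then show "\<exists>f\<in>snd ` good. f \<notin> p" by force
  qed
  then obtain F where F: "F \<subseteq> snd ` good" "finite F" "\<one>\<^bsub>A\<^esub> \<in> E.span F"
    using lspan_finite by metis
  then obtain G where G: "G \<subseteq> good" "finite G" "F = snd ` G" by (metis finite_subset_image)
  have Fcov: "\<exists>f\<in>F. f \<notin> p" if p: "primeideal p A" for p
  proof (rule ccontr)
    interpret p: primeideal p A by fact
    assume "\<not> ?thesis"
    then have "F \<subseteq> p" by blast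
    have "x \<in> p" if "x \<in> E.span F" for x
      using that \<open>F \<subseteq> p\<close> by (induction rule: lspan.induct) (auto intro: p.I_l_closed)
    then show False using F(3) prime_one_notin[OF p] by blast
  qed
  have ex_n: "\<exists>n::nat. (f \<otimes>\<^bsub>A\<^esub> f') [^]\<^bsub>A\<^esub> n \<otimes>\<^bsub>A\<^esub> (b \<otimes>\<^bsub>A\<^esub> f') = (f \<otimes>\<^bsub>A\<^esub> f') [^]\<^bsub>A\<^esub> n \<otimes>\<^bsub>A\<^esub> (b' \<otimes>\<^bsub>A\<^esub> f)"
    if g: "(b, f) \<in> good" "(b', f') \<in> good" for b f b' f'
  proof -
    have "\<exists>u\<in>carrier A - q. u \<otimes>\<^bsub>A\<^esub> (b \<otimes>\<^bsub>A\<^esub> f') = u \<otimes>\<^bsub>A\<^esub> (b' \<otimes>\<^bsub>A\<^esub> f)"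
      if q: "primeideal q A" "f \<otimes>\<^bsub>A\<^esub> f' \<notin> q" for q
    proof -
      interpret L: localised A "carrier A - q" by (rule localised_prime[OF q(1)])
      have n: "f \<notin> q" "f' \<notin> q" using q good_carr[OF g(1)] good_carr[OF g(2)]
          ideal.I_l_closed[OF primeideal.axioms(1)[OF q(1)]]
          ideal.I_r_closed[OF primeideal.axioms(1)[OF q(1)]] by blast+
      have "\<sigma> q = ?fr q b f" using n(1) g(1) q(1) unfolding good_def by blast
      moreover have "\<sigma> q = ?fr q b' f'" using n(2) g(2) q(1) unfolding good_def by blast
      ultimately have "?fr q b f = ?fr q b' f'" by simp
      then show ?thesis using n good_carr[OF g(1)] good_carr[OF g(2)] L.frac_eq_iff[of b f b' f'] by blast
    qed
    then show ?thesis
      using fractions_agree[OF A, of "f \<otimes>\<^bsub>A\<^esub> f'" "b \<otimes>\<^bsub>A\<^esub> f'" "b' \<otimes>\<^bsub>A\<^esub> f"]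
        good_carr[OF g(1)] good_carr[OF g(2)] by (metis m_closed)
  qed
  define nn where "nn x y = (SOME n::nat. (snd x \<otimes>\<^bsub>A\<^esub> snd y) [^]\<^bsub>A\<^esub> n \<otimes>\<^bsub>A\<^esub> (fst x \<otimes>\<^bsub>A\<^esub> snd y) =
      (snd x \<otimes>\<^bsub>A\<^esub> snd y) [^]\<^bsub>A\<^esub> n \<otimes>\<^bsub>A\<^esub> (fst y \<otimes>\<^bsub>A\<^esub> snd x))" for x y
  \<comment> \<open>One exponent for all pairs: since G is finite, the sum of the individual
    exponents bounds each of them.\<close>
  define N where "N = (\<Sum>x\<in>G. \<Sum>y\<in>G. nn x y)"
  have le: "nn x y \<le> N" if "x \<in> G" "y \<in> G" for x y
    unfolding N_def using member_le_sum[of x G "\<lambda>x. \<Sum>y\<in>G. nn x y"] member_le_sum[of y G "nn x"] that G(2)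
    by fastforce
  have eqN: "(f \<otimes>\<^bsub>A\<^esub> f') [^]\<^bsub>A\<^esub> N \<otimes>\<^bsub>A\<^esub> (b \<otimes>\<^bsub>A\<^esub> f') = (f \<otimes>\<^bsub>A\<^esub> f') [^]\<^bsub>A\<^esub> N \<otimes>\<^bsub>A\<^esub> (b' \<otimes>\<^bsub>A\<^esub> f)"
    if g: "(b, f) \<in> G" "(b', f') \<in> G" for b f b' f'
  proof -
    let ?n = "nn (b, f) (b', f')" and ?z = "f \<otimes>\<^bsub>A\<^esub> f'"
    have c: "b \<in> carrier A" "f \<in> carrier A" "b' \<in> carrier A" "f' \<in> carrier A"
      using good_carr g G(1) by blast+
    have n: "?z [^]\<^bsub>A\<^esub> ?n \<otimes>\<^bsub>A\<^esub> (b \<otimes>\<^bsub>A\<^esub> f') = ?z [^]\<^bsub>A\<^esub> ?n \<otimes>\<^bsub>A\<^esub> (b' \<otimes>\<^bsub>A\<^esub> f)"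
      unfolding nn_def fst_conv snd_conv using g G(1) by (intro someI_ex[OF ex_n]) blast+
    have "?z [^]\<^bsub>A\<^esub> N = ?z [^]\<^bsub>A\<^esub> (N - ?n) \<otimes>\<^bsub>A\<^esub> ?z [^]\<^bsub>A\<^esub> ?n"
      using nat_pow_mult[of ?z "N - ?n" ?n] le[OF g] c(2,4) by simp
    then show ?thesis using n c
      m_assoc[of "?z [^]\<^bsub>A\<^esub> (N - ?n)" "?z [^]\<^bsub>A\<^esub> ?n" "b \<otimes>\<^bsub>A\<^esub> f'"]
      m_assoc[of "?z [^]\<^bsub>A\<^esub> (N - ?n)" "?z [^]\<^bsub>A\<^esub> ?n" "b' \<otimes>\<^bsub>A\<^esub> f"] by simp
  qed
  \<comment> \<open>The numerator is built along a derivation of y from the powers f^(N+1) and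
    satisfies its equation for all pairs in G at once. The instance y = 1 then says that a equals
    b/f on D(f).\<close>
  have claim: "\<exists>a\<in>carrier A. \<forall>(b, f)\<in>G. a \<otimes>\<^bsub>A\<^esub> f [^]\<^bsub>A\<^esub> Suc N = (b \<otimes>\<^bsub>A\<^esub> f [^]\<^bsub>A\<^esub> N) \<otimes>\<^bsub>A\<^esub> y"
    if "y \<in> E.span ((\<lambda>f. f [^]\<^bsub>A\<^esub> Suc N) ` F)" for y
    using that
  proof (induction rule: lspan.induct)
    case zero
    have "\<zero>\<^bsub>A\<^esub> \<otimes>\<^bsub>A\<^esub> f [^]\<^bsub>A\<^esub> Suc N = (b \<otimes>\<^bsub>A\<^esub> f [^]\<^bsub>A\<^esub> N) \<otimes>\<^bsub>A\<^esub> \<zero>\<^bsub>A\<^esub>" if "(b, f) \<in> G" for b f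
      using that G(1) good_carr[of b f] by auto
    then show ?case by (intro bexI[of _ "\<zero>\<^bsub>A\<^esub>"]) auto
  next
    case (step k x y)
    then obtain a where a: "a \<in> carrier A"
      "\<And>b f. (b, f) \<in> G \<Longrightarrow> a \<otimes>\<^bsub>A\<^esub> f [^]\<^bsub>A\<^esub> Suc N = (b \<otimes>\<^bsub>A\<^esub> f [^]\<^bsub>A\<^esub> N) \<otimes>\<^bsub>A\<^esub> y" by blast
    obtain b0 f0 where g0: "(b0, f0) \<in> G" "x = f0 [^]\<^bsub>A\<^esub> Suc N" using step(2) G(3) by auto
    have c0: "b0 \<in> carrier A" "f0 \<in> carrier A" using g0 G(1) good_carr by blast+
    have yc: "y \<in> carrier A"
      using E.span_carr[OF step(3)] G(1,3) good_carr by (fastforce simp: image_iff)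
    let ?a = "k \<otimes>\<^bsub>A\<^esub> (b0 \<otimes>\<^bsub>A\<^esub> f0 [^]\<^bsub>A\<^esub> N) \<oplus>\<^bsub>A\<^esub> a"
    have "?a \<otimes>\<^bsub>A\<^esub> f [^]\<^bsub>A\<^esub> Suc N = (b \<otimes>\<^bsub>A\<^esub> f [^]\<^bsub>A\<^esub> N) \<otimes>\<^bsub>A\<^esub> (k \<otimes>\<^bsub>A\<^esub> x \<oplus>\<^bsub>A\<^esub> y)"
      if g: "(b, f) \<in> G" for b f
    proof -
      have c: "b \<in> carrier A" "f \<in> carrier A" using g G(1) good_carr by blast+
      \<comment> \<open>Here the agreement on overlaps enters: it exchanges b0 f for b f0 up to the
        common power of f0 f.\<close>
      have "b0 \<otimes>\<^bsub>A\<^esub> f0 [^]\<^bsub>A\<^esub> N \<otimes>\<^bsub>A\<^esub> f [^]\<^bsub>A\<^esub> Suc N =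
          (f0 \<otimes>\<^bsub>A\<^esub> f) [^]\<^bsub>A\<^esub> N \<otimes>\<^bsub>A\<^esub> (b0 \<otimes>\<^bsub>A\<^esub> f)"
        using c c0 by (simp add: m_ac nat_pow_distrib)
      also have "\<dots> = (f0 \<otimes>\<^bsub>A\<^esub> f) [^]\<^bsub>A\<^esub> N \<otimes>\<^bsub>A\<^esub> (b \<otimes>\<^bsub>A\<^esub> f0)" by (rule eqN[OF g0(1) g])
      also have "\<dots> = b \<otimes>\<^bsub>A\<^esub> f [^]\<^bsub>A\<^esub> N \<otimes>\<^bsub>A\<^esub> x" using c c0 g0(2) by (simp add: m_ac nat_pow_distrib)
      finally have 1: "b0 \<otimes>\<^bsub>A\<^esub> f0 [^]\<^bsub>A\<^esub> N \<otimes>\<^bsub>A\<^esub> f [^]\<^bsub>A\<^esub> Suc N = b \<otimes>\<^bsub>A\<^esub> f [^]\<^bsub>A\<^esub> N \<otimes>\<^bsub>A\<^esub> x" .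
      have x: "x \<in> carrier A" using g0 c0 by simp
      have "?a \<otimes>\<^bsub>A\<^esub> f [^]\<^bsub>A\<^esub> Suc N = k \<otimes>\<^bsub>A\<^esub> (b0 \<otimes>\<^bsub>A\<^esub> f0 [^]\<^bsub>A\<^esub> N \<otimes>\<^bsub>A\<^esub> f [^]\<^bsub>A\<^esub> Suc N) \<oplus>\<^bsub>A\<^esub> a \<otimes>\<^bsub>A\<^esub> f [^]\<^bsub>A\<^esub> Suc N"
        using c c0 a(1) step(1) by (simp add: l_distr m_assoc del: nat_pow_Suc)
      also have "\<dots> = k \<otimes>\<^bsub>A\<^esub> (b \<otimes>\<^bsub>A\<^esub> f [^]\<^bsub>A\<^esub> N \<otimes>\<^bsub>A\<^esub> x) \<oplus>\<^bsub>A\<^esub> b \<otimes>\<^bsub>A\<^esub> f [^]\<^bsub>A\<^esub> N \<otimes>\<^bsub>A\<^esub> y"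
        unfolding 1 a(2)[OF g] ..
      also have "\<dots> = (b \<otimes>\<^bsub>A\<^esub> f [^]\<^bsub>A\<^esub> N) \<otimes>\<^bsub>A\<^esub> (k \<otimes>\<^bsub>A\<^esub> x \<oplus>\<^bsub>A\<^esub> y)"
        using c x yc step(1) by (simp add: r_distr m_ac)
      finally show ?thesis .
    qed
    then show ?case using a(1) c0 step(1) by (intro bexI[of _ ?a]) auto
  qed
  have "\<one>\<^bsub>A\<^esub> \<in> E.span ((\<lambda>f. f [^]\<^bsub>A\<^esub> Suc N) ` F)"
  proof (rule unit)
    show "(\<lambda>f. f [^]\<^bsub>A\<^esub> Suc N) ` F \<subseteq> carrier A" using G good_carr by fastforce
    fix p assume p: "primeideal p A"
    then obtain f where f: "f \<in> F" "f \<notin> p" using Fcov by blast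
    then have "f \<in> carrier A" using G good_carr by fastforce
    then have "f [^]\<^bsub>A\<^esub> Suc N \<notin> p"
      using localised.M_pow[OF localised_prime[OF p], of f "Suc N"] f by blast
    then show "\<exists>f\<in>(\<lambda>f. f [^]\<^bsub>A\<^esub> Suc N) ` F. f \<notin> p" using f by blast
  qed
  from claim[OF this] obtain a where a: "a \<in> carrier A"
    "\<And>b f. (b, f) \<in> G \<Longrightarrow> a \<otimes>\<^bsub>A\<^esub> f [^]\<^bsub>A\<^esub> Suc N = (b \<otimes>\<^bsub>A\<^esub> f [^]\<^bsub>A\<^esub> N) \<otimes>\<^bsub>A\<^esub> \<one>\<^bsub>A\<^esub>" by blast
  have "\<sigma> q = ?fr q a \<one>\<^bsub>A\<^esub>" if q: "primeideal q A" for q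
  proof -
    interpret L: localised A "carrier A - q" by (rule localised_prime[OF q])
    obtain b f where g: "(b, f) \<in> G" "f \<notin> q" using Fcov[OF q] G(3) by auto
    have c: "b \<in> carrier A" "f \<in> carrier A" using g G(1) good_carr by blast+
    have "\<sigma> q = ?fr q b f" using g G(1) q unfolding good_def by blast
    also have "\<dots> = ?fr q a \<one>\<^bsub>A\<^esub>"
    proof -
      have "f [^]\<^bsub>A\<^esub> N \<otimes>\<^bsub>A\<^esub> (b \<otimes>\<^bsub>A\<^esub> \<one>\<^bsub>A\<^esub>) = f [^]\<^bsub>A\<^esub> N \<otimes>\<^bsub>A\<^esub> (a \<otimes>\<^bsub>A\<^esub> f)"
        using a(2)[OF g(1)] a(1) c by (simp add: m_ac)
      moreover have "f [^]\<^bsub>A\<^esub> N \<in> carrier A - q" using L.M_pow g c by blast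
      ultimately show ?thesis using L.frac_eq_iff[of b f a "\<one>\<^bsub>A\<^esub>"] g c a(1) L.M_one by blast
    qed
    finally show ?thesis .
  qed
  then have "\<sigma> = global_section A a"
    using \<sigma> unfolding sections_iff global_section_def by (intro ext) (auto simp: PiE_iff extensional_def)
  then show ?thesis using a(1) by blast
qed

section \<open>Morphisms of spectra\<close>

lemma Spec_simps:
  "rs_top (Spec A) = zariski A" "rs_sec (Spec A) = spec_sections A"
  "rs_res (Spec A) = (\<lambda>U V \<sigma>. restrict \<sigma> V)"
  unfolding Spec_def by simp_all

lemma prime_contraction:
  assumes "cring A" "\<phi> \<in> ring_hom A B" "primeideal q B"
  shows "primeideal {a \<in> carrier A. \<phi> a \<in> q} A"
proof -
  interpret A: cring A by fact
  interpret q: primeideal q B by fact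
  interpret h: ring_hom_ring A B \<phi>
    using assms(2) by (intro ring_hom_ringI2 A.ring_axioms q.ring_axioms)
  show ?thesis
  proof (rule primeidealI)
    show "ideal {a \<in> carrier A. \<phi> a \<in> q} A" using h.ideal_vimage[OF q.ideal_axioms] .
    show "cring A" by fact
    have "\<one>\<^bsub>A\<^esub> \<notin> {a \<in> carrier A. \<phi> a \<in> q}"
      using prime_one_notin[OF assms(3)] ring_hom_one[OF assms(2)] by simp
    then show "carrier A \<noteq> {a \<in> carrier A. \<phi> a \<in> q}" by blast
    show "a \<in> {a \<in> carrier A. \<phi> a \<in> q} \<or> b \<in> {a \<in> carrier A. \<phi> a \<in> q}"
      if "a \<in> carrier A" "b \<in> carrier A" "a \<otimes>\<^bsub>A\<^esub> b \<in> {a \<in> carrier A. \<phi> a \<in> q}" for a b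
      using that q.I_prime ring_hom_closed[OF assms(2)] by (auto simp: ring_hom_mult[OF assms(2)])
  qed
qed

locale spec_map = A: cring A + B: cring B
  for A :: "'a ring" and B :: "'b ring" and \<phi> :: "'a \<Rightarrow> 'b" +
  assumes hom: "\<phi> \<in> ring_hom A B"
begin

definition contr where "contr q = {a \<in> carrier A. \<phi> a \<in> q}"

lemma contr_prime: "primeideal q B \<Longrightarrow> primeideal (contr q) A"
  unfolding contr_def by (rule prime_contraction[OF A.is_cring hom])

lemma hom_closed: "a \<in> carrier A \<Longrightarrow> \<phi> a \<in> carrier B"
  by (rule ring_hom_closed[OF hom])

lemma compl_image: "\<phi> ` (carrier A - contr q) \<subseteq> carrier B - q"
  unfolding contr_def using hom_closed by auto

lemma map_point: "rm_pt (Spec_map A B \<phi>) q = contr q"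
  unfolding Spec_map_def contr_def Let_def by simp

lemma map_section:
  "rm_sec (Spec_map A B \<phi>) V \<sigma> = (\<lambda>q\<in>{q. primeideal q B \<and> contr q \<in> V}.
     localisation_map B (carrier B - q) \<phi> (\<sigma> (contr q)))"
  unfolding Spec_map_def contr_def Let_def by simp

lemma map_preimage: "rm_preimage (Spec B) (Spec_map A B \<phi>) V = {q. primeideal q B \<and> contr q \<in> V}"
  unfolding rm_preimage_def map_point by (simp add: Spec_def topspace_zariski)

lemma local_map_frac:
  assumes "primeideal q B" "a \<in> carrier A" "s \<in> carrier A" "\<phi> s \<notin> q"
  shows "localisation_map B (carrier B - q) \<phi> (loc_frac A (carrier A - contr q) a s) =
    loc_frac B (carrier B - q) (\<phi> a) (\<phi> s)"
  using assms compl_image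
  by (intro localisation_map_frac localised_prime contr_prime hom) (auto simp: contr_def)

lemma local_map_hom:
  assumes "primeideal q B"
  shows "localisation_map B (carrier B - q) \<phi> \<in> ring_hom (local_ring_at A (contr q)) (local_ring_at B q)"
  using assms compl_image by (intro localisation_map_hom localised_prime contr_prime hom) auto

lemma open_preimage:
  assumes "openin (zariski A) V"
  shows "openin (zariski B) {q. primeideal q B \<and> contr q \<in> V}"
proof -
  obtain E where E: "E \<subseteq> carrier A" "V = {p. primeideal p A \<and> \<not> E \<subseteq> p}"
    using assms unfolding openin_zariski by blast
  have "{q. primeideal q B \<and> contr q \<in> V} = {q. primeideal q B \<and> \<not> \<phi> ` E \<subseteq> q}"
    using E contr_prime unfolding contr_def by auto
  moreover have "\<phi> ` E \<subseteq> carrier B" using E(1) hom_closed by auto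
  ultimately show ?thesis unfolding openin_zariski by blast
qed

lemma map_continuous: "continuous_map (zariski B) (zariski A) (rm_pt (Spec_map A B \<phi>))"
  unfolding continuous_map_def topspace_zariski map_point
  using open_preimage contr_prime by auto

text \<open>Where a section is a/g, its pullback is \<phi> a/\<phi> g on the preimage of the same
  neighbourhood, so sections that are locally fractions pull back to such sections.\<close>

lemma map_section_hom:
  assumes V: "openin (zariski A) V"
  shows "rm_sec (Spec_map A B \<phi>) V \<in>
    ring_hom (spec_sections A V) (spec_sections B {q. primeideal q B \<and> contr q \<in> V})"
    (is "?f \<in> ring_hom ?S ?T")
proof (rule ring_hom_memI)
  note lh = local_map_hom
  fix \<sigma> assume \<sigma>: "\<sigma> \<in> carrier ?S"
  have \<sigma>c: "\<sigma> p \<in> carrier (local_ring_at A p)" if "p \<in> V" for p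
    using \<sigma> that unfolding sections_iff by auto
  show "?f \<sigma> \<in> carrier ?T"
    unfolding sections_iff
  proof (intro conjI ballI)
    show "?f \<sigma> \<in> (\<Pi>\<^sub>E q\<in>{q. primeideal q B \<and> contr q \<in> V}. carrier (local_ring_at B q))"
      unfolding map_section using ring_hom_closed[OF lh \<sigma>c] by auto
    fix q assume q: "q \<in> {q. primeideal q B \<and> contr q \<in> V}"
    then obtain W a g where W: "openin (zariski A) W" "contr q \<in> W" "W \<subseteq> V" "a \<in> carrier A" "g \<in> carrier A"
      and eq: "\<And>p. p \<in> W \<Longrightarrow> g \<notin> p \<and> \<sigma> p = loc_frac A (carrier A - p) a g"
      using \<sigma> unfolding sections_iff by (metis (no_types, lifting) mem_Collect_eq)
    have "\<phi> g \<notin> r \<and> ?f \<sigma> r = loc_frac B (carrier B - r) (\<phi> a) (\<phi> g)"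
      if r: "r \<in> {q. primeideal q B \<and> contr q \<in> W}" for r
    proof -
      have "g \<notin> contr r" using eq r by blast
      then have g: "\<phi> g \<notin> r" using W(5) by (simp add: contr_def)
      then show ?thesis using r eq[of "contr r"] W(3-5) local_map_frac[of r a g] by (auto simp: map_section)
    qed
    then show "\<exists>W a g. openin (zariski B) W \<and> q \<in> W \<and> W \<subseteq> {q. primeideal q B \<and> contr q \<in> V} \<and>
        a \<in> carrier B \<and> g \<in> carrier B \<and> (\<forall>q\<in>W. g \<notin> q \<and> ?f \<sigma> q = loc_frac B (carrier B - q) a g)"
      using open_preimage[OF W(1)] W q hom_closed
      by (intro exI[of _ "{q. primeideal q B \<and> contr q \<in> W}"] exI[of _ "\<phi> a"] exI[of _ "\<phi> g"]) auto
  qed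
  fix \<tau> assume \<tau>: "\<tau> \<in> carrier ?S"
  have \<tau>c: "\<tau> p \<in> carrier (local_ring_at A p)" if "p \<in> V" for p
    using \<tau> that unfolding sections_iff by auto
  show "?f (\<sigma> \<otimes>\<^bsub>?S\<^esub> \<tau>) = ?f \<sigma> \<otimes>\<^bsub>?T\<^esub> ?f \<tau>"
    unfolding sections_simps map_section
    by (intro restrict_ext) (simp add: ring_hom_mult[OF lh \<sigma>c \<tau>c])
  show "?f (\<sigma> \<oplus>\<^bsub>?S\<^esub> \<tau>) = ?f \<sigma> \<oplus>\<^bsub>?T\<^esub> ?f \<tau>"
    unfolding sections_simps map_section
    by (intro restrict_ext) (simp add: ring_hom_add[OF lh \<sigma>c \<tau>c])
next
  show "?f \<one>\<^bsub>?S\<^esub> = \<one>\<^bsub>?T\<^esub>"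
    unfolding sections_simps map_section
    by (intro restrict_ext) (simp add: ring_hom_one[OF local_map_hom])
qed

lemma map_global_section:
  assumes "a \<in> carrier A"
  shows "rm_sec (Spec_map A B \<phi>) (primes A) (global_section A a) = global_section B (\<phi> a)"
  unfolding map_section global_section_def
  using assms local_map_frac[of _ a "\<one>\<^bsub>A\<^esub>"] contr_prime
  by (intro ext) (auto simp: restrict_def ring_hom_one[OF hom])

end

lemma section_fracE:
  assumes "openin (zariski A) V" "\<sigma> \<in> carrier (spec_sections A V)" "p \<in> V"
  obtains a s where "a \<in> carrier A" "s \<in> carrier A" "s \<notin> p" "\<sigma> p = loc_frac A (carrier A - p) a s"
  using assms unfolding sections_iff by (metis (no_types, lifting))

text \<open>The composite may be any k agreeing with g after f on the carrier. This form covers both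
  sides of a naturality square and, with k the identity, mutually inverse homomorphisms.\<close>

lemma Spec_map_comp:
  assumes f: "spec_map A B f" and g: "spec_map B C g" and k: "\<And>a. a \<in> carrier A \<Longrightarrow> k a = g (f a)"
  shows "rm_eq (Spec C) (Spec A) (rm_comp (Spec B) (Spec_map A B f) (Spec_map B C g)) (Spec_map A C k)"
proof -
  interpret f: spec_map A B f by fact
  interpret g: spec_map B C g by fact
  have "g \<circ> f \<in> ring_hom A C" using f.hom g.hom by (rule ring_hom_trans)
  then have "k \<in> ring_hom A C" using k by (auto simp: ring_hom_def)
  then interpret k: spec_map A C k by unfold_locales
  have c: "f.contr (g.contr q) = k.contr q" for q
    unfolding f.contr_def g.contr_def k.contr_def using k f.hom_closed by auto
  show ?thesis
    unfolding rm_eq_def rm_comp_def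
  proof (intro conjI allI ballI impI; simp)
    show "rm_pt (Spec_map A B f) (rm_pt (Spec_map B C g) x) = rm_pt (Spec_map A C k) x" for x
      by (simp add: f.map_point g.map_point k.map_point c)
    fix V \<sigma> assume V: "openin (rs_top (Spec A)) V" and \<sigma>: "\<sigma> \<in> carrier (rs_sec (Spec A) V)"
    then have V: "openin (zariski A) V" and \<sigma>: "\<sigma> \<in> carrier (spec_sections A V)" by (simp_all add: Spec_def)
    show "rm_sec (Spec_map B C g) (rm_preimage (Spec B) (Spec_map A B f) V) (rm_sec (Spec_map A B f) V \<sigma>) =
        rm_sec (Spec_map A C k) V \<sigma>"
    proof
      fix q
      show "rm_sec (Spec_map B C g) (rm_preimage (Spec B) (Spec_map A B f) V) (rm_sec (Spec_map A B f) V \<sigma>) q =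
        rm_sec (Spec_map A C k) V \<sigma> q"
      proof (cases "primeideal q C \<and> k.contr q \<in> V")
        case True
        then obtain a s where as: "a \<in> carrier A" "s \<in> carrier A" "s \<notin> k.contr q"
          "\<sigma> (k.contr q) = loc_frac A (carrier A - k.contr q) a s"
          using section_fracE[OF V \<sigma>] by metis
        have gs: "g (f s) \<notin> q" "f s \<notin> g.contr q"
          using as k f.hom_closed unfolding k.contr_def g.contr_def by auto
        have 1: "localisation_map B (carrier B - g.contr q) f (\<sigma> (k.contr q)) =
            loc_frac B (carrier B - g.contr q) (f a) (f s)"
          using f.local_map_frac[of "g.contr q" a s] True as gs g.contr_prime by (simp add: c)
        have 2: "localisation_map C (carrier C - q) g (loc_frac B (carrier B - g.contr q) (f a) (f s)) =
            loc_frac C (carrier C - q) (g (f a)) (g (f s))"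
          using True as gs f.hom_closed by (intro g.local_map_frac) auto
        have 3: "localisation_map C (carrier C - q) k (\<sigma> (k.contr q)) =
            loc_frac C (carrier C - q) (k a) (k s)"
          unfolding as(4) using True as gs k by (intro k.local_map_frac) auto
        show ?thesis using True g.contr_prime
          by (simp add: g.map_section f.map_section k.map_section f.map_preimage c 1 2 3 k as(1-3))
      next
        case False
        then show ?thesis
          by (auto simp: g.map_section f.map_section k.map_section f.map_preimage c)
      qed
    qed
  qed
qed

lemma Spec_map_id:
  assumes "cring A" "\<And>a. a \<in> carrier A \<Longrightarrow> f a = a"
  shows "rm_eq (Spec A) (Spec A) (Spec_map A A f) rm_id"
proof -
  interpret cring A by fact
  have "f \<in> ring_hom A A" using assms(2) by (auto simp: ring_hom_def)
  then interpret f: spec_map A A f by unfold_locales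
  have c: "f.contr p = p" if "primeideal p A" for p
    unfolding f.contr_def using assms(2) ideal.Icarr[OF primeideal.axioms(1)[OF that]] by auto
  show ?thesis unfolding rm_eq_def rm_id_def
  proof (intro conjI allI ballI impI; simp)
    fix p assume "p \<in> topspace (rs_top (Spec A))"
    then show "rm_pt (Spec_map A A f) p = p" by (simp add: f.map_point c Spec_def topspace_zariski)
  next
    fix V \<sigma> assume "openin (rs_top (Spec A)) V" and "\<sigma> \<in> carrier (rs_sec (Spec A) V)"
    then have V: "openin (zariski A) V" and \<sigma>: "\<sigma> \<in> carrier (spec_sections A V)" by (simp_all add: Spec_def)
    show "rm_sec (Spec_map A A f) V \<sigma> = \<sigma>"
    proof
      fix p
      show "rm_sec (Spec_map A A f) V \<sigma> p = \<sigma> p"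
      proof (cases "p \<in> V")
        case True
        then have p: "primeideal p A" using openin_primes[OF V] by blast
        obtain a s where as: "a \<in> carrier A" "s \<in> carrier A" "s \<notin> p"
          "\<sigma> p = loc_frac A (carrier A - p) a s"
          using section_fracE[OF V \<sigma> True] by metis
        then show ?thesis using True p f.local_map_frac[OF p as(1,2)]
          by (simp add: f.map_section c assms(2))
      next
        case False
        \<comment> \<open>Sections are extensional functions, so outside V both sides take the
          default value.\<close>
        then have "\<sigma> p = undefined" using \<sigma> unfolding sections_iff by (auto simp: PiE_iff extensional_def)
        moreover have "\<not> (primeideal p A \<and> f.contr p \<in> V)" using False c by metis
        ultimately show ?thesis by (auto simp: f.map_section)
      qed
    qed
  qed
qed

lemma ring_hom_Units:
  assumes "h \<in> ring_hom R S" "x \<in> Units R"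
  shows "h x \<in> Units S"
proof -
  obtain y where y: "x \<in> carrier R" "y \<in> carrier R" "y \<otimes>\<^bsub>R\<^esub> x = \<one>\<^bsub>R\<^esub>" "x \<otimes>\<^bsub>R\<^esub> y = \<one>\<^bsub>R\<^esub>"
    using assms(2) unfolding Units_def by blast
  then have "h y \<otimes>\<^bsub>S\<^esub> h x = \<one>\<^bsub>S\<^esub>" "h x \<otimes>\<^bsub>S\<^esub> h y = \<one>\<^bsub>S\<^esub>"
    using ring_hom_mult[OF assms(1)] ring_hom_one[OF assms(1)] by metis+
  then show ?thesis using y ring_hom_closed[OF assms(1)] unfolding Units_def by blast
qed

text \<open>The inverse isomorphism transports a unit near a point back to the image point, so that the
  induced maps of stalks are local.\<close>

lemma Spec_map_iso_morphism:
  assumes f: "spec_map A B f" and g: "spec_map B A g"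
    and gf: "\<And>a. a \<in> carrier A \<Longrightarrow> g (f a) = a" and fg: "\<And>b. b \<in> carrier B \<Longrightarrow> f (g b) = b"
  shows "lrs_morphism (Spec B) (Spec A) (Spec_map A B f)"
proof -
  interpret f: spec_map A B f by fact
  interpret g: spec_map B A g by fact
  have c: "g.contr (f.contr q) = q" if "primeideal q B" for q
    unfolding f.contr_def g.contr_def
    using fg g.hom_closed ideal.Icarr[OF primeideal.axioms(1)[OF that]] by auto
  have c': "f.contr (g.contr q) = q" if "primeideal q A" for q
    unfolding f.contr_def g.contr_def
    using gf f.hom_closed ideal.Icarr[OF primeideal.axioms(1)[OF that]] by auto
  show ?thesis
    unfolding lrs_morphism_def
  proof (intro conjI allI impI ballI)
    show "continuous_map (rs_top (Spec B)) (rs_top (Spec A)) (rm_pt (Spec_map A B f))"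
      using f.map_continuous by (simp add: Spec_def)
    show "rm_sec (Spec_map A B f) V \<in> ring_hom (rs_sec (Spec A) V)
        (rs_sec (Spec B) (rm_preimage (Spec B) (Spec_map A B f) V))"
      if "openin (rs_top (Spec A)) V" for V
      unfolding f.map_preimage using f.map_section_hom that by (simp add: Spec_def)
    show "rm_sec (Spec_map A B f) V' (rs_res (Spec A) V V' s) =
        rs_res (Spec B) (rm_preimage (Spec B) (Spec_map A B f) V)
         (rm_preimage (Spec B) (Spec_map A B f) V') (rm_sec (Spec_map A B f) V s)"
      if "openin (rs_top (Spec A)) V \<and> openin (rs_top (Spec A)) V' \<and> V' \<subseteq> V" for V V' s
      unfolding f.map_preimage f.map_section using that
      by (auto simp: Spec_def restrict_def fun_eq_iff)
    fix V x s
    assume "openin (rs_top (Spec A)) V \<and> x \<in> rm_preimage (Spec B) (Spec_map A B f) V \<and>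
       s \<in> carrier (rs_sec (Spec A) V) \<and>
       germ_unit (Spec B) x (rm_preimage (Spec B) (Spec_map A B f) V) (rm_sec (Spec_map A B f) V s)"
    then have V: "openin (zariski A) V" and x: "primeideal x B" "f.contr x \<in> V"
      and s: "s \<in> carrier (spec_sections A V)"
      and "germ_unit (Spec B) x {q. primeideal q B \<and> f.contr q \<in> V} (rm_sec (Spec_map A B f) V s)"
      unfolding f.map_preimage by (simp_all add: Spec_def)
    then obtain W where W: "openin (zariski B) W" "x \<in> W" "W \<subseteq> {q. primeideal q B \<and> f.contr q \<in> V}"
      and unit: "restrict (rm_sec (Spec_map A B f) V s) W \<in> Units (spec_sections B W)"
      unfolding germ_unit_def by (auto simp: Spec_def)
    let ?W = "{p. primeideal p A \<and> g.contr p \<in> W}"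
    have "rm_sec (Spec_map B A g) W (restrict (rm_sec (Spec_map A B f) V s) W) \<in> Units (spec_sections A ?W)"
      by (rule ring_hom_Units[OF g.map_section_hom[OF W(1)] unit])
    \<comment> \<open>Pulling s back along f and then along g returns s, as one sees on a
      representing fraction at each prime. The unit on W thus becomes the restriction of s to a
      neighbourhood of the image point.\<close>
    moreover have "rm_sec (Spec_map B A g) W (restrict (rm_sec (Spec_map A B f) V s) W) = restrict s ?W"
      unfolding g.map_section
    proof (rule restrict_ext)
      fix p assume p: "p \<in> ?W"
      then have pV: "p \<in> V" using W(3) c' by force
      obtain a t where as: "a \<in> carrier A" "t \<in> carrier A" "t \<notin> p" "s p = loc_frac A (carrier A - p) a t"
        using section_fracE[OF V s pV] by metis
      have ft: "f t \<notin> g.contr p" using as gf unfolding g.contr_def by auto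
      have "localisation_map B (carrier B - g.contr p) f (s p) =
          loc_frac B (carrier B - g.contr p) (f a) (f t)"
        using f.local_map_frac[of "g.contr p" a t] g.contr_prime p as ft c' by auto
      moreover have "localisation_map A (carrier A - p) g (loc_frac B (carrier B - g.contr p) (f a) (f t)) =
          loc_frac A (carrier A - p) (g (f a)) (g (f t))"
        using p as gf f.hom_closed by (intro g.local_map_frac) auto
      ultimately show "localisation_map A (carrier A - p) g
          (restrict (rm_sec (Spec_map A B f) V s) W (g.contr p)) = s p"
        using p pV as gf c' g.contr_prime by (simp add: f.map_section)
    qed
    ultimately have "restrict s ?W \<in> Units (spec_sections A ?W)" by simp
    moreover have "?W \<subseteq> V" using W(3) c' by force
    moreover have "f.contr x \<in> ?W" using x W(2) c f.contr_prime by simp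
    ultimately show "germ_unit (Spec A) (rm_pt (Spec_map A B f) x) V s"
      unfolding germ_unit_def f.map_point using g.open_preimage[OF W(1)] by (auto simp: Spec_def)
  qed
qed

lemma Spec_map_iso:
  assumes f: "spec_map A B f" and g: "spec_map B A g"
    and gf: "\<And>a. a \<in> carrier A \<Longrightarrow> g (f a) = a" and fg: "\<And>b. b \<in> carrier B \<Longrightarrow> f (g b) = b"
  shows "lrs_iso (Spec B) (Spec A) (Spec_map A B f)"
proof -
  interpret f: spec_map A B f by fact
  interpret g: spec_map B A g by fact
  have trans: "rm_eq X Y a b \<Longrightarrow> rm_eq X Y b c \<Longrightarrow> rm_eq X Y a c" for X Y a b c
    unfolding rm_eq_def by simp
  have "rm_eq (Spec B) (Spec B) (rm_comp (Spec A) (Spec_map B A g) (Spec_map A B f)) rm_id"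
    by (rule trans[OF Spec_map_comp[OF g f, of "\<lambda>b. b"] Spec_map_id]) (use fg f.B.is_cring in simp_all)
  moreover have "rm_eq (Spec A) (Spec A) (rm_comp (Spec B) (Spec_map A B f) (Spec_map B A g)) rm_id"
    by (rule trans[OF Spec_map_comp[OF f g, of "\<lambda>b. b"] Spec_map_id]) (use gf f.A.is_cring in simp_all)
  ultimately show ?thesis
    unfolding lrs_iso_def using Spec_map_iso_morphism[OF f g gf fg] Spec_map_iso_morphism[OF g f fg gf] by blast
qed

section \<open>From isomorphisms of spectra to isomorphisms of rings\<close>

definition induced_hom :: "'a ring \<Rightarrow> 'b ring \<Rightarrow> ('b, 'a) affine_map \<Rightarrow> 'a \<Rightarrow> 'b" where
  "induced_hom A B \<theta> a =
     inv_into (carrier B) (global_section B) (rm_sec \<theta> (primes A) (global_section A a))"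

lemma lrs_morphism_preimage_all:
  assumes "lrs_morphism (Spec B) (Spec A) \<theta>"
  shows "rm_preimage (Spec B) \<theta> (primes A) = primes B"
  using assms unfolding lrs_morphism_def rm_preimage_def continuous_map_def Spec_def
  by (auto simp: topspace_zariski Pi_iff)

text \<open>An isomorphism of spectra is bijective on global sections, because its inverse induces
  the inverse map there, and both rings are identified with their global sections by the bijections
  \<open>global_section\<close>.\<close>

lemma induced_hom:
  assumes A: "cring A" and B: "cring B" and \<theta>: "lrs_iso (Spec B) (Spec A) \<theta>"
  shows "a \<in> carrier A \<Longrightarrow> global_section B (induced_hom A B \<theta> a) = rm_sec \<theta> (primes A) (global_section A a)"
    and "induced_hom A B \<theta> \<in> ring_hom A B"
    and "bij_betw (induced_hom A B \<theta>) (carrier A) (carrier B)"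
proof -
  let ?h = "rm_sec \<theta> (primes A)" and ?SA = "spec_sections A (primes A)" and ?SB = "spec_sections B (primes B)"
  have \<theta>m: "lrs_morphism (Spec B) (Spec A) \<theta>" using \<theta> unfolding lrs_iso_def by blast
  obtain \<eta> where \<eta>: "lrs_morphism (Spec A) (Spec B) \<eta>"
    and 1: "rm_eq (Spec B) (Spec B) (rm_comp (Spec A) \<eta> \<theta>) rm_id"
    and 2: "rm_eq (Spec A) (Spec A) (rm_comp (Spec B) \<theta> \<eta>) rm_id"
    using \<theta> unfolding lrs_iso_def by blast
  let ?k = "rm_sec \<eta> (primes B)"
  have h: "?h \<in> ring_hom ?SA ?SB"
    using \<theta>m lrs_morphism_preimage_all[OF \<theta>m] unfolding lrs_morphism_def
    by (auto simp: Spec_def) (metis openin_all)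
  have k: "?k \<in> ring_hom ?SB ?SA"
    using \<eta> lrs_morphism_preimage_all[OF \<eta>] unfolding lrs_morphism_def
    by (auto simp: Spec_def) (metis openin_all)
  have hk: "?h (?k s) = s" if "s \<in> carrier ?SB" for s
    using 1[unfolded rm_eq_def, THEN conjunct2, rule_format, of "primes B" s] that
      lrs_morphism_preimage_all[OF \<eta>] by (simp add: rm_comp_def rm_id_def Spec_simps)
  have kh: "?k (?h s) = s" if "s \<in> carrier ?SA" for s
    using 2[unfolded rm_eq_def, THEN conjunct2, rule_format, of "primes A" s] that
      lrs_morphism_preimage_all[OF \<theta>m] by (simp add: rm_comp_def rm_id_def Spec_simps)
  have ex: "\<exists>b\<in>carrier B. ?h (global_section A a) = global_section B b" if "a \<in> carrier A" for a
    using global_section_surj[OF B ring_hom_closed[OF h ring_hom_closed[OF global_section_hom[OF A] that]]] .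
  have eq: "global_section B (induced_hom A B \<theta> a) = ?h (global_section A a)" if "a \<in> carrier A" for a
    unfolding induced_hom_def using ex[OF that] by (intro f_inv_into_f) auto
  then show "a \<in> carrier A \<Longrightarrow> global_section B (induced_hom A B \<theta> a) = ?h (global_section A a)" .
  have cl: "induced_hom A B \<theta> a \<in> carrier B" if "a \<in> carrier A" for a
    unfolding induced_hom_def using ex[OF that] by (intro inv_into_into) auto
  note inj = inj_onD[OF global_section_inj[OF B]]
  note hA = global_section_hom[OF A] and hB = global_section_hom[OF B]
  interpret A: cring A by fact
  interpret B: cring B by fact
  show "induced_hom A B \<theta> \<in> ring_hom A B"
  proof (rule ring_hom_memI)
    fix a b assume a: "a \<in> carrier A" and b: "b \<in> carrier A"
    show "induced_hom A B \<theta> (a \<otimes>\<^bsub>A\<^esub> b) = induced_hom A B \<theta> a \<otimes>\<^bsub>B\<^esub> induced_hom A B \<theta> b"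
      using a b cl by (intro inj) (simp_all add: eq ring_hom_mult[OF hA] ring_hom_mult[OF hB]
        ring_hom_mult[OF h] ring_hom_closed[OF hA])
    show "induced_hom A B \<theta> (a \<oplus>\<^bsub>A\<^esub> b) = induced_hom A B \<theta> a \<oplus>\<^bsub>B\<^esub> induced_hom A B \<theta> b"
      using a b cl by (intro inj) (simp_all add: eq ring_hom_add[OF hA] ring_hom_add[OF hB]
        ring_hom_add[OF h] ring_hom_closed[OF hA])
  next
    show "induced_hom A B \<theta> \<one>\<^bsub>A\<^esub> = \<one>\<^bsub>B\<^esub>"
      using cl by (intro inj) (simp_all add: eq ring_hom_one[OF hA] ring_hom_one[OF hB] ring_hom_one[OF h])
  qed (rule cl)
  show "bij_betw (induced_hom A B \<theta>) (carrier A) (carrier B)"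
  proof (rule bij_betwI')
    fix a b assume a: "a \<in> carrier A" and b: "b \<in> carrier A"
    show "induced_hom A B \<theta> a = induced_hom A B \<theta> b \<longleftrightarrow> a = b"
    proof
      assume "induced_hom A B \<theta> a = induced_hom A B \<theta> b"
      then have "?k (?h (global_section A a)) = ?k (?h (global_section A b))" using eq a b by metis
      then have "global_section A a = global_section A b"
        using kh ring_hom_closed[OF hA] a b by simp
      then show "a = b" using inj_onD[OF global_section_inj[OF A]] a b by blast
    qed simp
  next
    fix b assume b: "b \<in> carrier B"
    obtain a where a: "a \<in> carrier A" "?k (global_section B b) = global_section A a"
      using global_section_surj[OF A ring_hom_closed[OF k ring_hom_closed[OF hB b]]] by blast
    have "global_section B (induced_hom A B \<theta> a) = global_section B b"
      using eq[OF a(1)] hk[OF ring_hom_closed[OF hB b]] a(2) by simp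
    then show "\<exists>a\<in>carrier A. b = induced_hom A B \<theta> a" using inj[OF _ cl b] a by blast
  qed (rule cl)
qed

section \<open>Monoid algebras\<close>

locale monoid_ring = R: cring R + M: comm_monoid M
  for R :: "'r ring" and M :: "'m monoid"
begin

abbreviation RM where "RM \<equiv> monoid_algebra R M"
abbreviation supp where "supp F \<equiv> {m. F m \<noteq> \<zero>\<^bsub>R\<^esub>}"
abbreviation sgl where "sgl \<equiv> ma_single R"

lemma carrD:
  assumes "F \<in> carrier RM"
  shows "F m \<in> carrier R" "finite (supp F)" "supp F \<subseteq> carrier M"
  using assms by (auto simp: monoid_algebra_def)

lemma carrI:
  "\<lbrakk>\<And>m. F m \<in> carrier R; finite X; X \<subseteq> carrier M; \<And>m. m \<notin> X \<Longrightarrow> F m = \<zero>\<^bsub>R\<^esub>\<rbrakk> \<Longrightarrow> F \<in> carrier RM"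
proof -
  assume a: "\<And>m. F m \<in> carrier R" "finite X" "X \<subseteq> carrier M" "\<And>m. m \<notin> X \<Longrightarrow> F m = \<zero>\<^bsub>R\<^esub>"
  have "supp F \<subseteq> X" using a(4) by blast
  then show ?thesis using a(1-3) finite_subset by (auto simp: monoid_algebra_def)
qed

lemma add_eq: "F \<oplus>\<^bsub>RM\<^esub> G = (\<lambda>m. F m \<oplus>\<^bsub>R\<^esub> G m)" and zero_eq: "\<zero>\<^bsub>RM\<^esub> = (\<lambda>m. \<zero>\<^bsub>R\<^esub>)"
  and one_eq: "\<one>\<^bsub>RM\<^esub> = sgl \<one>\<^bsub>R\<^esub> \<one>\<^bsub>M\<^esub>"
  by (simp_all add: monoid_algebra_def ma_single_def)

lemma sgl_carr [simp, intro]: "r \<in> carrier R \<Longrightarrow> m \<in> carrier M \<Longrightarrow> sgl r m \<in> carrier RM"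
  by (rule carrI[of _ "{m}"]) (auto simp: ma_single_def)

lemma zero_carr [simp, intro]: "\<zero>\<^bsub>RM\<^esub> \<in> carrier RM"
  by (rule carrI[of _ "{}"]) (auto simp: zero_eq)

lemma add_carr [simp, intro]:
  assumes "F \<in> carrier RM" "G \<in> carrier RM"
  shows "F \<oplus>\<^bsub>RM\<^esub> G \<in> carrier RM"
  by (rule carrI[of _ "supp F \<union> supp G"]) (use carrD[OF assms(1)] carrD[OF assms(2)] in \<open>auto simp: add_eq\<close>)

lemma abelian_group: "abelian_group RM"
proof (rule abelian_groupI)
  fix F assume F: "F \<in> carrier RM"
  let ?G = "\<lambda>m. \<ominus>\<^bsub>R\<^esub> F m"
  have "?G \<in> carrier RM" by (rule carrI[of _ "supp F"]) (use carrD[OF F] in auto)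
  moreover have "?G \<oplus>\<^bsub>RM\<^esub> F = \<zero>\<^bsub>RM\<^esub>" using carrD[OF F] by (simp add: add_eq zero_eq R.l_neg)
  ultimately show "\<exists>G\<in>carrier RM. G \<oplus>\<^bsub>RM\<^esub> F = \<zero>\<^bsub>RM\<^esub>" by blast
qed (auto simp: add_eq[of _ _] zero_eq carrD R.a_ac intro: add_carr[unfolded add_eq] zero_carr[unfolded zero_eq])

text \<open>The convolution is defined by a sum over the exact supports. Enlarging these to common
  finite sets X and Y lets products with different factors be compared over one index set.\<close>

lemma mult_eq_sum:
  assumes F: "F \<in> carrier RM" and G: "G \<in> carrier RM"
    and X: "finite X" "supp F \<subseteq> X" and Y: "finite Y" "supp G \<subseteq> Y"
  shows "(F \<otimes>\<^bsub>RM\<^esub> G) m =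
    (\<Oplus>\<^bsub>R\<^esub>x\<in>X \<times> Y. if fst x \<otimes>\<^bsub>M\<^esub> snd x = m then F (fst x) \<otimes>\<^bsub>R\<^esub> G (snd x) else \<zero>\<^bsub>R\<^esub>)"
proof -
  have "(F \<otimes>\<^bsub>RM\<^esub> G) m =
    (\<Oplus>\<^bsub>R\<^esub>x\<in>{(a, b). F a \<noteq> \<zero>\<^bsub>R\<^esub> \<and> G b \<noteq> \<zero>\<^bsub>R\<^esub> \<and> a \<otimes>\<^bsub>M\<^esub> b = m}. F (fst x) \<otimes>\<^bsub>R\<^esub> G (snd x))"
    by (simp add: monoid_algebra_def)
  also have "\<dots> = (\<Oplus>\<^bsub>R\<^esub>x\<in>X \<times> Y. if fst x \<otimes>\<^bsub>M\<^esub> snd x = m then F (fst x) \<otimes>\<^bsub>R\<^esub> G (snd x) else \<zero>\<^bsub>R\<^esub>)"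
    by (rule R.add.finprod_mono_neutral_cong_left) (use X Y carrD[OF F] carrD[OF G] in auto)
  finally show ?thesis .
qed

lemma mult_carr [simp, intro]:
  assumes F: "F \<in> carrier RM" and G: "G \<in> carrier RM"
  shows "F \<otimes>\<^bsub>RM\<^esub> G \<in> carrier RM"
proof (rule carrI[of _ "(\<lambda>(a, b). a \<otimes>\<^bsub>M\<^esub> b) ` (supp F \<times> supp G)"])
  note eq = mult_eq_sum[OF F G carrD(2)[OF F] subset_refl carrD(2)[OF G] subset_refl]
  show "(F \<otimes>\<^bsub>RM\<^esub> G) m \<in> carrier R" for m
    unfolding eq using carrD[OF F] carrD[OF G] by (intro R.finsum_closed) auto
  show "(F \<otimes>\<^bsub>RM\<^esub> G) m = \<zero>\<^bsub>R\<^esub>" if "m \<notin> (\<lambda>(a, b). a \<otimes>\<^bsub>M\<^esub> b) ` (supp F \<times> supp G)" for m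
    unfolding eq using that by (intro R.add.finprod_one_eqI) force
qed (use carrD[OF F] carrD[OF G] in auto)

lemma mult_l_distr:
  assumes F: "F \<in> carrier RM" and F': "F' \<in> carrier RM" and G: "G \<in> carrier RM"
  shows "(F \<oplus>\<^bsub>RM\<^esub> F') \<otimes>\<^bsub>RM\<^esub> G = F \<otimes>\<^bsub>RM\<^esub> G \<oplus>\<^bsub>RM\<^esub> F' \<otimes>\<^bsub>RM\<^esub> G"
proof
  fix m
  let ?X = "supp F \<union> supp F'" and ?Y = "supp G"
  have fin: "finite ?X" "finite ?Y" using carrD F F' G by auto
  have sub: "supp (F \<oplus>\<^bsub>RM\<^esub> F') \<subseteq> ?X" using carrD[OF F] carrD[OF F'] by (auto simp: add_eq)
  note c = carrD(1)[OF F] carrD(1)[OF F'] carrD(1)[OF G]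
  have "((F \<oplus>\<^bsub>RM\<^esub> F') \<otimes>\<^bsub>RM\<^esub> G) m =
      (\<Oplus>\<^bsub>R\<^esub>x\<in>?X \<times> ?Y. if fst x \<otimes>\<^bsub>M\<^esub> snd x = m then (F \<oplus>\<^bsub>RM\<^esub> F') (fst x) \<otimes>\<^bsub>R\<^esub> G (snd x) else \<zero>\<^bsub>R\<^esub>)"
    by (rule mult_eq_sum[OF add_carr[OF F F'] G fin(1) sub fin(2) subset_refl])
  also have "\<dots> = (\<Oplus>\<^bsub>R\<^esub>x\<in>?X \<times> ?Y. (if fst x \<otimes>\<^bsub>M\<^esub> snd x = m then F (fst x) \<otimes>\<^bsub>R\<^esub> G (snd x) else \<zero>\<^bsub>R\<^esub>) \<oplus>\<^bsub>R\<^esub>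
      (if fst x \<otimes>\<^bsub>M\<^esub> snd x = m then F' (fst x) \<otimes>\<^bsub>R\<^esub> G (snd x) else \<zero>\<^bsub>R\<^esub>))"
    by (rule R.finsum_cong') (use c in \<open>auto simp: add_eq R.l_distr\<close>)
  also have "\<dots> = (F \<otimes>\<^bsub>RM\<^esub> G) m \<oplus>\<^bsub>R\<^esub> (F' \<otimes>\<^bsub>RM\<^esub> G) m"
    using c by (subst R.finsum_addf)
      (auto simp: mult_eq_sum[OF F G fin(1) _ fin(2)] mult_eq_sum[OF F' G fin(1) _ fin(2)])
  finally show "((F \<oplus>\<^bsub>RM\<^esub> F') \<otimes>\<^bsub>RM\<^esub> G) m = (F \<otimes>\<^bsub>RM\<^esub> G \<oplus>\<^bsub>RM\<^esub> F' \<otimes>\<^bsub>RM\<^esub> G) m"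
    by (simp add: add_eq)
qed

lemma mult_r_distr:
  assumes F: "F \<in> carrier RM" and F': "F' \<in> carrier RM" and G: "G \<in> carrier RM"
  shows "G \<otimes>\<^bsub>RM\<^esub> (F \<oplus>\<^bsub>RM\<^esub> F') = G \<otimes>\<^bsub>RM\<^esub> F \<oplus>\<^bsub>RM\<^esub> G \<otimes>\<^bsub>RM\<^esub> F'"
proof
  fix m
  let ?X = "supp F \<union> supp F'" and ?Y = "supp G"
  have fin: "finite ?X" "finite ?Y" using carrD F F' G by auto
  have sub: "supp (F \<oplus>\<^bsub>RM\<^esub> F') \<subseteq> ?X" using carrD[OF F] carrD[OF F'] by (auto simp: add_eq)
  note c = carrD(1)[OF F] carrD(1)[OF F'] carrD(1)[OF G]
  have "(G \<otimes>\<^bsub>RM\<^esub> (F \<oplus>\<^bsub>RM\<^esub> F')) m =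
      (\<Oplus>\<^bsub>R\<^esub>x\<in>?Y \<times> ?X. if fst x \<otimes>\<^bsub>M\<^esub> snd x = m then G (fst x) \<otimes>\<^bsub>R\<^esub> (F \<oplus>\<^bsub>RM\<^esub> F') (snd x) else \<zero>\<^bsub>R\<^esub>)"
    by (rule mult_eq_sum[OF G add_carr[OF F F'] fin(2) subset_refl fin(1) sub])
  also have "\<dots> = (\<Oplus>\<^bsub>R\<^esub>x\<in>?Y \<times> ?X. (if fst x \<otimes>\<^bsub>M\<^esub> snd x = m then G (fst x) \<otimes>\<^bsub>R\<^esub> F (snd x) else \<zero>\<^bsub>R\<^esub>) \<oplus>\<^bsub>R\<^esub>
      (if fst x \<otimes>\<^bsub>M\<^esub> snd x = m then G (fst x) \<otimes>\<^bsub>R\<^esub> F' (snd x) else \<zero>\<^bsub>R\<^esub>))"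
    by (rule R.finsum_cong') (use c in \<open>auto simp: add_eq R.r_distr\<close>)
  also have "\<dots> = (G \<otimes>\<^bsub>RM\<^esub> F) m \<oplus>\<^bsub>R\<^esub> (G \<otimes>\<^bsub>RM\<^esub> F') m"
    using c by (subst R.finsum_addf)
      (auto simp: mult_eq_sum[OF G F fin(2) _ fin(1)] mult_eq_sum[OF G F' fin(2) _ fin(1)])
  finally show "(G \<otimes>\<^bsub>RM\<^esub> (F \<oplus>\<^bsub>RM\<^esub> F')) m = (G \<otimes>\<^bsub>RM\<^esub> F \<oplus>\<^bsub>RM\<^esub> G \<otimes>\<^bsub>RM\<^esub> F') m"
    by (simp add: add_eq)
qed

lemma mult_zero: "\<zero>\<^bsub>RM\<^esub> \<otimes>\<^bsub>RM\<^esub> G = \<zero>\<^bsub>RM\<^esub>" "G \<otimes>\<^bsub>RM\<^esub> \<zero>\<^bsub>RM\<^esub> = \<zero>\<^bsub>RM\<^esub>"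
  by (simp_all add: monoid_algebra_def)

lemma mult_sgl [simp]:
  assumes "r \<in> carrier R" "s \<in> carrier R" "a \<in> carrier M" "b \<in> carrier M"
  shows "sgl r a \<otimes>\<^bsub>RM\<^esub> sgl s b = sgl (r \<otimes>\<^bsub>R\<^esub> s) (a \<otimes>\<^bsub>M\<^esub> b)"
proof
  fix m
  have "(sgl r a \<otimes>\<^bsub>RM\<^esub> sgl s b) m = (\<Oplus>\<^bsub>R\<^esub>x\<in>{a} \<times> {b}. if fst x \<otimes>\<^bsub>M\<^esub> snd x = m then
      sgl r a (fst x) \<otimes>\<^bsub>R\<^esub> sgl s b (snd x) else \<zero>\<^bsub>R\<^esub>)"
    using assms by (intro mult_eq_sum sgl_carr) (auto simp: ma_single_def)
  also have "{a} \<times> {b} = {(a, b)}" by simp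
  finally show "(sgl r a \<otimes>\<^bsub>RM\<^esub> sgl s b) m = sgl (r \<otimes>\<^bsub>R\<^esub> s) (a \<otimes>\<^bsub>M\<^esub> b) m"
    using assms by (auto simp: ma_single_def)
qed

lemma sgl_add: "r \<in> carrier R \<Longrightarrow> s \<in> carrier R \<Longrightarrow> sgl (r \<oplus>\<^bsub>R\<^esub> s) m = sgl r m \<oplus>\<^bsub>RM\<^esub> sgl s m"
  by (auto simp: ma_single_def add_eq)

lemma sgl_zero: "sgl \<zero>\<^bsub>R\<^esub> m = \<zero>\<^bsub>RM\<^esub>"
  by (auto simp: ma_single_def zero_eq)

text \<open>Every element is a finite sum of single terms. The remaining ring axioms and the
  equality of homomorphisms thereby reduce to single terms, where they hold by the axioms of R and
  M.\<close>

lemma induct_sgl [consumes 1, case_names zero add]: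
  assumes F: "F \<in> carrier RM" and zero: "P \<zero>\<^bsub>RM\<^esub>"
    and add: "\<And>r m F. \<lbrakk>r \<in> carrier R; m \<in> carrier M; F \<in> carrier RM; P F\<rbrakk> \<Longrightarrow> P (sgl r m \<oplus>\<^bsub>RM\<^esub> F)"
  shows "P F"
proof -
  have "\<lbrakk>F \<in> carrier RM; supp F \<subseteq> X; X \<subseteq> carrier M\<rbrakk> \<Longrightarrow> P F" if "finite X" for X F
    using that
  proof (induction X arbitrary: F rule: finite_induct)
    case empty
    then have "F = \<zero>\<^bsub>RM\<^esub>" by (auto simp: zero_eq)
    then show ?case using zero by simp
  next
    case (insert x X)
    let ?G = "F(x := \<zero>\<^bsub>R\<^esub>)"
    have G: "?G \<in> carrier RM"
      by (rule carrI[of _ "supp F"]) (use carrD[OF insert.prems(1)] in auto)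
    moreover have "supp ?G \<subseteq> X" using insert.prems(2) by auto
    ultimately have "P ?G" using insert by blast
    moreover have "F = sgl (F x) x \<oplus>\<^bsub>RM\<^esub> ?G"
      using carrD[OF insert.prems(1)] by (auto simp: add_eq ma_single_def)
    ultimately show ?case using add[OF _ _ G] carrD[OF insert.prems(1)] insert.prems(3) by (metis insert_subset)
  qed
  then show ?thesis using carrD[OF F] F by blast
qed

lemma mult_comm:
  assumes F: "F \<in> carrier RM" and G: "G \<in> carrier RM"
  shows "F \<otimes>\<^bsub>RM\<^esub> G = G \<otimes>\<^bsub>RM\<^esub> F"
  using F
proof (induction rule: induct_sgl)
  case (add r m F)
  have "sgl r m \<otimes>\<^bsub>RM\<^esub> G = G \<otimes>\<^bsub>RM\<^esub> sgl r m"
    using G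
  proof (induction rule: induct_sgl)
    case (add s n G)
    then show ?case using \<open>r \<in> carrier R\<close> \<open>m \<in> carrier M\<close>
      by (simp add: mult_l_distr mult_r_distr R.m_comm M.m_comm)
  qed (simp add: mult_zero)
  then show ?case using add G by (simp add: mult_l_distr mult_r_distr)
qed (simp add: mult_zero)

lemma mult_assoc:
  assumes F: "F \<in> carrier RM" and G: "G \<in> carrier RM" and H: "H \<in> carrier RM"
  shows "F \<otimes>\<^bsub>RM\<^esub> G \<otimes>\<^bsub>RM\<^esub> H = F \<otimes>\<^bsub>RM\<^esub> (G \<otimes>\<^bsub>RM\<^esub> H)"
  using F
proof (induction rule: induct_sgl)
  case (add r m F)
  have "sgl r m \<otimes>\<^bsub>RM\<^esub> G \<otimes>\<^bsub>RM\<^esub> H = sgl r m \<otimes>\<^bsub>RM\<^esub> (G \<otimes>\<^bsub>RM\<^esub> H)"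
    using G
  proof (induction rule: induct_sgl)
    case (add s n G)
    have "sgl r m \<otimes>\<^bsub>RM\<^esub> sgl s n \<otimes>\<^bsub>RM\<^esub> H = sgl r m \<otimes>\<^bsub>RM\<^esub> (sgl s n \<otimes>\<^bsub>RM\<^esub> H)"
      using H
    proof (induction rule: induct_sgl)
      case (add t k H)
      then show ?case using add \<open>r \<in> carrier R\<close> \<open>m \<in> carrier M\<close> \<open>s \<in> carrier R\<close> \<open>n \<in> carrier M\<close>
        by (simp add: mult_r_distr R.m_assoc M.m_assoc del: mult_sgl) (simp add: R.m_assoc M.m_assoc)
    qed (simp add: mult_zero)
    then show ?case using add H \<open>r \<in> carrier R\<close> \<open>m \<in> carrier M\<close>
      by (simp add: mult_l_distr mult_r_distr del: mult_sgl)
  qed (simp add: mult_zero)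
  then show ?case using add G H by (simp add: mult_l_distr)
qed (simp add: mult_zero)

sublocale RM: cring RM
proof (rule cringI)
  show "abelian_group RM" by (rule abelian_group)
  show "comm_monoid RM"
  proof (rule comm_monoidI)
    fix F assume "F \<in> carrier RM"
    then show "\<one>\<^bsub>RM\<^esub> \<otimes>\<^bsub>RM\<^esub> F = F"
      unfolding one_eq by (induction rule: induct_sgl) (simp_all add: mult_zero mult_r_distr)
    show "F \<otimes>\<^bsub>RM\<^esub> G = G \<otimes>\<^bsub>RM\<^esub> F" if "G \<in> carrier RM" for G
      by (rule mult_comm[OF \<open>F \<in> carrier RM\<close> that])
    show "F \<otimes>\<^bsub>RM\<^esub> G \<otimes>\<^bsub>RM\<^esub> H = F \<otimes>\<^bsub>RM\<^esub> (G \<otimes>\<^bsub>RM\<^esub> H)" if "G \<in> carrier RM" "H \<in> carrier RM" for G H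
      by (rule mult_assoc[OF \<open>F \<in> carrier RM\<close> that])
    show "F \<otimes>\<^bsub>RM\<^esub> G \<in> carrier RM" if "G \<in> carrier RM" for G
      by (rule mult_carr[OF \<open>F \<in> carrier RM\<close> that])
  next
    show "\<one>\<^bsub>RM\<^esub> \<in> carrier RM" unfolding one_eq by (rule sgl_carr) simp_all
  qed
  show "(F \<oplus>\<^bsub>RM\<^esub> G) \<otimes>\<^bsub>RM\<^esub> H = F \<otimes>\<^bsub>RM\<^esub> H \<oplus>\<^bsub>RM\<^esub> G \<otimes>\<^bsub>RM\<^esub> H"
    if "F \<in> carrier RM" "G \<in> carrier RM" "H \<in> carrier RM" for F G H
    using mult_l_distr that by blast
qed

lemma hom_eq_on_sgl:
  assumes f: "f \<in> ring_hom RM C" and g: "g \<in> ring_hom RM C" and C: "ring C"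
    and eq: "\<And>r m. r \<in> carrier R \<Longrightarrow> m \<in> carrier M \<Longrightarrow> f (sgl r m) = g (sgl r m)"
    and F: "F \<in> carrier RM"
  shows "f F = g F"
  using F
proof (induction rule: induct_sgl)
  case zero
  show ?case using ring_hom_zero[OF f RM.ring_axioms C] ring_hom_zero[OF g RM.ring_axioms C] by simp
next
  case (add r m F)
  then show ?case by (simp add: ring_hom_add[OF f] ring_hom_add[OF g] eq)
qed

end

section \<open>The universal property of monoid algebras\<close>

definition ma_lift :: "'r ring \<Rightarrow> 'c ring \<Rightarrow> ('r \<Rightarrow> 'c) \<Rightarrow> ('m \<Rightarrow> 'c) \<Rightarrow> ('m \<Rightarrow> 'r) \<Rightarrow> 'c" where
  "ma_lift R C \<rho> \<mu> F = (\<Oplus>\<^bsub>C\<^esub>m\<in>{m. F m \<noteq> \<zero>\<^bsub>R\<^esub>}. \<rho> (F m) \<otimes>\<^bsub>C\<^esub> \<mu> m)"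

text \<open>Multiplicativity of \<mu> is left to \<open>lift_hom\<close>, because the additive part
  also serves for coordinate functionals, which are not multiplicative.\<close>

locale monoid_ring_lift = monoid_ring R M + C: cring C
  for R :: "'r ring" and M :: "'m monoid" and C :: "'c ring" +
  fixes \<rho> :: "'r \<Rightarrow> 'c" and \<mu> :: "'m \<Rightarrow> 'c"
  assumes \<rho>: "\<rho> \<in> ring_hom R C" and \<mu>: "\<And>m. m \<in> carrier M \<Longrightarrow> \<mu> m \<in> carrier C"
begin

abbreviation lift where "lift \<equiv> ma_lift R C \<rho> \<mu>"

lemma \<rho>_closed: "r \<in> carrier R \<Longrightarrow> \<rho> r \<in> carrier C"
  by (rule ring_hom_closed[OF \<rho>])

lemma \<rho>_zero: "\<rho> \<zero>\<^bsub>R\<^esub> = \<zero>\<^bsub>C\<^esub>"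
  by (rule ring_hom_zero[OF \<rho> R.ring_axioms C.ring_axioms])

lemma lift_eq_sum:
  assumes F: "F \<in> carrier RM" and X: "finite X" "supp F \<subseteq> X" "X \<subseteq> carrier M"
  shows "lift F = (\<Oplus>\<^bsub>C\<^esub>m\<in>X. \<rho> (F m) \<otimes>\<^bsub>C\<^esub> \<mu> m)"
  unfolding ma_lift_def
  by (rule C.add.finprod_mono_neutral_cong_left) (use X carrD[OF F] \<rho>_closed \<mu> \<rho>_zero in auto)

lemma lift_closed [simp, intro]: "F \<in> carrier RM \<Longrightarrow> lift F \<in> carrier C"
  unfolding ma_lift_def using carrD[of F] \<rho>_closed \<mu> by (intro C.finsum_closed) blast

lemma lift_add:
  assumes F: "F \<in> carrier RM" and G: "G \<in> carrier RM"
  shows "lift (F \<oplus>\<^bsub>RM\<^esub> G) = lift F \<oplus>\<^bsub>C\<^esub> lift G"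
proof -
  let ?X = "supp F \<union> supp G"
  have X: "finite ?X" "?X \<subseteq> carrier M" using carrD[OF F] carrD[OF G] by auto
  have "supp (F \<oplus>\<^bsub>RM\<^esub> G) \<subseteq> ?X" using carrD[OF F] carrD[OF G] by (auto simp: add_eq)
  note sub = this
  have cl: "(\<lambda>m. \<rho> (H m) \<otimes>\<^bsub>C\<^esub> \<mu> m) \<in> ?X \<rightarrow> carrier C" if "H \<in> carrier RM" for H
    using X(2) by (intro Pi_I C.m_closed \<rho>_closed \<mu> carrD(1)[OF that]) blast
  from sub have "lift (F \<oplus>\<^bsub>RM\<^esub> G) = (\<Oplus>\<^bsub>C\<^esub>m\<in>?X. \<rho> ((F \<oplus>\<^bsub>RM\<^esub> G) m) \<otimes>\<^bsub>C\<^esub> \<mu> m)"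
    using F G X by (intro lift_eq_sum) auto
  also have "\<dots> = (\<Oplus>\<^bsub>C\<^esub>m\<in>?X. \<rho> (F m) \<otimes>\<^bsub>C\<^esub> \<mu> m \<oplus>\<^bsub>C\<^esub> \<rho> (G m) \<otimes>\<^bsub>C\<^esub> \<mu> m)"
  proof (rule C.finsum_cong')
    fix m assume "m \<in> ?X"
    then have "m \<in> carrier M" using X by blast
    then show "\<rho> ((F \<oplus>\<^bsub>RM\<^esub> G) m) \<otimes>\<^bsub>C\<^esub> \<mu> m = \<rho> (F m) \<otimes>\<^bsub>C\<^esub> \<mu> m \<oplus>\<^bsub>C\<^esub> \<rho> (G m) \<otimes>\<^bsub>C\<^esub> \<mu> m"
      using carrD(1)[OF F] carrD(1)[OF G] \<mu> \<rho>_closed by (simp add: add_eq ring_hom_add[OF \<rho>] C.l_distr)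
  next
    show "(\<lambda>m. \<rho> (F m) \<otimes>\<^bsub>C\<^esub> \<mu> m \<oplus>\<^bsub>C\<^esub> \<rho> (G m) \<otimes>\<^bsub>C\<^esub> \<mu> m) \<in> ?X \<rightarrow> carrier C"
      using cl[OF F] cl[OF G] by (intro Pi_I C.a_closed) blast+
  qed simp
  also have "\<dots> = lift F \<oplus>\<^bsub>C\<^esub> lift G"
    unfolding lift_eq_sum[OF F X(1) Un_upper1 X(2)] lift_eq_sum[OF G X(1) Un_upper2 X(2)]
    by (rule C.finsum_addf[OF cl[OF F] cl[OF G]])
  finally show ?thesis .
qed

lemma lift_sgl:
  assumes "r \<in> carrier R" "m \<in> carrier M"
  shows "lift (sgl r m) = \<rho> r \<otimes>\<^bsub>C\<^esub> \<mu> m"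
proof -
  have "lift (sgl r m) = (\<Oplus>\<^bsub>C\<^esub>n\<in>{m}. \<rho> (sgl r m n) \<otimes>\<^bsub>C\<^esub> \<mu> n)"
    using assms by (intro lift_eq_sum sgl_carr) (auto simp: ma_single_def)
  then show ?thesis using assms \<rho>_closed \<mu> by (simp add: ma_single_def)
qed

lemma lift_zero: "lift \<zero>\<^bsub>RM\<^esub> = \<zero>\<^bsub>C\<^esub>"
  unfolding ma_lift_def by (simp add: zero_eq)

lemma lift_hom:
  assumes mult: "\<And>m n. m \<in> carrier M \<Longrightarrow> n \<in> carrier M \<Longrightarrow> \<mu> (m \<otimes>\<^bsub>M\<^esub> n) = \<mu> m \<otimes>\<^bsub>C\<^esub> \<mu> n"
    and one: "\<mu> \<one>\<^bsub>M\<^esub> = \<one>\<^bsub>C\<^esub>"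
  shows "lift \<in> ring_hom RM C"
proof (rule ring_hom_memI)
  show "lift \<one>\<^bsub>RM\<^esub> = \<one>\<^bsub>C\<^esub>" unfolding one_eq by (simp add: lift_sgl ring_hom_one[OF \<rho>] one)
  fix F G assume F: "F \<in> carrier RM" and G: "G \<in> carrier RM"
  show "lift (F \<oplus>\<^bsub>RM\<^esub> G) = lift F \<oplus>\<^bsub>C\<^esub> lift G" by (rule lift_add[OF F G])
  show "lift (F \<otimes>\<^bsub>RM\<^esub> G) = lift F \<otimes>\<^bsub>C\<^esub> lift G"
    using F
  proof (induction rule: induct_sgl)
    case zero
    then show ?case using G by (simp add: mult_zero lift_zero)
  next
    case (add r m F)
    have "lift (sgl r m \<otimes>\<^bsub>RM\<^esub> G) = lift (sgl r m) \<otimes>\<^bsub>C\<^esub> lift G"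
      using G
    proof (induction rule: induct_sgl)
      case zero
      then show ?case using add by (simp add: mult_zero lift_zero)
    next
      case (add s n G)
      then show ?case using \<open>r \<in> carrier R\<close> \<open>m \<in> carrier M\<close> \<rho>_closed \<mu>
        by (simp add: mult_r_distr lift_add lift_sgl C.r_distr mult ring_hom_mult[OF \<rho>] C.m_ac)
    qed
    then show ?case using add G by (simp add: mult_l_distr lift_add C.l_distr)
  qed
qed (rule lift_closed)

end

section \<open>Tensor powers\<close>

locale tensor = ring_extension R A \<iota>
  for R :: "'r ring" and A :: "'a ring" and \<iota> :: "'r \<Rightarrow> 'a" +
  fixes S :: "nat set"
begin

abbreviation M where "M \<equiv> product_group S (\<lambda>_. A)"
abbreviation TF where "TF \<equiv> tensor_free R A S"
abbreviation I where "I \<equiv> tensor_ideal R A \<iota> S"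
abbreviation T where "T \<equiv> tensor_power R A \<iota> S"
definition unit_family where "unit_family = (\<lambda>s\<in>S. \<one>\<^bsub>A\<^esub>)"
abbreviation cls where "cls F \<equiv> I +>\<^bsub>TF\<^esub> F"

lemma comm_monoid_M: "comm_monoid M"
  by (rule comm_monoidI) (auto simp: PiE_iff A.m_ac extensional_def fun_eq_iff)

sublocale monoid_ring R M
  by (intro monoid_ring.intro K.is_cring comm_monoid_M)

lemma TF_eq: "RM = TF"
  unfolding tensor_free_def ..

lemma upd_family [simp, intro]:
  "\<lbrakk>f \<in> S \<rightarrow>\<^sub>E carrier A; s \<in> S; a \<in> carrier A\<rbrakk> \<Longrightarrow> f(s := a) \<in> S \<rightarrow>\<^sub>E carrier A"
  by (auto simp: PiE_iff extensional_def)

lemma unit_family [simp, intro]: "unit_family \<in> S \<rightarrow>\<^sub>E carrier A"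
  unfolding unit_family_def by auto

lemma unit_family_apply [simp]: "s \<in> S \<Longrightarrow> unit_family s = \<one>\<^bsub>A\<^esub>"
  unfolding unit_family_def by simp

lemma one_M: "\<one>\<^bsub>M\<^esub> = unit_family"
  unfolding unit_family_def by simp

lemma mult_M: "f \<otimes>\<^bsub>M\<^esub> g = (\<lambda>s\<in>S. f s \<otimes>\<^bsub>A\<^esub> g s)"
  by simp

lemma carr_M: "carrier M = S \<rightarrow>\<^sub>E carrier A"
  by simp

lemma sgl_TF [simp, intro]: "r \<in> carrier R \<Longrightarrow> f \<in> S \<rightarrow>\<^sub>E carrier A \<Longrightarrow> sgl r f \<in> carrier TF"
  using sgl_carr[of r f] unfolding TF_eq by simp

lemma relations_carr: "tensor_relations R A \<iota> S \<subseteq> carrier TF"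
  unfolding tensor_relations_def TF_eq[symmetric]
  using \<iota>_closed by (auto intro!: RM.minus_closed add_carr sgl_carr A.m_closed)

sublocale TF: cring TF
  using RM.is_cring unfolding TF_eq .

sublocale I: ideal I TF
  unfolding tensor_ideal_def by (rule TF.genideal_ideal[OF relations_carr])

sublocale T: cring T
  unfolding tensor_power_def by (rule I.quotient_is_cring[OF TF.is_cring])

lemma cls_hom: "(\<lambda>F. cls F) \<in> ring_hom TF T"
  unfolding tensor_power_def by (rule I.rcos_ring_hom)

lemma cls_carr [simp, intro]: "F \<in> carrier TF \<Longrightarrow> cls F \<in> carrier T"
  by (rule ring_hom_closed[OF cls_hom])

lemma carr_T: "carrier T = cls ` carrier TF"
  unfolding tensor_power_def FactRing_def A_RCOSETS_def RCOSETS_def a_r_coset_def by auto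

lemma cls_eq_iff:
  "F \<in> carrier TF \<Longrightarrow> G \<in> carrier TF \<Longrightarrow> cls F = cls G \<longleftrightarrow> F \<ominus>\<^bsub>TF\<^esub> G \<in> I"
  using TF.quotient_eq_iff_same_a_r_cos[OF I.ideal_axioms] by blast

lemma cls_zero_iff: "F \<in> carrier TF \<Longrightarrow> cls F = \<zero>\<^bsub>T\<^esub> \<longleftrightarrow> F \<in> I"
  using cls_eq_iff[of F "\<zero>\<^bsub>TF\<^esub>"] ring_hom_zero[OF cls_hom TF.ring_axioms T.ring_axioms]
  by (simp add: TF.minus_eq)

lemma cls_sgl_add:
  assumes "f \<in> S \<rightarrow>\<^sub>E carrier A" "s \<in> S" "a \<in> carrier A" "b \<in> carrier A"
  shows "cls (sgl \<one>\<^bsub>R\<^esub> (f(s := a \<oplus>\<^bsub>A\<^esub> b))) =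
    cls (sgl \<one>\<^bsub>R\<^esub> (f(s := a)) \<oplus>\<^bsub>TF\<^esub> sgl \<one>\<^bsub>R\<^esub> (f(s := b)))"
proof -
  have "sgl \<one>\<^bsub>R\<^esub> (f(s := a \<oplus>\<^bsub>A\<^esub> b)) \<ominus>\<^bsub>TF\<^esub>
      (sgl \<one>\<^bsub>R\<^esub> (f(s := a)) \<oplus>\<^bsub>TF\<^esub> sgl \<one>\<^bsub>R\<^esub> (f(s := b))) \<in> tensor_relations R A \<iota> S"
    unfolding tensor_relations_def using assms by blast
  then have "sgl \<one>\<^bsub>R\<^esub> (f(s := a \<oplus>\<^bsub>A\<^esub> b)) \<ominus>\<^bsub>TF\<^esub>
      (sgl \<one>\<^bsub>R\<^esub> (f(s := a)) \<oplus>\<^bsub>TF\<^esub> sgl \<one>\<^bsub>R\<^esub> (f(s := b))) \<in> I"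
    using TF.genideal_self[OF relations_carr] unfolding tensor_ideal_def by blast
  then show ?thesis using assms by (subst cls_eq_iff) auto
qed

lemma cls_sgl_scale:
  assumes "f \<in> S \<rightarrow>\<^sub>E carrier A" "s \<in> S" "a \<in> carrier A" "r \<in> carrier R"
  shows "cls (sgl \<one>\<^bsub>R\<^esub> (f(s := \<iota> r \<otimes>\<^bsub>A\<^esub> a))) = cls (sgl r (f(s := a)))"
proof -
  have "sgl \<one>\<^bsub>R\<^esub> (f(s := \<iota> r \<otimes>\<^bsub>A\<^esub> a)) \<ominus>\<^bsub>TF\<^esub> sgl r (f(s := a)) \<in> tensor_relations R A \<iota> S"
    unfolding tensor_relations_def using assms by blast
  then have "sgl \<one>\<^bsub>R\<^esub> (f(s := \<iota> r \<otimes>\<^bsub>A\<^esub> a)) \<ominus>\<^bsub>TF\<^esub> sgl r (f(s := a)) \<in> I"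
    using TF.genideal_self[OF relations_carr] unfolding tensor_ideal_def by blast
  then show ?thesis using assms \<iota>_closed by (subst cls_eq_iff) auto
qed

text \<open>The kernel of h is an ideal, and it contains the generating relations as soon as h
  respects addition and scalars in each entry of a pure tensor.\<close>

lemma hom_kills_ideal:
  assumes h: "h \<in> ring_hom TF C" and C: "cring C"
    and add: "\<And>f s a b. \<lbrakk>f \<in> S \<rightarrow>\<^sub>E carrier A; s \<in> S; a \<in> carrier A; b \<in> carrier A\<rbrakk> \<Longrightarrow>
      h (sgl \<one>\<^bsub>R\<^esub> (f(s := a \<oplus>\<^bsub>A\<^esub> b))) = h (sgl \<one>\<^bsub>R\<^esub> (f(s := a))) \<oplus>\<^bsub>C\<^esub> h (sgl \<one>\<^bsub>R\<^esub> (f(s := b)))"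
    and scale: "\<And>f s a r. \<lbrakk>f \<in> S \<rightarrow>\<^sub>E carrier A; s \<in> S; a \<in> carrier A; r \<in> carrier R\<rbrakk> \<Longrightarrow>
      h (sgl \<one>\<^bsub>R\<^esub> (f(s := \<iota> r \<otimes>\<^bsub>A\<^esub> a))) = h (sgl r (f(s := a)))"
    and F: "F \<in> I"
  shows "h F = \<zero>\<^bsub>C\<^esub>"
proof -
  interpret C: cring C by fact
  interpret h: ring_hom_ring TF C h
    by (intro ring_hom_ringI2 TF.ring_axioms C.ring_axioms h)
  have minus: "h (x \<ominus>\<^bsub>TF\<^esub> y) = \<zero>\<^bsub>C\<^esub>" if "x \<in> carrier TF" "y \<in> carrier TF" "h x = h y" for x y
    using that by (simp add: TF.minus_eq C.r_neg)
  have "tensor_relations R A \<iota> S \<subseteq> a_kernel TF C h"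
  proof
    fix x assume x: "x \<in> tensor_relations R A \<iota> S"
    from x consider
        f s a b where "x = sgl \<one>\<^bsub>R\<^esub> (f(s := a \<oplus>\<^bsub>A\<^esub> b)) \<ominus>\<^bsub>TF\<^esub>
          (sgl \<one>\<^bsub>R\<^esub> (f(s := a)) \<oplus>\<^bsub>TF\<^esub> sgl \<one>\<^bsub>R\<^esub> (f(s := b)))"
          "f \<in> S \<rightarrow>\<^sub>E carrier A" "s \<in> S" "a \<in> carrier A" "b \<in> carrier A"
      | f s a r where "x = sgl \<one>\<^bsub>R\<^esub> (f(s := \<iota> r \<otimes>\<^bsub>A\<^esub> a)) \<ominus>\<^bsub>TF\<^esub> sgl r (f(s := a))"
          "f \<in> S \<rightarrow>\<^sub>E carrier A" "s \<in> S" "a \<in> carrier A" "r \<in> carrier R"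
      unfolding tensor_relations_def by blast
    then have "h x = \<zero>\<^bsub>C\<^esub>"
    proof cases
      case 1
      note c = sgl_TF[OF K.one_closed upd_family[OF 1(2,3)]]
      have "h (sgl \<one>\<^bsub>R\<^esub> (f(s := a \<oplus>\<^bsub>A\<^esub> b))) = h (sgl \<one>\<^bsub>R\<^esub> (f(s := a)) \<oplus>\<^bsub>TF\<^esub> sgl \<one>\<^bsub>R\<^esub> (f(s := b)))"
        unfolding ring_hom_add[OF h c[OF 1(4)] c[OF 1(5)]] by (rule add[OF 1(2-5)])
      from minus[OF c[OF A.a_closed[OF 1(4,5)]] TF.a_closed[OF c[OF 1(4)] c[OF 1(5)]] this]
      show ?thesis unfolding 1(1) .
    next
      case 2
      note c = upd_family[OF 2(2,3)]
      from minus[OF sgl_TF[OF K.one_closed c[OF A.m_closed[OF \<iota>_closed[OF 2(5)] 2(4)]]]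
          sgl_TF[OF 2(5) c[OF 2(4)]] scale[OF 2(2-5)]]
      show ?thesis unfolding 2(1) .
    qed
    then show "x \<in> a_kernel TF C h"
      unfolding a_kernel_def' using relations_carr x by blast
  qed
  then have "I \<subseteq> a_kernel TF C h"
    unfolding tensor_ideal_def by (intro TF.genideal_minimal h.kernel_is_ideal)
  then show ?thesis unfolding a_kernel_def' using F by blast
qed

definition str where "str r = cls (sgl r unit_family)"

lemma str_eq: "tensor_str R A \<iota> S r = str r"
  unfolding tensor_str_def str_def unit_family_def ..

lemma TF_one: "\<one>\<^bsub>TF\<^esub> = sgl \<one>\<^bsub>R\<^esub> unit_family"
  using one_eq unfolding TF_eq one_M .

lemma TF_mult_sgl:
  "\<lbrakk>r \<in> carrier R; t \<in> carrier R; f \<in> S \<rightarrow>\<^sub>E carrier A; g \<in> S \<rightarrow>\<^sub>E carrier A\<rbrakk> \<Longrightarrow>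
    sgl r f \<otimes>\<^bsub>TF\<^esub> sgl t g = sgl (r \<otimes>\<^bsub>R\<^esub> t) (f \<otimes>\<^bsub>M\<^esub> g)"
  using mult_sgl[of r t f g] unfolding TF_eq carr_M .

lemma M_unit_l: "f \<in> S \<rightarrow>\<^sub>E carrier A \<Longrightarrow> unit_family \<otimes>\<^bsub>M\<^esub> f = f"
  using M.l_one[of f] unfolding one_M carr_M .

lemma sgl_unit_hom: "(\<lambda>r. sgl r unit_family) \<in> ring_hom R TF"
proof (rule ring_hom_memI)
  fix x y assume x: "x \<in> carrier R" and y: "y \<in> carrier R"
  show "sgl (x \<otimes>\<^bsub>R\<^esub> y) unit_family = sgl x unit_family \<otimes>\<^bsub>TF\<^esub> sgl y unit_family"
    using TF_mult_sgl[OF x y unit_family unit_family] unfolding M_unit_l[OF unit_family] by (rule sym)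
  show "sgl (x \<oplus>\<^bsub>R\<^esub> y) unit_family = sgl x unit_family \<oplus>\<^bsub>TF\<^esub> sgl y unit_family"
    using sgl_add[OF x y] unfolding TF_eq .
  show "sgl x unit_family \<in> carrier TF" using x by (rule sgl_TF) (rule unit_family)
next
  show "sgl \<one>\<^bsub>R\<^esub> unit_family = \<one>\<^bsub>TF\<^esub>" by (rule TF_one[symmetric])
qed

lemma str_hom: "str \<in> ring_hom R T"
  unfolding str_def using ring_hom_trans[OF sgl_unit_hom cls_hom] by (simp add: comp_def)

lemma sgl_split:
  assumes "r \<in> carrier R" "f \<in> S \<rightarrow>\<^sub>E carrier A"
  shows "sgl r f = sgl r unit_family \<otimes>\<^bsub>TF\<^esub> sgl \<one>\<^bsub>R\<^esub> f"
  using TF_mult_sgl[OF assms(1) K.one_closed unit_family assms(2)] assms(1)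
  unfolding M_unit_l[OF assms(2)] by simp

end

text \<open>A pure tensor is a product of tensors with one nontrivial entry, and this already in the
  free algebra. Homomorphisms out of the tensor power are thus determined by their values on those
  and on scalars.\<close>

lemma (in tensor) sgl_prod:
  assumes S: "finite S" and f: "f \<in> S \<rightarrow>\<^sub>E carrier A"
  shows "sgl \<one>\<^bsub>R\<^esub> f = (\<Otimes>\<^bsub>TF\<^esub>s\<in>S. sgl \<one>\<^bsub>R\<^esub> (unit_family(s := f s)))"
proof -
  \<comment> \<open>The family f truncated to S', with 1 in the remaining places, so that the
    induction adds one entry at a time.\<close>
  define g where "g S' = (\<lambda>s\<in>S. if s \<in> S' then f s else \<one>\<^bsub>A\<^esub>)" for S'
  have fc: "f s \<in> carrier A" if "s \<in> S" for s using f that by auto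
  have gc: "g S' \<in> S \<rightarrow>\<^sub>E carrier A" for S' using fc by (auto simp: g_def)
  have "sgl \<one>\<^bsub>R\<^esub> (g S') = (\<Otimes>\<^bsub>TF\<^esub>s\<in>S'. sgl \<one>\<^bsub>R\<^esub> (unit_family(s := f s)))" if "finite S'" "S' \<subseteq> S" for S'
    using that
  proof (induction S' rule: finite_induct)
    case empty
    have "g {} = unit_family" by (auto simp: g_def unit_family_def)
    then show ?case using TF_one by simp
  next
    case (insert s S')
    have c: "unit_family(t := f t) \<in> S \<rightarrow>\<^sub>E carrier A" if "t \<in> S" for t
      using fc that by (intro upd_family unit_family)
    have sS: "s \<in> S" and IH: "sgl \<one>\<^bsub>R\<^esub> (g S') = (\<Otimes>\<^bsub>TF\<^esub>s\<in>S'. sgl \<one>\<^bsub>R\<^esub> (unit_family(s := f s)))"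
      using insert by blast+
    have "(\<Otimes>\<^bsub>TF\<^esub>s\<in>insert s S'. sgl \<one>\<^bsub>R\<^esub> (unit_family(s := f s))) =
        sgl \<one>\<^bsub>R\<^esub> (unit_family(s := f s)) \<otimes>\<^bsub>TF\<^esub> (\<Otimes>\<^bsub>TF\<^esub>s\<in>S'. sgl \<one>\<^bsub>R\<^esub> (unit_family(s := f s)))"
      using insert.hyps insert.prems sgl_TF[OF K.one_closed c] by (intro TF.finprod_insert Pi_I) blast+
    also have "\<dots> = sgl \<one>\<^bsub>R\<^esub> (unit_family(s := f s)) \<otimes>\<^bsub>TF\<^esub> sgl \<one>\<^bsub>R\<^esub> (g S')"
      unfolding IH ..
    also have "\<dots> = sgl \<one>\<^bsub>R\<^esub> (unit_family(s := f s) \<otimes>\<^bsub>M\<^esub> g S')"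
      using TF_mult_sgl[OF K.one_closed K.one_closed c[OF sS] gc] by simp
    also have "unit_family(s := f s) \<otimes>\<^bsub>M\<^esub> g S' = g (insert s S')"
      unfolding mult_M using insert fc by (auto simp: fun_eq_iff g_def)
    finally show ?case by (rule sym)
  qed
  from this[OF S subset_refl] have "sgl \<one>\<^bsub>R\<^esub> (g S) = (\<Otimes>\<^bsub>TF\<^esub>s\<in>S. sgl \<one>\<^bsub>R\<^esub> (unit_family(s := f s)))" .
  moreover have "g S = f" using f by (auto simp: fun_eq_iff PiE_iff extensional_def g_def)
  ultimately show ?thesis by simp
qed

text \<open>The universal property of the tensor power as a coproduct: homomorphisms
  \<open>u s\<close> out of the copies of A that agree on R combine to one out of the tensor power.
  Finiteness of S makes the product over all places meaningful.\<close>

locale tensor_lift = tensor R A \<iota> S + C: cring C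
  for R :: "'r ring" and A :: "'a ring" and \<iota> :: "'r \<Rightarrow> 'a" and S and C :: "'c ring" +
  fixes \<rho> :: "'r \<Rightarrow> 'c" and u :: "nat \<Rightarrow> 'a \<Rightarrow> 'c"
  assumes S: "finite S" and \<rho>: "\<rho> \<in> ring_hom R C" and u: "\<And>s. s \<in> S \<Longrightarrow> u s \<in> ring_hom A C"
    and u_str: "\<And>s r. s \<in> S \<Longrightarrow> r \<in> carrier R \<Longrightarrow> u s (\<iota> r) = \<rho> r"
begin

definition \<mu> where "\<mu> f = (\<Otimes>\<^bsub>C\<^esub>s\<in>S. u s (f s))"

lemma u_closed: "s \<in> S \<Longrightarrow> a \<in> carrier A \<Longrightarrow> u s a \<in> carrier C"
  using ring_hom_closed[OF u] .

lemma \<mu>_closed: "f \<in> S \<rightarrow>\<^sub>E carrier A \<Longrightarrow> \<mu> f \<in> carrier C"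
  unfolding \<mu>_def using u_closed by (intro C.finprod_closed) auto

sublocale monoid_ring_lift R M C \<rho> \<mu>
  by unfold_locales (use \<rho> \<mu>_closed in auto)

lemma \<mu>_mult:
  assumes "f \<in> S \<rightarrow>\<^sub>E carrier A" "g \<in> S \<rightarrow>\<^sub>E carrier A"
  shows "\<mu> (f \<otimes>\<^bsub>M\<^esub> g) = \<mu> f \<otimes>\<^bsub>C\<^esub> \<mu> g"
proof -
  have "\<mu> (f \<otimes>\<^bsub>M\<^esub> g) = (\<Otimes>\<^bsub>C\<^esub>s\<in>S. u s (f s) \<otimes>\<^bsub>C\<^esub> u s (g s))"
    unfolding \<mu>_def mult_M using assms u_closed
    by (intro C.finprod_cong') (auto simp: ring_hom_mult[OF u] PiE_iff)
  also have "\<dots> = \<mu> f \<otimes>\<^bsub>C\<^esub> \<mu> g"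
    unfolding \<mu>_def using assms u_closed by (intro C.finprod_multf) auto
  finally show ?thesis .
qed

lemma \<mu>_one: "\<mu> unit_family = \<one>\<^bsub>C\<^esub>"
  unfolding \<mu>_def by (intro C.finprod_one_eqI) (simp add: ring_hom_one[OF u])

text \<open>Splitting off the factor at s exhibits \<mu> as linear in the entry at s, which is what
  the relations demand.\<close>

lemma \<mu>_upd:
  assumes "f \<in> S \<rightarrow>\<^sub>E carrier A" "s \<in> S" "a \<in> carrier A"
  shows "\<mu> (f(s := a)) = u s a \<otimes>\<^bsub>C\<^esub> (\<Otimes>\<^bsub>C\<^esub>t\<in>S - {s}. u t (f t))"
proof -
  have "\<mu> (f(s := a)) = (\<Otimes>\<^bsub>C\<^esub>t\<in>insert s (S - {s}). u t ((f(s := a)) t))"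
    unfolding \<mu>_def using assms(2) by (simp add: insert_absorb)
  also have "\<dots> = u s ((f(s := a)) s) \<otimes>\<^bsub>C\<^esub> (\<Otimes>\<^bsub>C\<^esub>t\<in>S - {s}. u t ((f(s := a)) t))"
    using assms S u_closed by (intro C.finprod_insert) (auto simp: PiE_iff)
  also have "(\<Otimes>\<^bsub>C\<^esub>t\<in>S - {s}. u t ((f(s := a)) t)) = (\<Otimes>\<^bsub>C\<^esub>t\<in>S - {s}. u t (f t))"
    using assms u_closed by (intro C.finprod_cong') (auto simp: PiE_iff)
  finally show ?thesis by (simp only: fun_upd_same)
qed

lemma \<mu>_rest: "f \<in> S \<rightarrow>\<^sub>E carrier A \<Longrightarrow> (\<Otimes>\<^bsub>C\<^esub>t\<in>S - {s}. u t (f t)) \<in> carrier C"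
  using u_closed by (intro C.finprod_closed) (auto simp: PiE_iff)

lemma lift_ring_hom: "lift \<in> ring_hom TF C"
  unfolding TF_eq[symmetric] by (rule lift_hom) (simp_all only: carr_M one_M \<mu>_mult \<mu>_one)

lemma lift_sgl': "r \<in> carrier R \<Longrightarrow> f \<in> S \<rightarrow>\<^sub>E carrier A \<Longrightarrow> lift (sgl r f) = \<rho> r \<otimes>\<^bsub>C\<^esub> \<mu> f"
  by (rule lift_sgl) simp_all

lemma lift_kills_ideal:
  assumes "F \<in> I"
  shows "lift F = \<zero>\<^bsub>C\<^esub>"
proof (rule hom_kills_ideal[OF lift_ring_hom C.is_cring _ _ assms])
  fix f s a b assume f: "f \<in> S \<rightarrow>\<^sub>E carrier A" "s \<in> S" "a \<in> carrier A" "b \<in> carrier A"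
  show "lift (sgl \<one>\<^bsub>R\<^esub> (f(s := a \<oplus>\<^bsub>A\<^esub> b))) = lift (sgl \<one>\<^bsub>R\<^esub> (f(s := a))) \<oplus>\<^bsub>C\<^esub> lift (sgl \<one>\<^bsub>R\<^esub> (f(s := b)))"
    using f \<mu>_rest[OF f(1)] u_closed[OF f(2)]
    by (simp add: lift_sgl' \<mu>_upd ring_hom_one[OF \<rho>] ring_hom_add[OF u] C.l_distr)
next
  fix f s a r assume f: "f \<in> S \<rightarrow>\<^sub>E carrier A" "s \<in> S" "a \<in> carrier A" "r \<in> carrier R"
  show "lift (sgl \<one>\<^bsub>R\<^esub> (f(s := \<iota> r \<otimes>\<^bsub>A\<^esub> a))) = lift (sgl r (f(s := a)))"
    using f \<mu>_rest[OF f(1)] u_closed[OF f(2)] \<iota>_closed \<rho>_closed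
    by (simp add: lift_sgl' \<mu>_upd ring_hom_one[OF \<rho>] ring_hom_mult[OF u] u_str C.m_assoc)
qed

end

section \<open>Functoriality of tensor powers\<close>

locale tensor_inj = ring_extension R A \<iota>
  for R :: "'r ring" and A :: "'a ring" and \<iota> :: "'r \<Rightarrow> 'a" +
  fixes S T :: "nat set" and \<pi> :: "nat \<Rightarrow> nat"
  assumes \<pi>: "\<pi> \<in> fi_hom S T"
begin

sublocale S: tensor R A \<iota> S by unfold_locales
sublocale T: tensor R A \<iota> T by unfold_locales

abbreviation ext where "ext \<equiv> tensor_extend A S T \<pi>"

lemma \<pi>_inj: "inj_on \<pi> S" and \<pi>_mem: "s \<in> S \<Longrightarrow> \<pi> s \<in> T"
  using \<pi> by (auto simp: fi_hom_def)

lemma ext_apply: "s \<in> S \<Longrightarrow> ext f (\<pi> s) = f s"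
  unfolding tensor_extend_def using \<pi>_mem \<pi>_inj by (simp add: inv_into_f_f)

lemma ext_outside: "t \<in> T \<Longrightarrow> t \<notin> \<pi> ` S \<Longrightarrow> ext f t = \<one>\<^bsub>A\<^esub>"
  unfolding tensor_extend_def by simp

lemma ext_eqI:
  assumes "g \<in> extensional T" "\<And>s. s \<in> S \<Longrightarrow> g (\<pi> s) = f s" "\<And>t. t \<in> T \<Longrightarrow> t \<notin> \<pi> ` S \<Longrightarrow> g t = \<one>\<^bsub>A\<^esub>"
  shows "ext f = g"
proof
  fix t
  show "ext f t = g t"
  proof (cases "t \<in> T")
    case True
    then show ?thesis using assms ext_apply ext_outside by (cases "t \<in> \<pi> ` S") auto
  next
    case False
    then show ?thesis using assms(1) by (simp add: tensor_extend_def extensional_def)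
  qed
qed

lemma ext_carr [simp, intro]:
  assumes "f \<in> S \<rightarrow>\<^sub>E carrier A"
  shows "ext f \<in> T \<rightarrow>\<^sub>E carrier A"
proof (rule PiE_I)
  fix t assume t: "t \<in> T"
  show "ext f t \<in> carrier A"
    using t assms by (cases "t \<in> \<pi> ` S") (auto simp: ext_apply ext_outside PiE_iff)
qed (simp add: tensor_extend_def)

lemma ext_mult:
  assumes "f \<in> S \<rightarrow>\<^sub>E carrier A" "g \<in> S \<rightarrow>\<^sub>E carrier A"
  shows "ext (f \<otimes>\<^bsub>S.M\<^esub> g) = ext f \<otimes>\<^bsub>T.M\<^esub> ext g"
  unfolding S.mult_M T.mult_M by (rule ext_eqI) (auto simp: ext_apply ext_outside \<pi>_mem)

lemma ext_one: "ext S.unit_family = T.unit_family"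
  by (rule ext_eqI) (auto simp: \<pi>_mem T.unit_family_def)

lemma ext_upd:
  assumes "s \<in> S"
  shows "ext (f(s := a)) = (ext f)(\<pi> s := a)"
proof (rule ext_eqI)
  show "(ext f)(\<pi> s := a) \<in> extensional T" using \<pi>_mem[OF assms] by (simp add: tensor_extend_def extensional_def)
qed (use assms \<pi>_inj in \<open>auto simp: ext_apply ext_outside inj_on_eq_iff\<close>)

sublocale push: monoid_ring_lift R S.M T.TF "\<lambda>r. S.sgl r T.unit_family" "\<lambda>f. S.sgl \<one>\<^bsub>R\<^esub> (ext f)"
  by unfold_locales (auto intro!: T.sgl_unit_hom T.sgl_TF)

abbreviation push where "push \<equiv> push.lift"

lemma push_hom: "push \<in> ring_hom S.TF T.TF"
  unfolding S.TF_eq[symmetric]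
proof (rule push.lift_hom)
  fix f g assume "f \<in> carrier S.M" "g \<in> carrier S.M"
  then have f: "f \<in> S \<rightarrow>\<^sub>E carrier A" and g: "g \<in> S \<rightarrow>\<^sub>E carrier A" by simp_all
  show "S.sgl \<one>\<^bsub>R\<^esub> (ext (f \<otimes>\<^bsub>S.M\<^esub> g)) = S.sgl \<one>\<^bsub>R\<^esub> (ext f) \<otimes>\<^bsub>T.TF\<^esub> S.sgl \<one>\<^bsub>R\<^esub> (ext g)"
    unfolding ext_mult[OF f g] using T.TF_mult_sgl[OF K.one_closed K.one_closed ext_carr[OF f] ext_carr[OF g]] by simp
next
  show "S.sgl \<one>\<^bsub>R\<^esub> (ext \<one>\<^bsub>S.M\<^esub>) = \<one>\<^bsub>T.TF\<^esub>"
    unfolding S.one_M ext_one by (rule T.TF_one[symmetric])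
qed

lemma push_sgl:
  assumes "r \<in> carrier R" "f \<in> S \<rightarrow>\<^sub>E carrier A"
  shows "push (S.sgl r f) = S.sgl r (ext f)"
  using push.lift_sgl[of r f] T.sgl_split[OF assms(1) ext_carr[OF assms(2)]] assms by (simp only: S.carr_M)

lemma push_kills_ideal:
  assumes "F \<in> S.I"
  shows "push F \<in> T.I"
proof -
  have "(\<lambda>F. T.cls (push F)) \<in> ring_hom S.TF T.T"
    using ring_hom_trans[OF push_hom T.cls_hom] by (simp add: comp_def)
  then have "T.cls (push F) = \<zero>\<^bsub>T.T\<^esub>"
  proof (rule S.hom_kills_ideal[OF _ T.T.is_cring _ _ assms])
    fix f s a b assume f: "f \<in> S \<rightarrow>\<^sub>E carrier A" "s \<in> S" "a \<in> carrier A" "b \<in> carrier A"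
    then have "T.cls (push (S.sgl \<one>\<^bsub>R\<^esub> (f(s := a \<oplus>\<^bsub>A\<^esub> b)))) =
        T.cls (S.sgl \<one>\<^bsub>R\<^esub> ((ext f)(\<pi> s := a)) \<oplus>\<^bsub>T.TF\<^esub> S.sgl \<one>\<^bsub>R\<^esub> ((ext f)(\<pi> s := b)))"
      using T.cls_sgl_add[of "ext f" "\<pi> s" a b] \<pi>_mem by (simp add: push_sgl ext_upd)
    also have "\<dots> = T.cls (S.sgl \<one>\<^bsub>R\<^esub> ((ext f)(\<pi> s := a))) \<oplus>\<^bsub>T.T\<^esub> T.cls (S.sgl \<one>\<^bsub>R\<^esub> ((ext f)(\<pi> s := b)))"
      using f \<pi>_mem by (intro ring_hom_add[OF T.cls_hom] T.sgl_TF) auto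
    finally show "T.cls (push (S.sgl \<one>\<^bsub>R\<^esub> (f(s := a \<oplus>\<^bsub>A\<^esub> b)))) =
        T.cls (push (S.sgl \<one>\<^bsub>R\<^esub> (f(s := a)))) \<oplus>\<^bsub>T.T\<^esub> T.cls (push (S.sgl \<one>\<^bsub>R\<^esub> (f(s := b))))"
      using f by (simp add: push_sgl ext_upd)
  next
    fix f s a r assume f: "f \<in> S \<rightarrow>\<^sub>E carrier A" "s \<in> S" "a \<in> carrier A" "r \<in> carrier R"
    then show "T.cls (push (S.sgl \<one>\<^bsub>R\<^esub> (f(s := \<iota> r \<otimes>\<^bsub>A\<^esub> a)))) = T.cls (push (S.sgl r (f(s := a))))"
      using T.cls_sgl_scale[of "ext f" "\<pi> s" a r] \<pi>_mem \<iota>_closed by (simp add: push_sgl ext_upd)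
  qed
  moreover have "push F \<in> carrier T.TF"
    using ring_hom_closed[OF push_hom] S.I.Icarr[OF assms] by blast
  ultimately show ?thesis using T.cls_zero_iff by blast
qed

text \<open>\<open>tensor_map\<close> sums the coefficients over the fibres of \<open>ext\<close>.
  Here this sum is identified with the lift of a monoid homomorphism, from which additivity and
  multiplicativity can be read off.\<close>

lemma pushforward_eq:
  assumes F: "F \<in> carrier S.TF"
  shows "(\<lambda>g. \<Oplus>\<^bsub>R\<^esub>f\<in>{f. F f \<noteq> \<zero>\<^bsub>R\<^esub> \<and> ext f = g}. F f) = push F"
proof -
  let ?P = "\<lambda>F g. \<Oplus>\<^bsub>R\<^esub>f\<in>{f. F f \<noteq> \<zero>\<^bsub>R\<^esub> \<and> ext f = g}. F f"
  have alt: "?P F g = (\<Oplus>\<^bsub>R\<^esub>f\<in>X. if ext f = g then F f else \<zero>\<^bsub>R\<^esub>)"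
    if "F \<in> carrier S.RM" "finite X" "S.supp F \<subseteq> X" for F X g
    by (rule K.add.finprod_mono_neutral_cong_left) (use that S.carrD[OF that(1)] in auto)
  have "F \<in> carrier S.RM" using F S.TF_eq by simp
  then show ?thesis
  proof (induction rule: S.induct_sgl)
    case zero
    have "?P \<zero>\<^bsub>S.RM\<^esub> = \<zero>\<^bsub>T.RM\<^esub>" by (simp add: S.zero_eq T.zero_eq)
    then show ?case unfolding push.lift_zero T.TF_eq .
  next
    case (add r m F)
    let ?X = "insert m (S.supp F)"
    have X: "finite ?X" "S.supp (S.sgl r m) \<subseteq> ?X" "S.supp F \<subseteq> ?X" "S.supp (S.sgl r m \<oplus>\<^bsub>S.RM\<^esub> F) \<subseteq> ?X"
      using S.carrD[OF add(3)] add(1) by (auto simp: ma_single_def S.add_eq)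
    have Fc: "F f \<in> carrier R" and sc: "S.sgl r m f \<in> carrier R" for f
      using S.carrD(1)[OF add(3)] add(1) by (auto simp: ma_single_def)
    have Pg: "?P (S.sgl r m \<oplus>\<^bsub>S.RM\<^esub> F) g = ?P (S.sgl r m) g \<oplus>\<^bsub>R\<^esub> ?P F g" for g
    proof -
      have "?P (S.sgl r m \<oplus>\<^bsub>S.RM\<^esub> F) g =
          (\<Oplus>\<^bsub>R\<^esub>f\<in>?X. if ext f = g then (S.sgl r m \<oplus>\<^bsub>S.RM\<^esub> F) f else \<zero>\<^bsub>R\<^esub>)"
        using add X by (intro alt) auto
      also have "\<dots> = (\<Oplus>\<^bsub>R\<^esub>f\<in>?X. (if ext f = g then S.sgl r m f else \<zero>\<^bsub>R\<^esub>) \<oplus>\<^bsub>R\<^esub>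
          (if ext f = g then F f else \<zero>\<^bsub>R\<^esub>))"
        by (rule K.finsum_cong') (use Fc sc in \<open>auto simp: S.add_eq\<close>)
      also have "\<dots> = (\<Oplus>\<^bsub>R\<^esub>f\<in>?X. if ext f = g then S.sgl r m f else \<zero>\<^bsub>R\<^esub>) \<oplus>\<^bsub>R\<^esub>
          (\<Oplus>\<^bsub>R\<^esub>f\<in>?X. if ext f = g then F f else \<zero>\<^bsub>R\<^esub>)"
        by (rule K.finsum_addf) (use Fc sc in auto)
      also have "\<dots> = ?P (S.sgl r m) g \<oplus>\<^bsub>R\<^esub> ?P F g"
        using alt[OF S.sgl_carr[OF add(1,2)] X(1,2)] alt[OF add(3) X(1,3)] by simp
      finally show ?thesis .
    qed
    have Pm: "?P (S.sgl r m) = S.sgl r (ext m)"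
    proof
      fix g
      have "?P (S.sgl r m) g = (\<Oplus>\<^bsub>R\<^esub>f\<in>{m}. if ext f = g then S.sgl r m f else \<zero>\<^bsub>R\<^esub>)"
        using add by (intro alt S.sgl_carr) (auto simp: ma_single_def)
      then show "?P (S.sgl r m) g = S.sgl r (ext m) g" using add(1) by (simp add: ma_single_def)
    qed
    have "?P (S.sgl r m \<oplus>\<^bsub>S.RM\<^esub> F) = S.sgl r (ext m) \<oplus>\<^bsub>T.RM\<^esub> ?P F"
      unfolding T.add_eq using Pg fun_cong[OF Pm] by (intro HOL.ext) (simp only:)
    also have "\<dots> = push (S.sgl r m) \<oplus>\<^bsub>T.TF\<^esub> push F"
      unfolding add(4) T.TF_eq using push_sgl[of r m] add(1,2) by (simp only: S.carr_M)
    also have "\<dots> = push (S.sgl r m \<oplus>\<^bsub>S.RM\<^esub> F)"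
      by (rule push.lift_add[OF S.sgl_carr[OF add(1,2)] add(3), symmetric])
    finally show ?case .
  qed
qed

text \<open>\<open>tensor_map\<close> is a union over all representatives of a coset. Since
  \<open>push\<close> maps relations to relations, all of them give the same coset, and the union
  collapses.\<close>

lemma tensor_map_cls:
  assumes F: "F \<in> carrier S.TF"
  shows "tensor_map R A \<iota> S T \<pi> (S.cls F) = T.cls (push F)"
proof -
  have "T.cls (\<lambda>g. \<Oplus>\<^bsub>R\<^esub>f\<in>{f. G f \<noteq> \<zero>\<^bsub>R\<^esub> \<and> ext f = g}. G f) = T.cls (push F)" if G: "G \<in> S.cls F" for G
  proof -
    have Gc: "G \<in> carrier S.TF"
      using G F S.TF.a_r_coset_subset_G[OF S.I.a_subset] by blast
    have "S.cls G = S.cls F" using S.TF.a_repr_independence[OF G F S.I.a_subgroup] by simp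
    then have "G \<ominus>\<^bsub>S.TF\<^esub> F \<in> S.I" using S.cls_eq_iff[OF Gc F] by simp
    then have "push (G \<ominus>\<^bsub>S.TF\<^esub> F) \<in> T.I" by (rule push_kills_ideal)
    moreover have "push (G \<ominus>\<^bsub>S.TF\<^esub> F) = push G \<ominus>\<^bsub>T.TF\<^esub> push F"
    proof -
      interpret ring_hom_ring S.TF T.TF push
        by (intro ring_hom_ringI2 S.TF.ring_axioms T.TF.ring_axioms push_hom)
      show ?thesis using Gc F by (simp add: S.TF.minus_eq T.TF.minus_eq)
    qed
    ultimately have "T.cls (push G) = T.cls (push F)"
      using T.cls_eq_iff ring_hom_closed[OF push_hom] Gc F by simp
    then show ?thesis using pushforward_eq[OF Gc] by simp
  qed
  moreover have "F \<in> S.cls F" using S.I.a_rcos_self[OF F] .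
  ultimately show ?thesis unfolding tensor_map_def by blast
qed

lemma tensor_map_hom: "tensor_map R A \<iota> S T \<pi> \<in> ring_hom S.T T.T"
proof (rule ring_hom_memI)
  note h = S.cls_hom T.cls_hom push_hom
  fix x y assume "x \<in> carrier S.T" "y \<in> carrier S.T"
  then obtain F G where F: "F \<in> carrier S.TF" "x = S.cls F" and G: "G \<in> carrier S.TF" "y = S.cls G"
    unfolding S.carr_T by blast
  show "tensor_map R A \<iota> S T \<pi> x \<in> carrier T.T"
    unfolding F tensor_map_cls[OF F(1)] using ring_hom_closed[OF push_hom F(1)] by simp
  show "tensor_map R A \<iota> S T \<pi> (x \<otimes>\<^bsub>S.T\<^esub> y) = tensor_map R A \<iota> S T \<pi> x \<otimes>\<^bsub>T.T\<^esub> tensor_map R A \<iota> S T \<pi> y"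
    unfolding F G using F G by (simp add: tensor_map_cls ring_hom_closed[OF push_hom]
      ring_hom_mult[OF S.cls_hom, symmetric] ring_hom_mult[OF T.cls_hom, symmetric] ring_hom_mult[OF push_hom])
  show "tensor_map R A \<iota> S T \<pi> (x \<oplus>\<^bsub>S.T\<^esub> y) = tensor_map R A \<iota> S T \<pi> x \<oplus>\<^bsub>T.T\<^esub> tensor_map R A \<iota> S T \<pi> y"
    unfolding F G using F G by (simp add: tensor_map_cls ring_hom_closed[OF push_hom]
      ring_hom_add[OF S.cls_hom, symmetric] ring_hom_add[OF T.cls_hom, symmetric] ring_hom_add[OF push_hom])
next
  show "tensor_map R A \<iota> S T \<pi> \<one>\<^bsub>S.T\<^esub> = \<one>\<^bsub>T.T\<^esub>"
    unfolding ring_hom_one[OF S.cls_hom, symmetric]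
    by (simp add: tensor_map_cls ring_hom_one[OF push_hom] ring_hom_one[OF T.cls_hom])
qed

end

section \<open>Operations on FI-algebras\<close>

text \<open>The statement speaks of \<open>B([1])\<close> as the value at \<open>{1}\<close>, which the simplifier would turn into \<open>{Suc 0}\<close>.\<close>

declare One_nat_def [simp del]

lemma ring_hom_minus:
  assumes "ring A" "ring B" "\<phi> \<in> ring_hom A B" "x \<in> carrier A" "y \<in> carrier A"
  shows "\<phi> (x \<ominus>\<^bsub>A\<^esub> y) = \<phi> x \<ominus>\<^bsub>B\<^esub> \<phi> y"
proof -
  interpret A: ring A by fact
  interpret B: ring B by fact
  interpret ring_hom_ring A B \<phi> by (intro ring_hom_ringI2 assms)
  show ?thesis using assms(4,5) by (simp add: A.minus_eq B.minus_eq)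
qed

lemma fi_algD:
  assumes "is_fi_algebra K B"
  shows "cring K" "fi_base B = K" "finite S \<Longrightarrow> cring (fi_obj B S)"
    "finite S \<Longrightarrow> fi_str B S \<in> ring_hom K (fi_obj B S)"
    "\<lbrakk>finite S; finite T; \<pi> \<in> fi_hom S T\<rbrakk> \<Longrightarrow> fi_map B S T \<pi> \<in> ring_hom (fi_obj B S) (fi_obj B T)"
    "\<lbrakk>finite S; finite T; \<pi> \<in> fi_hom S T; k \<in> carrier K\<rbrakk> \<Longrightarrow> fi_map B S T \<pi> (fi_str B S k) = fi_str B T k"
    "\<lbrakk>finite S; b \<in> carrier (fi_obj B S)\<rbrakk> \<Longrightarrow> fi_map B S S (\<lambda>i\<in>S. i) b = b"
    "\<lbrakk>finite S; finite T; finite U; \<pi> \<in> fi_hom S T; \<rho> \<in> fi_hom T U; b \<in> carrier (fi_obj B S)\<rbrakk> \<Longrightarrow>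
       fi_map B S U (compose S \<rho> \<pi>) b = fi_map B T U \<rho> (fi_map B S T \<pi> b)"
proof -
  note a = assms[unfolded is_fi_algebra_def]
  note b = a[THEN conjunct2] note c = b[THEN conjunct2] note d = c[THEN conjunct2]
  note e = d[THEN conjunct2] note f = e[THEN conjunct2] note g = f[THEN conjunct2]
  show "cring K" using a by (rule conjunct1)
  show "fi_base B = K" using b by (rule conjunct1)
  show "finite S \<Longrightarrow> cring (fi_obj B S)" using c[THEN conjunct1] by blast
  show "finite S \<Longrightarrow> fi_str B S \<in> ring_hom K (fi_obj B S)" using d[THEN conjunct1] by blast
  show "\<lbrakk>finite S; finite T; \<pi> \<in> fi_hom S T\<rbrakk> \<Longrightarrow> fi_map B S T \<pi> \<in> ring_hom (fi_obj B S) (fi_obj B T)"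
    using e[THEN conjunct1] by blast
  show "\<lbrakk>finite S; finite T; \<pi> \<in> fi_hom S T; k \<in> carrier K\<rbrakk> \<Longrightarrow> fi_map B S T \<pi> (fi_str B S k) = fi_str B T k"
    using e[THEN conjunct1] by blast
  show "\<lbrakk>finite S; b \<in> carrier (fi_obj B S)\<rbrakk> \<Longrightarrow> fi_map B S S (\<lambda>i\<in>S. i) b = b"
    using f[THEN conjunct1] by blast
  show "\<lbrakk>finite S; finite T; finite U; \<pi> \<in> fi_hom S T; \<rho> \<in> fi_hom T U; b \<in> carrier (fi_obj B S)\<rbrakk> \<Longrightarrow>
       fi_map B S U (compose S \<rho> \<pi>) b = fi_map B T U \<rho> (fi_map B S T \<pi> b)"
    by (rule g[rule_format]) simp_all
qed

lemma fi_algI: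
  assumes "cring K" "fi_base B = K" "\<And>S. finite S \<Longrightarrow> cring (fi_obj B S)"
    "\<And>S. finite S \<Longrightarrow> fi_str B S \<in> ring_hom K (fi_obj B S)"
    "\<And>S T \<pi>. \<lbrakk>finite S; finite T; \<pi> \<in> fi_hom S T\<rbrakk> \<Longrightarrow> fi_map B S T \<pi> \<in> ring_hom (fi_obj B S) (fi_obj B T)"
    "\<And>S T \<pi> k. \<lbrakk>finite S; finite T; \<pi> \<in> fi_hom S T; k \<in> carrier K\<rbrakk> \<Longrightarrow> fi_map B S T \<pi> (fi_str B S k) = fi_str B T k"
    "\<And>S b. \<lbrakk>finite S; b \<in> carrier (fi_obj B S)\<rbrakk> \<Longrightarrow> fi_map B S S (\<lambda>i\<in>S. i) b = b"
    "\<And>S T U \<pi> \<rho> b. \<lbrakk>finite S; finite T; finite U; \<pi> \<in> fi_hom S T; \<rho> \<in> fi_hom T U; b \<in> carrier (fi_obj B S)\<rbrakk> \<Longrightarrow>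
       fi_map B S U (compose S \<rho> \<pi>) b = fi_map B T U \<rho> (fi_map B S T \<pi> b)"
  shows "is_fi_algebra K B"
  unfolding is_fi_algebra_def by (intro conjI allI impI ballI assms) auto

lemma fi_init_hom [simp, intro]: "fi_init \<in> fi_hom {} S"
  unfolding fi_hom_def by (simp add: restrict_def)

lemma compose_fi_init [simp]: "compose {} \<rho> fi_init = fi_init"
  unfolding compose_def by (simp add: restrict_def)

lemma fi_over_init_alg:
  assumes "is_fi_algebra K B"
  shows "is_fi_algebra (fi_obj B {}) (fi_over_init B)"
proof (rule fi_algI)
  note D = fi_algD[OF assms]
  show "fi_map (fi_over_init B) S T \<pi> (fi_str (fi_over_init B) S k) = fi_str (fi_over_init B) T k"
    if "finite S" "finite T" "\<pi> \<in> fi_hom S T" "k \<in> carrier (fi_obj B {})" for S T \<pi> k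
    using D(8)[of "{}" S T fi_init \<pi> k] that by (simp add: fi_over_init_def)
qed (use fi_algD[OF assms] in \<open>simp_all add: fi_over_init_def\<close>)

lemma finite_dunion [simp]: "finite S0 \<Longrightarrow> finite S \<Longrightarrow> finite (dunion S0 S)"
  unfolding dunion_def by simp

lemma dunion_map_hom:
  assumes "\<pi> \<in> fi_hom S T"
  shows "dunion_map S0 S \<pi> \<in> fi_hom (dunion S0 S) (dunion S0 T)"
proof -
  have "dunion_map S0 S \<pi> \<in> dunion S0 S \<rightarrow>\<^sub>E dunion S0 T"
    using assms unfolding dunion_map_def dunion_def fi_hom_def by (auto simp: PiE_iff)
  moreover have "inj_on (dunion_map S0 S \<pi>) (dunion S0 S)"
    using assms unfolding dunion_map_def dunion_def fi_hom_def
    by (auto intro!: inj_onI simp: sum_encode_eq dest: inj_onD)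
  ultimately show ?thesis unfolding fi_hom_def by simp
qed

lemma dunion_map_id: "dunion_map S0 S (\<lambda>i\<in>S. i) = (\<lambda>i\<in>dunion S0 S. i)"
  unfolding dunion_map_def dunion_def by (auto simp: fun_eq_iff)

lemma dunion_map_compose:
  assumes "\<pi> \<in> fi_hom S T"
  shows "dunion_map S0 S (compose S \<rho> \<pi>) = compose (dunion S0 S) (dunion_map S0 T \<rho>) (dunion_map S0 S \<pi>)"
  using assms unfolding dunion_map_def dunion_def compose_def fi_hom_def
  by (auto simp: fun_eq_iff sum_encode_eq PiE_iff)

lemma dunion_incl_hom: "(\<lambda>i\<in>S0. sum_encode (Inl i)) \<in> fi_hom S0 (dunion S0 S)"
  unfolding fi_hom_def dunion_def by (auto intro!: inj_onI simp: sum_encode_eq)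

lemma dunion_map_incl:
  "compose S0 (dunion_map S0 S \<pi>) (\<lambda>i\<in>S0. sum_encode (Inl i)) = (\<lambda>i\<in>S0. sum_encode (Inl i))"
  unfolding dunion_map_def dunion_def compose_def by (auto simp: fun_eq_iff)

lemma fi_shift_alg:
  assumes "is_fi_algebra K B" "finite S0"
  shows "is_fi_algebra (fi_obj B S0) (fi_shift S0 B)"
proof (rule fi_algI)
  note D = fi_algD[OF assms(1)]
  note s = fi_shift_def
  show "cring (fi_obj B S0)" using D(3) assms(2) .
  fix S :: "nat set" assume S: "finite S"
  show "cring (fi_obj (fi_shift S0 B) S)" using D(3) S assms(2) by (simp add: s)
  show "fi_str (fi_shift S0 B) S \<in> ring_hom (fi_obj B S0) (fi_obj (fi_shift S0 B) S)"
    using D(5)[OF _ _ dunion_incl_hom] S assms(2) by (simp add: s)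
  show "fi_map (fi_shift S0 B) S S (\<lambda>i\<in>S. i) b = b" if "b \<in> carrier (fi_obj (fi_shift S0 B) S)" for b
    using D(7) S assms(2) that by (simp add: s dunion_map_id)
  fix T :: "nat set" and \<pi> assume T: "finite T" and \<pi>: "\<pi> \<in> fi_hom S T"
  show "fi_map (fi_shift S0 B) S T \<pi> \<in> ring_hom (fi_obj (fi_shift S0 B) S) (fi_obj (fi_shift S0 B) T)"
    using D(5)[OF _ _ dunion_map_hom[OF \<pi>]] S T assms(2) by (simp add: s)
  show "fi_map (fi_shift S0 B) S T \<pi> (fi_str (fi_shift S0 B) S k) = fi_str (fi_shift S0 B) T k"
    if "k \<in> carrier (fi_obj B S0)" for k
    using D(8)[OF _ _ _ dunion_incl_hom dunion_map_hom[OF \<pi>] that] S T assms(2)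
    by (simp add: s dunion_map_incl)
  show "fi_map (fi_shift S0 B) S U (compose S \<rho> \<pi>) b =
      fi_map (fi_shift S0 B) T U \<rho> (fi_map (fi_shift S0 B) S T \<pi> b)"
    if "finite U" "\<rho> \<in> fi_hom T U" "b \<in> carrier (fi_obj (fi_shift S0 B) S)" for U \<rho> b
    using D(8)[OF _ _ _ dunion_map_hom[OF \<pi>] dunion_map_hom[OF that(2)]] S T assms(2) that(1,3)
    by (simp add: s dunion_map_compose[OF \<pi>])
qed (simp add: fi_shift_def)

section \<open>Inverting an element of the base\<close>

locale fi_localised =
  fixes R :: "'r ring" and B :: "('r, 'a) fi_algebra" and h :: 'r
  assumes alg: "is_fi_algebra R B" and h: "h \<in> carrier R"
begin

abbreviation P where "P S \<equiv> powers (fi_obj B S) (fi_str B S h)"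

lemma localised_base: "localised R (powers R h)"
  using fi_algD(1)[OF alg] h by (rule localised_powers)

lemma str_h: "finite S \<Longrightarrow> fi_str B S h \<in> carrier (fi_obj B S)"
  using ring_hom_closed[OF fi_algD(4)[OF alg]] h by blast

lemma localised_obj: "finite S \<Longrightarrow> localised (fi_obj B S) (P S)"
  using fi_algD(3)[OF alg] str_h by (intro localised_powers)

lemma str_powers: "finite S \<Longrightarrow> fi_str B S ` powers R h = P S"
  using fi_algD(1,3,4)[OF alg] h by (intro powers_image)

lemma map_powers:
  assumes "finite S" "finite T" "\<pi> \<in> fi_hom S T"
  shows "fi_map B S T \<pi> ` P S = P T"
  using powers_image[OF fi_algD(3)[OF alg assms(1)] fi_algD(3)[OF alg assms(2)] fi_algD(5)[OF alg assms] str_h[OF assms(1)]]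
    fi_algD(6)[OF alg assms h] by simp

lemma invert_simps:
  "fi_base (fi_invert B h) = localisation R (powers R h)"
  "fi_obj (fi_invert B h) S = localisation (fi_obj B S) (P S)"
  "fi_map (fi_invert B h) S T \<pi> = localisation_map (fi_obj B T) (P T) (fi_map B S T \<pi>)"
  "fi_str (fi_invert B h) S = localisation_map (fi_obj B S) (P S) (fi_str B S)"
  using fi_algD(2)[OF alg] unfolding fi_invert_def Let_def by simp_all

lemma map_frac:
  assumes "finite S" "finite T" "\<pi> \<in> fi_hom S T" "b \<in> carrier (fi_obj B S)" "s \<in> P S"
  shows "fi_map (fi_invert B h) S T \<pi> (loc_frac (fi_obj B S) (P S) b s) =
    loc_frac (fi_obj B T) (P T) (fi_map B S T \<pi> b) (fi_map B S T \<pi> s)"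
  unfolding invert_simps using assms map_powers fi_algD(5)[OF alg]
  by (intro localisation_map_frac localised_obj) auto

lemma str_frac:
  assumes "finite S" "r \<in> carrier R" "s \<in> powers R h"
  shows "fi_str (fi_invert B h) S (loc_frac R (powers R h) r s) =
    loc_frac (fi_obj B S) (P S) (fi_str B S r) (fi_str B S s)"
  unfolding invert_simps using assms str_powers fi_algD(4)[OF alg]
  by (intro localisation_map_frac localised_obj localised_base) auto

lemma invert_alg: "is_fi_algebra (localisation R (powers R h)) (fi_invert B h)"
proof (rule fi_algI)
  note D = fi_algD[OF alg]
  interpret base: localised R "powers R h" by (rule localised_base)
  show "cring (localisation R (powers R h))" by (rule base.L.is_cring)
  fix S :: "nat set" assume S: "finite S"
  interpret S: localised "fi_obj B S" "P S" by (rule localised_obj[OF S])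
  show "cring (fi_obj (fi_invert B h) S)" unfolding invert_simps by (rule S.L.is_cring)
  show "fi_str (fi_invert B h) S \<in> ring_hom (localisation R (powers R h)) (fi_obj (fi_invert B h) S)"
    unfolding invert_simps using D(4)[OF S] str_powers[OF S]
    by (intro localisation_map_hom localised_base localised_obj S) auto
  show "fi_map (fi_invert B h) S S (\<lambda>i\<in>S. i) b = b" if b: "b \<in> carrier (fi_obj (fi_invert B h) S)" for b
  proof -
    have i: "(\<lambda>i\<in>S. i) \<in> fi_hom S S" unfolding fi_hom_def by (auto intro: inj_onI)
    obtain a s where "a \<in> carrier (fi_obj B S)" "s \<in> P S" "b = S.frac a s"
      using b unfolding invert_simps by (rule S.carr_fracE)
    then show ?thesis using D(7)[OF S] S.M_carr map_frac[OF S S i] by simp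
  qed
  fix T :: "nat set" and \<pi> assume T: "finite T" and \<pi>: "\<pi> \<in> fi_hom S T"
  show "fi_map (fi_invert B h) S T \<pi> \<in> ring_hom (fi_obj (fi_invert B h) S) (fi_obj (fi_invert B h) T)"
    unfolding invert_simps using D(5)[OF S T \<pi>] map_powers[OF S T \<pi>]
    by (intro localisation_map_hom localised_obj S T) auto
  show "fi_map (fi_invert B h) S T \<pi> (fi_str (fi_invert B h) S k) = fi_str (fi_invert B h) T k"
    if k: "k \<in> carrier (localisation R (powers R h))" for k
  proof -
    obtain r t where "r \<in> carrier R" "t \<in> powers R h" "k = base.frac r t"
      using k by (rule base.carr_fracE)
    moreover have "fi_str B S t \<in> P S" if "t \<in> powers R h" for t using str_powers[OF S] that by blast
    ultimately show ?thesis
      using ring_hom_closed[OF D(4)[OF S]] D(6)[OF S T \<pi>] by (simp add: str_frac S T map_frac[OF S T \<pi>])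
  qed
  show "fi_map (fi_invert B h) S U (compose S \<rho> \<pi>) b = fi_map (fi_invert B h) T U \<rho> (fi_map (fi_invert B h) S T \<pi> b)"
    if U: "finite U" "\<rho> \<in> fi_hom T U" and b: "b \<in> carrier (fi_obj (fi_invert B h) S)" for U \<rho> b
  proof -
    have c: "compose S \<rho> \<pi> \<in> fi_hom S U"
      using \<pi> U(2) unfolding fi_hom_def
      by (auto simp: PiE_iff compose_def inj_on_def)
    obtain a s where as: "a \<in> carrier (fi_obj B S)" "s \<in> P S" "b = S.frac a s"
      using b unfolding invert_simps by (rule S.carr_fracE)
    have "fi_map B S T \<pi> s \<in> P T" using map_powers[OF S T \<pi>] as(2) by blast
    then show ?thesis
      using as D(8)[OF S T U(1) \<pi> U(2)] S.M_carr ring_hom_closed[OF D(5)[OF S T \<pi>]]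
      by (simp add: map_frac[OF S T \<pi>] map_frac[OF S U(1) c] map_frac[OF T U])
  qed
qed (simp add: invert_simps)

end

section \<open>Presentations by tensor powers\<close>

lemma ring_hom_finprod:
  assumes "cring A" "cring B" "\<phi> \<in> ring_hom A B" "f \<in> S \<rightarrow> carrier A"
  shows "\<phi> (\<Otimes>\<^bsub>A\<^esub>s\<in>S. f s) = (\<Otimes>\<^bsub>B\<^esub>s\<in>S. \<phi> (f s))"
proof -
  interpret ring_hom_cring A B \<phi> using assms by (simp add: ring_hom_cring_def ring_hom_cring_axioms_def)
  show ?thesis using hom_finprod[OF assms(4)] by (simp add: comp_def)
qed

text \<open>The map from the free algebra that multiplies the images of the entries of a family
  under the maps \<open>u S s\<close>. It is a homomorphism once these are homomorphisms over the
  base.\<close>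

definition tensor_hat :: "('r, 'a) fi_algebra \<Rightarrow> (nat set \<Rightarrow> nat \<Rightarrow> 'a \<Rightarrow> 'a) \<Rightarrow> nat set \<Rightarrow> ((nat \<Rightarrow> 'a) \<Rightarrow> 'r) \<Rightarrow> 'a" where
  "tensor_hat B u S = ma_lift (fi_base B) (fi_obj B S) (fi_str B S) (tensor_lift.\<mu> S (fi_obj B S) (u S))"

text \<open>Expresses that B(S) is the tensor power of B([1]) over the base, naturally in S, without
  mentioning the quotient: \<open>u S s\<close> is the map from the factor at s, the map from the
  free algebra is onto, and its kernel lies in the ideal of relations; the reverse inclusion is
  automatic. In this form the statement can be followed element by element under
  localisation.\<close>

definition tensor_presentation :: "('r, 'a) fi_algebra \<Rightarrow> (nat set \<Rightarrow> nat \<Rightarrow> 'a \<Rightarrow> 'a) \<Rightarrow> bool" where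
  "tensor_presentation B u \<longleftrightarrow>
    (\<forall>S. finite S \<longrightarrow> (\<forall>s\<in>S. u S s \<in> ring_hom (fi_obj B {1}) (fi_obj B S) \<and>
      (\<forall>r\<in>carrier (fi_base B). u S s (fi_str B {1} r) = fi_str B S r))) \<and>
    (\<forall>S T. finite S \<and> finite T \<longrightarrow> (\<forall>\<pi>\<in>fi_hom S T. \<forall>s\<in>S. \<forall>a\<in>carrier (fi_obj B {1}).
      fi_map B S T \<pi> (u S s a) = u T (\<pi> s) a)) \<and>
    (\<forall>S. finite S \<longrightarrow>
      carrier (fi_obj B S) \<subseteq> tensor_hat B u S ` carrier (tensor_free (fi_base B) (fi_obj B {1}) S)) \<and>
    (\<forall>S. finite S \<longrightarrow> (\<forall>F\<in>carrier (tensor_free (fi_base B) (fi_obj B {1}) S).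
      tensor_hat B u S F = \<zero>\<^bsub>fi_obj B S\<^esub> \<longrightarrow> F \<in> tensor_ideal (fi_base B) (fi_obj B {1}) (fi_str B {1}) S))"

text \<open>The inclusion of the factor at s. It is multiplicative already in the free algebra, but
  additive only modulo the relations.\<close>

lemma (in tensor) sgl_upd_hom:
  assumes s: "s \<in> S"
  shows "(\<lambda>a. cls (sgl \<one>\<^bsub>R\<^esub> (unit_family(s := a)))) \<in> ring_hom A T"
proof (rule ring_hom_memI)
  have u: "unit_family(s := a) \<in> S \<rightarrow>\<^sub>E carrier A" if "a \<in> carrier A" for a
    by (rule upd_family[OF unit_family s that])
  note c = sgl_TF[OF K.one_closed u]
  fix a b assume a: "a \<in> carrier A" and b: "b \<in> carrier A"
  show "cls (sgl \<one>\<^bsub>R\<^esub> (unit_family(s := a))) \<in> carrier T" by (rule cls_carr[OF c[OF a]])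
  have "unit_family(s := a) \<otimes>\<^bsub>M\<^esub> unit_family(s := b) = unit_family(s := a \<otimes>\<^bsub>A\<^esub> b)"
    unfolding mult_M using s by (auto simp: fun_eq_iff unit_family_def)
  then show "cls (sgl \<one>\<^bsub>R\<^esub> (unit_family(s := a \<otimes>\<^bsub>A\<^esub> b))) =
      cls (sgl \<one>\<^bsub>R\<^esub> (unit_family(s := a))) \<otimes>\<^bsub>T\<^esub> cls (sgl \<one>\<^bsub>R\<^esub> (unit_family(s := b)))"
    using TF_mult_sgl[OF K.one_closed K.one_closed u[OF a] u[OF b]]
    by (simp add: ring_hom_mult[OF cls_hom c[OF a] c[OF b], symmetric] del: mult_product_group fun_upd_apply)
  show "cls (sgl \<one>\<^bsub>R\<^esub> (unit_family(s := a \<oplus>\<^bsub>A\<^esub> b))) =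
      cls (sgl \<one>\<^bsub>R\<^esub> (unit_family(s := a))) \<oplus>\<^bsub>T\<^esub> cls (sgl \<one>\<^bsub>R\<^esub> (unit_family(s := b)))"
    unfolding cls_sgl_add[OF unit_family s a b] by (rule ring_hom_add[OF cls_hom c[OF a] c[OF b]])
next
  have "unit_family(s := \<one>\<^bsub>A\<^esub>) = unit_family" using s by (auto simp: fun_eq_iff)
  then show "cls (sgl \<one>\<^bsub>R\<^esub> (unit_family(s := \<one>\<^bsub>A\<^esub>))) = \<one>\<^bsub>T\<^esub>"
    using ring_hom_one[OF cls_hom] TF_one by simp
qed

text \<open>Over R all factors agree, since a scalar in any place can be moved into the
  coefficient.\<close>

lemma (in tensor) cls_upd_\<iota>:
  assumes s: "s \<in> S" and r: "r \<in> carrier R"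
  shows "cls (sgl \<one>\<^bsub>R\<^esub> (unit_family(s := \<iota> r))) = str r"
proof -
  have "unit_family(s := \<one>\<^bsub>A\<^esub>) = unit_family" using s by (auto simp: fun_eq_iff)
  then show ?thesis
    using cls_sgl_scale[OF unit_family s A.one_closed r] \<iota>_closed[OF r] unfolding str_def by simp
qed

text \<open>Only the action on global sections is compared, which suffices because
  \<open>global_section\<close> is injective.\<close>

lemma induced_hom_natural:
  assumes A: "cring A" "cring B" "lrs_iso (Spec B) (Spec A) \<theta>"
    and A': "cring A'" "cring B'" "lrs_iso (Spec B') (Spec A') \<theta>'"
    and f: "f \<in> ring_hom A A'" and g: "g \<in> ring_hom B B'"
    and eq: "rm_eq (Spec B') (Spec A) (rm_comp (Spec B) \<theta> (Spec_map B B' g)) (rm_comp (Spec A') (Spec_map A A' f) \<theta>')"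
    and x: "x \<in> carrier A"
  shows "g (induced_hom A B \<theta> x) = induced_hom A' B' \<theta>' (f x)"
proof -
  interpret f: spec_map A A' f using A A' f by (simp add: spec_map_def spec_map_axioms_def)
  interpret g: spec_map B B' g using A A' g by (simp add: spec_map_def spec_map_axioms_def)
  note I = induced_hom[OF A] and I' = induced_hom[OF A']
  have m: "lrs_morphism (Spec B) (Spec A) \<theta>" using A(3) unfolding lrs_iso_def by blast
  have pre: "rm_preimage (Spec A') (Spec_map A A' f) (primes A) = primes A'"
    unfolding f.map_preimage using f.contr_prime by auto
  have "rm_sec (rm_comp (Spec B) \<theta> (Spec_map B B' g)) (primes A) (global_section A x) =
      rm_sec (rm_comp (Spec A') (Spec_map A A' f) \<theta>') (primes A) (global_section A x)"
    using eq[unfolded rm_eq_def, THEN conjunct2, rule_format, of "primes A" "global_section A x"]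
      ring_hom_closed[OF global_section_hom[OF A(1)] x] by (simp add: Spec_simps)
  then have "global_section B' (g (induced_hom A B \<theta> x)) = global_section B' (induced_hom A' B' \<theta>' (f x))"
    using x ring_hom_closed[OF I(2) x] f.hom_closed[OF x]
    by (simp add: rm_comp_def lrs_morphism_preimage_all[OF m] pre I(1)[symmetric] I'(1)
      g.map_global_section f.map_global_section)
  then show ?thesis
    using inj_onD[OF global_section_inj[OF A'(2)]] ring_hom_closed[OF I(2) x] ring_hom_closed[OF I'(2)]
      f.hom_closed[OF x] g.hom_closed by blast
qed

lemma induced_hom_over:
  assumes A: "cring A" "cring B" "lrs_iso (Spec B) (Spec A) \<theta>" and R: "cring R"
    and a: "a \<in> ring_hom R A" and b: "b \<in> ring_hom R B"
    and eq: "rm_eq (Spec B) (Spec R) (rm_comp (Spec A) (Spec_map R A a) \<theta>) (Spec_map R B b)"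
    and r: "r \<in> carrier R"
  shows "induced_hom A B \<theta> (a r) = b r"
proof -
  interpret a: spec_map R A a using A R a by (simp add: spec_map_def spec_map_axioms_def)
  interpret b: spec_map R B b using A R b by (simp add: spec_map_def spec_map_axioms_def)
  note I = induced_hom[OF A]
  have pre: "rm_preimage (Spec A) (Spec_map R A a) (primes R) = primes A"
    unfolding a.map_preimage using a.contr_prime by auto
  have "rm_sec (rm_comp (Spec A) (Spec_map R A a) \<theta>) (primes R) (global_section R r) =
      rm_sec (Spec_map R B b) (primes R) (global_section R r)"
    using eq[unfolded rm_eq_def, THEN conjunct2, rule_format, of "primes R" "global_section R r"]
      ring_hom_closed[OF global_section_hom[OF R] r] by (simp add: Spec_simps)
  then have "global_section B (induced_hom A B \<theta> (a r)) = global_section B (b r)"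
    using r a.hom_closed[OF r]
    by (simp add: rm_comp_def pre I(1) a.map_global_section b.map_global_section)
  then show ?thesis
    using inj_onD[OF global_section_inj[OF A(2)]] ring_hom_closed[OF I(2) a.hom_closed[OF r]] b.hom_closed[OF r]
    by blast
qed

locale fi_alg_over =
  fixes R :: "'r ring" and B :: "('r, 'a) fi_algebra"
  assumes alg: "is_fi_algebra R B"
begin

abbreviation A where "A \<equiv> fi_obj B {1}"
abbreviation \<iota> where "\<iota> \<equiv> fi_str B {1}"

sublocale ring_extension R A \<iota>
  using fi_algD(1)[OF alg] fi_algD(3,4)[OF alg, of "{1}"] by (simp add: ring_extension_def ring_extension_axioms_def)

lemma tensor: "tensor R A \<iota>"
  by unfold_locales

lemma powers_simps:
  "fs_base (fibre_powers R A \<iota>) = Spec R"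
  "fs_obj (fibre_powers R A \<iota>) S = Spec (tensor_power R A \<iota> S)"
  "fs_map (fibre_powers R A \<iota>) S T \<pi> =
    Spec_map (tensor_power R A \<iota> S) (tensor_power R A \<iota> T) (tensor_map R A \<iota> S T \<pi>)"
  "fs_str (fibre_powers R A \<iota>) S = Spec_map R (tensor_power R A \<iota> S) (tensor_str R A \<iota> S)"
  unfolding fibre_powers_def fi_Spec_def fi_tensor_def by simp_all

lemma Spec_B_simps:
  "fs_base (fi_Spec B) = Spec R" "fs_obj (fi_Spec B) S = Spec (fi_obj B S)"
  "fs_map (fi_Spec B) S T \<pi> = Spec_map (fi_obj B S) (fi_obj B T) (fi_map B S T \<pi>)"
  "fs_str (fi_Spec B) S = Spec_map R (fi_obj B S) (fi_str B S)"
  unfolding fi_Spec_def using fi_algD(2)[OF alg] by simp_all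

text \<open>Over the affine base, an isomorphism of \<open>Spec B\<close> with the fibre powers of \<open>Spec A\<close> is determined
  by the images of the tensors with a single nontrivial entry.\<close>

lemma iso_imp_presentation:
  assumes iso: "fi_scheme_iso (fi_Spec B) (fibre_powers R A \<iota>)"
  shows "\<exists>u. tensor_presentation B u"
proof -
  let ?T = "tensor_power R A \<iota>"
  obtain \<theta> where \<theta>0: "(\<forall>S. finite S \<longrightarrow> lrs_iso (Spec (fi_obj B S)) (Spec (?T S)) (\<theta> S) \<and>
        rm_eq (Spec (fi_obj B S)) (Spec R)
          (rm_comp (Spec (?T S)) (Spec_map R (?T S) (tensor_str R A \<iota> S)) (\<theta> S))
          (Spec_map R (fi_obj B S) (fi_str B S))) \<and>
      (\<forall>S T. finite S \<and> finite T \<longrightarrow> (\<forall>\<pi>\<in>fi_hom S T. rm_eq (Spec (fi_obj B T)) (Spec (?T S))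
        (rm_comp (Spec (fi_obj B S)) (\<theta> S) (Spec_map (fi_obj B S) (fi_obj B T) (fi_map B S T \<pi>)))
        (rm_comp (Spec (?T T)) (Spec_map (?T S) (?T T) (tensor_map R A \<iota> S T \<pi>)) (\<theta> T))))"
    using iso[unfolded fi_scheme_iso_def Spec_B_simps powers_simps, THEN conjunct2] by (rule exE)
  have \<theta>: "lrs_iso (Spec (fi_obj B S)) (Spec (?T S)) (\<theta> S)"
    and over: "rm_eq (Spec (fi_obj B S)) (Spec R)
      (rm_comp (Spec (?T S)) (Spec_map R (?T S) (tensor_str R A \<iota> S)) (\<theta> S))
      (Spec_map R (fi_obj B S) (fi_str B S))" if "finite S" for S
    using \<theta>0[THEN conjunct1, rule_format, OF that] by (rule conjunct1, rule conjunct2)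
  have nat: "rm_eq (Spec (fi_obj B T)) (Spec (?T S))
        (rm_comp (Spec (fi_obj B S)) (\<theta> S) (Spec_map (fi_obj B S) (fi_obj B T) (fi_map B S T \<pi>)))
        (rm_comp (Spec (?T T)) (Spec_map (?T S) (?T T) (tensor_map R A \<iota> S T \<pi>)) (\<theta> T))"
    if "finite S" "finite T" "\<pi> \<in> fi_hom S T" for S T \<pi>
    by (rule \<theta>0[THEN conjunct2, rule_format, OF conjI[OF that(1,2)] that(3)])
  define \<gamma> where "\<gamma> S = induced_hom (tensor_power R A \<iota> S) (fi_obj B S) (\<theta> S)" for S
  define u where "u S s a = \<gamma> S (tensor.cls R A \<iota> S
    (ma_single R \<one>\<^bsub>R\<^esub> ((tensor.unit_family A S)(s := a))))" for S s a
  have T: "cring (tensor_power R A \<iota> S)" for S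
  proof -
    interpret S: tensor R A \<iota> S by (rule tensor)
    show ?thesis by (rule S.T.is_cring)
  qed
  have \<gamma>: "\<gamma> S \<in> ring_hom (tensor_power R A \<iota> S) (fi_obj B S)"
    "bij_betw (\<gamma> S) (carrier (tensor_power R A \<iota> S)) (carrier (fi_obj B S))" if "finite S" for S
    using induced_hom(2,3)[OF T fi_algD(3)[OF alg that] \<theta>[OF that]] unfolding \<gamma>_def by blast+
  have u_hom: "u S s \<in> ring_hom A (fi_obj B S)" and u_str: "\<And>r. r \<in> carrier R \<Longrightarrow> u S s (\<iota> r) = fi_str B S r"
    if S: "finite S" and s: "s \<in> S" for S s
  proof -
    interpret S: tensor R A \<iota> S by (rule tensor)
    show "u S s \<in> ring_hom A (fi_obj B S)"
      using ring_hom_trans[OF S.sgl_upd_hom[OF s] \<gamma>(1)[OF S]] unfolding u_def[abs_def] comp_def .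
    fix r assume r: "r \<in> carrier R"
    show "u S s (\<iota> r) = fi_str B S r"
      unfolding u_def S.cls_upd_\<iota>[OF s r] \<gamma>_def S.str_eq[symmetric]
      using S.str_hom S.str_eq
      by (intro induced_hom_over[OF T fi_algD(3)[OF alg S] \<theta>[OF S] K.is_cring _ fi_algD(4)[OF alg S] over[OF S] r])
        (simp add: S.str_eq[abs_def])
  qed
  have u_nat: "fi_map B S T \<pi> (u S s a) = u T (\<pi> s) a"
    if S: "finite S" and T': "finite T" and \<pi>: "\<pi> \<in> fi_hom S T" and s: "s \<in> S" and a: "a \<in> carrier A" for S T \<pi> s a
  proof -
    interpret P: tensor_inj R A \<iota> S T \<pi> by unfold_locales (rule \<pi>)
    have f: "P.S.unit_family(s := a) \<in> S \<rightarrow>\<^sub>E carrier A" by (intro P.S.upd_family P.S.unit_family s a)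
    note F = P.S.sgl_TF[OF K.one_closed f]
    have "fi_map B S T \<pi> (u S s a) = \<gamma> T (tensor_map R A \<iota> S T \<pi> (P.S.cls (P.S.sgl \<one>\<^bsub>R\<^esub> (P.S.unit_family(s := a)))))"
      unfolding u_def \<gamma>_def
      by (rule induced_hom_natural[OF T fi_algD(3)[OF alg S] \<theta>[OF S] T fi_algD(3)[OF alg T'] \<theta>[OF T']
        P.tensor_map_hom fi_algD(5)[OF alg S T' \<pi>] nat[OF S T' \<pi>] P.S.cls_carr[OF F]])
    also have "\<dots> = u T (\<pi> s) a"
      unfolding P.tensor_map_cls[OF F] P.push_sgl[OF K.one_closed f] P.ext_upd[OF s] P.ext_one u_def ..
    finally show ?thesis .
  qed
  \<comment> \<open>The map from the free algebra is \<gamma> after the quotient map: both are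
    homomorphisms, and they agree on scalars and, by the choice of u, on tensors with one nontrivial
    entry. Surjectivity and kernel are then those of the bijection \<gamma>.\<close>
  have hat: "tensor_hat B u S F = \<gamma> S (tensor.cls R A \<iota> S F)"
    if S: "finite S" and F: "F \<in> carrier (tensor_free R A S)" for S F
  proof -
    interpret S: tensor_lift R A \<iota> S "fi_obj B S" "fi_str B S" "u S"
      using fi_algD(3,4)[OF alg S] S u_hom[OF S] u_str[OF S]
      by (intro tensor_lift.intro tensor tensor_lift_axioms.intro)
    have l: "tensor_hat B u S = S.lift" unfolding tensor_hat_def fi_algD(2)[OF alg] ..
    have c: "(\<lambda>F. \<gamma> S (S.cls F)) \<in> ring_hom S.TF (fi_obj B S)"
      using ring_hom_trans[OF S.cls_hom \<gamma>(1)[OF S]] by (simp add: comp_def)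
    have "S.lift F = \<gamma> S (S.cls F)"
    proof (rule S.hom_eq_on_sgl[unfolded S.TF_eq, OF S.lift_ring_hom c S.C.ring_axioms _ F])
      fix r f assume r: "r \<in> carrier R" and "f \<in> carrier S.M"
      then have f: "f \<in> S \<rightarrow>\<^sub>E carrier A" by simp
      have fs: "f s \<in> carrier A" if "s \<in> S" for s using f that by blast
      have us: "S.sgl \<one>\<^bsub>R\<^esub> (S.unit_family(s := f s)) \<in> carrier S.TF" if "s \<in> S" for s
        using that fs by (intro S.sgl_TF K.one_closed S.upd_family S.unit_family)
      have "\<gamma> S (S.cls (S.sgl \<one>\<^bsub>R\<^esub> f)) = (\<Otimes>\<^bsub>fi_obj B S\<^esub>s\<in>S. \<gamma> S (S.cls (S.sgl \<one>\<^bsub>R\<^esub> (S.unit_family(s := f s)))))"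
        unfolding S.sgl_prod[OF S f] using us
        by (intro ring_hom_finprod[OF S.TF.is_cring S.C.is_cring c]) blast
      also have "\<dots> = S.\<mu> f" unfolding S.\<mu>_def u_def ..
      finally have 1: "\<gamma> S (S.cls (S.sgl \<one>\<^bsub>R\<^esub> f)) = S.\<mu> f" .
      have 2: "\<gamma> S (S.cls (S.sgl r S.unit_family)) = fi_str B S r"
        unfolding \<gamma>_def S.str_def[symmetric] S.str_eq[symmetric]
        by (intro induced_hom_over[OF T fi_algD(3)[OF alg S] \<theta>[OF S] K.is_cring _ fi_algD(4)[OF alg S] over[OF S] r])
          (use S.str_hom in \<open>simp add: S.str_eq[abs_def]\<close>)
      have "\<gamma> S (S.cls (S.sgl r f)) = fi_str B S r \<otimes>\<^bsub>fi_obj B S\<^esub> S.\<mu> f"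
        unfolding S.sgl_split[OF r f]
          ring_hom_mult[OF c S.sgl_TF[OF r S.unit_family] S.sgl_TF[OF K.one_closed f]] 1 2 ..
      then show "S.lift (S.sgl r f) = \<gamma> S (S.cls (S.sgl r f))"
        unfolding S.lift_sgl'[OF r f] by (rule sym)
    qed
    then show ?thesis unfolding l .
  qed
  have surj: "carrier (fi_obj B S) \<subseteq> tensor_hat B u S ` carrier (tensor_free R A S)" if S: "finite S" for S
  proof
    interpret S: tensor R A \<iota> S by (rule tensor)
    fix b assume "b \<in> carrier (fi_obj B S)"
    then obtain t where "t \<in> carrier S.T" "b = \<gamma> S t"
      using \<gamma>(2)[OF S] unfolding bij_betw_def by blast
    then obtain F where "F \<in> carrier S.TF" "b = \<gamma> S (S.cls F)" unfolding S.carr_T by blast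
    then show "b \<in> tensor_hat B u S ` carrier (tensor_free R A S)" using hat[OF S] by auto
  qed
  have ker: "F \<in> tensor_ideal R A \<iota> S"
    if S: "finite S" and F: "F \<in> carrier (tensor_free R A S)" and z: "tensor_hat B u S F = \<zero>\<^bsub>fi_obj B S\<^esub>" for S F
  proof -
    interpret S: tensor R A \<iota> S by (rule tensor)
    interpret C: cring "fi_obj B S" by (rule fi_algD(3)[OF alg S])
    have "\<gamma> S (S.cls F) = \<gamma> S \<zero>\<^bsub>S.T\<^esub>"
      using z unfolding hat[OF S F] ring_hom_zero[OF \<gamma>(1)[OF S] S.T.ring_axioms C.ring_axioms] .
    then have "S.cls F = \<zero>\<^bsub>S.T\<^esub>"
      using \<gamma>(2)[OF S] S.cls_carr[OF F] unfolding bij_betw_def inj_on_def by blast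
    then show ?thesis using S.cls_zero_iff[OF F] by blast
  qed
  have "tensor_presentation B u"
    unfolding tensor_presentation_def fi_algD(2)[OF alg]
    by (intro conjI allI impI ballI) (simp_all add: u_hom u_str u_nat surj ker)
  then show ?thesis by blast
qed

text \<open>Surjectivity and the bound on the kernel make the induced map from the tensor power
  bijective. A bijective homomorphism gives an isomorphism of spectra, and naturality is checked on
  pure tensors.\<close>

lemma presentation_imp_iso:
  assumes pres: "tensor_presentation B u"
  shows "fi_scheme_iso (fi_Spec B) (fibre_powers R A \<iota>)"
proof -
  note P = pres[unfolded tensor_presentation_def fi_algD(2)[OF alg]]
  note P1 = P[THEN conjunct1] and P2 = P[THEN conjunct2, THEN conjunct1]
    and P3 = P[THEN conjunct2, THEN conjunct2, THEN conjunct1]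
    and P4 = P[THEN conjunct2, THEN conjunct2, THEN conjunct2]
  have u_hom: "u S s \<in> ring_hom A (fi_obj B S)" and u_str: "\<And>r. r \<in> carrier R \<Longrightarrow> u S s (\<iota> r) = fi_str B S r"
    if "finite S" "s \<in> S" for S s using P1 that by blast+
  have u_nat: "fi_map B S T \<pi> (u S s a) = u T (\<pi> s) a"
    if "finite S" "finite T" "\<pi> \<in> fi_hom S T" "s \<in> S" "a \<in> carrier A" for S T \<pi> s a using P2 that by blast
  have surj: "carrier (fi_obj B S) \<subseteq> tensor_hat B u S ` carrier (tensor_free R A S)" if "finite S" for S
    using P3 that by blast
  have ker: "F \<in> tensor_ideal R A \<iota> S"
    if "finite S" "F \<in> carrier (tensor_free R A S)" "tensor_hat B u S F = \<zero>\<^bsub>fi_obj B S\<^esub>" for S F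
    using P4 that by blast
  have lift: "tensor_lift R A \<iota> S (fi_obj B S) (fi_str B S) (u S)" if S: "finite S" for S
    using fi_algD(3,4)[OF alg S] S u_hom[OF S] u_str[OF S]
    by (intro tensor_lift.intro tensor tensor_lift_axioms.intro)
  have hat_eq: "tensor_hat B u S = ma_lift R (fi_obj B S) (fi_str B S) (tensor_lift.\<mu> S (fi_obj B S) (u S))" for S
    unfolding tensor_hat_def fi_algD(2)[OF alg] ..
  let ?T = "tensor_power R A \<iota>"
  \<comment> \<open>The induced map is evaluated on a chosen representative. The choice does not
    matter because the lift vanishes on the ideal of relations.\<close>
  define \<gamma> where "\<gamma> S t = tensor_hat B u S
    (SOME F. F \<in> carrier (tensor_free R A S) \<and> tensor.cls R A \<iota> S F = t)" for S t
  have \<gamma>_cls: "\<gamma> S (tensor.cls R A \<iota> S F) = tensor_hat B u S F"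
    if S: "finite S" and F: "F \<in> carrier (tensor_free R A S)" for S F
  proof -
    interpret S: tensor_lift R A \<iota> S "fi_obj B S" "fi_str B S" "u S" by (rule lift[OF S])
    define G where "G = (SOME G. G \<in> carrier S.TF \<and> S.cls G = S.cls F)"
    have G: "G \<in> carrier S.TF" "S.cls G = S.cls F"
      using someI[of "\<lambda>G. G \<in> carrier S.TF \<and> S.cls G = S.cls F" F] F unfolding G_def by blast+
    have "S.lift (G \<ominus>\<^bsub>S.TF\<^esub> F) = \<zero>\<^bsub>fi_obj B S\<^esub>"
      using S.lift_kills_ideal S.cls_eq_iff[OF G(1) F] G(2) by blast
    then have "S.lift G \<ominus>\<^bsub>fi_obj B S\<^esub> S.lift F = \<zero>\<^bsub>fi_obj B S\<^esub>"
      using ring_hom_minus[OF S.TF.ring_axioms S.C.ring_axioms S.lift_ring_hom G(1) F] by simp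
    then have "S.lift G = S.lift F"
      using ring_hom_closed[OF S.lift_ring_hom G(1)] ring_hom_closed[OF S.lift_ring_hom F] by simp
    then show ?thesis unfolding \<gamma>_def hat_eq G_def .
  qed
  have \<gamma>_iso: "\<gamma> S \<in> ring_iso (?T S) (fi_obj B S)" if S: "finite S" for S
  proof -
    interpret S: tensor_lift R A \<iota> S "fi_obj B S" "fi_str B S" "u S" by (rule lift[OF S])
    have g: "\<gamma> S (S.cls F) = S.lift F" if "F \<in> carrier S.TF" for F
      using \<gamma>_cls[OF S that] unfolding hat_eq .
    show ?thesis
    proof (rule ring_iso_memI)
      fix x y assume "x \<in> carrier S.T" "y \<in> carrier S.T"
      then obtain F G where F: "F \<in> carrier S.TF" "x = S.cls F" and G: "G \<in> carrier S.TF" "y = S.cls G"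
        unfolding S.carr_T by blast
      show "\<gamma> S x \<in> carrier (fi_obj B S)" using F g ring_hom_closed[OF S.lift_ring_hom] by simp
      show "\<gamma> S (x \<otimes>\<^bsub>S.T\<^esub> y) = \<gamma> S x \<otimes>\<^bsub>fi_obj B S\<^esub> \<gamma> S y"
        unfolding F G ring_hom_mult[OF S.cls_hom F(1) G(1), symmetric]
        using F G by (simp add: g ring_hom_mult[OF S.lift_ring_hom])
      show "\<gamma> S (x \<oplus>\<^bsub>S.T\<^esub> y) = \<gamma> S x \<oplus>\<^bsub>fi_obj B S\<^esub> \<gamma> S y"
        unfolding F G ring_hom_add[OF S.cls_hom F(1) G(1), symmetric]
        using F G by (simp add: g ring_hom_add[OF S.lift_ring_hom])
    next
      show "\<gamma> S \<one>\<^bsub>S.T\<^esub> = \<one>\<^bsub>fi_obj B S\<^esub>"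
        using g[of "\<one>\<^bsub>S.TF\<^esub>"] by (simp add: ring_hom_one[OF S.cls_hom] ring_hom_one[OF S.lift_ring_hom])
    next
      have "x = y" if xy: "x \<in> carrier S.T" "y \<in> carrier S.T" "\<gamma> S x = \<gamma> S y" for x y
      proof -
        from xy obtain F G where F: "F \<in> carrier S.TF" "x = S.cls F" and G: "G \<in> carrier S.TF" "y = S.cls G"
          unfolding S.carr_T by blast
        have "S.lift F = S.lift G" using xy(3) g F G by simp
        then have "S.lift (F \<ominus>\<^bsub>S.TF\<^esub> G) = \<zero>\<^bsub>fi_obj B S\<^esub>"
          using ring_hom_minus[OF S.TF.ring_axioms S.C.ring_axioms S.lift_ring_hom F(1) G(1)]
            ring_hom_closed[OF S.lift_ring_hom G(1)] by simp
        then have "F \<ominus>\<^bsub>S.TF\<^esub> G \<in> S.I"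
          using ker[OF S] F(1) G(1) unfolding hat_eq by simp
        then show ?thesis using S.cls_eq_iff[OF F(1) G(1)] F G by simp
      qed
      moreover have "carrier (fi_obj B S) \<subseteq> \<gamma> S ` carrier S.T"
      proof
        fix b assume "b \<in> carrier (fi_obj B S)"
        then obtain F where F: "F \<in> carrier S.TF" "b = S.lift F" using surj[OF S] unfolding hat_eq by blast
        then have "b = \<gamma> S (S.cls F)" using g by simp
        then show "b \<in> \<gamma> S ` carrier S.T" using S.cls_carr[OF F(1)] by blast
      qed
      moreover have "\<gamma> S ` carrier S.T \<subseteq> carrier (fi_obj B S)"
        using g ring_hom_closed[OF S.lift_ring_hom] unfolding S.carr_T by auto
      ultimately show "bij_betw (\<gamma> S) (carrier S.T) (carrier (fi_obj B S))"
        unfolding bij_betw_def inj_on_def by blast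
    qed
  qed
  have T: "cring (?T S)" for S
  proof -
    interpret S: tensor R A \<iota> S by (rule tensor)
    show ?thesis by (rule S.T.is_cring)
  qed
  have \<gamma>_hom: "\<gamma> S \<in> ring_hom (?T S) (fi_obj B S)" and \<gamma>_bij: "bij_betw (\<gamma> S) (carrier (?T S)) (carrier (fi_obj B S))"
    if S: "finite S" for S using \<gamma>_iso[OF S] unfolding ring_iso_def by blast+
  have \<gamma>_spec: "spec_map (?T S) (fi_obj B S) (\<gamma> S)" if S: "finite S" for S
    using T fi_algD(3)[OF alg S] \<gamma>_hom[OF S] by (simp add: spec_map_def spec_map_axioms_def)
  have str_spec: "spec_map R (?T S) (tensor_str R A \<iota> S)" for S
  proof -
    interpret S: tensor R A \<iota> S by (rule tensor)
    show ?thesis using T K.is_cring S.str_hom by (simp add: spec_map_def spec_map_axioms_def S.str_eq[abs_def])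
  qed
  have \<gamma>_str: "\<gamma> S (tensor_str R A \<iota> S r) = fi_str B S r" if S: "finite S" and r: "r \<in> carrier R" for S r
  proof -
    interpret S: tensor_lift R A \<iota> S "fi_obj B S" "fi_str B S" "u S" by (rule lift[OF S])
    show ?thesis
      using \<gamma>_cls[OF S S.sgl_TF[OF r S.unit_family]] S.lift_sgl'[OF r S.unit_family]
        ring_hom_closed[OF fi_algD(4)[OF alg S] r]
      unfolding hat_eq S.str_eq S.str_def by (simp add: S.\<mu>_one)
  qed
  have \<gamma>_nat: "fi_map B S T \<pi> (\<gamma> S t) = \<gamma> T (tensor_map R A \<iota> S T \<pi> t)"
    if S: "finite S" and T': "finite T" and \<pi>: "\<pi> \<in> fi_hom S T" and t: "t \<in> carrier (?T S)" for S T \<pi> t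
  proof -
    interpret P: tensor_inj R A \<iota> S T \<pi> by unfold_locales (rule \<pi>)
    interpret S: tensor_lift R A \<iota> S "fi_obj B S" "fi_str B S" "u S" by (rule lift[OF S])
    interpret T: tensor_lift R A \<iota> T "fi_obj B T" "fi_str B T" "u T" by (rule lift[OF T'])
    note m = fi_algD(5)[OF alg S T' \<pi>]
    obtain F where F: "F \<in> carrier P.S.TF" "t = P.S.cls F" using t unfolding P.S.carr_T by blast
    have "fi_map B S T \<pi> (S.lift F) = T.lift (P.push F)"
    proof (rule P.S.hom_eq_on_sgl[unfolded P.S.TF_eq, OF _ _ T.C.ring_axioms _ F(1)])
      show "(\<lambda>F. fi_map B S T \<pi> (S.lift F)) \<in> ring_hom P.S.TF (fi_obj B T)"
        using ring_hom_trans[OF S.lift_ring_hom m] by (simp add: comp_def)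
      show "(\<lambda>F. T.lift (P.push F)) \<in> ring_hom P.S.TF (fi_obj B T)"
        using ring_hom_trans[OF P.push_hom T.lift_ring_hom] by (simp add: comp_def)
      fix r f assume r: "r \<in> carrier R" and "f \<in> carrier P.S.M"
      then have f: "f \<in> S \<rightarrow>\<^sub>E carrier A" by simp
      have fc: "f s \<in> carrier A" if "s \<in> S" for s using f that by blast
      \<comment> \<open>Outside the image of \<pi> the extended family has entry 1 and contributes a
        factor 1; the rest of the product is reindexed along the injection.\<close>
      have "T.\<mu> (P.ext f) = (\<Otimes>\<^bsub>fi_obj B T\<^esub>t\<in>\<pi> ` S. u T t (P.ext f t))"
        unfolding T.\<mu>_def using P.\<pi>_mem T' P.ext_outside P.ext_carr[OF f]
        by (intro T.C.finprod_mono_neutral_cong_right)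
          (auto simp: ring_hom_one[OF T.u] intro!: T.u_closed)
      also have "\<dots> = (\<Otimes>\<^bsub>fi_obj B T\<^esub>s\<in>S. u T (\<pi> s) (P.ext f (\<pi> s)))"
        using P.\<pi>_inj P.\<pi>_mem P.ext_carr[OF f] by (intro T.C.finprod_reindex) (auto intro!: T.u_closed)
      also have "\<dots> = (\<Otimes>\<^bsub>fi_obj B T\<^esub>s\<in>S. fi_map B S T \<pi> (u S s (f s)))"
        using fc u_nat[OF S T' \<pi>] P.ext_apply S.u_closed ring_hom_closed[OF m]
        by (intro T.C.finprod_cong') (auto intro!: T.u_closed P.\<pi>_mem)
      also have "\<dots> = fi_map B S T \<pi> (S.\<mu> f)"
        unfolding S.\<mu>_def using S.u_closed fc
        by (intro ring_hom_finprod[OF S.C.is_cring T.C.is_cring m, symmetric]) auto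
      finally have 1: "T.\<mu> (P.ext f) = fi_map B S T \<pi> (S.\<mu> f)" .
      show "fi_map B S T \<pi> (S.lift (P.S.sgl r f)) = T.lift (P.push (P.S.sgl r f))"
        unfolding P.push_sgl[OF r f] S.lift_sgl'[OF r f] T.lift_sgl'[OF r P.ext_carr[OF f]] 1
          ring_hom_mult[OF m S.\<rho>_closed[OF r] S.\<mu>_closed[OF f]] fi_algD(6)[OF alg S T' \<pi> r] ..
    qed
    then show ?thesis
      unfolding F(2) \<gamma>_cls[OF S F(1)] P.tensor_map_cls[OF F(1)]
        \<gamma>_cls[OF T' ring_hom_closed[OF P.push_hom F(1)]] hat_eq .
  qed
  have sym: "rm_eq X Y a b \<Longrightarrow> rm_eq X Y c b \<Longrightarrow> rm_eq X Y a c" for X Y a b c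
    unfolding rm_eq_def by simp
  show ?thesis
    unfolding fi_scheme_iso_def Spec_B_simps powers_simps
  proof (intro conjI exI[of _ "\<lambda>S. Spec_map (?T S) (fi_obj B S) (\<gamma> S)"] allI impI ballI refl)
    fix S :: "nat set" assume S: "finite S"
    show "lrs_iso (Spec (fi_obj B S)) (Spec (?T S)) (Spec_map (?T S) (fi_obj B S) (\<gamma> S))"
    proof (rule Spec_map_iso[OF \<gamma>_spec[OF S], of "inv_into (carrier (?T S)) (\<gamma> S)"])
      have "inv_into (carrier (?T S)) (\<gamma> S) \<in> ring_hom (fi_obj B S) (?T S)"
        using ring_iso_set_sym[OF cring.axioms(1)[OF T] \<gamma>_iso[OF S]] unfolding ring_iso_def by blast
      then show "spec_map (fi_obj B S) (?T S) (inv_into (carrier (?T S)) (\<gamma> S))"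
        using T fi_algD(3)[OF alg S] by (simp add: spec_map_def spec_map_axioms_def)
      show "inv_into (carrier (?T S)) (\<gamma> S) (\<gamma> S t) = t" if "t \<in> carrier (?T S)" for t
        using \<gamma>_bij[OF S] that by (simp add: bij_betw_inv_into_left)
      show "\<gamma> S (inv_into (carrier (?T S)) (\<gamma> S) b) = b" if "b \<in> carrier (fi_obj B S)" for b
        using \<gamma>_bij[OF S] that by (simp add: bij_betw_inv_into_right)
    qed
    show "rm_eq (Spec (fi_obj B S)) (Spec R) (rm_comp (Spec (?T S)) (Spec_map R (?T S) (tensor_str R A \<iota> S))
        (Spec_map (?T S) (fi_obj B S) (\<gamma> S))) (Spec_map R (fi_obj B S) (fi_str B S))"
      by (rule Spec_map_comp[OF str_spec \<gamma>_spec[OF S]]) (simp add: \<gamma>_str[OF S])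
  next
    fix S T \<pi> assume "finite S \<and> finite T" and \<pi>: "\<pi> \<in> fi_hom S T"
    then have S: "finite S" and T': "finite T" by blast+
    interpret P: tensor_inj R A \<iota> S T \<pi> by unfold_locales (rule \<pi>)
    have m: "spec_map (fi_obj B S) (fi_obj B T) (fi_map B S T \<pi>)"
      using fi_algD(3)[OF alg S] fi_algD(3)[OF alg T'] fi_algD(5)[OF alg S T' \<pi>]
      by (simp add: spec_map_def spec_map_axioms_def)
    have tm: "spec_map (?T S) (?T T) (tensor_map R A \<iota> S T \<pi>)"
      using T P.tensor_map_hom by (simp add: spec_map_def spec_map_axioms_def)
    show "rm_eq (Spec (fi_obj B T)) (Spec (?T S))
        (rm_comp (Spec (fi_obj B S)) (Spec_map (?T S) (fi_obj B S) (\<gamma> S))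
          (Spec_map (fi_obj B S) (fi_obj B T) (fi_map B S T \<pi>)))
        (rm_comp (Spec (?T T)) (Spec_map (?T S) (?T T) (tensor_map R A \<iota> S T \<pi>))
          (Spec_map (?T T) (fi_obj B T) (\<gamma> T)))"
      by (rule sym[OF Spec_map_comp[OF \<gamma>_spec[OF S] m refl] Spec_map_comp[OF tm \<gamma>_spec[OF T']]])
        (simp add: \<gamma>_nat[OF S T' \<pi>])
  qed
qed

end

section \<open>Localisation of presentations\<close>

text \<open>Base change of tensor powers along a commutative square of rings, acting on coefficients
  by \<rho> and on entries by \<alpha>. It is applied to the passage from R and A to their
  localisations.\<close>

locale tensor_base_change = T: tensor R A \<iota> S + T': tensor R' A' \<iota>' S
  for R :: "'r ring" and A :: "'a ring" and \<iota> :: "'r \<Rightarrow> 'a"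
    and R' :: "'s ring" and A' :: "'b ring" and \<iota>' :: "'s \<Rightarrow> 'b" and S +
  fixes \<rho> :: "'r \<Rightarrow> 's" and \<alpha> :: "'a \<Rightarrow> 'b"
  assumes \<rho>: "\<rho> \<in> ring_hom R R'" and \<alpha>: "\<alpha> \<in> ring_hom A A'"
    and \<alpha>_\<iota>: "\<And>r. r \<in> carrier R \<Longrightarrow> \<alpha> (\<iota> r) = \<iota>' (\<rho> r)"
begin

definition fam where "fam f = (\<lambda>s\<in>S. \<alpha> (f s))"

lemma fam_apply [simp]: "s \<in> S \<Longrightarrow> fam f s = \<alpha> (f s)"
  unfolding fam_def by simp

lemma \<rho>_closed: "r \<in> carrier R \<Longrightarrow> \<rho> r \<in> carrier R'"
  by (rule ring_hom_closed[OF \<rho>])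

lemma fam_carr: "f \<in> S \<rightarrow>\<^sub>E carrier A \<Longrightarrow> fam f \<in> S \<rightarrow>\<^sub>E carrier A'"
  unfolding fam_def using ring_hom_closed[OF \<alpha>] by (auto simp: PiE_iff)

lemma fam_mult:
  assumes "f \<in> S \<rightarrow>\<^sub>E carrier A" "g \<in> S \<rightarrow>\<^sub>E carrier A"
  shows "fam (f \<otimes>\<^bsub>T.M\<^esub> g) = fam f \<otimes>\<^bsub>T'.M\<^esub> fam g"
  unfolding T.mult_M T'.mult_M using assms
  by (auto simp: fam_def fun_eq_iff PiE_iff ring_hom_mult[OF \<alpha>])

lemma fam_one: "fam T.unit_family = T'.unit_family"
  unfolding fam_def T'.unit_family_def by (intro restrict_ext) (simp add: ring_hom_one[OF \<alpha>])

lemma fam_upd: "s \<in> S \<Longrightarrow> fam (f(s := a)) = (fam f)(s := \<alpha> a)"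
  unfolding fam_def by (auto simp: fun_eq_iff)

sublocale change: monoid_ring_lift R T.M T'.TF "\<lambda>r. T'.sgl (\<rho> r) T'.unit_family" "\<lambda>f. T'.sgl \<one>\<^bsub>R'\<^esub> (fam f)"
proof unfold_locales
  show "(\<lambda>r. T'.sgl (\<rho> r) T'.unit_family) \<in> ring_hom R T'.TF"
    using ring_hom_trans[OF \<rho> T'.sgl_unit_hom] by (simp add: comp_def)
  show "T'.sgl \<one>\<^bsub>R'\<^esub> (fam f) \<in> carrier T'.TF" if "f \<in> carrier T.M" for f
    using that fam_carr[of f] by (intro T'.sgl_TF) simp_all
qed

abbreviation change where "change \<equiv> change.lift"

lemma change_hom: "change \<in> ring_hom T.TF T'.TF"
  unfolding T.TF_eq[symmetric]
proof (rule change.lift_hom)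
  fix f g assume "f \<in> carrier T.M" "g \<in> carrier T.M"
  then have f: "f \<in> S \<rightarrow>\<^sub>E carrier A" and g: "g \<in> S \<rightarrow>\<^sub>E carrier A" by simp_all
  show "T'.sgl \<one>\<^bsub>R'\<^esub> (fam (f \<otimes>\<^bsub>T.M\<^esub> g)) = T'.sgl \<one>\<^bsub>R'\<^esub> (fam f) \<otimes>\<^bsub>T'.TF\<^esub> T'.sgl \<one>\<^bsub>R'\<^esub> (fam g)"
    unfolding fam_mult[OF f g]
    using T'.TF_mult_sgl[OF T'.K.one_closed T'.K.one_closed fam_carr[OF f] fam_carr[OF g]] by simp
next
  show "T'.sgl \<one>\<^bsub>R'\<^esub> (fam \<one>\<^bsub>T.M\<^esub>) = \<one>\<^bsub>T'.TF\<^esub>"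
    unfolding T.one_M fam_one by (rule T'.TF_one[symmetric])
qed

lemma change_sgl:
  assumes "r \<in> carrier R" "f \<in> S \<rightarrow>\<^sub>E carrier A"
  shows "change (T.sgl r f) = T'.sgl (\<rho> r) (fam f)"
  using change.lift_sgl[of r f] T'.sgl_split[OF \<rho>_closed[OF assms(1)] fam_carr[OF assms(2)]] assms
  by (simp only: T.carr_M)

lemma change_kills_ideal:
  assumes "F \<in> T.I"
  shows "change F \<in> T'.I"
proof -
  have "(\<lambda>F. T'.cls (change F)) \<in> ring_hom T.TF T'.T"
    using ring_hom_trans[OF change_hom T'.cls_hom] by (simp add: comp_def)
  then have "T'.cls (change F) = \<zero>\<^bsub>T'.T\<^esub>"
  proof (rule T.hom_kills_ideal[OF _ T'.T.is_cring _ _ assms])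
    note \<alpha>c = ring_hom_closed[OF \<alpha>]
    fix f s a b assume f: "f \<in> S \<rightarrow>\<^sub>E carrier A" "s \<in> S" "a \<in> carrier A" "b \<in> carrier A"
    note g = fam_carr[OF f(1)] and c = T'.sgl_TF[OF T'.K.one_closed T'.upd_family[OF fam_carr[OF f(1)] f(2)]]
    have "T'.cls (change (T.sgl \<one>\<^bsub>R\<^esub> (f(s := x)))) = T'.cls (T'.sgl \<one>\<^bsub>R'\<^esub> ((fam f)(s := \<alpha> x)))"
      if "x \<in> carrier A" for x
      unfolding change_sgl[OF T.K.one_closed T.upd_family[OF f(1,2) that]] fam_upd[OF f(2)] ring_hom_one[OF \<rho>] ..
    then show "T'.cls (change (T.sgl \<one>\<^bsub>R\<^esub> (f(s := a \<oplus>\<^bsub>A\<^esub> b)))) =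
        T'.cls (change (T.sgl \<one>\<^bsub>R\<^esub> (f(s := a)))) \<oplus>\<^bsub>T'.T\<^esub> T'.cls (change (T.sgl \<one>\<^bsub>R\<^esub> (f(s := b))))"
      using f(3,4) T'.cls_sgl_add[OF g f(2) \<alpha>c[OF f(3)] \<alpha>c[OF f(4)]]
        ring_hom_add[OF T'.cls_hom c[OF \<alpha>c[OF f(3)]] c[OF \<alpha>c[OF f(4)]]]
      by (simp add: ring_hom_add[OF \<alpha>] del: fun_upd_apply)
  next
    note \<alpha>c = ring_hom_closed[OF \<alpha>]
    fix f s a r assume f: "f \<in> S \<rightarrow>\<^sub>E carrier A" "s \<in> S" "a \<in> carrier A" "r \<in> carrier R"
    show "T'.cls (change (T.sgl \<one>\<^bsub>R\<^esub> (f(s := \<iota> r \<otimes>\<^bsub>A\<^esub> a)))) = T'.cls (change (T.sgl r (f(s := a))))"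
      unfolding change_sgl[OF f(4) T.upd_family[OF f(1-3)]] fam_upd[OF f(2)] ring_hom_one[OF \<rho>]
        change_sgl[OF T.K.one_closed T.upd_family[OF f(1,2) T.A.m_closed[OF T.\<iota>_closed[OF f(4)] f(3)]]]
        ring_hom_mult[OF \<alpha> T.\<iota>_closed[OF f(4)] f(3)] \<alpha>_\<iota>[OF f(4)]
      by (rule T'.cls_sgl_scale[OF fam_carr[OF f(1)] f(2) \<alpha>c[OF f(3)] \<rho>_closed[OF f(4)]])
  qed
  moreover have "change F \<in> carrier T'.TF"
    using ring_hom_closed[OF change_hom] T.I.Icarr[OF assms] by blast
  ultimately show ?thesis using T'.cls_zero_iff by blast
qed

end

text \<open>Phrased with \<open>eventually\<close>, so that one exponent serves finitely many
  fractions at the same time.\<close>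

lemma (in localised) eventually_integral:
  assumes M: "M = powers A x" and xc: "x \<in> carrier A" and y: "y \<in> carrier L"
  shows "\<forall>\<^sub>F n in sequentially. \<exists>a\<in>carrier A. y \<otimes>\<^bsub>L\<^esub> frac x \<one> [^]\<^bsub>L\<^esub> (n::nat) = frac a \<one>"
proof -
  obtain a s where a: "a \<in> carrier A" "s \<in> M" "y = frac a s" using y by (rule carr_fracE)
  then obtain k :: nat where k: "s = x [^] k" unfolding M powers_def by blast
  have "\<exists>a\<in>carrier A. y \<otimes>\<^bsub>L\<^esub> frac x \<one> [^]\<^bsub>L\<^esub> n = frac a \<one>" if "k \<le> n" for n
  proof
    have p: "x [^] n = x [^] (n - k) \<otimes> x [^] k" using nat_pow_mult[OF xc, of "n - k" k] that by simp
    have "y \<otimes>\<^bsub>L\<^esub> frac x \<one> [^]\<^bsub>L\<^esub> n = frac (a \<otimes> x [^] n) s"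
      unfolding a(3) using a xc by (simp add: frac_pow)
    also have "\<dots> = frac (a \<otimes> x [^] (n - k)) \<one>"
      using a xc p k by (intro frac_eqI) (auto simp: m_ac)
    finally show "y \<otimes>\<^bsub>L\<^esub> frac x \<one> [^]\<^bsub>L\<^esub> n = frac (a \<otimes> x [^] (n - k)) \<one>" .
    show "a \<otimes> x [^] (n - k) \<in> carrier A" using a xc by simp
  qed
  then show ?thesis unfolding eventually_sequentially by blast
qed

lemma base_in_powers: "cring A \<Longrightarrow> x \<in> carrier A \<Longrightarrow> x \<in> powers A x"
proof -
  assume "cring A" "x \<in> carrier A"
  then interpret cring A by simp
  have "x = x [^]\<^bsub>A\<^esub> (1::nat)" using \<open>x \<in> carrier A\<close> by (simp add: One_nat_def)
  then show ?thesis unfolding powers_def by blast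
qed

text \<open>Every element of the localised monoid algebra becomes the image of an element of the original one
  after multiplication by a power of the unit \<open>D\<close>, which clears all denominators of coefficients and
  tensor factors.\<close>

lemma (in fi_localised) invert_presentation:
  assumes pres: "tensor_presentation B u"
  defines "u' \<equiv> \<lambda>S s. localisation_map (fi_obj B S) (P S) (u S s)"
  shows "tensor_presentation (fi_invert B h) u'"
proof -
  note base = fi_algD(2)[OF alg]
  note pr = pres[unfolded tensor_presentation_def base]
  note P1 = pr[THEN conjunct1] and P2 = pr[THEN conjunct2, THEN conjunct1]
    and P3 = pr[THEN conjunct2, THEN conjunct2, THEN conjunct1]
    and P4 = pr[THEN conjunct2, THEN conjunct2, THEN conjunct2]
  let ?A = "fi_obj B {1}" and ?\<iota> = "fi_str B {1}" and ?B' = "fi_invert B h"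
  let ?R' = "localisation R (powers R h)"
  note alg' = invert_alg
  note base' = fi_algD(2)[OF alg']
  interpret r: localised R "powers R h" by (rule localised_base)
  interpret a: localised ?A "P {1}" by (rule localised_obj) simp
  have A': "fi_obj ?B' {1} = a.L" by (rule invert_simps)
  have u_hom: "u S s \<in> ring_hom ?A (fi_obj B S)" and u_str: "\<And>r. r \<in> carrier R \<Longrightarrow> u S s (?\<iota> r) = fi_str B S r"
    if "finite S" "s \<in> S" for S s using P1 that by blast+
  have u_nat: "fi_map B S T \<pi> (u S s x) = u T (\<pi> s) x"
    if "finite S" "finite T" "\<pi> \<in> fi_hom S T" "s \<in> S" "x \<in> carrier ?A" for S T \<pi> s x using P2 that by blast
  \<comment> \<open>The maps u are compatible with the base, so they carry the powers of h onto the
    powers of h; this makes their localisations well defined.\<close>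
  have u_P: "u S s ` P {1} = P S" if "finite S" "s \<in> S" for S s
    using powers_image[OF a.is_cring fi_algD(3)[OF alg that(1)] u_hom[OF that] str_h] u_str[OF that h] by simp
  have u'_frac: "u' S s (a.frac x t) = loc_frac (fi_obj B S) (P S) (u S s x) (u S s t)"
    if "finite S" "s \<in> S" "x \<in> carrier ?A" "t \<in> P {1}" for S s x t
    unfolding u'_def using u_hom[OF that(1,2)] u_P[OF that(1,2)] that
    by (intro localisation_map_frac localised_obj a.localised_axioms) auto
  have u'_hom: "u' S s \<in> ring_hom a.L (fi_obj ?B' S)" if "finite S" "s \<in> S" for S s
    unfolding u'_def invert_simps using u_hom[OF that] u_P[OF that] that
    by (intro localisation_map_hom localised_obj a.localised_axioms) auto
  have \<iota>_P: "?\<iota> t \<in> P {1}" if "t \<in> powers R h" for t using str_powers[of "{1}"] that by blast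
  have u'_str: "u' S s (fi_str ?B' {1} x) = fi_str ?B' S x" if S: "finite S" "s \<in> S" and x: "x \<in> carrier ?R'" for S s x
  proof -
    obtain y t where y: "y \<in> carrier R" "t \<in> powers R h" "x = r.frac y t" using x by (rule r.carr_fracE)
    show ?thesis
      using y S ring_hom_closed[OF fi_algD(4)[OF alg]] \<iota>_P r.M_carr
      by (simp add: str_frac u'_frac u_str)
  qed
  have u'_nat: "fi_map ?B' S T \<pi> (u' S s x) = u' T (\<pi> s) x"
    if S: "finite S" and T: "finite T" and \<pi>: "\<pi> \<in> fi_hom S T" and s: "s \<in> S" and x: "x \<in> carrier a.L" for S T \<pi> s x
  proof -
    obtain y t where y: "y \<in> carrier ?A" "t \<in> P {1}" "x = a.frac y t" using x by (rule a.carr_fracE)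
    have \<pi>s: "\<pi> s \<in> T" using \<pi> s by (auto simp: fi_hom_def)
    have "u S s t \<in> P S" using u_P[OF S s] y(2) by blast
    then show ?thesis
      using y S T s \<pi>s u_nat[OF S T \<pi> s] ring_hom_closed[OF u_hom[OF S s]] a.M_carr
      by (simp add: u'_frac map_frac[OF S T \<pi>])
  qed
  have main: "carrier (fi_obj ?B' S) \<subseteq> tensor_hat ?B' u' S ` carrier (tensor_free ?R' a.L S)"
    and ker: "\<And>F. \<lbrakk>F \<in> carrier (tensor_free ?R' a.L S); tensor_hat ?B' u' S F = \<zero>\<^bsub>fi_obj ?B' S\<^esub>\<rbrakk> \<Longrightarrow>
      F \<in> tensor_ideal ?R' a.L (fi_str ?B' {1}) S"
    if S: "finite S" for S
  proof -
    interpret b: localised "fi_obj B S" "P S" by (rule localised_obj[OF S])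
    interpret X: fi_alg_over R B by unfold_locales (rule alg)
    interpret X': fi_alg_over ?R' ?B' by unfold_locales (rule alg')
    interpret T: tensor_lift R ?A ?\<iota> S "fi_obj B S" "fi_str B S" "u S"
      using fi_algD(3,4)[OF alg S] S u_hom[OF S] u_str[OF S]
      by (intro tensor_lift.intro X.tensor tensor_lift_axioms.intro)
    interpret T': tensor_lift ?R' a.L "fi_str ?B' {1}" S "fi_obj ?B' S" "fi_str ?B' S" "u' S"
      using fi_algD(3,4)[OF alg' S] S u'_hom[OF S] u'_str[OF S] X'.tensor unfolding A'
      by (intro tensor_lift.intro tensor_lift_axioms.intro)
    interpret C: tensor_base_change R ?A ?\<iota> ?R' a.L "fi_str ?B' {1}" S
      "\<lambda>x. r.frac x \<one>\<^bsub>R\<^esub>" "\<lambda>x. a.frac x \<one>\<^bsub>?A\<^esub>"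
    proof (intro tensor_base_change.intro tensor_base_change_axioms.intro X.tensor r.frac_hom a.frac_hom)
      show "tensor ?R' a.L (fi_str ?B' {1})" by (rule T'.tensor_axioms)
      show "a.frac (?\<iota> x) \<one>\<^bsub>?A\<^esub> = fi_str ?B' {1} (r.frac x \<one>\<^bsub>R\<^esub>)" if "x \<in> carrier R" for x
        using that ring_hom_one[OF fi_algD(4)[OF alg, of "{1}"]] by (simp add: str_frac)
    qed
    have B': "fi_obj ?B' S = b.L" by (rule invert_simps)
    have hat: "tensor_hat B u S = T.lift" unfolding tensor_hat_def base ..
    have hat': "tensor_hat ?B' u' S = T'.lift" unfolding tensor_hat_def base' ..
    have str1: "fi_str ?B' S (r.frac x \<one>\<^bsub>R\<^esub>) = b.frac (fi_str B S x) \<one>\<^bsub>fi_obj B S\<^esub>" if "x \<in> carrier R" for x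
      using that ring_hom_one[OF fi_algD(4)[OF alg S]] S by (simp add: str_frac)
    \<comment> \<open>The square formed by the two lifts and the two localisations commutes. Both
      ways round it are homomorphisms, so single terms decide.\<close>
    have compat: "T'.lift (C.change F) = b.frac (T.lift F) \<one>\<^bsub>fi_obj B S\<^esub>" if F: "F \<in> carrier T.TF" for F
    proof (rule T.hom_eq_on_sgl[unfolded T.TF_eq, OF _ _ T'.C.ring_axioms _ F])
      show "(\<lambda>F. T'.lift (C.change F)) \<in> ring_hom T.TF (fi_obj ?B' S)"
        using ring_hom_trans[OF C.change_hom T'.lift_ring_hom] by (simp add: comp_def)
      show "(\<lambda>F. b.frac (T.lift F) \<one>\<^bsub>fi_obj B S\<^esub>) \<in> ring_hom T.TF (fi_obj ?B' S)"
        unfolding B' using ring_hom_trans[OF T.lift_ring_hom b.frac_hom] by (simp add: comp_def)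
      fix x f assume x: "x \<in> carrier R" and "f \<in> carrier T.M"
      then have f: "f \<in> S \<rightarrow>\<^sub>E carrier ?A" by simp
      have fc: "f s \<in> carrier ?A" if "s \<in> S" for s using f that by blast
      have "T'.\<mu> (C.fam f) = (\<Otimes>\<^bsub>fi_obj ?B' S\<^esub>s\<in>S. b.frac (u S s (f s)) \<one>\<^bsub>fi_obj B S\<^esub>)"
        unfolding T'.\<mu>_def
        using fc T.u_closed S by (intro T'.C.finprod_cong') (auto simp: u'_frac ring_hom_one[OF T.u] B')
      also have "\<dots> = (\<Otimes>\<^bsub>b.L\<^esub>s\<in>S. b.frac (u S s (f s)) \<one>\<^bsub>fi_obj B S\<^esub>)" unfolding B' ..
      also have "\<dots> = b.frac (T.\<mu> f) \<one>\<^bsub>fi_obj B S\<^esub>"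
        unfolding T.\<mu>_def using fc T.u_closed
        by (intro ring_hom_finprod[OF b.is_cring b.L.is_cring b.frac_hom, symmetric]) auto
      finally have 1: "T'.\<mu> (C.fam f) = b.frac (T.\<mu> f) \<one>\<^bsub>fi_obj B S\<^esub>" .
      have "T'.lift (C.change (T.sgl x f)) =
          b.frac (fi_str B S x) \<one>\<^bsub>fi_obj B S\<^esub> \<otimes>\<^bsub>fi_obj ?B' S\<^esub> b.frac (T.\<mu> f) \<one>\<^bsub>fi_obj B S\<^esub>"
        unfolding C.change_sgl[OF x f] T'.lift_sgl'[OF C.\<rho>_closed[OF x] C.fam_carr[OF f]] 1 str1[OF x] ..
      also have "\<dots> = b.frac (T.lift (T.sgl x f)) \<one>\<^bsub>fi_obj B S\<^esub>"
        unfolding B' T.lift_sgl'[OF x f] using T.\<rho>_closed[OF x] T.\<mu>_closed[OF f] by simp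
      finally show "T'.lift (C.change (T.sgl x f)) = b.frac (T.lift (T.sgl x f)) \<one>\<^bsub>fi_obj B S\<^esub>" .
    qed
    define d where "d = r.frac h \<one>\<^bsub>R\<^esub>"
    define e where "e = r.frac \<one>\<^bsub>R\<^esub> h"
    define dA where "dA = a.frac (?\<iota> h) \<one>\<^bsub>?A\<^esub>"
    define eA where "eA = a.frac \<one>\<^bsub>?A\<^esub> (?\<iota> h)"
    have hP: "h \<in> powers R h" by (rule base_in_powers[OF r.is_cring h])
    have \<iota>h: "?\<iota> h \<in> carrier ?A" "?\<iota> h \<in> P {1}" using str_h[of "{1}"] \<iota>_P[OF hP] by simp_all
    have de: "d \<in> carrier ?R'" "e \<in> carrier ?R'" "d \<otimes>\<^bsub>?R'\<^esub> e = \<one>\<^bsub>?R'\<^esub>"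
      unfolding d_def e_def using h hP r.frac_self_one by simp_all
    have deA: "dA \<in> carrier a.L" "eA \<in> carrier a.L" "dA \<otimes>\<^bsub>a.L\<^esub> eA = \<one>\<^bsub>a.L\<^esub>"
      unfolding dA_def eA_def using \<iota>h a.frac_self_one by simp_all
    have constA: "(\<lambda>s\<in>S. x) \<in> S \<rightarrow>\<^sub>E carrier a.L" if "x \<in> carrier a.L" for x using that by auto
    \<comment> \<open>D carries h in the coefficient and in every entry. It has the inverse E
      already in the free algebra, before any relation is imposed, so that multiplication by D can
      be undone there.\<close>
    define D where "D = T'.sgl d (\<lambda>s\<in>S. dA)"
    define E where "E = T'.sgl e (\<lambda>s\<in>S. eA)"
    define D0 where "D0 = T.sgl h (\<lambda>s\<in>S. ?\<iota> h)"
    have D0c: "D0 \<in> carrier T.TF" unfolding D0_def using \<iota>h by (intro T.sgl_TF h) auto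
    have Dc: "D \<in> carrier T'.TF" and Ec: "E \<in> carrier T'.TF"
      unfolding D_def E_def by (intro T'.sgl_TF de constA deA)+
    have DE: "D \<otimes>\<^bsub>T'.TF\<^esub> E = \<one>\<^bsub>T'.TF\<^esub>"
    proof -
      have "(\<lambda>s\<in>S. dA) \<otimes>\<^bsub>T'.M\<^esub> (\<lambda>s\<in>S. eA) = T'.unit_family"
        unfolding T'.mult_M T'.unit_family_def by (intro restrict_ext) (simp add: deA)
      then show ?thesis unfolding D_def E_def T'.TF_mult_sgl[OF de(1,2) constA[OF deA(1)] constA[OF deA(2)]] de(3)
          T'.TF_one by simp
    qed
    have D0: "C.change D0 = D"
    proof -
      have f: "(\<lambda>s\<in>S. ?\<iota> h) \<in> S \<rightarrow>\<^sub>E carrier ?A" using \<iota>h by auto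
      have "C.fam (\<lambda>s\<in>S. ?\<iota> h) = (\<lambda>s\<in>S. dA)" unfolding C.fam_def dA_def by (intro restrict_ext) simp
      then show ?thesis unfolding D0_def C.change_sgl[OF h f] D_def d_def by simp
    qed
    have Dpow: "D [^]\<^bsub>T'.TF\<^esub> n = T'.sgl (d [^]\<^bsub>?R'\<^esub> n) (\<lambda>s\<in>S. dA [^]\<^bsub>a.L\<^esub> n)" for n :: nat
    proof (induction n)
      case 0
      have e: "(\<lambda>s\<in>S. dA [^]\<^bsub>a.L\<^esub> (0::nat)) = T'.unit_family"
        unfolding T'.unit_family_def by (intro restrict_ext) simp
      show ?case unfolding e by (simp add: T'.TF_one)
    next
      case (Suc n)
      have "(\<lambda>s\<in>S. dA [^]\<^bsub>a.L\<^esub> n) \<otimes>\<^bsub>T'.M\<^esub> (\<lambda>s\<in>S. dA) = (\<lambda>s\<in>S. dA [^]\<^bsub>a.L\<^esub> Suc n)"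
        unfolding T'.mult_M by (intro restrict_ext) simp
      note e = this
      have "D [^]\<^bsub>T'.TF\<^esub> Suc n = D [^]\<^bsub>T'.TF\<^esub> n \<otimes>\<^bsub>T'.TF\<^esub> D" by simp
      also have "\<dots> = T'.sgl (d [^]\<^bsub>?R'\<^esub> n) (\<lambda>s\<in>S. dA [^]\<^bsub>a.L\<^esub> n) \<otimes>\<^bsub>T'.TF\<^esub> T'.sgl d (\<lambda>s\<in>S. dA)"
        unfolding Suc unfolding D_def ..
      also have "\<dots> = T'.sgl (d [^]\<^bsub>?R'\<^esub> n \<otimes>\<^bsub>?R'\<^esub> d) (\<lambda>s\<in>S. dA [^]\<^bsub>a.L\<^esub> Suc n)"
        unfolding e[symmetric]
        by (rule T'.TF_mult_sgl[OF r.L.nat_pow_closed[OF de(1)] de(1)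
          constA[OF a.L.nat_pow_closed[OF deA(1)]] constA[OF deA(1)]])
      finally show ?case unfolding r.L.nat_pow_Suc .
    qed
    have clear: "\<exists>(n::nat) F. F \<in> carrier T.TF \<and> G \<otimes>\<^bsub>T'.TF\<^esub> D [^]\<^bsub>T'.TF\<^esub> n = C.change F"
      if G: "G \<in> carrier T'.TF" for G
    proof -
      have "G \<in> carrier T'.RM" using G T'.TF_eq by simp
      then show ?thesis
      proof (induction rule: T'.induct_sgl)
        case zero
        have "\<zero>\<^bsub>T'.TF\<^esub> \<otimes>\<^bsub>T'.TF\<^esub> D [^]\<^bsub>T'.TF\<^esub> (0::nat) = C.change \<zero>\<^bsub>T.TF\<^esub>"
          using ring_hom_zero[OF C.change_hom T.TF.ring_axioms T'.TF.ring_axioms] by simp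
        then show ?case unfolding T'.TF_eq by blast
      next
        case (add x f G)
        then have f: "f \<in> S \<rightarrow>\<^sub>E carrier a.L" by simp
        have "\<forall>\<^sub>F n in sequentially. \<forall>s\<in>S. \<exists>y\<in>carrier ?A. f s \<otimes>\<^bsub>a.L\<^esub> dA [^]\<^bsub>a.L\<^esub> n = a.frac y \<one>\<^bsub>?A\<^esub>"
          unfolding dA_def using f by (intro eventually_ball_finite S ballI a.eventually_integral[OF refl \<iota>h(1)]) blast
        moreover have "\<forall>\<^sub>F n in sequentially. \<exists>y\<in>carrier R. x \<otimes>\<^bsub>?R'\<^esub> d [^]\<^bsub>?R'\<^esub> n = r.frac y \<one>\<^bsub>R\<^esub>"
          unfolding d_def by (rule r.eventually_integral[OF refl h add(1)])
        ultimately have "\<forall>\<^sub>F n in sequentially. (\<forall>s\<in>S. \<exists>y\<in>carrier ?A. f s \<otimes>\<^bsub>a.L\<^esub> dA [^]\<^bsub>a.L\<^esub> n = a.frac y \<one>\<^bsub>?A\<^esub>) \<and>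
          (\<exists>y\<in>carrier R. x \<otimes>\<^bsub>?R'\<^esub> d [^]\<^bsub>?R'\<^esub> n = r.frac y \<one>\<^bsub>R\<^esub>)" by (rule eventually_conj)
        then obtain n :: nat where n: "\<forall>s\<in>S. \<exists>y\<in>carrier ?A. f s \<otimes>\<^bsub>a.L\<^esub> dA [^]\<^bsub>a.L\<^esub> n = a.frac y \<one>\<^bsub>?A\<^esub>"
          "\<exists>y\<in>carrier R. x \<otimes>\<^bsub>?R'\<^esub> d [^]\<^bsub>?R'\<^esub> n = r.frac y \<one>\<^bsub>R\<^esub>"
          using eventually_happens'[OF sequentially_bot] by blast
        obtain y where y: "y \<in> carrier R" "x \<otimes>\<^bsub>?R'\<^esub> d [^]\<^bsub>?R'\<^esub> n = r.frac y \<one>\<^bsub>R\<^esub>" using n(2) by blast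
        obtain g where g: "\<And>s. s \<in> S \<Longrightarrow> g s \<in> carrier ?A \<and> f s \<otimes>\<^bsub>a.L\<^esub> dA [^]\<^bsub>a.L\<^esub> n = a.frac (g s) \<one>\<^bsub>?A\<^esub>"
          using bchoice[OF n(1)[unfolded Bex_def]] by blast
        have gc: "restrict g S \<in> S \<rightarrow>\<^sub>E carrier ?A" using g by auto
        have "f \<otimes>\<^bsub>T'.M\<^esub> (\<lambda>s\<in>S. dA [^]\<^bsub>a.L\<^esub> n) = C.fam (restrict g S)"
          unfolding T'.mult_M C.fam_def using g by (intro restrict_ext) simp
        then have sg: "T'.sgl x f \<otimes>\<^bsub>T'.TF\<^esub> D [^]\<^bsub>T'.TF\<^esub> n = C.change (T.sgl y (restrict g S))"
          unfolding Dpow T'.TF_mult_sgl[OF add(1) r.L.nat_pow_closed[OF de(1)] f constA[OF a.L.nat_pow_closed[OF deA(1)]]]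
            C.change_sgl[OF y(1) gc] y(2) by simp
        obtain m :: nat and F where F: "F \<in> carrier T.TF" "G \<otimes>\<^bsub>T'.TF\<^esub> D [^]\<^bsub>T'.TF\<^esub> m = C.change F" using add(4) by blast
        have Gc: "G \<in> carrier T'.TF" and sc: "T'.sgl x f \<in> carrier T'.TF"
          using add(3) T'.sgl_TF[OF add(1) f] unfolding T'.TF_eq by simp_all
        let ?s = "T.sgl y (restrict g S)"
        have s: "?s \<in> carrier T.TF" by (rule T.sgl_TF[OF y(1) gc])
        note D0p = T.TF.nat_pow_closed[OF D0c]
        note Dp = T'.TF.nat_pow_closed[OF Dc]
        have D0pow: "C.change (D0 [^]\<^bsub>T.TF\<^esub> k) = D [^]\<^bsub>T'.TF\<^esub> k" for k :: nat
          using ring_hom_nat_pow[OF T.TF.ring_axioms T'.TF.ring_axioms C.change_hom D0c] D0 by simp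
        \<comment> \<open>Each summand is cleared by its own power of D; the surplus power stays in
          the image because D comes from D0.\<close>
        have "(T'.sgl x f \<oplus>\<^bsub>T'.TF\<^esub> G) \<otimes>\<^bsub>T'.TF\<^esub> D [^]\<^bsub>T'.TF\<^esub> (n + m) =
            D [^]\<^bsub>T'.TF\<^esub> m \<otimes>\<^bsub>T'.TF\<^esub> (T'.sgl x f \<otimes>\<^bsub>T'.TF\<^esub> D [^]\<^bsub>T'.TF\<^esub> n) \<oplus>\<^bsub>T'.TF\<^esub>
            D [^]\<^bsub>T'.TF\<^esub> n \<otimes>\<^bsub>T'.TF\<^esub> (G \<otimes>\<^bsub>T'.TF\<^esub> D [^]\<^bsub>T'.TF\<^esub> m)"
          unfolding T'.TF.l_distr[OF sc Gc Dp] unfolding T'.TF.nat_pow_mult[OF Dc, symmetric]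
          using Gc sc Dp by (simp add: T'.TF.m_ac)
        also have "\<dots> = C.change (D0 [^]\<^bsub>T.TF\<^esub> m \<otimes>\<^bsub>T.TF\<^esub> ?s \<oplus>\<^bsub>T.TF\<^esub> D0 [^]\<^bsub>T.TF\<^esub> n \<otimes>\<^bsub>T.TF\<^esub> F)"
          unfolding sg F(2) ring_hom_add[OF C.change_hom T.TF.m_closed[OF D0p s] T.TF.m_closed[OF D0p F(1)]]
            ring_hom_mult[OF C.change_hom D0p s] ring_hom_mult[OF C.change_hom D0p F(1)] D0pow ..
        finally show ?case
          using T.TF.a_closed[OF T.TF.m_closed[OF D0p s] T.TF.m_closed[OF D0p F(1)]] unfolding T'.TF_eq by blast
      qed
    qed
    show "carrier (fi_obj ?B' S) \<subseteq> tensor_hat ?B' u' S ` carrier (tensor_free ?R' a.L S)"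
    proof
      fix y assume "y \<in> carrier (fi_obj ?B' S)"
      then obtain x t where x: "x \<in> carrier (fi_obj B S)" "t \<in> P S" "y = b.frac x t"
        unfolding B' by (rule b.carr_fracE)
      obtain t0 where t0: "t0 \<in> powers R h" "t = fi_str B S t0" using x(2) str_powers[OF S] by blast
      obtain F where F: "F \<in> carrier T.TF" "x = T.lift F"
        using P3[rule_format, OF S, unfolded hat] x(1) by blast
      \<comment> \<open>The denominator t comes from the base and is supplied by the coefficient
        1/t0; the numerator x is in the image before localisation.\<close>
      let ?q = "r.frac \<one>\<^bsub>R\<^esub> t0"
      let ?G = "T'.sgl ?q T'.unit_family \<otimes>\<^bsub>T'.TF\<^esub> C.change F"
      have q: "?q \<in> carrier ?R'" using t0 by blast
      have Gc: "T'.sgl ?q T'.unit_family \<in> carrier T'.TF" "C.change F \<in> carrier T'.TF"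
        using T'.sgl_TF[OF q T'.unit_family] ring_hom_closed[OF C.change_hom F(1)] by blast+
      have "T'.lift ?G = fi_str ?B' S ?q \<otimes>\<^bsub>b.L\<^esub> b.frac x \<one>\<^bsub>fi_obj B S\<^esub>"
        unfolding ring_hom_mult[OF T'.lift_ring_hom Gc] compat[OF F(1)] F(2)[symmetric]
          T'.lift_sgl'[OF q T'.unit_family] T'.\<mu>_one
        using T'.\<rho>_closed[OF q] B' by simp
      also have "fi_str ?B' S ?q = b.frac \<one>\<^bsub>fi_obj B S\<^esub> t"
        using t0 S ring_hom_one[OF fi_algD(4)[OF alg S]] by (simp add: str_frac)
      also have "b.frac \<one>\<^bsub>fi_obj B S\<^esub> t \<otimes>\<^bsub>b.L\<^esub> b.frac x \<one>\<^bsub>fi_obj B S\<^esub> = y"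
        using x by simp
      finally show "y \<in> tensor_hat ?B' u' S ` carrier (tensor_free ?R' a.L S)"
        using T'.TF.m_closed[OF Gc] unfolding hat' by blast
    qed
    \<comment> \<open>The kernel: clearing denominators turns G into the image of some F. The lift
      of F is killed by some t from the base, so t0 F lies in the ideal of relations before
      localisation. Multiplying by the inverses of t0 and of the power of D recovers G inside the
      ideal.\<close>
    fix G assume G: "G \<in> carrier (tensor_free ?R' a.L S)" and z: "tensor_hat ?B' u' S G = \<zero>\<^bsub>fi_obj ?B' S\<^esub>"
    obtain n :: nat and F where F: "F \<in> carrier T.TF" "G \<otimes>\<^bsub>T'.TF\<^esub> D [^]\<^bsub>T'.TF\<^esub> n = C.change F"
      using clear[OF G] by blast
    note Dn = T'.TF.nat_pow_closed[OF Dc, of n] and En = T'.TF.nat_pow_closed[OF Ec, of n]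
    have "b.frac (T.lift F) \<one>\<^bsub>fi_obj B S\<^esub> = T'.lift G \<otimes>\<^bsub>fi_obj ?B' S\<^esub> T'.lift (D [^]\<^bsub>T'.TF\<^esub> n)"
      unfolding compat[OF F(1), symmetric] F(2)[symmetric] by (rule ring_hom_mult[OF T'.lift_ring_hom G Dn])
    also have "\<dots> = \<zero>\<^bsub>b.L\<^esub>"
      using z ring_hom_closed[OF T'.lift_ring_hom Dn] unfolding hat' B' by simp
    finally obtain t where t: "t \<in> P S" "t \<otimes>\<^bsub>fi_obj B S\<^esub> T.lift F = \<zero>\<^bsub>fi_obj B S\<^esub>"
      using b.frac_zero_iff[of "T.lift F" "\<one>\<^bsub>fi_obj B S\<^esub>"] ring_hom_closed[OF T.lift_ring_hom F(1)] by auto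
    obtain t0 where t0: "t0 \<in> powers R h" "t = fi_str B S t0" using t(1) str_powers[OF S] by blast
    have t0c: "t0 \<in> carrier R" using t0 by blast
    let ?s = "T.sgl t0 T.unit_family"
    have s: "?s \<in> carrier T.TF" by (rule T.sgl_TF[OF t0c T.unit_family])
    have "T.lift (?s \<otimes>\<^bsub>T.TF\<^esub> F) = \<zero>\<^bsub>fi_obj B S\<^esub>"
      unfolding ring_hom_mult[OF T.lift_ring_hom s F(1)] T.lift_sgl'[OF t0c T.unit_family] T.\<mu>_one
      using t t0 T.\<rho>_closed[OF t0c] by simp
    then have "?s \<otimes>\<^bsub>T.TF\<^esub> F \<in> T.I"
      by (rule P4[rule_format, OF S T.TF.m_closed[OF s F(1)], unfolded hat])
    then have "C.change (?s \<otimes>\<^bsub>T.TF\<^esub> F) \<in> T'.I" by (rule C.change_kills_ideal)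
    then have in_I: "T'.sgl (r.frac t0 \<one>\<^bsub>R\<^esub>) T'.unit_family \<otimes>\<^bsub>T'.TF\<^esub> C.change F \<in> T'.I"
      unfolding ring_hom_mult[OF C.change_hom s F(1)] C.change_sgl[OF t0c T.unit_family] C.fam_one .
    let ?q = "r.frac \<one>\<^bsub>R\<^esub> t0" and ?p = "r.frac t0 \<one>\<^bsub>R\<^esub>"
    have q: "?q \<in> carrier ?R'" "?p \<in> carrier ?R'" using t0 t0c by blast+
    note qc = T'.sgl_TF[OF q(1) T'.unit_family] and pc = T'.sgl_TF[OF q(2) T'.unit_family]
    have qp: "T'.sgl ?q T'.unit_family \<otimes>\<^bsub>T'.TF\<^esub> T'.sgl ?p T'.unit_family = \<one>\<^bsub>T'.TF\<^esub>"
      unfolding T'.TF_mult_sgl[OF q T'.unit_family T'.unit_family] T'.M_unit_l[OF T'.unit_family] T'.TF_one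
      using t0 t0c r.frac_self_one by simp
    have DnEn: "D [^]\<^bsub>T'.TF\<^esub> n \<otimes>\<^bsub>T'.TF\<^esub> E [^]\<^bsub>T'.TF\<^esub> n = \<one>\<^bsub>T'.TF\<^esub>"
      using T'.TF.nat_pow_distrib[OF Dc Ec, of n] DE by simp
    note Fc = ring_hom_closed[OF C.change_hom F(1)]
    have "(T'.sgl ?q T'.unit_family \<otimes>\<^bsub>T'.TF\<^esub> E [^]\<^bsub>T'.TF\<^esub> n) \<otimes>\<^bsub>T'.TF\<^esub>
        (T'.sgl ?p T'.unit_family \<otimes>\<^bsub>T'.TF\<^esub> C.change F) =
        (T'.sgl ?q T'.unit_family \<otimes>\<^bsub>T'.TF\<^esub> T'.sgl ?p T'.unit_family) \<otimes>\<^bsub>T'.TF\<^esub>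
        (C.change F \<otimes>\<^bsub>T'.TF\<^esub> E [^]\<^bsub>T'.TF\<^esub> n)"
      using qc pc En Fc by (simp add: T'.TF.m_ac)
    also have "\<dots> = G"
      unfolding qp F(2)[symmetric] using G Dn En DnEn by (simp add: T'.TF.m_assoc)
    finally show "G \<in> tensor_ideal ?R' a.L (fi_str ?B' {1}) S"
      using T'.I.I_l_closed[OF in_I T'.TF.m_closed[OF qc En]] by simp
  qed
  show ?thesis
    unfolding tensor_presentation_def base' A'
    by (intro conjI allI impI ballI) (simp_all add: u'_hom u'_str u'_nat main ker)
qed

section \<open>Monomials\<close>

inductive_set monomials :: "'a ring \<Rightarrow> 'a set \<Rightarrow> 'a set" for A X where
  one: "\<one>\<^bsub>A\<^esub> \<in> monomials A X"
| mult: "x \<in> X \<Longrightarrow> m \<in> monomials A X \<Longrightarrow> x \<otimes>\<^bsub>A\<^esub> m \<in> monomials A X"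

definition finitely_generated_algebra :: "'k ring \<Rightarrow> 'a ring \<Rightarrow> ('k \<Rightarrow> 'a) \<Rightarrow> bool" where
  "finitely_generated_algebra K A \<iota> \<longleftrightarrow>
     (\<exists>X\<subseteq>carrier A. finite X \<and> carrier A \<subseteq> lspan K A \<iota> (monomials A X))"

lemma monomials_subset:
  fixes A :: "'a ring"
  assumes "cring A" "X \<subseteq> carrier A"
  shows "monomials A X \<subseteq> carrier A"
proof
  interpret A: cring A by fact
  fix m assume "m \<in> monomials A X"
  then show "m \<in> carrier A" by induction (use assms(2) in auto)
qed

lemma monomials_incl:
  assumes "cring A" "X \<subseteq> carrier A" "x \<in> X"
  shows "x \<in> monomials A X"
proof -
  interpret A: cring A by fact
  have "x \<otimes>\<^bsub>A\<^esub> \<one>\<^bsub>A\<^esub> \<in> monomials A X" using assms(3) by (intro monomials.intros)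
  then show ?thesis using assms(2,3) by (simp add: subset_iff)
qed

lemma monomials_mult:
  assumes "cring A" "X \<subseteq> carrier A" "m \<in> monomials A X" "n \<in> monomials A X"
  shows "m \<otimes>\<^bsub>A\<^esub> n \<in> monomials A X"
proof -
  interpret A: cring A by fact
  have c: "n \<in> carrier A" using monomials_subset assms by blast
  show ?thesis using assms(3)
  proof induction
    case one
    then show ?case using assms(4) c by simp
  next
    case (mult x m)
    have "x \<in> carrier A" "m \<in> carrier A" using mult monomials_subset[OF assms(1,2)] assms(2) by blast+
    then show ?case using mult monomials.mult[of x X "m \<otimes>\<^bsub>A\<^esub> n" A] c by (simp add: A.m_assoc)
  qed
qed

text \<open>The span of the monomials is already a subring, because products of monomials are
  monomials.\<close>

lemma (in ring_extension) generate_ring_span: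
  assumes X: "X \<subseteq> carrier A"
  shows "generate_ring A (\<iota> ` carrier K \<union> X) \<subseteq> span (monomials A X)"
proof
  note mc = monomials_subset[OF A.is_cring X]
  fix y assume "y \<in> generate_ring A (\<iota> ` carrier K \<union> X)"
  then show "y \<in> span (monomials A X)"
  proof induction
    case one
    show ?case by (rule span_incl[OF monomials.one mc])
  next
    case (incl y)
    then consider k where "k \<in> carrier K" "y = \<iota> k" | "y \<in> X" by blast
    then show ?case
    proof cases
      case 1
      then show ?thesis using span_scale[OF span_incl[OF monomials.one mc] mc 1(1)] \<iota>_closed by simp
    next
      case 2
      then show ?thesis using span_incl[OF monomials_incl[OF A.is_cring X] mc] by blast
    qed
  next
    case (a_inv y)
    then show ?case using span_minus mc by blast
  next
    case (eng_add y z)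
    then show ?case using span_add mc by blast
  next
    case (eng_mult y z)
    show ?case
      by (rule span_prod[OF eng_mult(3,4) mc mc mc]) (rule span_incl[OF monomials_mult[OF A.is_cring X] mc])
  qed
qed

text \<open>One further generator 1/x suffices, since a/x^n is the n-th power of 1/x times the image
  of a.\<close>

lemma fg_localisation:
  assumes ext: "ring_extension K A \<iota>" and x: "x \<in> carrier A" and fg: "finitely_generated_algebra K A \<iota>"
  defines "M \<equiv> powers A x"
  shows "finitely_generated_algebra K (localisation A M) (\<lambda>k. loc_frac A M (\<iota> k) \<one>\<^bsub>A\<^esub>)"
proof -
  interpret ring_extension K A \<iota> by fact
  interpret L: localised A M unfolding M_def by (rule localised_powers[OF A.is_cring x])
  interpret L': ring_extension K L.L "\<lambda>k. L.frac (\<iota> k) \<one>\<^bsub>A\<^esub>"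
    using ring_hom_trans[OF hom L.frac_hom]
    by unfold_locales (simp add: comp_def)
  obtain X where X: "X \<subseteq> carrier A" "finite X" "carrier A \<subseteq> span (monomials A X)"
    using fg unfolding finitely_generated_algebra_def by blast
  note mc = monomials_subset[OF A.is_cring X(1)]
  have xM: "x \<in> M" unfolding M_def by (rule base_in_powers[OF A.is_cring x])
  let ?f = "\<lambda>y. L.frac y \<one>\<^bsub>A\<^esub>"
  let ?q = "L.frac \<one>\<^bsub>A\<^esub> x"
  let ?X = "insert ?q (?f ` X)"
  have X'c: "?X \<subseteq> carrier L.L" using X(1) xM by auto
  note mc' = monomials_subset[OF L.L.is_cring X'c]
  have m1: "?f m \<in> monomials L.L ?X" if "m \<in> monomials A X" for m
    using that
  proof induction
    case one
    show ?case using monomials.one[of L.L ?X] unfolding L.L_one .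
  next
    case (mult y m)
    then have "?f (y \<otimes>\<^bsub>A\<^esub> m) = ?f y \<otimes>\<^bsub>L.L\<^esub> ?f m" using X(1) mc by (subst L.frac_mult) auto
    then show ?case using mult by (auto intro: monomials.mult)
  qed
  have s1: "?f y \<in> L'.span (monomials L.L ?X)" if "y \<in> span (monomials A X)" for y
    using that
  proof induction
    case zero
    show ?case using lspan.zero[of L.L K "\<lambda>k. L.frac (\<iota> k) \<one>\<^bsub>A\<^esub>" "monomials L.L ?X"] unfolding L.L_zero .
  next
    case (step k m y)
    have c: "m \<in> carrier A" "y \<in> carrier A" "\<iota> k \<in> carrier A" using step mc span_carr \<iota>_closed by auto
    then have "?f (\<iota> k \<otimes>\<^bsub>A\<^esub> m \<oplus>\<^bsub>A\<^esub> y) = ?f (\<iota> k) \<otimes>\<^bsub>L.L\<^esub> ?f m \<oplus>\<^bsub>L.L\<^esub> ?f y" by simp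
    then show ?case using step m1 by (auto intro: lspan.step)
  qed
  have q: "?q [^]\<^bsub>L.L\<^esub> n \<in> monomials L.L ?X" for n :: nat
  proof (induction n)
    case 0
    show ?case by (simp add: monomials.one)
  next
    case (Suc n)
    have "?q [^]\<^bsub>L.L\<^esub> Suc n = ?q \<otimes>\<^bsub>L.L\<^esub> ?q [^]\<^bsub>L.L\<^esub> n" using xM by (simp add: L.L.m_comm)
    then show ?case using Suc by (auto intro: monomials.mult)
  qed
  have "y \<in> L'.span (monomials L.L ?X)" if y: "y \<in> carrier L.L" for y
  proof -
    obtain a s where as: "a \<in> carrier A" "s \<in> M" "y = L.frac a s" using y by (rule L.carr_fracE)
    obtain n :: nat where n: "s = x [^]\<^bsub>A\<^esub> n" using as(2) unfolding M_def powers_def by blast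
    have "y = ?q [^]\<^bsub>L.L\<^esub> n \<otimes>\<^bsub>L.L\<^esub> ?f a" using as xM n by (simp add: L.frac_pow)
    also have "\<dots> \<in> L'.span (monomials L.L ?X)"
    proof (rule L'.span_mult[OF _ mc' _ _ mc'])
      show "?f a \<in> L'.span (monomials L.L ?X)" using s1 X(3) as(1) by blast
      show "?q [^]\<^bsub>L.L\<^esub> n \<in> carrier L.L" using xM by simp
      show "?q [^]\<^bsub>L.L\<^esub> n \<otimes>\<^bsub>L.L\<^esub> m \<in> L'.span (monomials L.L ?X)" if "m \<in> monomials L.L ?X" for m
        by (rule L'.span_incl[OF monomials_mult[OF L.L.is_cring X'c q that] mc'])
    qed
    finally show ?thesis .
  qed
  then show ?thesis unfolding finitely_generated_algebra_def using X'c X(2) by (intro exI[of _ ?X]) auto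
qed

text \<open>Scalars from K act through R, so what spans over K also spans over R.\<close>

lemma fg_over_extension:
  assumes "finitely_generated_algebra K A \<kappa>"
    and "\<And>k. k \<in> carrier K \<Longrightarrow> \<exists>r\<in>carrier R. \<iota> r = \<kappa> k"
  shows "finitely_generated_algebra R A \<iota>"
proof -
  have "y \<in> lspan R A \<iota> Y" if "y \<in> lspan K A \<kappa> Y" for y Y
    using that
  proof induction
    case (step k x y)
    then obtain r where "r \<in> carrier R" "\<iota> r = \<kappa> k" using assms(2) by blast
    then show ?case using lspan.step[of r R x Y y A \<iota>] step by simp
  qed (rule lspan.zero)
  then show ?thesis using assms(1) unfolding finitely_generated_algebra_def by blast
qed

text \<open>Monomials are indexed by the positive integers with prime factors in a fixed finite set, one prime
  for each generator. The usual order of the integers is then a monomial order, and Dickson's lemma is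
  a statement on divisibility.\<close>

lemma nat_mono_subseq:
  fixes a :: "nat \<Rightarrow> nat"
  shows "\<exists>\<phi>::nat \<Rightarrow> nat. strict_mono \<phi> \<and> (\<forall>i j. i \<le> j \<longrightarrow> a (\<phi> i) \<le> a (\<phi> j))"
proof -
  obtain f :: "nat \<Rightarrow> nat" where f: "strict_mono f" "monoseq (\<lambda>n. a (f n))" using seq_monosub by blast
  show ?thesis
  proof (cases "\<forall>m n. m \<le> n \<longrightarrow> a (f m) \<le> a (f n)")
    case True
    then show ?thesis using f(1) by (intro exI[of _ f]) simp
  next
    case False
    then have dec: "\<And>m n. m \<le> n \<Longrightarrow> a (f n) \<le> a (f m)" using f(2) unfolding monoseq_def by blast
    obtain N where N: "\<And>n. a (f N) \<le> a (f n)"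
      using ex_has_least_nat[of "\<lambda>_. True" 0 "\<lambda>n. a (f n)"] by blast
    \<comment> \<open>A nonincreasing sequence of naturals is constant from the place N of its least
      value on; starting there makes it nondecreasing.\<close>
    have "a (f (n + N)) = a (f N)" for n using N dec[of N "n + N"] by (simp add: le_antisym)
    then show ?thesis using f(1)
      by (intro exI[of _ "\<lambda>n. f (n + N)"]) (auto simp: strict_mono_def)
  qed
qed

text \<open>Passing to a subsequence for one prime at a time makes the exponents at all primes of Q
  nondecreasing. Primes outside Q do not occur, so comparing exponents gives divisibility.\<close>

lemma dickson:
  fixes a :: "nat \<Rightarrow> nat" and Q :: "nat set"
  assumes "finite Q" "\<And>k. a k > 0" "\<And>k p. Factorial_Ring.prime p \<Longrightarrow> p dvd a k \<Longrightarrow> p \<in> Q"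
  shows "\<exists>\<phi>::nat \<Rightarrow> nat. strict_mono \<phi> \<and> (\<forall>i j. i \<le> j \<longrightarrow> a (\<phi> i) dvd a (\<phi> j))"
proof -
  have "\<exists>\<phi>::nat \<Rightarrow> nat. strict_mono \<phi> \<and> (\<forall>p\<in>Q. \<forall>i j. i \<le> j \<longrightarrow> multiplicity p (a (\<phi> i)) \<le> multiplicity p (a (\<phi> j)))"
    using assms(1)
  proof (induction Q rule: finite_induct)
    case empty
    show ?case by (intro exI[of _ id]) (auto simp: strict_mono_def)
  next
    case (insert q Q)
    then obtain \<phi> :: "nat \<Rightarrow> nat" where \<phi>: "strict_mono \<phi>"
      "\<And>p i j. p \<in> Q \<Longrightarrow> i \<le> j \<Longrightarrow> multiplicity p (a (\<phi> i)) \<le> multiplicity p (a (\<phi> j))" by blast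
    obtain \<psi> :: "nat \<Rightarrow> nat" where \<psi>: "strict_mono \<psi>"
      "\<And>i j. i \<le> j \<Longrightarrow> multiplicity q (a (\<phi> (\<psi> i))) \<le> multiplicity q (a (\<phi> (\<psi> j)))"
      using nat_mono_subseq[of "\<lambda>k. multiplicity q (a (\<phi> k))"] by blast
    have "\<psi> i \<le> \<psi> j" if "i \<le> j" for i j using \<psi>(1) that by (simp add: strict_mono_less_eq)
    then show ?case using \<phi> \<psi>
      by (intro exI[of _ "\<lambda>n. \<phi> (\<psi> n)"]) (auto simp: strict_mono_def)
  qed
  then obtain \<phi> :: "nat \<Rightarrow> nat" where \<phi>: "strict_mono \<phi>"
    "\<And>p i j. p \<in> Q \<Longrightarrow> i \<le> j \<Longrightarrow> multiplicity p (a (\<phi> i)) \<le> multiplicity p (a (\<phi> j))" by blast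
  have "a (\<phi> i) dvd a (\<phi> j)" if "i \<le> j" for i j
  proof (rule multiplicity_le_imp_dvd)
    show "a (\<phi> i) \<noteq> 0" using assms(2) by (metis less_numeral_extra(3))
    fix p :: nat assume p: "Factorial_Ring.prime p"
    show "multiplicity p (a (\<phi> i)) \<le> multiplicity p (a (\<phi> j))"
      using \<phi>(2)[OF _ that] assms(3)[OF p] not_dvd_imp_multiplicity_0[of p "a (\<phi> i)"] by fastforce
  qed
  then show ?thesis using \<phi>(1) by blast
qed

text \<open>Despite the name, the monomials \<open>e n\<close> only span A; their linear relations
  are the object of study. The axioms retain what the arguments on leading terms use: products,
  exact quotients, Dickson's property, and multiplicativity of e.\<close>

locale monomial_basis = ring_extension K A \<iota>
  for K :: "'k ring" and A :: "'a ring" and \<iota> :: "'k \<Rightarrow> 'a" +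
  fixes I :: "nat set" and e :: "nat \<Rightarrow> 'a"
  assumes I_pos: "n \<in> I \<Longrightarrow> n > 0"
    and I_div: "\<lbrakk>m \<in> I; n \<in> I; m dvd n\<rbrakk> \<Longrightarrow> n div m \<in> I"
    and I_mult: "\<lbrakk>m \<in> I; n \<in> I\<rbrakk> \<Longrightarrow> m * n \<in> I"
    and I_dickson: "(\<And>k. a k \<in> I) \<Longrightarrow>
      \<exists>\<phi>::nat \<Rightarrow> nat. strict_mono \<phi> \<and> (\<forall>i j. i \<le> j \<longrightarrow> a (\<phi> i) dvd a (\<phi> j))"
    and e_carr: "n \<in> I \<Longrightarrow> e n \<in> carrier A"
    and e_mult: "\<lbrakk>m \<in> I; n \<in> I\<rbrakk> \<Longrightarrow> e (m * n) = e m \<otimes>\<^bsub>A\<^esub> e n"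
    and e_span: "carrier A \<subseteq> lspan K A \<iota> (e ` I)"

lemma fg_monomial_basis:
  assumes ext: "ring_extension K A \<iota>" and fg: "finitely_generated_algebra K A \<iota>"
  shows "\<exists>I e. monomial_basis K A \<iota> I e"
proof -
  interpret ring_extension K A \<iota> by fact
  obtain X where X: "X \<subseteq> carrier A" "finite X" "carrier A \<subseteq> span (monomials A X)"
    using fg unfolding finitely_generated_algebra_def by blast
  obtain Q where Q: "finite Q" "card Q = card X" "Q \<subseteq> {p::nat. Factorial_Ring.prime p}"
    using infinite_arbitrarily_large[OF primes_infinite] by metis
  obtain x where x: "bij_betw x Q X" using finite_same_card_bij[OF Q(1) X(2) Q(2)] by blast
  have xc: "x p \<in> carrier A" if "p \<in> Q" for p using x X(1) that unfolding bij_betw_def by blast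
  have Qp: "prime_elem p" "Factorial_Ring.prime p" if "p \<in> Q" for p using Q(3) that by auto
  define I where "I = {n::nat. n > 0 \<and> (\<forall>p. Factorial_Ring.prime p \<and> p dvd n \<longrightarrow> p \<in> Q)}"
  \<comment> \<open>Multiplicities of a prime add under multiplication of integers, which makes e
    multiplicative on I.\<close>
  define e where "e n = (\<Otimes>\<^bsub>A\<^esub>p\<in>Q. x p [^]\<^bsub>A\<^esub> multiplicity p n)" for n
  have I_mult: "m * n \<in> I" if "m \<in> I" "n \<in> I" for m n
    using that unfolding I_def by (auto simp: prime_dvd_mult_iff)
  have e_mult: "e (m * n) = e m \<otimes>\<^bsub>A\<^esub> e n" if "m \<in> I" "n \<in> I" for m n
  proof -
    have "e (m * n) = (\<Otimes>\<^bsub>A\<^esub>p\<in>Q. x p [^]\<^bsub>A\<^esub> multiplicity p m \<otimes>\<^bsub>A\<^esub> x p [^]\<^bsub>A\<^esub> multiplicity p n)"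
      unfolding e_def
    proof (rule A.finprod_cong'[OF refl])
      fix p assume p: "p \<in> Q"
      have "multiplicity p (m * n) = multiplicity p m + multiplicity p n"
        using that Qp(1)[OF p] by (intro prime_elem_multiplicity_mult_distrib) (auto simp: I_def)
      then show "x p [^]\<^bsub>A\<^esub> multiplicity p (m * n) = x p [^]\<^bsub>A\<^esub> multiplicity p m \<otimes>\<^bsub>A\<^esub> x p [^]\<^bsub>A\<^esub> multiplicity p n"
        using xc[OF p] by (simp add: A.nat_pow_mult)
    qed (use xc in auto)
    also have "\<dots> = e m \<otimes>\<^bsub>A\<^esub> e n" unfolding e_def using xc by (intro A.finprod_multf) auto
    finally show ?thesis .
  qed
  have e1: "e 1 = \<one>\<^bsub>A\<^esub>" unfolding e_def by (intro A.finprod_one_eqI) simp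
  have I1: "1 \<in> I" unfolding I_def by auto
  have ep: "e p = x p" "p \<in> I" if p: "p \<in> Q" for p
  proof -
    have "e p = (\<Otimes>\<^bsub>A\<^esub>q\<in>Q. if p = q then x q else \<one>\<^bsub>A\<^esub>)"
      unfolding e_def using p xc Qp
      by (intro A.finprod_cong') (auto simp: prime_multiplicity_other multiplicity_self)
    also have "\<dots> = x p" using p Q(1) xc by (intro A.finprod_singleton) auto
    finally show "e p = x p" .
    show "p \<in> I" using p Qp[OF p] primes_dvd_imp_eq[OF _ Qp(2)[OF p]] unfolding I_def by (auto simp: prime_gt_0_nat)
  qed
  have mon: "m \<in> e ` I" if "m \<in> monomials A X" for m
    using that
  proof induction
    case one
    show ?case using e1 I1 by (metis imageI)
  next
    case (mult y m)
    then obtain p n where "p \<in> Q" "y = x p" "n \<in> I" "m = e n" using x unfolding bij_betw_def by blast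
    then have "y \<otimes>\<^bsub>A\<^esub> m = e (p * n)" "p * n \<in> I" using ep e_mult I_mult by simp_all
    then show ?case by blast
  qed
  have "monomial_basis K A \<iota> I e"
  proof (intro monomial_basis.intro monomial_basis_axioms.intro ext)
    show "n > 0" if "n \<in> I" for n using that unfolding I_def by simp
    show "n div m \<in> I" if mn: "m \<in> I" "n \<in> I" "m dvd n" for m n
    proof -
      obtain k where k: "n = m * k" using mn(3) by blast
      then have "n div m = k" "k > 0" using mn(1,2) unfolding I_def by auto
      then show ?thesis using mn(2) k unfolding I_def by auto
    qed
    show "m * n \<in> I" if "m \<in> I" "n \<in> I" for m n by (rule I_mult[OF that])
    show "\<exists>\<phi>::nat \<Rightarrow> nat. strict_mono \<phi> \<and> (\<forall>i j. i \<le> j \<longrightarrow> a (\<phi> i) dvd a (\<phi> j))" if "\<And>k. a k \<in> I" for a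
    proof -
      have "a k > 0" "\<And>p. Factorial_Ring.prime p \<Longrightarrow> p dvd a k \<Longrightarrow> p \<in> Q" for k
        using that[of k] unfolding I_def by blast+
      then show ?thesis by (intro dickson[OF Q(1)])
    qed
    show "e n \<in> carrier A" for n unfolding e_def using xc by (intro A.finprod_closed) auto
    show "e (m * n) = e m \<otimes>\<^bsub>A\<^esub> e n" if "m \<in> I" "n \<in> I" for m n by (rule e_mult[OF that])
    show "carrier A \<subseteq> span (e ` I)" using X(3) lspan_mono mon by (meson subsetD subsetI)
  qed
  then show ?thesis by blast
qed

text \<open>A derivation in \<open>lspan\<close> may use a several times; its occurrences are
  collected into one coefficient.\<close>

lemma (in ring_extension) span_insertE:
  assumes "z \<in> span (insert a X)" "a \<in> carrier A" "X \<subseteq> carrier A"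
  obtains k y where "k \<in> carrier K" "y \<in> span X" "z = \<iota> k \<otimes>\<^bsub>A\<^esub> a \<oplus>\<^bsub>A\<^esub> y"
proof -
  have "\<exists>k\<in>carrier K. \<exists>y\<in>span X. z = \<iota> k \<otimes>\<^bsub>A\<^esub> a \<oplus>\<^bsub>A\<^esub> y"
    using assms(1)
  proof induction
    case zero
    show ?case using assms(2) lspan.zero[of A K \<iota> X]
      by (intro bexI[of _ "\<zero>\<^bsub>K\<^esub>"] bexI[of _ "\<zero>\<^bsub>A\<^esub>"]) (auto simp: \<iota>_simps)
  next
    case (step l x z)
    then obtain k y where ky: "k \<in> carrier K" "y \<in> span X" "z = \<iota> k \<otimes>\<^bsub>A\<^esub> a \<oplus>\<^bsub>A\<^esub> y" by blast
    have yc: "y \<in> carrier A" using span_carr[OF ky(2) assms(3)] .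
    show ?case
    proof (cases "x = a")
      case True
      have "\<iota> l \<otimes>\<^bsub>A\<^esub> x \<oplus>\<^bsub>A\<^esub> z = \<iota> (l \<oplus>\<^bsub>K\<^esub> k) \<otimes>\<^bsub>A\<^esub> a \<oplus>\<^bsub>A\<^esub> y"
        using True ky step(1) assms(2) yc \<iota>_closed by (simp add: \<iota>_simps A.l_distr A.a_assoc)
      then show ?thesis using ky step(1) by (metis K.a_closed)
    next
      case False
      then have x: "x \<in> X" using step(2) by blast
      then have "\<iota> l \<otimes>\<^bsub>A\<^esub> x \<oplus>\<^bsub>A\<^esub> z = \<iota> k \<otimes>\<^bsub>A\<^esub> a \<oplus>\<^bsub>A\<^esub> (\<iota> l \<otimes>\<^bsub>A\<^esub> x \<oplus>\<^bsub>A\<^esub> y)"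
        using ky step(1) assms(2,3) yc \<iota>_closed by (simp add: A.a_lcomm subset_iff)
      then show ?thesis using ky lspan.step[OF step(1) x ky(2)] by metis
    qed
  qed
  then show thesis using that by blast
qed

section \<open>Spans of monomials below a bound\<close>

context monomial_basis
begin

text \<open>These spans replace the notion of degree:
  \<open>\<iota> c \<otimes> e n \<in> low n\<close> says that c is the leading coefficient of a
  linear relation with leading monomial n.\<close>

definition low where "low n = span (e ` {k \<in> I. k < n})"

lemma low_set_carr: "e ` {k \<in> I. k < n} \<subseteq> carrier A"
  using e_carr by auto

lemma low_carr: "y \<in> low n \<Longrightarrow> y \<in> carrier A"
  unfolding low_def using span_carr low_set_carr by blast

lemma low_add: "y \<in> low n \<Longrightarrow> z \<in> low n \<Longrightarrow> y \<oplus>\<^bsub>A\<^esub> z \<in> low n"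
  and low_minus: "y \<in> low n \<Longrightarrow> \<ominus>\<^bsub>A\<^esub> y \<in> low n"
  and low_scale: "y \<in> low n \<Longrightarrow> k \<in> carrier K \<Longrightarrow> \<iota> k \<otimes>\<^bsub>A\<^esub> y \<in> low n"
  and low_zero: "\<zero>\<^bsub>A\<^esub> \<in> low n"
  unfolding low_def
  by (rule span_add[OF _ _ low_set_carr] span_minus[OF _ low_set_carr] span_scale[OF _ low_set_carr] lspan.zero;
    assumption)+

text \<open>The usual order is a monomial order: multiplying by the positive integer q preserves
  strict inequalities.\<close>

lemma low_mult:
  assumes y: "y \<in> low m" and q: "q \<in> I"
  shows "e q \<otimes>\<^bsub>A\<^esub> y \<in> low (m * q)"
proof -
  have "e q \<otimes>\<^bsub>A\<^esub> y \<in> span (e ` {k \<in> I. k < m * q})"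
  proof (rule span_mult[OF y[unfolded low_def] low_set_carr e_carr[OF q] _ low_set_carr])
    fix x assume "x \<in> e ` {k \<in> I. k < m}"
    then obtain k where k: "k \<in> I" "k < m" "x = e k" by blast
    then have "e q \<otimes>\<^bsub>A\<^esub> x = e (k * q)" using e_mult[OF k(1) q] A.m_comm e_carr q by simp
    moreover have "k * q \<in> {k \<in> I. k < m * q}" using k I_mult q I_pos[OF q] by simp
    ultimately show "e q \<otimes>\<^bsub>A\<^esub> x \<in> span (e ` {k \<in> I. k < m * q})" using span_incl[OF _ low_set_carr] by simp
  qed
  then show ?thesis unfolding low_def .
qed

lemma low_SucE:
  assumes "x \<in> low (Suc n)" "n \<in> I"
  obtains k y where "k \<in> carrier K" "y \<in> low n" "x = \<iota> k \<otimes>\<^bsub>A\<^esub> e n \<oplus>\<^bsub>A\<^esub> y"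
proof -
  have "e ` {k \<in> I. k < Suc n} = insert (e n) (e ` {k \<in> I. k < n})" using assms(2) by (auto simp: less_Suc_eq)
  then have "x \<in> span (insert (e n) (e ` {k \<in> I. k < n}))" using assms(1) unfolding low_def by simp
  then show thesis
    by (rule span_insertE[OF _ e_carr[OF assms(2)] low_set_carr]) (rule that[unfolded low_def])
qed

lemma low_Suc_notin: "n \<notin> I \<Longrightarrow> low (Suc n) = low n"
proof -
  assume "n \<notin> I"
  then have "{k \<in> I. k < Suc n} = {k \<in> I. k < n}" by (auto simp: less_Suc_eq)
  then show ?thesis unfolding low_def by simp
qed

lemma carr_low:
  assumes "x \<in> carrier A"
  obtains n where "x \<in> low n"
proof -
  have "x \<in> span (e ` I)" using e_span assms by blast
  from lspan_finite[OF this] obtain X where X: "X \<subseteq> e ` I" "finite X" "x \<in> span X" by blast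
  then obtain N where N: "N \<subseteq> I" "finite N" "X = e ` N" by (metis finite_subset_image)
  \<comment> \<open>For empty N the value of \<open>Max\<close> is unspecified, but then X is empty
    too.\<close>
  then have "X \<subseteq> e ` {k \<in> I. k < Suc (Max N)}" by (auto simp: less_Suc_eq_le)
  then have "x \<in> low (Suc (Max N))" unfolding low_def by (rule lspan_mono[OF X(3)])
  then show thesis by (rule that)
qed

lemma low_0: "low 0 = {\<zero>\<^bsub>A\<^esub>}"
proof -
  have "y = \<zero>\<^bsub>A\<^esub>" if "y \<in> span {}" for y using that by cases auto
  moreover have "low 0 = span {}" unfolding low_def by simp
  ultimately show ?thesis using low_zero[of 0] by blast
qed

section \<open>The basis theorem\<close>

text \<open>The leading coefficients of J at n. Since the monomials may be dependent, an element can
  have several leading terms; every way of writing it counts, including the ways of writing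
  0.\<close>

definition lead where
  "lead J n = {c \<in> carrier K. \<exists>y\<in>low n. \<iota> c \<otimes>\<^bsub>A\<^esub> e n \<oplus>\<^bsub>A\<^esub> y \<in> J}"

lemma lead_ideal:
  assumes J: "ideal J A" and n: "n \<in> I"
  shows "ideal (lead J n) K"
proof -
  interpret J: ideal J A by fact
  have en: "e n \<in> carrier A" by (rule e_carr[OF n])
  have scale: "k \<otimes>\<^bsub>K\<^esub> c \<in> lead J n" if c: "c \<in> lead J n" and k: "k \<in> carrier K" for c k
  proof -
    obtain y where y: "c \<in> carrier K" "y \<in> low n" "\<iota> c \<otimes>\<^bsub>A\<^esub> e n \<oplus>\<^bsub>A\<^esub> y \<in> J" using c unfolding lead_def by blast
    have "\<iota> k \<otimes>\<^bsub>A\<^esub> (\<iota> c \<otimes>\<^bsub>A\<^esub> e n \<oplus>\<^bsub>A\<^esub> y) = \<iota> (k \<otimes>\<^bsub>K\<^esub> c) \<otimes>\<^bsub>A\<^esub> e n \<oplus>\<^bsub>A\<^esub> \<iota> k \<otimes>\<^bsub>A\<^esub> y"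
      using y(1) k en low_carr[OF y(2)] \<iota>_closed by (simp add: \<iota>_simps A.r_distr A.m_assoc)
    then have "\<iota> (k \<otimes>\<^bsub>K\<^esub> c) \<otimes>\<^bsub>A\<^esub> e n \<oplus>\<^bsub>A\<^esub> \<iota> k \<otimes>\<^bsub>A\<^esub> y \<in> J" using J.I_l_closed[OF y(3) \<iota>_closed[OF k]] by simp
    then show ?thesis using low_scale[OF y(2) k] y(1) k unfolding lead_def by blast
  qed
  show ?thesis
  proof (rule idealI)
    show "subgroup (lead J n) (add_monoid K)"
    proof (rule K.add.subgroupI)
      show "lead J n \<subseteq> carrier K" unfolding lead_def by blast
      have "\<iota> \<zero>\<^bsub>K\<^esub> \<otimes>\<^bsub>A\<^esub> e n \<oplus>\<^bsub>A\<^esub> \<zero>\<^bsub>A\<^esub> \<in> J" using en J.zero_closed by (simp add: \<iota>_simps)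
      then show "lead J n \<noteq> {}" unfolding lead_def using low_zero by blast
      fix c assume c: "c \<in> lead J n"
      then have cc: "c \<in> carrier K" unfolding lead_def by blast
      have "\<ominus>\<^bsub>K\<^esub> c = (\<ominus>\<^bsub>K\<^esub> \<one>\<^bsub>K\<^esub>) \<otimes>\<^bsub>K\<^esub> c" using cc by (simp add: K.l_minus)
      then show "\<ominus>\<^bsub>K\<^esub> c \<in> lead J n" using scale[OF c, of "\<ominus>\<^bsub>K\<^esub> \<one>\<^bsub>K\<^esub>"] by simp
      fix d assume d: "d \<in> lead J n"
      obtain y where y: "y \<in> low n" "\<iota> c \<otimes>\<^bsub>A\<^esub> e n \<oplus>\<^bsub>A\<^esub> y \<in> J" using c unfolding lead_def by blast
      obtain z where z: "d \<in> carrier K" "z \<in> low n" "\<iota> d \<otimes>\<^bsub>A\<^esub> e n \<oplus>\<^bsub>A\<^esub> z \<in> J" using d unfolding lead_def by blast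
      have "(\<iota> c \<otimes>\<^bsub>A\<^esub> e n \<oplus>\<^bsub>A\<^esub> y) \<oplus>\<^bsub>A\<^esub> (\<iota> d \<otimes>\<^bsub>A\<^esub> e n \<oplus>\<^bsub>A\<^esub> z) = \<iota> (c \<oplus>\<^bsub>K\<^esub> d) \<otimes>\<^bsub>A\<^esub> e n \<oplus>\<^bsub>A\<^esub> (y \<oplus>\<^bsub>A\<^esub> z)"
        using cc z(1) en low_carr[OF y(1)] low_carr[OF z(2)] \<iota>_closed
        by (simp add: \<iota>_simps A.l_distr A.a_ac)
      then have "\<iota> (c \<oplus>\<^bsub>K\<^esub> d) \<otimes>\<^bsub>A\<^esub> e n \<oplus>\<^bsub>A\<^esub> (y \<oplus>\<^bsub>A\<^esub> z) \<in> J" using J.a_closed[OF y(2) z(3)] by simp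
      then show "c \<oplus>\<^bsub>K\<^esub> d \<in> lead J n" using low_add[OF y(1) z(2)] cc z(1) unfolding lead_def by blast
    qed
    fix c k assume c: "c \<in> lead J n" and k: "k \<in> carrier K"
    show "k \<otimes>\<^bsub>K\<^esub> c \<in> lead J n" by (rule scale[OF c k])
    moreover have "c \<in> carrier K" using c unfolding lead_def by blast
    ultimately show "c \<otimes>\<^bsub>K\<^esub> k \<in> lead J n" using k by (simp add: K.m_comm)
  qed (rule K.ring_axioms)
qed

text \<open>Multiplying by the monomial of the quotient moves the leading term from m to n and keeps
  its coefficient.\<close>

lemma lead_dvd:
  assumes J: "ideal J A" and "m \<in> I" "n \<in> I" "m dvd n"
  shows "lead J m \<subseteq> lead J n"
proof
  interpret J: ideal J A by fact
  fix c assume "c \<in> lead J m"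
  then obtain y where y: "c \<in> carrier K" "y \<in> low m" "\<iota> c \<otimes>\<^bsub>A\<^esub> e m \<oplus>\<^bsub>A\<^esub> y \<in> J" unfolding lead_def by blast
  define q where "q = n div m"
  have q: "q \<in> I" "n = m * q" unfolding q_def using assms(2-4) I_div by auto
  have "e q \<otimes>\<^bsub>A\<^esub> (\<iota> c \<otimes>\<^bsub>A\<^esub> e m \<oplus>\<^bsub>A\<^esub> y) = \<iota> c \<otimes>\<^bsub>A\<^esub> e n \<oplus>\<^bsub>A\<^esub> e q \<otimes>\<^bsub>A\<^esub> y"
    unfolding q(2) e_mult[OF assms(2) q(1)]
    using \<iota>_closed[OF y(1)] low_carr[OF y(2)] e_carr[OF q(1)] e_carr[OF assms(2)]
    by (simp add: A.r_distr A.m_ac)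
  then have "\<iota> c \<otimes>\<^bsub>A\<^esub> e n \<oplus>\<^bsub>A\<^esub> e q \<otimes>\<^bsub>A\<^esub> y \<in> J" using J.I_l_closed[OF y(3) e_carr[OF q(1)]] by simp
  then show "c \<in> lead J n" using y(1) low_mult[OF y(2) q(1)] unfolding lead_def q(2) by blast
qed

lemma lead_mono: "J \<subseteq> J' \<Longrightarrow> lead J n \<subseteq> lead J' n"
  unfolding lead_def by blast

text \<open>Reduction of leading terms: from an element of J' one subtracts an element of J with the
  same leading term, and the difference, still in J', involves only smaller monomials.\<close>

lemma lead_determines:
  assumes J: "ideal J A" and J': "ideal J' A" and sub: "J \<subseteq> J'"
    and lead: "\<And>n. n \<in> I \<Longrightarrow> lead J' n \<subseteq> lead J n"
  shows "J' \<subseteq> J"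
proof
  interpret J: ideal J A by fact
  interpret J': ideal J' A by fact
  have claim: "x \<in> J" if "x \<in> J'" "x \<in> low n" for x n
    using that
  proof (induction n arbitrary: x)
    case 0
    then show ?case using low_0 J.zero_closed by simp
  next
    case (Suc n)
    show ?case
    proof (cases "n \<in> I")
      case False
      then show ?thesis using Suc low_Suc_notin by simp
    next
      case True
      obtain c y where cy: "c \<in> carrier K" "y \<in> low n" "x = \<iota> c \<otimes>\<^bsub>A\<^esub> e n \<oplus>\<^bsub>A\<^esub> y"
        using low_SucE[OF Suc.prems(2) True] by metis
      then have "c \<in> lead J' n" using Suc.prems(1) unfolding lead_def by blast
      then have "c \<in> lead J n" using lead[OF True] by blast
      then obtain z where z: "z \<in> low n" "\<iota> c \<otimes>\<^bsub>A\<^esub> e n \<oplus>\<^bsub>A\<^esub> z \<in> J" unfolding lead_def by blast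
      let ?w = "\<iota> c \<otimes>\<^bsub>A\<^esub> e n"
      have car: "?w \<in> carrier A" "y \<in> carrier A" "z \<in> carrier A"
        using \<iota>_closed[OF cy(1)] e_carr[OF True] low_carr cy(2) z(1) by auto
      have e: "y \<oplus>\<^bsub>A\<^esub> \<ominus>\<^bsub>A\<^esub> z = x \<oplus>\<^bsub>A\<^esub> \<ominus>\<^bsub>A\<^esub> (?w \<oplus>\<^bsub>A\<^esub> z)"
      proof -
        have "x \<oplus>\<^bsub>A\<^esub> \<ominus>\<^bsub>A\<^esub> (?w \<oplus>\<^bsub>A\<^esub> z) = (?w \<oplus>\<^bsub>A\<^esub> \<ominus>\<^bsub>A\<^esub> ?w) \<oplus>\<^bsub>A\<^esub> (y \<oplus>\<^bsub>A\<^esub> \<ominus>\<^bsub>A\<^esub> z)"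
          unfolding cy(3) A.minus_add[OF car(1,3)] using car by (simp only: A.a_ac A.a_closed A.a_inv_closed)
        then show ?thesis using car by (simp add: A.r_neg)
      qed
      have "y \<oplus>\<^bsub>A\<^esub> \<ominus>\<^bsub>A\<^esub> z \<in> J'"
        unfolding e by (rule J'.a_closed[OF Suc.prems(1) J'.a_inv_closed[OF subsetD[OF sub z(2)]]])
      then have yz: "y \<oplus>\<^bsub>A\<^esub> \<ominus>\<^bsub>A\<^esub> z \<in> J" using Suc.IH low_add[OF cy(2) low_minus[OF z(1)]] by blast
      have "x = (?w \<oplus>\<^bsub>A\<^esub> z) \<oplus>\<^bsub>A\<^esub> (y \<oplus>\<^bsub>A\<^esub> \<ominus>\<^bsub>A\<^esub> z)"
      proof -
        have "(?w \<oplus>\<^bsub>A\<^esub> z) \<oplus>\<^bsub>A\<^esub> (y \<oplus>\<^bsub>A\<^esub> \<ominus>\<^bsub>A\<^esub> z) = ?w \<oplus>\<^bsub>A\<^esub> y \<oplus>\<^bsub>A\<^esub> (z \<oplus>\<^bsub>A\<^esub> \<ominus>\<^bsub>A\<^esub> z)"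
          using car by (simp only: A.a_ac A.a_closed A.a_inv_closed)
        then show ?thesis using car cy(3) by (simp add: A.r_neg)
      qed
      then show ?thesis using J.a_closed[OF z(2) yz] by simp
    qed
  qed
  fix x assume x: "x \<in> J'"
  then obtain n where "x \<in> low n" using carr_low[OF J'.Icarr] by blast
  then show "x \<in> J" using claim x by blast
qed

text \<open>Hilbert's basis theorem for chains. Each strict step is visible in the leading
  coefficients at some monomial. Along a subsequence these monomials divide one another, and the
  ideals of leading coefficients would increase forever in K.\<close>

lemma no_increasing_ideals:
  assumes K: "noetherian_ring K" and J: "\<And>k. ideal (J k) A" and inc: "\<And>k. J k \<subset> J (Suc k)"
  shows False
proof -
  have mono: "J k \<subseteq> J l" if "k \<le> l" for k l using that inc by (induction rule: dec_induct) auto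
  have "\<exists>n\<in>I. \<not> lead (J (Suc k)) n \<subseteq> lead (J k) n" for k
    using lead_determines[OF J J, of k "Suc k"] inc[of k] by blast
  then obtain a where a: "\<And>k. a k \<in> I" "\<And>k. \<not> lead (J (Suc k)) (a k) \<subseteq> lead (J k) (a k)" by metis
  obtain \<phi> :: "nat \<Rightarrow> nat" where \<phi>: "strict_mono \<phi>" "\<And>i j. i \<le> j \<Longrightarrow> a (\<phi> i) dvd a (\<phi> j)"
    using I_dickson[of a] a(1) by blast
  define U where "U i = lead (J (\<phi> i)) (a (\<phi> i))" for i
  \<comment> \<open>The growth at the monomial \<open>a (\<phi> i)\<close> takes place on passing to
    \<open>Suc (\<phi> i)\<close>. For j above i this index is at most \<open>\<phi> j\<close>, so
    every later U contains the larger ideal.\<close>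
  have step: "lead (J (Suc (\<phi> i))) (a (\<phi> i)) \<subseteq> U j" if "i < j" for i j
  proof -
    have "Suc (\<phi> i) \<le> \<phi> j" using \<phi>(1) that by (simp add: Suc_leI strict_monoD)
    then have "lead (J (Suc (\<phi> i))) (a (\<phi> i)) \<subseteq> lead (J (\<phi> j)) (a (\<phi> i))" by (intro lead_mono mono)
    also have "\<dots> \<subseteq> U j" unfolding U_def using \<phi>(2)[of i j] that by (intro lead_dvd J a(1)) simp
    finally show ?thesis .
  qed
  have U_mono: "U i \<subseteq> U j" if "i \<le> j" for i j
  proof (cases "i = j")
    case False
    then have "i < j" using that by simp
    have "U i \<subseteq> lead (J (Suc (\<phi> i))) (a (\<phi> i))" unfolding U_def by (intro lead_mono mono) simp
    also have "\<dots> \<subseteq> U j" by (rule step[OF \<open>i < j\<close>])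
    finally show ?thesis .
  qed simp
  interpret noetherian_ring K by fact
  have "subset.chain {I. ideal I K} (range U)"
    unfolding subset_chain_def U_def[symmetric]
  proof (intro conjI ballI)
    show "range U \<subseteq> {I. ideal I K}" unfolding U_def using lead_ideal J a(1) by blast
    fix x y assume "x \<in> range U" "y \<in> range U"
    then show "x \<subseteq> y \<or> y \<subseteq> x" using U_mono by (metis nle_le rangeE)
  qed
  then have "\<Union>(range U) \<in> range U" by (intro ideal_chain_is_trivial) auto
  then obtain i where i: "\<Union>(range U) = U i" by blast
  then have "U (Suc i) \<subseteq> U i" by blast
  then have "lead (J (Suc (\<phi> i))) (a (\<phi> i)) \<subseteq> lead (J (\<phi> i)) (a (\<phi> i))"
    using step[of i "Suc i"] unfolding U_def by blast
  then show False using a(2) by blast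
qed

text \<open>An annihilator which is maximal among the annihilators of nonzero elements is prime.\<close>

lemma exists_prime_annihilator:
  assumes K: "noetherian_ring K" and ne: "\<one>\<^bsub>A\<^esub> \<noteq> \<zero>\<^bsub>A\<^esub>"
  shows "\<exists>h\<in>carrier A. h \<noteq> \<zero>\<^bsub>A\<^esub> \<and> (\<forall>a\<in>carrier A. \<forall>b\<in>carrier A.
    (a \<otimes>\<^bsub>A\<^esub> b) \<otimes>\<^bsub>A\<^esub> h = \<zero>\<^bsub>A\<^esub> \<longrightarrow> a \<otimes>\<^bsub>A\<^esub> h = \<zero>\<^bsub>A\<^esub> \<or> b \<otimes>\<^bsub>A\<^esub> h = \<zero>\<^bsub>A\<^esub>)"
proof (rule ccontr)
  define ann where "ann h = {a \<in> carrier A. a \<otimes>\<^bsub>A\<^esub> h = \<zero>\<^bsub>A\<^esub>}" for h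
  have ann_ideal: "ideal (ann h) A" if h: "h \<in> carrier A" for h
  proof (rule idealI)
    show "subgroup (ann h) (add_monoid A)"
      unfolding ann_def using h by (intro A.add.subgroupI) (auto simp: A.l_distr A.l_minus intro: exI[of _ "\<zero>\<^bsub>A\<^esub>"])
    fix x a assume "a \<in> ann h" "x \<in> carrier A"
    then show "x \<otimes>\<^bsub>A\<^esub> a \<in> ann h" "a \<otimes>\<^bsub>A\<^esub> x \<in> ann h"
      unfolding ann_def using h A.m_comm[of a x] by (auto simp: A.m_assoc)
  qed (rule A.ring_axioms)
  assume contra: "\<not> ?thesis"
  have bad: "\<exists>g\<in>carrier A. g \<noteq> \<zero>\<^bsub>A\<^esub> \<and> ann h \<subset> ann g" if h: "h \<in> carrier A" "h \<noteq> \<zero>\<^bsub>A\<^esub>" for h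
  proof -
    \<comment> \<open>If primeness fails for h, then b h is again nonzero and has a larger
      annihilator, which now contains a.\<close>
    obtain a b where ab: "a \<in> carrier A" "b \<in> carrier A" "(a \<otimes>\<^bsub>A\<^esub> b) \<otimes>\<^bsub>A\<^esub> h = \<zero>\<^bsub>A\<^esub>"
      "a \<otimes>\<^bsub>A\<^esub> h \<noteq> \<zero>\<^bsub>A\<^esub>" "b \<otimes>\<^bsub>A\<^esub> h \<noteq> \<zero>\<^bsub>A\<^esub>" using contra h by blast
    have "c \<otimes>\<^bsub>A\<^esub> (b \<otimes>\<^bsub>A\<^esub> h) = b \<otimes>\<^bsub>A\<^esub> (c \<otimes>\<^bsub>A\<^esub> h)" if "c \<in> carrier A" for c
      using ab h that by (simp add: A.m_lcomm)
    then have "ann h \<subseteq> ann (b \<otimes>\<^bsub>A\<^esub> h)" unfolding ann_def using ab(2) by auto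
    moreover have "a \<in> ann (b \<otimes>\<^bsub>A\<^esub> h)" "a \<notin> ann h"
      unfolding ann_def using ab h by (simp_all add: A.m_assoc)
    ultimately show ?thesis using ab(2,5) h(1) by (metis A.m_closed psubsetI)
  qed
  have "\<exists>f. \<forall>n::nat. (f n \<in> carrier A \<and> f n \<noteq> \<zero>\<^bsub>A\<^esub>) \<and> ann (f n) \<subset> ann (f (Suc n))"
    by (rule dependent_nat_choice) (use ne bad in blast)+
  then obtain f where "\<And>n::nat. f n \<in> carrier A" "\<And>n. ann (f n) \<subset> ann (f (Suc n))" by blast
  then show False using no_increasing_ideals[OF K, of "\<lambda>n. ann (f n)"] ann_ideal by blast
qed

section \<open>Generic freeness\<close>

text \<open>The witness \<open>f\<close> is the product of the leading coefficients at the finitely many minimal leading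
  monomials.\<close>

lemma exists_leading_denominator:
  assumes h: "h \<in> carrier K" and hh: "h \<otimes>\<^bsub>K\<^esub> h \<noteq> \<zero>\<^bsub>K\<^esub>"
    and prime: "\<And>a b. \<lbrakk>a \<in> carrier K; b \<in> carrier K; (a \<otimes>\<^bsub>K\<^esub> b) \<otimes>\<^bsub>K\<^esub> h = \<zero>\<^bsub>K\<^esub>\<rbrakk> \<Longrightarrow>
      a \<otimes>\<^bsub>K\<^esub> h = \<zero>\<^bsub>K\<^esub> \<or> b \<otimes>\<^bsub>K\<^esub> h = \<zero>\<^bsub>K\<^esub>"
  shows "\<exists>f\<in>carrier K. f \<otimes>\<^bsub>K\<^esub> h \<noteq> \<zero>\<^bsub>K\<^esub> \<and> (\<forall>n\<in>I. \<forall>c\<in>carrier K.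
    c \<otimes>\<^bsub>K\<^esub> h \<noteq> \<zero>\<^bsub>K\<^esub> \<and> \<iota> c \<otimes>\<^bsub>A\<^esub> e n \<in> low n \<longrightarrow> \<iota> f \<otimes>\<^bsub>A\<^esub> e n \<in> low n)"
proof -
  \<comment> \<open>The leading monomials of relations, where a coefficient counts as nonzero when h
    does not kill it.\<close>
  define Ld where "Ld = {n \<in> I. \<exists>c\<in>carrier K. c \<otimes>\<^bsub>K\<^esub> h \<noteq> \<zero>\<^bsub>K\<^esub> \<and> \<iota> c \<otimes>\<^bsub>A\<^esub> e n \<in> low n}"
  define Mn where "Mn = {n \<in> Ld. \<forall>m\<in>Ld. m dvd n \<longrightarrow> m = n}"
  have sub: "Mn \<subseteq> Ld" "Ld \<subseteq> I" unfolding Mn_def Ld_def by auto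
  \<comment> \<open>By Dickson's lemma an infinite set of monomials contains two that divide, which
    minimal ones cannot do.\<close>
  have fin: "finite Mn"
  proof (rule ccontr)
    assume "infinite Mn"
    then obtain a :: "nat \<Rightarrow> nat" where a: "inj a" "range a \<subseteq> Mn" by (metis infinite_countable_subset)
    have "\<And>k. a k \<in> I" using a(2) sub by blast
    then obtain \<phi> :: "nat \<Rightarrow> nat" where \<phi>: "strict_mono \<phi>" "\<And>i j. i \<le> j \<Longrightarrow> a (\<phi> i) dvd a (\<phi> j)"
      using I_dickson[of a] by blast
    have "a (\<phi> 0) = a (\<phi> 1)" using \<phi>(2)[of 0 1] a(2) sub(1) unfolding Mn_def by blast
    then have "\<phi> 0 = \<phi> 1" using a(1) by (simp add: inj_eq)
    then show False using strict_monoD[OF \<phi>(1), of 0 1] by simp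
  qed
  have min: "\<exists>m\<in>Mn. m dvd n" if n: "n \<in> Ld" for n
  proof -
    define m where "m = (LEAST m. m \<in> Ld \<and> m dvd n)"
    have m: "m \<in> Ld" "m dvd n" using LeastI[of "\<lambda>m. m \<in> Ld \<and> m dvd n" n] n unfolding m_def by auto
    have "k = m" if k: "k \<in> Ld" "k dvd m" for k
    proof -
      have "m \<le> k" unfolding m_def using k m(2) dvd_trans[of k m n] by (intro Least_le) (auto simp: m_def)
      moreover have "k \<le> m" using k(2) I_pos m(1) sub(2) by (intro dvd_imp_le) auto
      ultimately show ?thesis by simp
    qed
    then show ?thesis using m unfolding Mn_def by blast
  qed
  have "\<forall>n\<in>Mn. \<exists>c. c \<in> carrier K \<and> c \<otimes>\<^bsub>K\<^esub> h \<noteq> \<zero>\<^bsub>K\<^esub> \<and> \<iota> c \<otimes>\<^bsub>A\<^esub> e n \<in> low n"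
    using sub(1) unfolding Ld_def by blast
  from bchoice[OF this] obtain c where
    c0: "\<forall>n\<in>Mn. c n \<in> carrier K \<and> c n \<otimes>\<^bsub>K\<^esub> h \<noteq> \<zero>\<^bsub>K\<^esub> \<and> \<iota> (c n) \<otimes>\<^bsub>A\<^esub> e n \<in> low n" by (rule exE)
  have c: "c n \<in> carrier K \<and> c n \<otimes>\<^bsub>K\<^esub> h \<noteq> \<zero>\<^bsub>K\<^esub> \<and> \<iota> (c n) \<otimes>\<^bsub>A\<^esub> e n \<in> low n" if "n \<in> Mn" for n
    using c0 that by (rule bspec)
  define f where "f = (\<Otimes>\<^bsub>K\<^esub>n\<in>Mn. c n)"
  have cc: "c n \<in> carrier K" if "n \<in> Mn" for n using c that by blast
  \<comment> \<open>The elements not killed by h form a multiplicative set, as the annihilator of h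
    is prime; for the empty product this says that h is nonzero.\<close>
  have prod: "(\<Otimes>\<^bsub>K\<^esub>n\<in>N. c n) \<otimes>\<^bsub>K\<^esub> h \<noteq> \<zero>\<^bsub>K\<^esub>" if "finite N" "N \<subseteq> Mn" for N
    using that
  proof (induction N rule: finite_induct)
    case empty
    then show ?case using h hh by auto
  next
    case (insert n N)
    have pc: "(\<Otimes>\<^bsub>K\<^esub>n\<in>N. c n) \<in> carrier K" using insert.prems cc by (intro K.finprod_closed) auto
    have "(\<Otimes>\<^bsub>K\<^esub>n\<in>insert n N. c n) = c n \<otimes>\<^bsub>K\<^esub> (\<Otimes>\<^bsub>K\<^esub>n\<in>N. c n)"
      using insert.hyps insert.prems cc by (intro K.finprod_insert) auto
    then show ?case using prime[OF cc pc, of n] insert c[of n] by auto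
  qed
  have fc: "f \<in> carrier K" unfolding f_def using cc by (intro K.finprod_closed) auto
  have "\<iota> f \<otimes>\<^bsub>A\<^esub> e n \<in> low n" if n: "n \<in> Ld" for n
  proof -
    obtain m where m: "m \<in> Mn" "m dvd n" using min[OF n] by blast
    have mI: "m \<in> I" and nI: "n \<in> I" using m(1) n sub by auto
    define q where "q = n div m"
    have q: "q \<in> I" "n = m * q" unfolding q_def using mI nI m(2) I_div by auto
    have "f = (\<Otimes>\<^bsub>K\<^esub>n\<in>insert m (Mn - {m}). c n)" unfolding f_def using m(1) by (simp add: insert_absorb)
    also have "\<dots> = c m \<otimes>\<^bsub>K\<^esub> (\<Otimes>\<^bsub>K\<^esub>n\<in>Mn - {m}. c n)"
      using fin m(1) cc by (intro K.finprod_insert) auto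
    finally have f: "f = c m \<otimes>\<^bsub>K\<^esub> (\<Otimes>\<^bsub>K\<^esub>n\<in>Mn - {m}. c n)" .
    let ?r = "\<Otimes>\<^bsub>K\<^esub>n\<in>Mn - {m}. c n"
    have rc: "?r \<in> carrier K" using cc by (intro K.finprod_closed) auto
    have cm: "c m \<in> carrier K" "\<iota> (c m) \<otimes>\<^bsub>A\<^esub> e m \<in> low m" using c[OF m(1)] by auto
    \<comment> \<open>The relation at the minimal monomial m is multiplied by the monomial of q and
      by the remaining factors of f.\<close>
    have "\<iota> f \<otimes>\<^bsub>A\<^esub> e n = \<iota> ?r \<otimes>\<^bsub>A\<^esub> (e q \<otimes>\<^bsub>A\<^esub> (\<iota> (c m) \<otimes>\<^bsub>A\<^esub> e m))"
      unfolding f q(2) e_mult[OF mI q(1)] using cm(1) rc e_carr[OF mI] e_carr[OF q(1)] \<iota>_closed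
      by (simp add: \<iota>_simps A.m_ac)
    also have "\<dots> \<in> low n" unfolding q(2) by (intro low_scale low_mult cm q(1) rc)
    finally show ?thesis .
  qed
  then show ?thesis using fc prod[OF fin subset_refl] unfolding f_def[symmetric] Ld_def by blast
qed

end

section \<open>Tensor powers of free modules\<close>

text \<open>The last assumption is linear independence with one term isolated, which fits the
  inductive spans and directly yields uniqueness of the coefficient at e.\<close>

locale free_extension = ring_extension R A \<iota> + domain R
  for R :: "'r ring" and A :: "'a ring" and \<iota> :: "'r \<Rightarrow> 'a" +
  fixes E :: "'a set"
  assumes E_carr: "E \<subseteq> carrier A" and E_span: "carrier A \<subseteq> lspan R A \<iota> E"
    and E_indep: "\<lbrakk>e \<in> E; r \<in> carrier R; \<iota> r \<otimes>\<^bsub>A\<^esub> e \<in> lspan R A \<iota> (E - {e})\<rbrakk> \<Longrightarrow> r = \<zero>\<^bsub>R\<^esub>"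
begin

definition coord where
  "coord e a = (THE r. r \<in> carrier R \<and> (\<exists>y\<in>span (E - {e}). a = \<iota> r \<otimes>\<^bsub>A\<^esub> e \<oplus>\<^bsub>A\<^esub> y))"

lemma rest_carr: "E - {e} \<subseteq> carrier A"
  using E_carr by blast

text \<open>Two representations differ by a multiple of e that lies in the span of the other basis
  elements, so by independence their coefficients agree.\<close>

lemma coordI:
  assumes e: "e \<in> E" and r: "r \<in> carrier R" and y: "y \<in> span (E - {e})" and a: "a = \<iota> r \<otimes>\<^bsub>A\<^esub> e \<oplus>\<^bsub>A\<^esub> y"
  shows "coord e a = r"
  unfolding coord_def
proof (rule the_equality)
  show "r \<in> carrier R \<and> (\<exists>y\<in>span (E - {e}). a = \<iota> r \<otimes>\<^bsub>A\<^esub> e \<oplus>\<^bsub>A\<^esub> y)" using assms by blast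
  fix s assume "s \<in> carrier R \<and> (\<exists>y\<in>span (E - {e}). a = \<iota> s \<otimes>\<^bsub>A\<^esub> e \<oplus>\<^bsub>A\<^esub> y)"
  then obtain z where s: "s \<in> carrier R" "z \<in> span (E - {e})" "a = \<iota> s \<otimes>\<^bsub>A\<^esub> e \<oplus>\<^bsub>A\<^esub> z" by blast
  let ?se = "\<iota> s \<otimes>\<^bsub>A\<^esub> e" and ?re = "\<iota> r \<otimes>\<^bsub>A\<^esub> e"
  have c: "e \<in> carrier A" "y \<in> carrier A" "z \<in> carrier A" "?se \<in> carrier A" "?re \<in> carrier A"
    using e E_carr span_carr[OF y rest_carr] span_carr[OF s(2) rest_carr] \<iota>_closed r s(1) by auto
  have "\<iota> (s \<oplus>\<^bsub>R\<^esub> \<ominus>\<^bsub>R\<^esub> r) \<otimes>\<^bsub>A\<^esub> e = ?se \<oplus>\<^bsub>A\<^esub> \<ominus>\<^bsub>A\<^esub> ?re"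
    using r s(1) c \<iota>_closed by (simp add: \<iota>_simps A.l_distr A.l_minus)
  also have "\<dots> = y \<oplus>\<^bsub>A\<^esub> \<ominus>\<^bsub>A\<^esub> z"
  proof -
    have "?se \<oplus>\<^bsub>A\<^esub> \<ominus>\<^bsub>A\<^esub> ?re = (?se \<oplus>\<^bsub>A\<^esub> z) \<oplus>\<^bsub>A\<^esub> (\<ominus>\<^bsub>A\<^esub> ?re \<oplus>\<^bsub>A\<^esub> \<ominus>\<^bsub>A\<^esub> z)"
    proof -
      have "(?se \<oplus>\<^bsub>A\<^esub> z) \<oplus>\<^bsub>A\<^esub> (\<ominus>\<^bsub>A\<^esub> ?re \<oplus>\<^bsub>A\<^esub> \<ominus>\<^bsub>A\<^esub> z) = (?se \<oplus>\<^bsub>A\<^esub> \<ominus>\<^bsub>A\<^esub> ?re) \<oplus>\<^bsub>A\<^esub> (z \<oplus>\<^bsub>A\<^esub> \<ominus>\<^bsub>A\<^esub> z)"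
        using c by (simp only: A.a_ac A.a_closed A.a_inv_closed)
      then show ?thesis using c by (simp add: A.r_neg)
    qed
    also have "?se \<oplus>\<^bsub>A\<^esub> z = ?re \<oplus>\<^bsub>A\<^esub> y" using s(3) a by simp
    also have "(?re \<oplus>\<^bsub>A\<^esub> y) \<oplus>\<^bsub>A\<^esub> (\<ominus>\<^bsub>A\<^esub> ?re \<oplus>\<^bsub>A\<^esub> \<ominus>\<^bsub>A\<^esub> z) = (?re \<oplus>\<^bsub>A\<^esub> \<ominus>\<^bsub>A\<^esub> ?re) \<oplus>\<^bsub>A\<^esub> (y \<oplus>\<^bsub>A\<^esub> \<ominus>\<^bsub>A\<^esub> z)"
      using c by (simp only: A.a_ac A.a_closed A.a_inv_closed)
    finally show ?thesis using c by (simp add: A.r_neg)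
  qed
  also have "\<dots> \<in> span (E - {e})"
    by (rule span_add[OF y span_minus[OF s(2) rest_carr] rest_carr])
  finally have in_span: "\<iota> (s \<oplus>\<^bsub>R\<^esub> \<ominus>\<^bsub>R\<^esub> r) \<otimes>\<^bsub>A\<^esub> e \<in> span (E - {e})" .
  have "s \<oplus>\<^bsub>R\<^esub> \<ominus>\<^bsub>R\<^esub> r = \<zero>\<^bsub>R\<^esub>" by (rule E_indep[OF e _ in_span]) (use r s(1) in simp)
  then show "s = r" using r s(1) K.r_right_minus_eq[of s r] by (simp add: K.minus_eq)
qed

lemma coordE:
  assumes e: "e \<in> E" and a: "a \<in> carrier A"
  obtains y where "coord e a \<in> carrier R" "y \<in> span (E - {e})" "a = \<iota> (coord e a) \<otimes>\<^bsub>A\<^esub> e \<oplus>\<^bsub>A\<^esub> y"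
proof -
  have "a \<in> span (insert e (E - {e}))" using E_span a e by (auto simp: insert_absorb)
  then obtain r y where "r \<in> carrier R" "y \<in> span (E - {e})" "a = \<iota> r \<otimes>\<^bsub>A\<^esub> e \<oplus>\<^bsub>A\<^esub> y"
    using span_insertE[OF _ _ rest_carr] e E_carr by blast
  moreover from this have "coord e a = r" by (rule coordI[OF e])
  ultimately show thesis using that by simp
qed

lemma coord_closed: "e \<in> E \<Longrightarrow> a \<in> carrier A \<Longrightarrow> coord e a \<in> carrier R"
  by (rule coordE)

lemma coord_add:
  assumes e: "e \<in> E" and a: "a \<in> carrier A" and b: "b \<in> carrier A"
  shows "coord e (a \<oplus>\<^bsub>A\<^esub> b) = coord e a \<oplus>\<^bsub>R\<^esub> coord e b"
proof -
  obtain y where y: "coord e a \<in> carrier R" "y \<in> span (E - {e})" "a = \<iota> (coord e a) \<otimes>\<^bsub>A\<^esub> e \<oplus>\<^bsub>A\<^esub> y"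
    using coordE[OF e a] .
  obtain z where z: "coord e b \<in> carrier R" "z \<in> span (E - {e})" "b = \<iota> (coord e b) \<otimes>\<^bsub>A\<^esub> e \<oplus>\<^bsub>A\<^esub> z"
    using coordE[OF e b] .
  define p q where "p = coord e a" and "q = coord e b"
  have c: "e \<in> carrier A" "y \<in> carrier A" "z \<in> carrier A" "\<iota> p \<in> carrier A" "\<iota> q \<in> carrier A"
    using e E_carr span_carr[OF y(2) rest_carr] span_carr[OF z(2) rest_carr] \<iota>_closed y(1) z(1)
    unfolding p_def q_def by auto
  have "a \<oplus>\<^bsub>A\<^esub> b = (\<iota> p \<otimes>\<^bsub>A\<^esub> e \<oplus>\<^bsub>A\<^esub> y) \<oplus>\<^bsub>A\<^esub> (\<iota> q \<otimes>\<^bsub>A\<^esub> e \<oplus>\<^bsub>A\<^esub> z)"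
    using y(3) z(3) unfolding p_def q_def by metis
  also have "\<dots> = \<iota> (p \<oplus>\<^bsub>R\<^esub> q) \<otimes>\<^bsub>A\<^esub> e \<oplus>\<^bsub>A\<^esub> (y \<oplus>\<^bsub>A\<^esub> z)"
    using c y(1) z(1) unfolding p_def[symmetric] q_def[symmetric]
    by (simp add: \<iota>_simps A.l_distr A.a_ac)
  finally have eq: "a \<oplus>\<^bsub>A\<^esub> b = \<iota> (p \<oplus>\<^bsub>R\<^esub> q) \<otimes>\<^bsub>A\<^esub> e \<oplus>\<^bsub>A\<^esub> (y \<oplus>\<^bsub>A\<^esub> z)" .
  have "coord e (a \<oplus>\<^bsub>A\<^esub> b) = p \<oplus>\<^bsub>R\<^esub> q"
    by (rule coordI[OF e _ span_add[OF y(2) z(2) rest_carr] eq]) (use y(1) z(1) in \<open>simp add: p_def q_def\<close>)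
  then show ?thesis unfolding p_def q_def .
qed

lemma coord_scale:
  assumes e: "e \<in> E" and a: "a \<in> carrier A" and r: "r \<in> carrier R"
  shows "coord e (\<iota> r \<otimes>\<^bsub>A\<^esub> a) = r \<otimes>\<^bsub>R\<^esub> coord e a"
proof -
  obtain y where y: "coord e a \<in> carrier R" "y \<in> span (E - {e})" "a = \<iota> (coord e a) \<otimes>\<^bsub>A\<^esub> e \<oplus>\<^bsub>A\<^esub> y"
    using coordE[OF e a] .
  define p where "p = coord e a"
  have c: "e \<in> carrier A" "y \<in> carrier A" "\<iota> p \<in> carrier A"
    using e E_carr span_carr[OF y(2) rest_carr] \<iota>_closed y(1) unfolding p_def by auto
  have "\<iota> r \<otimes>\<^bsub>A\<^esub> a = \<iota> r \<otimes>\<^bsub>A\<^esub> (\<iota> p \<otimes>\<^bsub>A\<^esub> e \<oplus>\<^bsub>A\<^esub> y)" using y(3) unfolding p_def by simp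
  also have "\<dots> = \<iota> (r \<otimes>\<^bsub>R\<^esub> p) \<otimes>\<^bsub>A\<^esub> e \<oplus>\<^bsub>A\<^esub> \<iota> r \<otimes>\<^bsub>A\<^esub> y"
    using c y(1) r \<iota>_closed unfolding p_def[symmetric] by (simp add: \<iota>_simps A.r_distr A.m_assoc)
  finally have eq: "\<iota> r \<otimes>\<^bsub>A\<^esub> a = \<iota> (r \<otimes>\<^bsub>R\<^esub> p) \<otimes>\<^bsub>A\<^esub> e \<oplus>\<^bsub>A\<^esub> \<iota> r \<otimes>\<^bsub>A\<^esub> y" .
  have "coord e (\<iota> r \<otimes>\<^bsub>A\<^esub> a) = r \<otimes>\<^bsub>R\<^esub> p"
    by (rule coordI[OF e _ span_scale[OF y(2) rest_carr r] eq]) (use y(1) r in \<open>simp add: p_def\<close>)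
  then show ?thesis unfolding p_def .
qed

lemma coord_basis:
  assumes e: "e \<in> E" and g: "g \<in> E"
  shows "coord e g = (if e = g then \<one>\<^bsub>R\<^esub> else \<zero>\<^bsub>R\<^esub>)"
proof -
  have c: "e \<in> carrier A" "g \<in> carrier A" using e g E_carr by blast+
  show ?thesis
  proof (cases "e = g")
    case True
    have "coord e e = \<one>\<^bsub>R\<^esub>"
      by (rule coordI[OF e K.one_closed lspan.zero]) (use c in \<open>simp add: \<iota>_simps\<close>)
    then show ?thesis using True by simp
  next
    case False
    then have "g \<in> E - {e}" using g by blast
    then have "coord e g = \<zero>\<^bsub>R\<^esub>"
      by (intro coordI[OF e K.zero_closed span_incl[OF _ rest_carr, of g]]) (use c in \<open>simp_all add: \<iota>_simps\<close>)
    then show ?thesis using False by simp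
  qed
qed

end

locale free_tensor = free_extension R A \<iota> E + tensor R A \<iota> S
  for R :: "'r ring" and A :: "'a ring" and \<iota> :: "'r \<Rightarrow> 'a" and E and S :: "nat set" +
  assumes S: "finite S"
begin

text \<open>The coordinate of the pure tensor f at the basis tensor g.\<close>

definition cc where "cc g f = (\<Otimes>\<^bsub>R\<^esub>s\<in>S. coord (g s) (f s))"

lemma cc_closed: "g \<in> S \<rightarrow> E \<Longrightarrow> f \<in> S \<rightarrow>\<^sub>E carrier A \<Longrightarrow> cc g f \<in> carrier R"
  unfolding cc_def by (intro K.finprod_closed Pi_I coord_closed) auto

lemma cc_upd:
  assumes g: "g \<in> S \<rightarrow> E" and f: "f \<in> S \<rightarrow>\<^sub>E carrier A" and s: "s \<in> S" and a: "a \<in> carrier A"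
  shows "cc g (f(s := a)) = coord (g s) a \<otimes>\<^bsub>R\<^esub> (\<Otimes>\<^bsub>R\<^esub>t\<in>S - {s}. coord (g t) (f t))"
    and "(\<Otimes>\<^bsub>R\<^esub>t\<in>S - {s}. coord (g t) (f t)) \<in> carrier R"
proof -
  have c: "coord (g t) (f t) \<in> carrier R" if "t \<in> S" for t
    by (rule coord_closed) (use g f that in auto)
  have "cc g (f(s := a)) = (\<Otimes>\<^bsub>R\<^esub>t\<in>insert s (S - {s}). coord (g t) ((f(s := a)) t))"
    unfolding cc_def using s by (simp add: insert_absorb)
  also have "\<dots> = coord (g s) ((f(s := a)) s) \<otimes>\<^bsub>R\<^esub> (\<Otimes>\<^bsub>R\<^esub>t\<in>S - {s}. coord (g t) ((f(s := a)) t))"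
  proof (rule K.finprod_insert)
    show "(\<lambda>t. coord (g t) ((f(s := a)) t)) \<in> S - {s} \<rightarrow> carrier R" using c by auto
    show "coord (g s) ((f(s := a)) s) \<in> carrier R" using coord_closed[of "g s" a] g s a by auto
  qed (use S in auto)
  also have "(\<Otimes>\<^bsub>R\<^esub>t\<in>S - {s}. coord (g t) ((f(s := a)) t)) = (\<Otimes>\<^bsub>R\<^esub>t\<in>S - {s}. coord (g t) (f t))"
    by (rule K.finprod_cong') (use c in auto)
  finally show "cc g (f(s := a)) = coord (g s) a \<otimes>\<^bsub>R\<^esub> (\<Otimes>\<^bsub>R\<^esub>t\<in>S - {s}. coord (g t) (f t))"
    by (simp only: fun_upd_same)
  show "(\<Otimes>\<^bsub>R\<^esub>t\<in>S - {s}. coord (g t) (f t)) \<in> carrier R" by (rule K.finprod_closed) (use c in auto)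
qed

text \<open>A coordinate functional of the tensor power. It is linear but not multiplicative, so its
  vanishing on the ideal of relations is tested against all multiples.\<close>

abbreviation lin where "lin g \<equiv> ma_lift R R (\<lambda>r. r) (cc g)"

lemma lin: "g \<in> S \<rightarrow> E \<Longrightarrow> monoid_ring_lift R M R (\<lambda>r. r) (cc g)"
proof (unfold_locales)
  show "(\<lambda>r. r) \<in> ring_hom R R" by (auto simp: ring_hom_def)
  show "g \<in> S \<rightarrow> E \<Longrightarrow> m \<in> carrier M \<Longrightarrow> cc g m \<in> carrier R" for m using cc_closed[of g m] by simp
qed

lemma lin_kills_ideal:
  assumes g: "g \<in> S \<rightarrow> E" and F: "F \<in> I"
  shows "lin g F = \<zero>\<^bsub>R\<^esub>"
proof -
  interpret l: monoid_ring_lift R M R "\<lambda>r. r" "cc g" by (rule lin[OF g])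
  note lc = l.lift_closed[unfolded TF_eq] and la = l.lift_add[unfolded TF_eq] and lz = l.lift_zero[unfolded TF_eq]
  have ls: "lin g (sgl r f) = r \<otimes>\<^bsub>R\<^esub> cc g f" if "r \<in> carrier R" "f \<in> S \<rightarrow>\<^sub>E carrier A" for r f
    using l.lift_sgl[of r f] that by simp
  \<comment> \<open>The largest ideal of the free algebra on which the functional vanishes; it
    suffices that it contains the relations.\<close>
  define J where "J = {F \<in> carrier TF. \<forall>G\<in>carrier TF. lin g (F \<otimes>\<^bsub>TF\<^esub> G) = \<zero>\<^bsub>R\<^esub>}"
  have lm: "lin g (\<ominus>\<^bsub>TF\<^esub> F) = \<ominus>\<^bsub>R\<^esub> lin g F" if "F \<in> carrier TF" for F
  proof -
    have "lin g (\<ominus>\<^bsub>TF\<^esub> F) \<oplus>\<^bsub>R\<^esub> lin g F = \<zero>\<^bsub>R\<^esub>" using la[of "\<ominus>\<^bsub>TF\<^esub> F" F] that lz by (simp add: TF.l_neg)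
    then show ?thesis using lc that by (simp add: K.minus_equality)
  qed
  have J: "ideal J TF"
  proof (rule idealI)
    show "subgroup J (add_monoid TF)"
    proof (rule TF.add.subgroupI)
      show "J \<subseteq> carrier TF" unfolding J_def by blast
      have "\<zero>\<^bsub>TF\<^esub> \<in> J" unfolding J_def using lz by simp
      then show "J \<noteq> {}" by blast
      fix x assume x: "x \<in> J"
      then show "\<ominus>\<^bsub>TF\<^esub> x \<in> J" unfolding J_def by (simp add: TF.l_minus lm)
      fix y assume "y \<in> J"
      then show "x \<oplus>\<^bsub>TF\<^esub> y \<in> J" using x unfolding J_def by (simp add: TF.l_distr la)
    qed
    fix x y assume x: "x \<in> J" and y: "y \<in> carrier TF"
    then show "x \<otimes>\<^bsub>TF\<^esub> y \<in> J" unfolding J_def by (simp add: TF.m_assoc)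
    then show "y \<otimes>\<^bsub>TF\<^esub> x \<in> J" using x y unfolding J_def by (simp add: TF.m_comm)
  qed (rule TF.ring_axioms)
  \<comment> \<open>By additivity it is enough to test against multiples by single terms.\<close>
  have single: "F \<in> J" if F: "F \<in> carrier TF"
    and z: "\<And>r k. \<lbrakk>r \<in> carrier R; k \<in> S \<rightarrow>\<^sub>E carrier A\<rbrakk> \<Longrightarrow> lin g (F \<otimes>\<^bsub>TF\<^esub> sgl r k) = \<zero>\<^bsub>R\<^esub>" for F
  proof -
    have "lin g (F \<otimes>\<^bsub>TF\<^esub> G) = \<zero>\<^bsub>R\<^esub>" if "G \<in> carrier RM" for G
      using that
    proof (induction rule: induct_sgl)
      case zero
      then show ?case using F lz by (simp add: TF_eq)
    next
      case (add r k G)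
      then have k: "k \<in> S \<rightarrow>\<^sub>E carrier A" and G: "G \<in> carrier TF" by (simp_all add: TF_eq)
      have "F \<otimes>\<^bsub>TF\<^esub> (sgl r k \<oplus>\<^bsub>TF\<^esub> G) = F \<otimes>\<^bsub>TF\<^esub> sgl r k \<oplus>\<^bsub>TF\<^esub> F \<otimes>\<^bsub>TF\<^esub> G"
        by (rule TF.r_distr[OF sgl_TF[OF add(1) k] G F])
      then show ?case
        unfolding TF_eq using la[OF TF.m_closed[OF F sgl_TF[OF add(1) k]] TF.m_closed[OF F G]] z[OF add(1) k] add(4) by simp
    qed
    then show ?thesis unfolding J_def using F TF_eq by simp
  qed
  \<comment> \<open>A relation multiplied by a pure tensor k keeps its shape, with the entry a
    replaced by the product of a and \<open>k s\<close>. Linearity of the coordinate in the entry at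
    s therefore still applies.\<close>
  have mult_upd: "f(s := a) \<otimes>\<^bsub>M\<^esub> k = (f \<otimes>\<^bsub>M\<^esub> k)(s := a \<otimes>\<^bsub>A\<^esub> k s)" if "s \<in> S" for f s a k
    unfolding mult_M using that by (auto simp: fun_eq_iff)
  have Mc: "f \<otimes>\<^bsub>M\<^esub> k \<in> S \<rightarrow>\<^sub>E carrier A" if "f \<in> S \<rightarrow>\<^sub>E carrier A" "k \<in> S \<rightarrow>\<^sub>E carrier A" for f k
    using M.m_closed[of f k] that unfolding carr_M by blast
  have ev: "lin g (sgl t (f(s := a)) \<otimes>\<^bsub>TF\<^esub> sgl r k) = (t \<otimes>\<^bsub>R\<^esub> r) \<otimes>\<^bsub>R\<^esub>
      (coord (g s) (a \<otimes>\<^bsub>A\<^esub> k s) \<otimes>\<^bsub>R\<^esub> (\<Otimes>\<^bsub>R\<^esub>u\<in>S - {s}. coord (g u) ((f \<otimes>\<^bsub>M\<^esub> k) u)))"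
    if "t \<in> carrier R" "r \<in> carrier R" "f \<in> S \<rightarrow>\<^sub>E carrier A" "s \<in> S" "a \<in> carrier A" "k \<in> S \<rightarrow>\<^sub>E carrier A" for t r f s a k
  proof -
    have ks: "a \<otimes>\<^bsub>A\<^esub> k s \<in> carrier A" using that by auto
    show ?thesis
      unfolding TF_mult_sgl[OF that(1,2) upd_family[OF that(3-5)] that(6)] mult_upd[OF that(4)]
        ls[OF K.m_closed[OF that(1,2)] upd_family[OF Mc[OF that(3,6)] that(4) ks]]
        cc_upd(1)[OF g Mc[OF that(3,6)] that(4) ks] ..
  qed
  have "tensor_relations R A \<iota> S \<subseteq> J"
  proof
    fix x assume x: "x \<in> tensor_relations R A \<iota> S"
    then have xc: "x \<in> carrier TF" using relations_carr by blast
    show "x \<in> J"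
    proof (rule single[OF xc])
      fix r k assume r: "r \<in> carrier R" and k: "k \<in> S \<rightarrow>\<^sub>E carrier A"
      have sk: "sgl r k \<in> carrier TF" by (rule sgl_TF[OF r k])
      from x consider
          f s a b where "x = sgl \<one>\<^bsub>R\<^esub> (f(s := a \<oplus>\<^bsub>A\<^esub> b)) \<ominus>\<^bsub>TF\<^esub>
            (sgl \<one>\<^bsub>R\<^esub> (f(s := a)) \<oplus>\<^bsub>TF\<^esub> sgl \<one>\<^bsub>R\<^esub> (f(s := b)))"
            "f \<in> S \<rightarrow>\<^sub>E carrier A" "s \<in> S" "a \<in> carrier A" "b \<in> carrier A"
        | f s a t where "x = sgl \<one>\<^bsub>R\<^esub> (f(s := \<iota> t \<otimes>\<^bsub>A\<^esub> a)) \<ominus>\<^bsub>TF\<^esub> sgl t (f(s := a))"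
            "f \<in> S \<rightarrow>\<^sub>E carrier A" "s \<in> S" "a \<in> carrier A" "t \<in> carrier R"
        unfolding tensor_relations_def by blast
      then show "lin g (x \<otimes>\<^bsub>TF\<^esub> sgl r k) = \<zero>\<^bsub>R\<^esub>"
      proof cases
        case 1
        note c = sgl_TF[OF K.one_closed upd_family[OF 1(2,3)]]
        let ?X = "sgl \<one>\<^bsub>R\<^esub> (f(s := a \<oplus>\<^bsub>A\<^esub> b))" and ?Y = "sgl \<one>\<^bsub>R\<^esub> (f(s := a))" and ?Z = "sgl \<one>\<^bsub>R\<^esub> (f(s := b))"
        have X: "?X \<in> carrier TF" and Y: "?Y \<in> carrier TF" and Z: "?Z \<in> carrier TF"
          using c[OF A.a_closed[OF 1(4,5)]] c[OF 1(4)] c[OF 1(5)] by blast+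
        have ks: "k s \<in> carrier A" "g s \<in> E" using k g 1(3) by auto
        let ?p = "\<Otimes>\<^bsub>R\<^esub>u\<in>S - {s}. coord (g u) ((f \<otimes>\<^bsub>M\<^esub> k) u)"
        have p: "?p \<in> carrier R" by (rule cc_upd(2)[OF g Mc[OF 1(2) k] 1(3,4)])
        have q: "coord (g s) (a \<otimes>\<^bsub>A\<^esub> k s) \<in> carrier R" "coord (g s) (b \<otimes>\<^bsub>A\<^esub> k s) \<in> carrier R"
          using coord_closed[OF ks(2)] ks(1) 1(4,5) by simp_all
        have "lin g (?X \<otimes>\<^bsub>TF\<^esub> sgl r k) = lin g (?Y \<otimes>\<^bsub>TF\<^esub> sgl r k) \<oplus>\<^bsub>R\<^esub> lin g (?Z \<otimes>\<^bsub>TF\<^esub> sgl r k)"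
          unfolding ev[OF K.one_closed r 1(2,3) A.a_closed[OF 1(4,5)] k] ev[OF K.one_closed r 1(2,3,4) k]
            ev[OF K.one_closed r 1(2,3,5) k] A.l_distr[OF 1(4,5) ks(1)]
            coord_add[OF ks(2) A.m_closed[OF 1(4) ks(1)] A.m_closed[OF 1(5) ks(1)]]
          using p q r by (simp add: K.l_distr K.r_distr)
        moreover have "x \<otimes>\<^bsub>TF\<^esub> sgl r k = ?X \<otimes>\<^bsub>TF\<^esub> sgl r k \<oplus>\<^bsub>TF\<^esub> \<ominus>\<^bsub>TF\<^esub> (?Y \<otimes>\<^bsub>TF\<^esub> sgl r k \<oplus>\<^bsub>TF\<^esub> ?Z \<otimes>\<^bsub>TF\<^esub> sgl r k)"
          unfolding 1(1) using X Y Z sk by (simp add: TF.minus_eq TF.l_distr TF.l_minus)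
        ultimately show ?thesis
          using X Y Z sk lc by (simp add: la lm K.r_neg)
      next
        case 2
        let ?X = "sgl \<one>\<^bsub>R\<^esub> (f(s := \<iota> t \<otimes>\<^bsub>A\<^esub> a))" and ?Y = "sgl t (f(s := a))"
        have ta: "\<iota> t \<otimes>\<^bsub>A\<^esub> a \<in> carrier A" using \<iota>_closed[OF 2(5)] 2(4) by simp
        have X: "?X \<in> carrier TF" and Y: "?Y \<in> carrier TF"
          using sgl_TF[OF K.one_closed upd_family[OF 2(2,3) ta]] sgl_TF[OF 2(5) upd_family[OF 2(2-4)]] by blast+
        have ks: "k s \<in> carrier A" "g s \<in> E" using k g 2(3) by auto
        let ?p = "\<Otimes>\<^bsub>R\<^esub>u\<in>S - {s}. coord (g u) ((f \<otimes>\<^bsub>M\<^esub> k) u)"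
        have p: "?p \<in> carrier R" by (rule cc_upd(2)[OF g Mc[OF 2(2) k] 2(3,4)])
        have q: "coord (g s) (a \<otimes>\<^bsub>A\<^esub> k s) \<in> carrier R"
          using coord_closed[OF ks(2)] ks(1) 2(4) by simp
        have "lin g (?X \<otimes>\<^bsub>TF\<^esub> sgl r k) = lin g (?Y \<otimes>\<^bsub>TF\<^esub> sgl r k)"
          unfolding ev[OF K.one_closed r 2(2,3) ta k] ev[OF 2(5) r 2(2,3,4) k]
            A.m_assoc[OF \<iota>_closed[OF 2(5)] 2(4) ks(1)]
            coord_scale[OF ks(2) A.m_closed[OF 2(4) ks(1)] 2(5)]
          using p q r 2(5) by (simp add: K.m_ac)
        moreover have "x \<otimes>\<^bsub>TF\<^esub> sgl r k = ?X \<otimes>\<^bsub>TF\<^esub> sgl r k \<oplus>\<^bsub>TF\<^esub> \<ominus>\<^bsub>TF\<^esub> (?Y \<otimes>\<^bsub>TF\<^esub> sgl r k)"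
          unfolding 2(1) using X Y sk by (simp add: TF.minus_eq TF.l_distr TF.l_minus)
        ultimately show ?thesis
          using X Y sk lc by (simp add: la lm K.r_neg)
      qed
    qed
  qed
  then have "I \<subseteq> J" unfolding tensor_ideal_def by (intro TF.genideal_minimal J)
  then have "F \<in> J" using F by blast
  then have "lin g (F \<otimes>\<^bsub>TF\<^esub> \<one>\<^bsub>TF\<^esub>) = \<zero>\<^bsub>R\<^esub>" unfolding J_def by blast
  then show ?thesis using I.Icarr[OF F] by simp
qed

section \<open>Expansion in basis tensors and torsion freeness\<close>

lemma cls_sgl_add':
  assumes "t \<in> carrier R" "f \<in> S \<rightarrow>\<^sub>E carrier A" "s \<in> S" "a \<in> carrier A" "b \<in> carrier A"
  shows "cls (sgl t (f(s := a \<oplus>\<^bsub>A\<^esub> b))) = cls (sgl t (f(s := a)) \<oplus>\<^bsub>TF\<^esub> sgl t (f(s := b)))"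
proof -
  note u = upd_family[OF assms(2,3)]
  note c = sgl_TF[OF K.one_closed u] and tc = sgl_TF[OF assms(1) unit_family]
  have "cls (sgl t (f(s := a \<oplus>\<^bsub>A\<^esub> b))) = cls (sgl t unit_family) \<otimes>\<^bsub>T\<^esub> cls (sgl \<one>\<^bsub>R\<^esub> (f(s := a \<oplus>\<^bsub>A\<^esub> b)))"
    unfolding sgl_split[OF assms(1) u[OF A.a_closed[OF assms(4,5)]]]
    by (rule ring_hom_mult[OF cls_hom tc c[OF A.a_closed[OF assms(4,5)]]])
  also have "\<dots> = cls (sgl t unit_family \<otimes>\<^bsub>TF\<^esub> (sgl \<one>\<^bsub>R\<^esub> (f(s := a)) \<oplus>\<^bsub>TF\<^esub> sgl \<one>\<^bsub>R\<^esub> (f(s := b))))"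
    unfolding cls_sgl_add[OF assms(2-5)]
    by (rule ring_hom_mult[OF cls_hom tc TF.a_closed[OF c[OF assms(4)] c[OF assms(5)]], symmetric])
  also have "\<dots> = cls (sgl t (f(s := a)) \<oplus>\<^bsub>TF\<^esub> sgl t (f(s := b)))"
    unfolding TF.r_distr[OF c[OF assms(4)] c[OF assms(5)] tc] sgl_split[OF assms(1) u[OF assms(4)]]
      sgl_split[OF assms(1) u[OF assms(5)]] ..
  finally show ?thesis .
qed

lemma cls_sgl_scale':
  assumes "t \<in> carrier R" "f \<in> S \<rightarrow>\<^sub>E carrier A" "s \<in> S" "a \<in> carrier A" "k \<in> carrier R"
  shows "cls (sgl t (f(s := \<iota> k \<otimes>\<^bsub>A\<^esub> a))) = cls (sgl (t \<otimes>\<^bsub>R\<^esub> k) (f(s := a)))"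
proof -
  note u = upd_family[OF assms(2,3)]
  note c = sgl_TF[OF K.one_closed u] and tc = sgl_TF[OF assms(1) unit_family]
  have ka: "\<iota> k \<otimes>\<^bsub>A\<^esub> a \<in> carrier A" using \<iota>_closed assms by simp
  have "cls (sgl t (f(s := \<iota> k \<otimes>\<^bsub>A\<^esub> a))) = cls (sgl t unit_family) \<otimes>\<^bsub>T\<^esub> cls (sgl \<one>\<^bsub>R\<^esub> (f(s := \<iota> k \<otimes>\<^bsub>A\<^esub> a)))"
    unfolding sgl_split[OF assms(1) u[OF ka]] by (rule ring_hom_mult[OF cls_hom tc c[OF ka]])
  also have "\<dots> = cls (sgl t unit_family \<otimes>\<^bsub>TF\<^esub> sgl k (f(s := a)))"
    unfolding cls_sgl_scale[OF assms(2-5)]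
    by (rule ring_hom_mult[OF cls_hom tc sgl_TF[OF assms(5) u[OF assms(4)]], symmetric])
  also have "\<dots> = cls (sgl (t \<otimes>\<^bsub>R\<^esub> k) (f(s := a)))"
    unfolding TF_mult_sgl[OF assms(1,5) unit_family u[OF assms(4)]] M_unit_l[OF u[OF assms(4)]] ..
  finally show ?thesis .
qed

definition based where
  "based F \<longleftrightarrow> (\<exists>G\<in>carrier TF. supp G \<subseteq> S \<rightarrow>\<^sub>E E \<and> cls F = cls G)"

lemma based_add:
  assumes "F \<in> carrier TF" "F' \<in> carrier TF" "based F" "based F'"
  shows "based (F \<oplus>\<^bsub>TF\<^esub> F')"
proof -
  obtain G G' where G: "G \<in> carrier TF" "supp G \<subseteq> S \<rightarrow>\<^sub>E E" "cls F = cls G"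
    and G': "G' \<in> carrier TF" "supp G' \<subseteq> S \<rightarrow>\<^sub>E E" "cls F' = cls G'"
    using assms(3,4) unfolding based_def by blast
  have "supp (G \<oplus>\<^bsub>TF\<^esub> G') \<subseteq> supp G \<union> supp G'"
    unfolding TF_eq[symmetric] add_eq by auto
  moreover have "cls (F \<oplus>\<^bsub>TF\<^esub> F') = cls (G \<oplus>\<^bsub>TF\<^esub> G')"
    unfolding ring_hom_add[OF cls_hom assms(1,2)] ring_hom_add[OF cls_hom G(1) G'(1)] G(3) G'(3) ..
  ultimately show ?thesis unfolding based_def using G G' TF.a_closed[OF G(1) G'(1)] by blast
qed

lemma based_cong: "based F \<Longrightarrow> cls F' = cls F \<Longrightarrow> based F'"
  unfolding based_def by simp

lemma based_zero: "based \<zero>\<^bsub>TF\<^esub>"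
proof -
  have "supp \<zero>\<^bsub>TF\<^esub> \<subseteq> S \<rightarrow>\<^sub>E E" unfolding TF_eq[symmetric] zero_eq by simp
  then show ?thesis unfolding based_def using TF.zero_closed by blast
qed

text \<open>S' is the set of places whose entries are still arbitrary. One place at a time is
  expanded in the basis; the scalars that appear move into the coefficient, so both t and f have to
  vary in the induction.\<close>

lemma based_sgl:
  assumes "finite S'" "S' \<subseteq> S" "t \<in> carrier R" "f \<in> S \<rightarrow>\<^sub>E carrier A" "\<And>s. s \<in> S - S' \<Longrightarrow> f s \<in> E"
  shows "based (sgl t f)"
  using assms
proof (induction S' arbitrary: t f rule: finite_induct)
  case empty
  then have "f \<in> S \<rightarrow>\<^sub>E E" by (auto simp: PiE_iff)
  then show ?case unfolding based_def using sgl_TF[OF empty(2,3)] by (intro bexI[of _ "sgl t f"]) (auto simp: ma_single_def)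
next
  case (insert s S')
  have s: "s \<in> S" and S': "S' \<subseteq> S" using insert.prems(1) by auto
  note t = insert.prems(2) and f = insert.prems(3)
  have "based (sgl t (f(s := x)))" if "x \<in> span E" for x
    using that
  proof induction
    case zero
    have "cls (sgl t (f(s := \<zero>\<^bsub>A\<^esub>))) = cls (sgl (t \<otimes>\<^bsub>R\<^esub> \<zero>\<^bsub>R\<^esub>) (f(s := \<zero>\<^bsub>A\<^esub>)))"
      using cls_sgl_scale'[OF t f s A.zero_closed K.zero_closed] by (simp add: \<iota>_simps)
    also have "\<dots> = cls \<zero>\<^bsub>TF\<^esub>" using t sgl_zero TF_eq by simp
    finally show ?case by (rule based_cong[OF based_zero])
  next
    case (step k e y)
    have ec: "e \<in> carrier A" "y \<in> carrier A" "\<iota> k \<otimes>\<^bsub>A\<^esub> e \<in> carrier A"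
      using step E_carr span_carr[OF step(3) E_carr] \<iota>_closed by auto
    have "based (sgl (t \<otimes>\<^bsub>R\<^esub> k) (f(s := e)))"
      by (rule insert.IH[OF S' K.m_closed[OF t step(1)] upd_family[OF f s ec(1)]])
        (use insert.prems(4) step(2) in auto)
    then have b1: "based (sgl t (f(s := \<iota> k \<otimes>\<^bsub>A\<^esub> e)))"
      by (rule based_cong) (rule cls_sgl_scale'[OF t f s ec(1) step(1)])
    show ?case
      by (rule based_cong[OF based_add[OF _ _ b1 step(4)] cls_sgl_add'[OF t f s ec(3,2)]])
        (rule sgl_TF[OF t upd_family[OF f s]], rule ec)+
  qed
  from this[of "f s"] show ?case using E_span f s by (auto simp: PiE_iff)
qed

lemma based_all:
  assumes "F \<in> carrier TF"
  shows "based F"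
proof -
  have "F \<in> carrier RM" using assms TF_eq by simp
  then show ?thesis
  proof (induction rule: induct_sgl)
    case zero
    then show ?case using based_zero TF_eq by simp
  next
    case (add r m F)
    then have m: "m \<in> S \<rightarrow>\<^sub>E carrier A" and F: "F \<in> carrier TF" by (simp_all add: TF_eq)
    have "based (sgl r m)" by (rule based_sgl[OF S subset_refl add(1) m]) simp
    then show ?case using based_add[OF sgl_TF[OF add(1) m] F _ add(4)] TF_eq by simp
  qed
qed

text \<open>Represent t by a combination G of basis tensors. The functional at g vanishes on the
  ideal of relations and reads off the coefficient G g, so r G g = 0 in the domain R, for every
  g.\<close>

lemma str_nonzero_divisor:
  assumes r: "r \<in> carrier R" "r \<noteq> \<zero>\<^bsub>R\<^esub>" and t: "t \<in> carrier T" "str r \<otimes>\<^bsub>T\<^esub> t = \<zero>\<^bsub>T\<^esub>"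
  shows "t = \<zero>\<^bsub>T\<^esub>"
proof -
  obtain F where "F \<in> carrier TF" "t = cls F" using t(1) unfolding carr_T by blast
  then obtain G where G: "G \<in> carrier TF" "supp G \<subseteq> S \<rightarrow>\<^sub>E E" "t = cls G"
    using based_all unfolding based_def by metis
  let ?r = "sgl r unit_family"
  have rc: "?r \<in> carrier TF" by (rule sgl_TF[OF r(1) unit_family])
  have "cls (?r \<otimes>\<^bsub>TF\<^esub> G) = \<zero>\<^bsub>T\<^esub>"
    using t(2) unfolding ring_hom_mult[OF cls_hom rc G(1)] str_def G(3) .
  then have inI: "?r \<otimes>\<^bsub>TF\<^esub> G \<in> I" using cls_zero_iff[OF TF.m_closed[OF rc G(1)]] by blast
  have "G g = \<zero>\<^bsub>R\<^esub>" if g: "g \<in> S \<rightarrow>\<^sub>E E" for g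
  proof -
    have g': "g \<in> S \<rightarrow> E" using g by auto
    interpret l: monoid_ring_lift R M R "\<lambda>r. r" "cc g" by (rule lin[OF g'])
    note lc = l.lift_closed[unfolded TF_eq] and la = l.lift_add[unfolded TF_eq] and lz = l.lift_zero[unfolded TF_eq]
    have "lin g (?r \<otimes>\<^bsub>TF\<^esub> H) = r \<otimes>\<^bsub>R\<^esub> lin g H" if "H \<in> carrier RM" for H
      using that
    proof (induction rule: induct_sgl)
      case zero
      then show ?case using rc lz r(1) by (simp add: TF_eq)
    next
      case (add q m H)
      then have m: "m \<in> S \<rightarrow>\<^sub>E carrier A" and H: "H \<in> carrier TF" by (simp_all add: TF_eq)
      have sm: "sgl q m \<in> carrier TF" by (rule sgl_TF[OF add(1) m])
      have "lin g (?r \<otimes>\<^bsub>TF\<^esub> sgl q m) = r \<otimes>\<^bsub>R\<^esub> lin g (sgl q m)"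
        unfolding TF_mult_sgl[OF r(1) add(1) unit_family m] M_unit_l[OF m]
          l.lift_sgl[OF K.m_closed[OF r(1) add(1)] add(2)] l.lift_sgl[OF add(1,2)]
        using r(1) add(1) cc_closed[OF g' m] by (simp add: K.m_assoc)
      moreover have "?r \<otimes>\<^bsub>TF\<^esub> (sgl q m \<oplus>\<^bsub>TF\<^esub> H) = ?r \<otimes>\<^bsub>TF\<^esub> sgl q m \<oplus>\<^bsub>TF\<^esub> ?r \<otimes>\<^bsub>TF\<^esub> H"
        by (rule TF.r_distr[OF sm H rc])
      ultimately show ?case
        unfolding TF_eq using add(4) r(1) lc[OF sm] lc[OF H]
        by (simp add: la[OF TF.m_closed[OF rc sm] TF.m_closed[OF rc H]] la[OF sm H] K.r_distr)
    qed
    then have "r \<otimes>\<^bsub>R\<^esub> lin g G = \<zero>\<^bsub>R\<^esub>"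
      using lin_kills_ideal[OF g' inI] G(1) TF_eq by simp
    then have z: "lin g G = \<zero>\<^bsub>R\<^esub>" using integral[OF _ r(1) lc[OF G(1)]] r(2) by blast
    have GR: "G \<in> carrier RM" using G(1) TF_eq by simp
    have gc: "g \<in> carrier M" using g E_carr by auto
    let ?X = "insert g (supp G)"
    have X: "finite ?X" "supp G \<subseteq> ?X" "?X \<subseteq> carrier M" using carrD[OF GR] gc by auto
    \<comment> \<open>On basis tensors the functionals are dual to each other, as products of dual
      coordinates.\<close>
    have cc: "cc g f = (if g = f then \<one>\<^bsub>R\<^esub> else \<zero>\<^bsub>R\<^esub>)" if f: "f \<in> S \<rightarrow>\<^sub>E E" for f
    proof (cases "g = f")
      case True
      have "cc g f = \<one>\<^bsub>R\<^esub>"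
        unfolding cc_def
      proof (rule K.finprod_one_eqI)
        fix s assume "s \<in> S"
        then have "f s \<in> E" using f by blast
        then show "coord (g s) (f s) = \<one>\<^bsub>R\<^esub>" using True coord_basis by simp
      qed
      then show ?thesis using True by simp
    next
      case False
      then obtain s where s: "s \<in> S" "g s \<noteq> f s" using g f by (metis PiE_ext)
      have fc: "f \<in> S \<rightarrow>\<^sub>E carrier A" using f E_carr by auto
      have fs: "f s \<in> carrier A" "g s \<in> E" "f s \<in> E" using fc g f s by auto
      \<comment> \<open>Writing f as an update of itself lets \<open>cc_upd\<close> isolate the
        factor at a place s where f and g differ, and that factor is 0.\<close>
      have "cc g (f(s := f s)) = \<zero>\<^bsub>R\<^esub>"
        unfolding cc_upd(1)[OF g' fc s(1) fs(1)] coord_basis[OF fs(2,3)]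
        using s(2) cc_upd(2)[OF g' fc s(1) fs(1)] by simp
      then show ?thesis using False by simp
    qed
    have "lin g G = (\<Oplus>\<^bsub>R\<^esub>f\<in>?X. G f \<otimes>\<^bsub>R\<^esub> cc g f)" by (rule l.lift_eq_sum[OF GR X])
    also have "\<dots> = (\<Oplus>\<^bsub>R\<^esub>f\<in>?X. if g = f then G f else \<zero>\<^bsub>R\<^esub>)"
    proof (rule K.finsum_cong'[OF refl])
      show "(\<lambda>f. if g = f then G f else \<zero>\<^bsub>R\<^esub>) \<in> ?X \<rightarrow> carrier R" using carrD(1)[OF GR] by auto
      fix f assume "f \<in> ?X"
      then have "f \<in> S \<rightarrow>\<^sub>E E" using g G(2) by blast
      then show "G f \<otimes>\<^bsub>R\<^esub> cc g f = (if g = f then G f else \<zero>\<^bsub>R\<^esub>)" using cc carrD(1)[OF GR, of f] by simp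
    qed
    also have "\<dots> = G g" using X(1) carrD(1)[OF GR] by (intro K.finsum_singleton) auto
    finally show ?thesis using z by simp
  qed
  then have "G = \<zero>\<^bsub>RM\<^esub>" using G(2) unfolding zero_eq by (intro ext) blast
  then show ?thesis using G(3) ring_hom_zero[OF cls_hom TF.ring_axioms T.ring_axioms] TF_eq by simp
qed

end

section \<open>Irreducible components\<close>

lemma closedin_zariski:
  "closedin (zariski A) D \<longleftrightarrow> (\<exists>E\<subseteq>carrier A. D = {p. primeideal p A \<and> E \<subseteq> p})"
proof
  assume "closedin (zariski A) D"
  then have D: "D \<subseteq> primes A" "openin (zariski A) (primes A - D)" by (auto simp: closedin_def topspace_zariski)
  then obtain E where "E \<subseteq> carrier A" "primes A - D = {p. primeideal p A \<and> \<not> E \<subseteq> p}"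
    unfolding openin_zariski by blast
  then show "\<exists>E\<subseteq>carrier A. D = {p. primeideal p A \<and> E \<subseteq> p}" using D(1) by (intro exI[of _ E]) auto
next
  assume "\<exists>E\<subseteq>carrier A. D = {p. primeideal p A \<and> E \<subseteq> p}"
  then obtain E where E: "E \<subseteq> carrier A" "D = {p. primeideal p A \<and> E \<subseteq> p}" by blast
  then have "primes A - D = {p. primeideal p A \<and> \<not> E \<subseteq> p}" by auto
  then show "closedin (zariski A) D"
    unfolding closedin_def topspace_zariski openin_zariski using E by auto
qed

text \<open>P is a generic point: a closed set containing P contains all primes above P.\<close>

lemma irreducible_zeros:
  assumes P: "primeideal P A"
  shows "irreducible_in (zariski A) {q. primeideal q A \<and> P \<subseteq> q}"
  unfolding irreducible_in_def
proof (intro conjI allI impI)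
  show "{q. primeideal q A \<and> P \<subseteq> q} \<subseteq> topspace (zariski A)" by (auto simp: topspace_zariski)
  show "{q. primeideal q A \<and> P \<subseteq> q} \<noteq> {}" using P by blast
  fix D E assume "closedin (zariski A) D \<and> closedin (zariski A) E \<and> {q. primeideal q A \<and> P \<subseteq> q} \<subseteq> D \<union> E"
  moreover have "{q. primeideal q A \<and> P \<subseteq> q} \<subseteq> D" if "closedin (zariski A) D" "P \<in> D" for D
    using that unfolding closedin_zariski by blast
  ultimately show "{q. primeideal q A \<and> P \<subseteq> q} \<subseteq> D \<or> {q. primeideal q A \<and> P \<subseteq> q} \<subseteq> E"
    using P by blast
qed

text \<open>P is the intersection of C, and irreducibility makes it prime. For a prime Q inside P
  the set V(Q) is irreducible and contains C, so it equals C by maximality; hence Q lies in C and so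
  contains P.\<close>

lemma component_minimal_prime:
  assumes A: "cring A" and C: "C \<in> irreducible_components (zariski A)"
  obtains P where "P \<in> C" "primeideal P A" "\<And>Q. primeideal Q A \<Longrightarrow> Q \<subseteq> P \<Longrightarrow> Q = P"
proof -
  interpret cring A by fact
  have irr: "irreducible_in (zariski A) C" and max: "\<And>D. irreducible_in (zariski A) D \<Longrightarrow> C \<subseteq> D \<Longrightarrow> D = C"
    using C unfolding irreducible_components_def by blast+
  have Cp: "primeideal q A" if "q \<in> C" for q using irr that unfolding irreducible_in_def topspace_zariski by blast
  obtain q0 where q0: "q0 \<in> C" using irr unfolding irreducible_in_def by blast
  define P where "P = \<Inter>C"
  have P: "primeideal P A"
  proof (rule primeidealI)
    show "ideal P A" unfolding P_def
      using Cp q0 by (intro i_Intersect) (auto intro: primeideal.axioms)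
    show "cring A" by fact
    show "carrier A \<noteq> P" using prime_one_notin[OF Cp[OF q0]] q0 unfolding P_def by auto
    fix a b assume ab: "a \<in> carrier A" "b \<in> carrier A" "a \<otimes>\<^bsub>A\<^esub> b \<in> P"
    have cl: "closedin (zariski A) {p. primeideal p A \<and> {x} \<subseteq> p}" if "x \<in> carrier A" for x
      unfolding closedin_zariski using that by blast
    \<comment> \<open>If a b lies in P, every point of C contains a or b, so two closed sets cover C
      and irreducibility selects one of them.\<close>
    have "C \<subseteq> {p. primeideal p A \<and> {a} \<subseteq> p} \<union> {p. primeideal p A \<and> {b} \<subseteq> p}"
      using ab Cp unfolding P_def by auto
    then have "C \<subseteq> {p. primeideal p A \<and> {a} \<subseteq> p} \<or> C \<subseteq> {p. primeideal p A \<and> {b} \<subseteq> p}"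
      using irr[unfolded irreducible_in_def, THEN conjunct2, THEN conjunct2, rule_format,
          OF conjI[OF cl[OF ab(1)] conjI[OF cl[OF ab(2)]]]] by blast
    then show "a \<in> P \<or> b \<in> P" unfolding P_def by blast
  qed
  have zeros: "{q. primeideal q A \<and> Q \<subseteq> q} = C" if "primeideal Q A" "Q \<subseteq> P" for Q
    using that Cp unfolding P_def by (intro max irreducible_zeros) blast+
  have "P \<in> C" using zeros[OF P] P by blast
  moreover have "Q = P" if "primeideal Q A" "Q \<subseteq> P" for Q
  proof -
    have "Q \<in> C" using zeros[OF that] that(1) by blast
    then show ?thesis using that(2) unfolding P_def by blast
  qed
  ultimately show thesis using that P by blast
qed

text \<open>A minimal prime P in C contracts to 0: an element that does not divide zero lies in no
  minimal prime. The image of C therefore contains the generic point of the spectrum of the domain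
  R.\<close>

lemma component_dominant:
  assumes R: "domain R" and T: "cring T" and \<phi>: "\<phi> \<in> ring_hom R T"
    and nzd: "\<And>r t. \<lbrakk>r \<in> carrier R; r \<noteq> \<zero>\<^bsub>R\<^esub>; t \<in> carrier T; \<phi> r \<otimes>\<^bsub>T\<^esub> t = \<zero>\<^bsub>T\<^esub>\<rbrakk> \<Longrightarrow> t = \<zero>\<^bsub>T\<^esub>"
    and C: "C \<in> irreducible_components (zariski T)"
  shows "maps_dominantly (Spec R) (Spec_map R T \<phi>) C"
proof -
  interpret R: domain R by fact
  interpret T: cring T by fact
  interpret f: spec_map R T \<phi> by unfold_locales (rule \<phi>)
  obtain P where P: "P \<in> C" "primeideal P T" "\<And>Q. primeideal Q T \<Longrightarrow> Q \<subseteq> P \<Longrightarrow> Q = P"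
    using component_minimal_prime[OF T C] by blast
  interpret P: primeideal P T by (rule P(2))
  have notin: "\<phi> r \<notin> P" if r: "r \<in> carrier R" "r \<noteq> \<zero>\<^bsub>R\<^esub>" for r
  proof
    assume rP: "\<phi> r \<in> P"
    have rc: "\<phi> r \<in> carrier T" by (rule f.hom_closed[OF r(1)])
    \<comment> \<open>The multiplicative set generated by \<phi> r and the complement of P. A prime
      avoiding it lies inside P and omits \<phi> r, which contradicts the minimality of P.\<close>
    define M where "M = {s \<otimes>\<^bsub>T\<^esub> \<phi> r [^]\<^bsub>T\<^esub> n | s n. s \<in> carrier T - P \<and> n \<in> (UNIV :: nat set)}"
    have MI: "s \<otimes>\<^bsub>T\<^esub> \<phi> r [^]\<^bsub>T\<^esub> (n::nat) \<in> M" if "s \<in> carrier T" "s \<notin> P" for s n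
      using that unfolding M_def by blast
    have one: "\<one>\<^bsub>T\<^esub> \<notin> P" by (rule prime_one_notin[OF P(2)])
    have "submonoid M T"
    proof (rule submonoid.intro)
      show "M \<subseteq> carrier T" unfolding M_def using rc by auto
      show "\<one>\<^bsub>T\<^esub> \<in> M" using MI[OF T.one_closed one, of 0] by simp
      fix x y assume "x \<in> M" "y \<in> M"
      then obtain s n t m where "s \<in> carrier T" "s \<notin> P" "x = s \<otimes>\<^bsub>T\<^esub> \<phi> r [^]\<^bsub>T\<^esub> (n::nat)"
        "t \<in> carrier T" "t \<notin> P" "y = t \<otimes>\<^bsub>T\<^esub> \<phi> r [^]\<^bsub>T\<^esub> (m::nat)" unfolding M_def by blast
      then have "x \<otimes>\<^bsub>T\<^esub> y = (s \<otimes>\<^bsub>T\<^esub> t) \<otimes>\<^bsub>T\<^esub> \<phi> r [^]\<^bsub>T\<^esub> (n + m)" "s \<otimes>\<^bsub>T\<^esub> t \<in> carrier T" "s \<otimes>\<^bsub>T\<^esub> t \<notin> P"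
        using rc P(2) by (simp_all add: T.nat_pow_mult[symmetric] T.m_ac)
      then show "x \<otimes>\<^bsub>T\<^esub> y \<in> M" using MI by simp
    qed
    then interpret M: localised T M by (intro localised.intro localised_axioms.intro T)
    \<comment> \<open>The hypothesis on nonzero elements of R removes the powers of \<phi> r one at
      a time. Thus 0 in M would force s = 0, although s lies outside P.\<close>
    have cancel: "s = \<zero>\<^bsub>T\<^esub>" if "s \<in> carrier T" "s \<otimes>\<^bsub>T\<^esub> \<phi> r [^]\<^bsub>T\<^esub> (n::nat) = \<zero>\<^bsub>T\<^esub>" for s n
      using that
    proof (induction n)
      case (Suc n)
      have "\<phi> r \<otimes>\<^bsub>T\<^esub> (s \<otimes>\<^bsub>T\<^esub> \<phi> r [^]\<^bsub>T\<^esub> n) = \<zero>\<^bsub>T\<^esub>"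
        using Suc.prems rc by (simp add: T.m_ac)
      then have "s \<otimes>\<^bsub>T\<^esub> \<phi> r [^]\<^bsub>T\<^esub> n = \<zero>\<^bsub>T\<^esub>" using nzd[OF r] Suc.prems(1) rc by simp
      then show ?case using Suc by blast
    qed simp
    have disj: "{\<zero>\<^bsub>T\<^esub>} \<inter> M = {}"
    proof -
      have "\<zero>\<^bsub>T\<^esub> \<notin> M" unfolding M_def using cancel P.zero_closed by fastforce
      then show ?thesis by blast
    qed
    obtain Q where Q: "primeideal Q T" "{\<zero>\<^bsub>T\<^esub>} \<subseteq> Q" "Q \<inter> M = {}"
      by (rule M.prime_avoiding[OF T.zeroideal disj])
    have "Q \<subseteq> P"
    proof
      fix x assume x: "x \<in> Q"
      then have xc: "x \<in> carrier T" using ideal.Icarr[OF primeideal.axioms(1)[OF Q(1)]] by blast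
      show "x \<in> P"
      proof (rule ccontr)
        assume "x \<notin> P"
        then have "x \<in> M" using MI[OF xc, of 0] xc by simp
        then show False using x Q(3) by blast
      qed
    qed
    then have "Q = P" using P(3) Q(1) by blast
    moreover have "\<phi> r \<in> M" using MI[OF T.one_closed one, of "Suc 0"] rc by simp
    ultimately show False using rP Q(3) by blast
  qed
  show ?thesis
    unfolding maps_dominantly_def Spec_simps topspace_zariski
  proof
    show "zariski R closure_of (rm_pt (Spec_map R T \<phi>) ` C) \<subseteq> primes R"
      using closure_of_subset_topspace[of "zariski R"] unfolding topspace_zariski .
    show "primes R \<subseteq> zariski R closure_of (rm_pt (Spec_map R T \<phi>) ` C)"
    proof
      fix p assume p: "p \<in> primes R"
      show "p \<in> zariski R closure_of (rm_pt (Spec_map R T \<phi>) ` C)"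
        unfolding in_closure_of topspace_zariski
      proof (intro conjI allI impI p)
        fix U assume U: "p \<in> U \<and> openin (zariski R) U"
        then obtain e where e: "e \<in> carrier R" "e \<notin> p" "\<And>q. primeideal q R \<Longrightarrow> e \<notin> q \<Longrightarrow> q \<in> U"
          using open_contains_basic by metis
        have "e \<noteq> \<zero>\<^bsub>R\<^esub>"
          using e(2) additive_subgroup.zero_closed[OF ideal.axioms(1)[OF primeideal.axioms(1)]] p by blast
        \<comment> \<open>As P contracts to 0, the contraction lies in every nonempty basic open
          set.\<close>
        then have "e \<notin> f.contr P" using notin[OF e(1)] unfolding f.contr_def by blast
        then have "f.contr P \<in> U" using e(3) f.contr_prime[OF P(2)] by blast
        then show "\<exists>y. y \<in> rm_pt (Spec_map R T \<phi>) ` C \<and> y \<in> U"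
          using P(1) unfolding f.map_point by blast
      qed
    qed
  qed
qed

section \<open>Freeness after localisation\<close>

text \<open>The setting of generic freeness: f is a common leading coefficient for all relations, up
  to coefficients killed by h. Inverting x = f h makes f and h units and the base a domain.\<close>

locale leading_denominator = monomial_basis R A \<iota> I e
  for R :: "'r ring" and A :: "'a ring" and \<iota> :: "'r \<Rightarrow> 'a" and I and e +
  fixes h f
  assumes h: "h \<in> carrier R" and hh: "h \<otimes>\<^bsub>R\<^esub> h \<noteq> \<zero>\<^bsub>R\<^esub>"
    and prime: "\<And>a b. \<lbrakk>a \<in> carrier R; b \<in> carrier R; (a \<otimes>\<^bsub>R\<^esub> b) \<otimes>\<^bsub>R\<^esub> h = \<zero>\<^bsub>R\<^esub>\<rbrakk> \<Longrightarrow>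
      a \<otimes>\<^bsub>R\<^esub> h = \<zero>\<^bsub>R\<^esub> \<or> b \<otimes>\<^bsub>R\<^esub> h = \<zero>\<^bsub>R\<^esub>"
    and f: "f \<in> carrier R" and fh: "f \<otimes>\<^bsub>R\<^esub> h \<noteq> \<zero>\<^bsub>R\<^esub>"
    and leading: "\<And>n c. \<lbrakk>n \<in> I; c \<in> carrier R; c \<otimes>\<^bsub>R\<^esub> h \<noteq> \<zero>\<^bsub>R\<^esub>; \<iota> c \<otimes>\<^bsub>A\<^esub> e n \<in> low n\<rbrakk> \<Longrightarrow>
      \<iota> f \<otimes>\<^bsub>A\<^esub> e n \<in> low n"
begin

definition x where "x = f \<otimes>\<^bsub>R\<^esub> h"

lemma x_carr: "x \<in> carrier R"
  unfolding x_def using f h by simp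

abbreviation PR where "PR \<equiv> powers R x"
abbreviation PA where "PA \<equiv> powers A (\<iota> x)"
abbreviation \<iota>' where "\<iota>' \<equiv> localisation_map A PA \<iota>"

sublocale r: localised R PR
  by (rule localised_powers[OF K.is_cring x_carr])

sublocale a: localised A PA
  by (rule localised_powers[OF A.is_cring \<iota>_closed[OF x_carr]])

lemma \<iota>_powers: "\<iota> ` PR = PA"
  by (rule powers_image[OF K.is_cring A.is_cring hom x_carr])

lemma \<iota>_PR: "t \<in> PR \<Longrightarrow> \<iota> t \<in> PA"
  using \<iota>_powers by blast

lemma \<iota>'_frac: "y \<in> carrier R \<Longrightarrow> t \<in> PR \<Longrightarrow> \<iota>' (r.frac y t) = a.frac (\<iota> y) (\<iota> t)"
  using \<iota>_powers by (intro localisation_map_frac r.localised_axioms a.localised_axioms hom) auto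

lemma ext': "ring_extension r.L a.L \<iota>'"
  using \<iota>_powers
  by (intro ring_extension.intro ring_extension_axioms.intro r.L.is_cring a.L.is_cring
    localisation_map_hom r.localised_axioms a.localised_axioms hom) auto

sublocale X: ring_extension r.L a.L \<iota>'
  by (rule ext')

text \<open>Both f and h lie outside the prime annihilator of h, as neither f h nor h h vanishes.
  Hence no power of x lies in it, and such powers can be cancelled.\<close>

lemma cancel_power:
  assumes "t \<in> PR" "y \<in> carrier R" "(t \<otimes>\<^bsub>R\<^esub> y) \<otimes>\<^bsub>R\<^esub> h = \<zero>\<^bsub>R\<^esub>"
  shows "y \<otimes>\<^bsub>R\<^esub> h = \<zero>\<^bsub>R\<^esub>"
proof -
  have "(x [^]\<^bsub>R\<^esub> n \<otimes>\<^bsub>R\<^esub> y) \<otimes>\<^bsub>R\<^esub> h = \<zero>\<^bsub>R\<^esub> \<Longrightarrow> y \<otimes>\<^bsub>R\<^esub> h = \<zero>\<^bsub>R\<^esub>" for n :: nat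
  proof (induction n)
    case 0
    then show ?case using assms(2) by simp
  next
    case (Suc n)
    let ?z = "x [^]\<^bsub>R\<^esub> n \<otimes>\<^bsub>R\<^esub> y"
    have z: "?z \<in> carrier R" using x_carr assms(2) by simp
    have "(f \<otimes>\<^bsub>R\<^esub> (h \<otimes>\<^bsub>R\<^esub> ?z)) \<otimes>\<^bsub>R\<^esub> h = (x [^]\<^bsub>R\<^esub> Suc n \<otimes>\<^bsub>R\<^esub> y) \<otimes>\<^bsub>R\<^esub> h"
      using f h x_carr assms(2) by (simp add: x_def K.m_ac)
    then have "(h \<otimes>\<^bsub>R\<^esub> ?z) \<otimes>\<^bsub>R\<^esub> h = \<zero>\<^bsub>R\<^esub>" using prime[OF f, of "h \<otimes>\<^bsub>R\<^esub> ?z"] fh h z Suc.prems by simp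
    then have "?z \<otimes>\<^bsub>R\<^esub> h = \<zero>\<^bsub>R\<^esub>" using prime[OF h z] hh by simp
    then show ?case by (rule Suc.IH)
  qed
  then show ?thesis using assms(1,3) unfolding powers_def by blast
qed

lemma x_in_PR: "x \<in> PR"
  by (rule base_in_powers[OF K.is_cring x_carr])

text \<open>The kernel of the localisation is exactly the annihilator of h: it absorbs the
  cancellation of powers of x, and conversely x, being a multiple of h, kills it.\<close>

lemma frac_zero:
  assumes "y \<in> carrier R" "t \<in> PR"
  shows "r.frac y t = \<zero>\<^bsub>r.L\<^esub> \<longleftrightarrow> y \<otimes>\<^bsub>R\<^esub> h = \<zero>\<^bsub>R\<^esub>"
  unfolding r.frac_zero_iff[OF assms]
proof
  assume "\<exists>u\<in>PR. u \<otimes>\<^bsub>R\<^esub> y = \<zero>\<^bsub>R\<^esub>"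
  then obtain u where "u \<in> PR" "u \<otimes>\<^bsub>R\<^esub> y = \<zero>\<^bsub>R\<^esub>" by blast
  then show "y \<otimes>\<^bsub>R\<^esub> h = \<zero>\<^bsub>R\<^esub>" using cancel_power[of u y] assms(1) h by simp
next
  assume z: "y \<otimes>\<^bsub>R\<^esub> h = \<zero>\<^bsub>R\<^esub>"
  have "x \<otimes>\<^bsub>R\<^esub> y = f \<otimes>\<^bsub>R\<^esub> (y \<otimes>\<^bsub>R\<^esub> h)" using f h assms(1) by (simp add: x_def K.m_ac)
  then have "x \<otimes>\<^bsub>R\<^esub> y = \<zero>\<^bsub>R\<^esub>" using z f by simp
  then show "\<exists>u\<in>PR. u \<otimes>\<^bsub>R\<^esub> y = \<zero>\<^bsub>R\<^esub>" using x_in_PR by blast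
qed

lemma h_nonzero: "h \<noteq> \<zero>\<^bsub>R\<^esub>"
  using hh h by auto

text \<open>A product of fractions vanishes only if h kills the product of the numerators, and
  primeness of the annihilator then selects one factor.\<close>

lemma domain_L: "domain r.L"
proof (intro domain.intro domain_axioms.intro r.L.is_cring)
  show "\<one>\<^bsub>r.L\<^esub> \<noteq> \<zero>\<^bsub>r.L\<^esub>"
    unfolding r.L_one using frac_zero[of "\<one>\<^bsub>R\<^esub>" "\<one>\<^bsub>R\<^esub>"] h h_nonzero by simp
  fix u v assume uv: "u \<otimes>\<^bsub>r.L\<^esub> v = \<zero>\<^bsub>r.L\<^esub>" and u: "u \<in> carrier r.L" and v: "v \<in> carrier r.L"
  obtain y s where y: "y \<in> carrier R" "s \<in> PR" "u = r.frac y s" using u by (rule r.carr_fracE)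
  obtain z t where z: "z \<in> carrier R" "t \<in> PR" "v = r.frac z t" using v by (rule r.carr_fracE)
  have "r.frac (y \<otimes>\<^bsub>R\<^esub> z) (s \<otimes>\<^bsub>R\<^esub> t) = \<zero>\<^bsub>r.L\<^esub>" using uv y z by simp
  then have "(y \<otimes>\<^bsub>R\<^esub> z) \<otimes>\<^bsub>R\<^esub> h = \<zero>\<^bsub>R\<^esub>" using frac_zero y z by simp
  then show "u = \<zero>\<^bsub>r.L\<^esub> \<or> v = \<zero>\<^bsub>r.L\<^esub>" using prime y z frac_zero by simp
qed

section \<open>The basis of nonleading monomials\<close>

definition e' where "e' n = a.frac (e n) \<one>\<^bsub>A\<^esub>"
text \<open>In R[1/x] an element c vanishes exactly when h kills it. So these are the monomials that
  lead no relation over the localised ring, described over R.\<close>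

definition N where "N = {n \<in> I. \<forall>c\<in>carrier R. \<iota> c \<otimes>\<^bsub>A\<^esub> e n \<in> low n \<longrightarrow> c \<otimes>\<^bsub>R\<^esub> h = \<zero>\<^bsub>R\<^esub>}"

lemma e'_carr: "n \<in> I \<Longrightarrow> e' n \<in> carrier a.L"
  unfolding e'_def using e_carr by simp

lemma e'_image_carr: "J \<subseteq> I \<Longrightarrow> e' ` J \<subseteq> carrier a.L"
  using e'_carr by blast

lemma span_frac:
  assumes "y \<in> span (e ` J)" "J \<subseteq> I"
  shows "a.frac y \<one>\<^bsub>A\<^esub> \<in> X.span (e' ` J)"
  using assms(1)
proof induction
  case zero
  show ?case using lspan.zero[of a.L r.L \<iota>' "e' ` J"] unfolding a.L_zero .
next
  case (step k m y)
  then obtain n where n: "n \<in> J" "m = e n" by blast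
  have c: "m \<in> carrier A" "y \<in> carrier A" "\<iota> k \<in> carrier A"
    using n assms(2) e_carr span_carr[OF step(3)] \<iota>_closed[OF step(1)] by auto
  have "a.frac (\<iota> k \<otimes>\<^bsub>A\<^esub> m \<oplus>\<^bsub>A\<^esub> y) \<one>\<^bsub>A\<^esub> = \<iota>' (r.frac k \<one>\<^bsub>R\<^esub>) \<otimes>\<^bsub>a.L\<^esub> e' n \<oplus>\<^bsub>a.L\<^esub> a.frac y \<one>\<^bsub>A\<^esub>"
    using c step(1) n(2) by (simp add: \<iota>'_frac e'_def \<iota>_simps)
  moreover have "\<iota>' (r.frac k \<one>\<^bsub>R\<^esub>) \<otimes>\<^bsub>a.L\<^esub> e' n \<oplus>\<^bsub>a.L\<^esub> a.frac y \<one>\<^bsub>A\<^esub> \<in> X.span (e' ` J)"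
    using step n by (intro lspan.step) auto
  ultimately show ?case by simp
qed

text \<open>Finitely many coefficients have a common denominator t. As t comes from R, clearing it
  changes only the coefficients and not the set of monomials.\<close>

lemma span_clear:
  assumes "y' \<in> X.span (e' ` J)" "J \<subseteq> I"
  shows "\<exists>t\<in>PR. \<exists>y\<in>span (e ` J). \<iota>' (r.frac t \<one>\<^bsub>R\<^esub>) \<otimes>\<^bsub>a.L\<^esub> y' = a.frac y \<one>\<^bsub>A\<^esub>"
  using assms(1)
proof induction
  case zero
  have "\<iota>' (r.frac \<one>\<^bsub>R\<^esub> \<one>\<^bsub>R\<^esub>) \<otimes>\<^bsub>a.L\<^esub> \<zero>\<^bsub>a.L\<^esub> = a.frac \<zero>\<^bsub>A\<^esub> \<one>\<^bsub>A\<^esub>"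
    using a.L_zero by (simp add: \<iota>'_frac \<iota>_simps)
  then show ?case using lspan.zero[of A R \<iota> "e ` J"] r.M_one by blast
next
  case (step k' m y')
  obtain n where n: "n \<in> J" "m = e' n" using step(2) by blast
  obtain t y where t: "t \<in> PR" "y \<in> span (e ` J)" "\<iota>' (r.frac t \<one>\<^bsub>R\<^esub>) \<otimes>\<^bsub>a.L\<^esub> y' = a.frac y \<one>\<^bsub>A\<^esub>"
    using step(4) by blast
  obtain k s where k: "k \<in> carrier R" "s \<in> PR" "k' = r.frac k s" using step(1) by (rule r.carr_fracE)
  have Jc: "e ` J \<subseteq> carrier A" using e_carr assms(2) by auto
  have c: "e n \<in> carrier A" "y \<in> carrier A" "t \<in> carrier R" "s \<in> carrier R"
    using n e_carr assms(2) span_carr[OF t(2) Jc] t(1) k(2) by auto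
  have y'c: "y' \<in> carrier a.L" using X.span_carr[OF step(3) e'_image_carr[OF assms(2)]] .
  have mc: "m \<in> carrier a.L" using n e'_carr assms(2) by auto
  let ?T = "\<iota>' (r.frac t \<one>\<^bsub>R\<^esub>)" and ?S = "\<iota>' (r.frac s \<one>\<^bsub>R\<^esub>)"
  have TS: "?T \<in> carrier a.L" "?S \<in> carrier a.L" "\<iota>' k' \<in> carrier a.L"
    using X.\<iota>_closed c step(1) by simp_all
  have 1: "\<iota>' (r.frac (t \<otimes>\<^bsub>R\<^esub> s) \<one>\<^bsub>R\<^esub>) = ?T \<otimes>\<^bsub>a.L\<^esub> ?S"
    using c by (simp add: X.\<iota>_simps(1)[symmetric])
  have "r.frac s \<one>\<^bsub>R\<^esub> \<otimes>\<^bsub>r.L\<^esub> k' = r.frac k \<one>\<^bsub>R\<^esub>"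
    unfolding k(3) using k c by simp (intro r.frac_eqI, auto simp: K.m_ac)
  then have "?S \<otimes>\<^bsub>a.L\<^esub> \<iota>' k' = \<iota>' (r.frac k \<one>\<^bsub>R\<^esub>)"
    using X.\<iota>_simps(1)[of "r.frac s \<one>\<^bsub>R\<^esub>" k'] c step(1) by simp
  then have 2: "?T \<otimes>\<^bsub>a.L\<^esub> ?S \<otimes>\<^bsub>a.L\<^esub> (\<iota>' k' \<otimes>\<^bsub>a.L\<^esub> m) = a.frac (\<iota> (t \<otimes>\<^bsub>R\<^esub> k) \<otimes>\<^bsub>A\<^esub> e n) \<one>\<^bsub>A\<^esub>"
  proof -
    assume e: "?S \<otimes>\<^bsub>a.L\<^esub> \<iota>' k' = \<iota>' (r.frac k \<one>\<^bsub>R\<^esub>)"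
    have "?T \<otimes>\<^bsub>a.L\<^esub> ?S \<otimes>\<^bsub>a.L\<^esub> (\<iota>' k' \<otimes>\<^bsub>a.L\<^esub> m) = ?T \<otimes>\<^bsub>a.L\<^esub> (?S \<otimes>\<^bsub>a.L\<^esub> \<iota>' k') \<otimes>\<^bsub>a.L\<^esub> m"
      using TS mc by (simp add: a.L.m_ac)
    also have "\<dots> = a.frac (\<iota> (t \<otimes>\<^bsub>R\<^esub> k) \<otimes>\<^bsub>A\<^esub> e n) \<one>\<^bsub>A\<^esub>"
      unfolding e n(2) e'_def using c k \<iota>_closed by (simp add: \<iota>'_frac \<iota>_simps)
    finally show ?thesis .
  qed
  have 3: "?T \<otimes>\<^bsub>a.L\<^esub> ?S \<otimes>\<^bsub>a.L\<^esub> y' = a.frac (\<iota> s \<otimes>\<^bsub>A\<^esub> y) \<one>\<^bsub>A\<^esub>"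
  proof -
    have "?T \<otimes>\<^bsub>a.L\<^esub> ?S \<otimes>\<^bsub>a.L\<^esub> y' = ?S \<otimes>\<^bsub>a.L\<^esub> (?T \<otimes>\<^bsub>a.L\<^esub> y')" using TS y'c by (simp add: a.L.m_ac)
    also have "\<dots> = a.frac (\<iota> s \<otimes>\<^bsub>A\<^esub> y) \<one>\<^bsub>A\<^esub>"
      unfolding t(3) using c \<iota>_closed by (simp add: \<iota>'_frac \<iota>_simps)
    finally show ?thesis .
  qed
  have sy: "\<iota> s \<otimes>\<^bsub>A\<^esub> y \<in> span (e ` J)" by (rule span_scale[OF t(2) Jc c(4)])
  have "\<iota>' (r.frac (t \<otimes>\<^bsub>R\<^esub> s) \<one>\<^bsub>R\<^esub>) \<otimes>\<^bsub>a.L\<^esub> (\<iota>' k' \<otimes>\<^bsub>a.L\<^esub> m \<oplus>\<^bsub>a.L\<^esub> y') =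
      a.frac (\<iota> (t \<otimes>\<^bsub>R\<^esub> k) \<otimes>\<^bsub>A\<^esub> e n) \<one>\<^bsub>A\<^esub> \<oplus>\<^bsub>a.L\<^esub> a.frac (\<iota> s \<otimes>\<^bsub>A\<^esub> y) \<one>\<^bsub>A\<^esub>"
    unfolding 1 2[symmetric] 3[symmetric] using TS mc y'c by (intro a.L.r_distr) simp_all
  also have "\<dots> = a.frac (\<iota> (t \<otimes>\<^bsub>R\<^esub> k) \<otimes>\<^bsub>A\<^esub> e n \<oplus>\<^bsub>A\<^esub> \<iota> s \<otimes>\<^bsub>A\<^esub> y) \<one>\<^bsub>A\<^esub>"
    using c k \<iota>_closed by (intro a.frac_add_same) simp_all
  finally show ?case
    using lspan.step[OF K.m_closed[OF c(3) k(1)] imageI[OF n(1)] sy] r.M_mult[OF t(1) k(2)] n(2) by blast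
qed

text \<open>A leading relation over the localised rings clears to one over R, whose coefficient h
  kills because n is in N; the extra powers of x cancel.\<close>

lemma leading_zero:
  assumes n: "n \<in> N" and c: "c' \<in> carrier r.L"
    and rel: "\<iota>' c' \<otimes>\<^bsub>a.L\<^esub> e' n \<in> X.span (e' ` {k \<in> I. k < n})"
  shows "c' = \<zero>\<^bsub>r.L\<^esub>"
proof -
  have nI: "n \<in> I" using n unfolding N_def by blast
  obtain c s where cs: "c \<in> carrier R" "s \<in> PR" "c' = r.frac c s" using c by (rule r.carr_fracE)
  obtain t y where t: "t \<in> PR" "y \<in> span (e ` {k \<in> I. k < n})"
    "\<iota>' (r.frac t \<one>\<^bsub>R\<^esub>) \<otimes>\<^bsub>a.L\<^esub> (\<iota>' c' \<otimes>\<^bsub>a.L\<^esub> e' n) = a.frac y \<one>\<^bsub>A\<^esub>" using span_clear[OF rel] by blast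
  have y: "y \<in> low n" using t(2) unfolding low_def .
  have car: "e n \<in> carrier A" "y \<in> carrier A" "t \<in> carrier R" "s \<in> carrier R"
    using e_carr[OF nI] low_carr[OF y] t(1) cs(2) by auto
  have "\<iota>' (r.frac t \<one>\<^bsub>R\<^esub>) \<otimes>\<^bsub>a.L\<^esub> (\<iota>' c' \<otimes>\<^bsub>a.L\<^esub> e' n) = a.frac (\<iota> t \<otimes>\<^bsub>A\<^esub> (\<iota> c \<otimes>\<^bsub>A\<^esub> e n)) (\<iota> s)"
    unfolding cs(3) e'_def using cs car \<iota>_closed \<iota>_PR by (simp add: \<iota>'_frac \<iota>_simps)
  then have "a.frac (\<iota> t \<otimes>\<^bsub>A\<^esub> (\<iota> c \<otimes>\<^bsub>A\<^esub> e n)) (\<iota> s) = a.frac y \<one>\<^bsub>A\<^esub>" using t(3) by simp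
  moreover have "\<iota> t \<otimes>\<^bsub>A\<^esub> (\<iota> c \<otimes>\<^bsub>A\<^esub> e n) \<in> carrier A" "\<iota> s \<in> PA"
    using cs car \<iota>_closed \<iota>_PR by simp_all
  ultimately obtain u where u: "u \<in> PA"
    "u \<otimes>\<^bsub>A\<^esub> ((\<iota> t \<otimes>\<^bsub>A\<^esub> (\<iota> c \<otimes>\<^bsub>A\<^esub> e n)) \<otimes>\<^bsub>A\<^esub> \<one>\<^bsub>A\<^esub>) = u \<otimes>\<^bsub>A\<^esub> (y \<otimes>\<^bsub>A\<^esub> \<iota> s)"
    using car by (subst (asm) a.frac_eq_iff) auto
  obtain w where w: "w \<in> PR" "u = \<iota> w" using u(1) \<iota>_powers by blast
  have wc: "w \<in> carrier R" using w(1) by blast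
  have "\<iota> (w \<otimes>\<^bsub>R\<^esub> t \<otimes>\<^bsub>R\<^esub> c) \<otimes>\<^bsub>A\<^esub> e n = u \<otimes>\<^bsub>A\<^esub> ((\<iota> t \<otimes>\<^bsub>A\<^esub> (\<iota> c \<otimes>\<^bsub>A\<^esub> e n)) \<otimes>\<^bsub>A\<^esub> \<one>\<^bsub>A\<^esub>)"
    unfolding w(2) using wc cs car \<iota>_closed by (simp add: \<iota>_simps A.m_assoc)
  also have "\<dots> = \<iota> (w \<otimes>\<^bsub>R\<^esub> s) \<otimes>\<^bsub>A\<^esub> y"
    unfolding u(2) unfolding w(2) using wc cs car \<iota>_closed by (simp add: \<iota>_simps A.m_ac)
  also have "\<dots> \<in> low n" by (rule low_scale[OF y K.m_closed[OF wc car(4)]])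
  finally have "(w \<otimes>\<^bsub>R\<^esub> t \<otimes>\<^bsub>R\<^esub> c) \<otimes>\<^bsub>R\<^esub> h = \<zero>\<^bsub>R\<^esub>" using n wc car cs unfolding N_def by simp
  then have "c \<otimes>\<^bsub>R\<^esub> h = \<zero>\<^bsub>R\<^esub>" by (rule cancel_power[OF r.M_mult[OF w(1) t(1)] cs(1)])
  then show ?thesis using frac_zero cs by simp
qed

lemma N_sub: "N \<subseteq> I"
  unfolding N_def by blast

text \<open>Strong induction: after multiplication by f a leading monomial is a combination of
  smaller ones, and f is a unit in R[1/x].\<close>

lemma e'_in_span: "n \<in> I \<Longrightarrow> e' n \<in> X.span (e' ` N)"
proof (induction n rule: less_induct)
  case (less n)
  show ?case
  proof (cases "n \<in> N")
    case True
    then show ?thesis using X.span_incl[OF _ e'_image_carr[OF N_sub]] by blast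
  next
    case False
    then obtain c where "c \<in> carrier R" "c \<otimes>\<^bsub>R\<^esub> h \<noteq> \<zero>\<^bsub>R\<^esub>" "\<iota> c \<otimes>\<^bsub>A\<^esub> e n \<in> low n"
      using less.prems unfolding N_def by blast
    then have "\<iota> f \<otimes>\<^bsub>A\<^esub> e n \<in> span (e ` {k \<in> I. k < n})" using leading[OF less.prems] unfolding low_def by blast
    then have 1: "a.frac (\<iota> f \<otimes>\<^bsub>A\<^esub> e n) \<one>\<^bsub>A\<^esub> \<in> X.span (e' ` {k \<in> I. k < n})" by (rule span_frac) blast
    have "e' ` {k \<in> I. k < n} \<subseteq> X.span (e' ` N)" using less.IH by blast
    then have 2: "a.frac (\<iota> f \<otimes>\<^bsub>A\<^esub> e n) \<one>\<^bsub>A\<^esub> \<in> X.span (e' ` N)"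
      by (rule X.span_subset[OF 1 _ e'_image_carr[OF N_sub]])
    \<comment> \<open>The inverse of f in the localisation, since x = f h.\<close>
    let ?g = "r.frac h x"
    have g: "?g \<in> carrier r.L" using h x_in_PR by blast
    have "\<iota>' ?g \<otimes>\<^bsub>a.L\<^esub> a.frac (\<iota> f \<otimes>\<^bsub>A\<^esub> e n) \<one>\<^bsub>A\<^esub> = a.frac (\<iota> h \<otimes>\<^bsub>A\<^esub> (\<iota> f \<otimes>\<^bsub>A\<^esub> e n)) (\<iota> x)"
      using h f x_in_PR \<iota>_closed e_carr[OF less.prems] \<iota>_PR[OF x_in_PR] by (simp add: \<iota>'_frac)
    also have "\<dots> = e' n"
      unfolding e'_def
    proof (rule a.frac_eqI[OF _ \<iota>_PR[OF x_in_PR] e_carr[OF less.prems] a.M_one])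
      show "\<iota> h \<otimes>\<^bsub>A\<^esub> (\<iota> f \<otimes>\<^bsub>A\<^esub> e n) \<otimes>\<^bsub>A\<^esub> \<one>\<^bsub>A\<^esub> = e n \<otimes>\<^bsub>A\<^esub> \<iota> x"
        unfolding x_def using h f \<iota>_closed e_carr[OF less.prems] by (simp add: \<iota>_simps A.m_ac)
    qed (use h f \<iota>_closed e_carr[OF less.prems] in simp)
    finally show ?thesis using X.span_scale[OF 2 e'_image_carr[OF N_sub] g] by simp
  qed
qed

text \<open>The relation may involve monomials above n. The largest of them is in N, so its
  coefficient vanishes by \<open>leading_zero\<close>. Descending on the bound m leaves monomials
  below n, where \<open>leading_zero\<close> applies to n itself.\<close>

lemma e'_indep:
  assumes n: "n \<in> N" and c: "c \<in> carrier r.L"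
    and rel: "\<iota>' c \<otimes>\<^bsub>a.L\<^esub> e' n \<in> X.span (e' ` {k \<in> N. k \<noteq> n \<and> k < m})"
  shows "c = \<zero>\<^bsub>r.L\<^esub>"
  using rel
proof (induction m)
  case 0
  have "{k \<in> N. k \<noteq> n \<and> k < 0} \<subseteq> {k \<in> I. k < n}" by simp
  then have "e' ` {k \<in> N. k \<noteq> n \<and> k < 0} \<subseteq> e' ` {k \<in> I. k < n}" by blast
  then show ?case using leading_zero[OF n c] lspan_mono[OF 0] by blast
next
  case (Suc m)
  show ?case
  proof (cases "m \<in> N \<and> n < m")
    case False
    then have "{k \<in> N. k \<noteq> n \<and> k < Suc m} \<subseteq> {k \<in> N. k \<noteq> n \<and> k < m} \<or>
        {k \<in> N. k \<noteq> n \<and> k < Suc m} \<subseteq> {k \<in> I. k < n}" using N_sub by (auto simp: less_Suc_eq)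
    then have "e' ` {k \<in> N. k \<noteq> n \<and> k < Suc m} \<subseteq> e' ` {k \<in> N. k \<noteq> n \<and> k < m} \<or>
        e' ` {k \<in> N. k \<noteq> n \<and> k < Suc m} \<subseteq> e' ` {k \<in> I. k < n}" by blast
    then show ?thesis using Suc.IH lspan_mono[OF Suc.prems] leading_zero[OF n c] by blast
  next
    case True
    let ?S = "{k \<in> N. k \<noteq> n \<and> k < m}"
    have SI: "?S \<subseteq> I" using N_sub by blast
    note Sc = e'_image_carr[OF SI]
    have "e' ` {k \<in> N. k \<noteq> n \<and> k < Suc m} = insert (e' m) (e' ` ?S)" using True by (auto simp: less_Suc_eq)
    then have ins: "\<iota>' c \<otimes>\<^bsub>a.L\<^esub> e' n \<in> X.span (insert (e' m) (e' ` ?S))" using Suc.prems by simp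
    have mI: "m \<in> I" and nI: "n \<in> I" using True n N_sub by blast+
    obtain d y where d: "d \<in> carrier r.L" "y \<in> X.span (e' ` ?S)"
      "\<iota>' c \<otimes>\<^bsub>a.L\<^esub> e' n = \<iota>' d \<otimes>\<^bsub>a.L\<^esub> e' m \<oplus>\<^bsub>a.L\<^esub> y"
      by (rule X.span_insertE[OF ins e'_carr[OF mI] Sc])
    have car: "\<iota>' c \<otimes>\<^bsub>a.L\<^esub> e' n \<in> carrier a.L" "\<iota>' d \<otimes>\<^bsub>a.L\<^esub> e' m \<in> carrier a.L" "y \<in> carrier a.L"
      using X.\<iota>_closed[OF c] X.\<iota>_closed[OF d(1)] e'_carr[OF mI] e'_carr[OF nI] X.span_carr[OF d(2) Sc] by simp_all
    let ?L = "e' ` {k \<in> I. k < m}"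
    have Lc: "?L \<subseteq> carrier a.L" by (rule e'_image_carr) blast
    have "e' n \<in> X.span ?L" using nI True by (intro X.span_incl[OF _ Lc]) blast
    then have 1: "\<iota>' c \<otimes>\<^bsub>a.L\<^esub> e' n \<in> X.span ?L" by (rule X.span_scale[OF _ Lc c])
    have 2: "y \<in> X.span ?L" by (rule lspan_mono[OF d(2)]) (use SI in auto)
    have "\<iota>' d \<otimes>\<^bsub>a.L\<^esub> e' m = \<iota>' c \<otimes>\<^bsub>a.L\<^esub> e' n \<oplus>\<^bsub>a.L\<^esub> \<ominus>\<^bsub>a.L\<^esub> y"
      unfolding d(3) using car by (simp add: a.L.a_assoc a.L.r_neg)
    also have "\<dots> \<in> X.span ?L" by (rule X.span_add[OF 1 X.span_minus[OF 2 Lc] Lc])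
    finally have "d = \<zero>\<^bsub>r.L\<^esub>" using leading_zero[of m d] True d(1) by blast
    then have "\<iota>' c \<otimes>\<^bsub>a.L\<^esub> e' n = y" using d(3) car e'_carr[OF mI] by (simp add: X.\<iota>_simps)
    then show ?thesis using Suc.IH d(2) by simp
  qed
qed

lemma free: "free_extension r.L a.L \<iota>' (e' ` N)"
proof (intro free_extension.intro free_extension_axioms.intro ext' domain_L)
  note Nc = e'_image_carr[OF N_sub]
  show "e' ` N \<subseteq> carrier a.L" by (rule Nc)
  show "carrier a.L \<subseteq> X.span (e' ` N)"
  proof
    fix y' assume "y' \<in> carrier a.L"
    then obtain y s where y: "y \<in> carrier A" "s \<in> PA" "y' = a.frac y s" by (rule a.carr_fracE)
    obtain t where t: "t \<in> PR" "s = \<iota> t" using y(2) \<iota>_powers by blast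
    have "a.frac y \<one>\<^bsub>A\<^esub> \<in> X.span (e' ` I)" using span_frac[of y I] e_span y(1) by blast
    then have 1: "a.frac y \<one>\<^bsub>A\<^esub> \<in> X.span (e' ` N)"
      by (rule X.span_subset[OF _ _ Nc]) (use e'_in_span in blast)
    have "r.frac \<one>\<^bsub>R\<^esub> t \<in> carrier r.L" using t by blast
    from X.span_scale[OF 1 Nc this] show "y' \<in> X.span (e' ` N)"
      using y t by (simp add: \<iota>'_frac \<iota>_simps)
  qed
  fix g c assume g: "g \<in> e' ` N" and c: "c \<in> carrier r.L"
    and rel: "\<iota>' c \<otimes>\<^bsub>a.L\<^esub> g \<in> X.span (e' ` N - {g})"
  obtain n where n: "n \<in> N" "g = e' n" using g by blast
  \<comment> \<open>The basis may be infinite, whereas \<open>e'_indep\<close> works below a bound;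
    the finitely many monomials in the relation supply one.\<close>
  obtain X' where X': "X' \<subseteq> e' ` N - {g}" "finite X'" "\<iota>' c \<otimes>\<^bsub>a.L\<^esub> g \<in> X.span X'"
    using lspan_finite[OF rel] by blast
  have "X' \<subseteq> e' ` {k \<in> N. k \<noteq> n}" using X'(1) n(2) by blast
  from finite_subset_image[OF X'(2) this]
  obtain N' where N': "N' \<subseteq> {k \<in> N. k \<noteq> n}" "finite N'" "X' = e' ` N'" by (elim exE conjE)
  have "N' \<subseteq> {k \<in> N. k \<noteq> n \<and> k < Suc (Max N')}" using N'(1,2) by (auto simp: less_Suc_eq_le)
  then have sub: "X' \<subseteq> e' ` {k \<in> N. k \<noteq> n \<and> k < Suc (Max N')}" unfolding N'(3) by (rule image_mono)
  have "\<iota>' c \<otimes>\<^bsub>a.L\<^esub> e' n \<in> X.span (e' ` {k \<in> N. k \<noteq> n \<and> k < Suc (Max N')})"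
    using lspan_mono[OF X'(3) sub] unfolding n(2) .
  then show "c = \<zero>\<^bsub>r.L\<^esub>" by (rule e'_indep[OF n(1) c])
qed

end

section \<open>The main theorem\<close>

text \<open>Finite sets have finitely many injections between them, so the finitely many generators
  have finitely many images in B(S).\<close>

lemma fi_fin_gen_obj:
  assumes alg: "is_fi_algebra K B" and gen: "fi_fin_gen_width_le d B" and S: "finite S"
  shows "finitely_generated_algebra K (fi_obj B S) (fi_str B S)"
proof -
  interpret ring_extension K "fi_obj B S" "fi_str B S"
    using fi_algD(1)[OF alg] fi_algD(3,4)[OF alg S] by (simp add: ring_extension_def ring_extension_axioms_def)
  obtain G where G: "finite G" "\<And>T b. (T, b) \<in> G \<Longrightarrow> finite T \<and> b \<in> carrier (fi_obj B T)"
    and gen: "generate_ring (fi_obj B S) (fi_str B S ` carrier K \<union>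
      {fi_map B T S \<pi> b | T b \<pi>. (T, b) \<in> G \<and> \<pi> \<in> fi_hom T S}) = carrier (fi_obj B S)"
    using gen S fi_algD(2)[OF alg] unfolding fi_fin_gen_width_le_def by fast
  let ?X = "{fi_map B T S \<pi> b | T b \<pi>. (T, b) \<in> G \<and> \<pi> \<in> fi_hom T S}"
  have "?X = (\<Union>(T, b)\<in>G. (\<lambda>\<pi>. fi_map B T S \<pi> b) ` fi_hom T S)" by auto
  moreover have "finite (fi_hom T S)" if "finite T" for T
    using finite_PiE[OF that, of "\<lambda>_. S"] S unfolding fi_hom_def by simp
  ultimately have fin: "finite ?X" using G by auto
  have X: "?X \<subseteq> carrier (fi_obj B S)"
    using G(2) ring_hom_closed[OF fi_algD(5)[OF alg _ S]] by blast
  show ?thesis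
    unfolding finitely_generated_algebra_def using generate_ring_span[OF X] gen fin X by blast
qed

lemma fi_over_init_simps:
  "fi_base (fi_over_init B) = fi_obj B {}" "fi_obj (fi_over_init B) = fi_obj B"
  "fi_map (fi_over_init B) = fi_map B" "fi_str (fi_over_init B) S = fi_map B {} S fi_init"
  unfolding fi_over_init_def by simp_all

text \<open>An FI-algebra taken over its value at the empty set stays so under localisation, because
  its structure map at the empty set is the identity. This reconciles the two uses of
  \<open>fi_over_init\<close> in the statement.\<close>

lemma fi_invert_over_init:
  assumes alg: "is_fi_algebra K B" and h: "h \<in> carrier (fi_obj B {})"
  shows "fi_over_init (fi_invert (fi_over_init B) h) = fi_invert (fi_over_init B) h"
proof -
  have "fi_map B {} {} fi_init h = h" using fi_algD(7)[OF alg, of "{}" h] h by simp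
  then show ?thesis
    unfolding fi_over_init_def fi_invert_def Let_def by simp
qed

theorem proposition3p3:
  fixes K :: "'k ring" and B :: "('k, 'a) fi_algebra" and S0 :: "nat set" and h :: 'a
    and B' :: "(('a \<times> 'a) set, ('a \<times> 'a) set) fi_algebra"
  assumes "noetherian_ring K"
    and "is_fi_algebra K B"
    and "fi_reduced B"
    and "fi_nice B"
    and "fi_fin_gen_width_le 1 B"
    and "\<one>\<^bsub>fi_obj B {}\<^esub> \<noteq> \<zero>\<^bsub>fi_obj B {}\<^esub>"
    and "finite S0"
    and "h \<in> carrier (fi_obj B S0)"
    and "h \<noteq> \<zero>\<^bsub>fi_obj B S0\<^esub>"
    and "B' = fi_over_init (fi_invert (fi_shift S0 B) h)"
    and "fi_scheme_iso (fi_Spec B')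
           (fibre_powers (fi_obj B' {}) (fi_obj B' {1}) (fi_str B' {1}))"
  shows "\<exists>h'\<in>carrier (fi_obj B' {}). h' \<noteq> \<zero>\<^bsub>fi_obj B' {}\<^esub> \<and>
    (let B'' = fi_over_init (fi_invert B' h');
         V_powers = fibre_powers (fi_obj B'' {}) (fi_obj B'' {1}) (fi_str B'' {1})
     in fi_scheme_iso (fi_Spec B'') V_powers \<and>
        domain (fi_obj B'' {}) \<and>
        (\<forall>S. finite S \<longrightarrow>
           (\<forall>C\<in>irreducible_components (rs_top (fs_obj V_powers S)).
              maps_dominantly (Spec (fi_obj B'' {})) (fs_str V_powers S) C)))"
proof -

  \<comment> \<open>The algebra over R and its presentation\<close>
  note alg = assms(2) and S0 = assms(7) and h = assms(8)
  let ?Sh = "fi_shift S0 B"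
  note shift_alg = fi_shift_alg[OF alg S0]
  interpret Sh: fi_localised "fi_obj B S0" ?Sh h by unfold_locales (rule shift_alg, rule h)
  let ?B0 = "fi_invert ?Sh h"
  note alg0 = Sh.invert_alg
  have B': "B' = fi_over_init ?B0" by (rule assms(10))
  have alg': "is_fi_algebra (fi_obj B' {}) B'"
    using fi_over_init_alg[OF alg0] unfolding B' fi_over_init_simps .
  define R where "R = fi_obj B' {}"
  define A where "A = fi_obj B' {1}"
  define \<iota> where "\<iota> = fi_str B' {1}"
  have algR: "is_fi_algebra R B'" using alg' unfolding R_def .
  interpret X: fi_alg_over R B' by unfold_locales (rule algR)
  have ext: "ring_extension R A \<iota>" unfolding A_def \<iota>_def by (rule X.ring_extension_axioms)
  obtain u where u: "tensor_presentation B' u"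
    using X.iso_imp_presentation[OF assms(11)[folded R_def]] by blast

  \<comment> \<open>Finite generation over K and over R\<close>
  have Sh_obj: "fi_obj ?Sh S = fi_obj B (dunion S0 S)" for S by (simp add: fi_shift_def)
  let ?P = "\<lambda>S. powers (fi_obj ?Sh S) (fi_str ?Sh S h)"
  have obj: "fi_obj B' S = localisation (fi_obj ?Sh S) (?P S)" for S
    unfolding B' fi_over_init_simps Sh.invert_simps ..
  \<comment> \<open>The structure map from K is no longer part of B', whose base is R. It is rebuilt
    as the structure map of B followed by localisation, since the chain condition comes from
    K.\<close>
  define \<kappa> where "\<kappa> S k = loc_frac (fi_obj ?Sh S) (?P S) (fi_str B (dunion S0 S) k) \<one>\<^bsub>fi_obj ?Sh S\<^esub>" for S k
  have extK: "ring_extension K (fi_obj ?Sh S) (fi_str B (dunion S0 S))" if "finite S" for S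
    unfolding Sh_obj using fi_algD(1)[OF alg] fi_algD(3,4)[OF alg finite_dunion[OF S0 that]]
    by (simp add: ring_extension_def ring_extension_axioms_def)
  have fg: "finitely_generated_algebra K (fi_obj B' S) (\<kappa> S)" if S: "finite S" for S
    unfolding obj \<kappa>_def using fi_fin_gen_obj[OF alg assms(5) finite_dunion[OF S0 S]]
    by (intro fg_localisation extK[OF S] Sh.str_h[OF S]) (simp add: Sh_obj)
  have extR: "ring_extension K R (\<kappa> {})"
  proof -
    interpret E: ring_extension K "fi_obj ?Sh {}" "fi_str B (dunion S0 {})" by (rule extK) simp
    interpret L: localised "fi_obj ?Sh {}" "?P {}" by (rule Sh.localised_obj) simp
    show ?thesis
      unfolding R_def obj \<kappa>_def[abs_def]
      using ring_hom_trans[OF E.hom L.frac_hom] E.K.is_cring L.L.is_cring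
      by (simp add: ring_extension_def ring_extension_axioms_def comp_def)
  qed
  \<comment> \<open>The image of K in A factors through R, so that finite generation over K passes
    to R.\<close>
  have \<kappa>_\<iota>: "\<exists>r\<in>carrier R. \<iota> r = \<kappa> {1} k" if k: "k \<in> carrier K" for k
  proof
    show "\<kappa> {} k \<in> carrier R" using extR k unfolding ring_extension_def ring_extension_axioms_def
      by (metis ring_hom_closed)
    interpret L: localised "fi_obj ?Sh {}" "?P {}" by (rule Sh.localised_obj) simp
    have i: "dunion_map S0 {} fi_init \<in> fi_hom (dunion S0 {}) (dunion S0 {1})"
      by (rule dunion_map_hom) simp
    have str: "fi_str B (dunion S0 {}) k \<in> carrier (fi_obj ?Sh {})"
      unfolding Sh_obj using ring_hom_closed[OF fi_algD(4)[OF alg]] k S0 by simp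
    have "\<iota> (\<kappa> {} k) = fi_map ?B0 {} {1} fi_init (\<kappa> {} k)"
      unfolding \<iota>_def B' fi_over_init_simps ..
    also have "\<dots> = loc_frac (fi_obj ?Sh {1}) (?P {1}) (fi_map ?Sh {} {1} fi_init (fi_str B (dunion S0 {}) k))
        (fi_map ?Sh {} {1} fi_init \<one>\<^bsub>fi_obj ?Sh {}\<^esub>)"
      unfolding \<kappa>_def using str by (intro Sh.map_frac) simp_all
    also have "fi_map ?Sh {} {1} fi_init \<one>\<^bsub>fi_obj ?Sh {}\<^esub> = \<one>\<^bsub>fi_obj ?Sh {1}\<^esub>"
      by (rule ring_hom_one[OF fi_algD(5)[OF shift_alg]]) simp_all
    also have "fi_map ?Sh {} {1} fi_init (fi_str B (dunion S0 {}) k) = fi_str B (dunion S0 {1}) k"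
      using fi_algD(6)[OF alg _ _ i k] S0 by (simp add: fi_shift_def)
    finally show "\<iota> (\<kappa> {} k) = \<kappa> {1} k" unfolding \<kappa>_def .
  qed
  have fgA: "finitely_generated_algebra R A \<iota>"
    unfolding A_def by (rule fg_over_extension[OF fg[OF finite.insertI[OF finite.emptyI]] \<kappa>_\<iota>])

  \<comment> \<open>R is nonzero\<close>
  interpret L: localised "fi_obj ?Sh {}" "?P {}" by (rule Sh.localised_obj) simp
  have red: "a = \<zero>\<^bsub>fi_obj ?Sh {}\<^esub>" if "a \<in> carrier (fi_obj ?Sh {})" "a [^]\<^bsub>fi_obj ?Sh {}\<^esub> (n::nat) = \<zero>\<^bsub>fi_obj ?Sh {}\<^esub>" for a n
    using assms(3) that S0 finite_dunion[OF S0, of "{}"] unfolding fi_reduced_def reduced_ring_def Sh_obj by blast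
  have R: "R = L.L" unfolding R_def obj ..
  \<comment> \<open>If 1 = 0 in R, some power of the image of h vanishes. Reducedness makes that
    image 0, and niceness makes h itself 0.\<close>
  have one: "\<one>\<^bsub>R\<^esub> \<noteq> \<zero>\<^bsub>R\<^esub>"
  proof
    let ?h = "fi_str ?Sh {} h"
    assume "\<one>\<^bsub>R\<^esub> = \<zero>\<^bsub>R\<^esub>"
    then obtain w where w: "w \<in> ?P {}" "w = \<zero>\<^bsub>fi_obj ?Sh {}\<^esub>"
      unfolding R L.L_one using L.frac_zero_iff[OF L.one_closed L.M_one] by auto
    then obtain n :: nat where "?h [^]\<^bsub>fi_obj ?Sh {}\<^esub> n = \<zero>\<^bsub>fi_obj ?Sh {}\<^esub>" unfolding powers_def by blast
    then have "?h = \<zero>\<^bsub>fi_obj ?Sh {}\<^esub>" using red Sh.str_h[of "{}"] by blast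
    moreover have "?h = fi_map B S0 (dunion S0 {}) (\<lambda>i\<in>S0. sum_encode (Inl i)) h" by (simp add: fi_shift_def)
    moreover have m: "fi_map B S0 (dunion S0 {}) (\<lambda>i\<in>S0. sum_encode (Inl i)) \<in>
        ring_hom (fi_obj B S0) (fi_obj B (dunion S0 {}))"
      using S0 by (intro fi_algD(5)[OF alg] dunion_incl_hom finite_dunion) simp_all
    moreover have "fi_map B S0 (dunion S0 {}) (\<lambda>i\<in>S0. sum_encode (Inl i)) \<zero>\<^bsub>fi_obj B S0\<^esub> = \<zero>\<^bsub>fi_obj ?Sh {}\<^esub>"
      unfolding Sh_obj using S0
      by (intro ring_hom_zero[OF m] cring.axioms(1) fi_algD(3)[OF alg] finite_dunion) simp_all
    moreover have "inj_on (fi_map B S0 (dunion S0 {}) (\<lambda>i\<in>S0. sum_encode (Inl i))) (carrier (fi_obj B S0))"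
      using assms(4) S0 finite_dunion[OF S0, of "{}"] dunion_incl_hom[of S0 "{}"] unfolding fi_nice_def by blast
    moreover have "\<zero>\<^bsub>fi_obj B S0\<^esub> \<in> carrier (fi_obj B S0)"
      using fi_algD(3)[OF alg S0] by (simp add: abelian_monoid.zero_closed abelian_group.axioms(1) ring.axioms(1) cring.axioms(1))
    ultimately have "h = \<zero>\<^bsub>fi_obj B S0\<^esub>" using h by (metis inj_onD)
    then show False using assms(9) by blast
  qed

  \<comment> \<open>An element of R with prime annihilator\<close>
  have fgR: "finitely_generated_algebra K R (\<kappa> {})" unfolding R_def by (rule fg) simp
  \<comment> \<open>First use of monomials, over K: they give the chain condition that provides a
    maximal annihilator.\<close>
  obtain IK eK where "monomial_basis K R (\<kappa> {}) IK eK" using fg_monomial_basis[OF extR fgR] by blast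
  then have "\<exists>g\<in>carrier R. g \<noteq> \<zero>\<^bsub>R\<^esub> \<and> (\<forall>a\<in>carrier R. \<forall>b\<in>carrier R.
      (a \<otimes>\<^bsub>R\<^esub> b) \<otimes>\<^bsub>R\<^esub> g = \<zero>\<^bsub>R\<^esub> \<longrightarrow> a \<otimes>\<^bsub>R\<^esub> g = \<zero>\<^bsub>R\<^esub> \<or> b \<otimes>\<^bsub>R\<^esub> g = \<zero>\<^bsub>R\<^esub>)"
    by (rule monomial_basis.exists_prime_annihilator[OF _ assms(1) one])
  then obtain g where g: "g \<in> carrier R" "g \<noteq> \<zero>\<^bsub>R\<^esub>" and prime: "\<And>a b. a \<in> carrier R \<Longrightarrow> b \<in> carrier R \<Longrightarrow>
      (a \<otimes>\<^bsub>R\<^esub> b) \<otimes>\<^bsub>R\<^esub> g = \<zero>\<^bsub>R\<^esub> \<Longrightarrow> a \<otimes>\<^bsub>R\<^esub> g = \<zero>\<^bsub>R\<^esub> \<or> b \<otimes>\<^bsub>R\<^esub> g = \<zero>\<^bsub>R\<^esub>"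
    by blast
  have gg: "g \<otimes>\<^bsub>R\<^esub> g \<noteq> \<zero>\<^bsub>R\<^esub>"
  proof
    assume z: "g \<otimes>\<^bsub>R\<^esub> g = \<zero>\<^bsub>R\<^esub>"
    obtain a s where as: "a \<in> carrier (fi_obj ?Sh {})" "s \<in> ?P {}" "g = L.frac a s"
      using g(1) unfolding R by (rule L.carr_fracE)
    have "L.frac (a \<otimes>\<^bsub>fi_obj ?Sh {}\<^esub> a) (s \<otimes>\<^bsub>fi_obj ?Sh {}\<^esub> s) = \<zero>\<^bsub>L.L\<^esub>" using z as unfolding R by simp
    then obtain w where w: "w \<in> ?P {}" "w \<otimes>\<^bsub>fi_obj ?Sh {}\<^esub> (a \<otimes>\<^bsub>fi_obj ?Sh {}\<^esub> a) = \<zero>\<^bsub>fi_obj ?Sh {}\<^esub>"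
      using L.frac_zero_iff[of "a \<otimes>\<^bsub>fi_obj ?Sh {}\<^esub> a" "s \<otimes>\<^bsub>fi_obj ?Sh {}\<^esub> s"] as by auto
    \<comment> \<open>Reducedness is known for B and not directly for R: from w a a = 0 one gets (w
      a)^2 = 0, hence w a = 0, which says that the fraction g is 0.\<close>
    let ?wa = "w \<otimes>\<^bsub>fi_obj ?Sh {}\<^esub> a"
    have wc: "w \<in> carrier (fi_obj ?Sh {})" using w(1) by (rule L.M_carr)
    have "?wa [^]\<^bsub>fi_obj ?Sh {}\<^esub> (2::nat) = w \<otimes>\<^bsub>fi_obj ?Sh {}\<^esub> (w \<otimes>\<^bsub>fi_obj ?Sh {}\<^esub> (a \<otimes>\<^bsub>fi_obj ?Sh {}\<^esub> a))"
      using wc as(1) by (simp add: numeral_2_eq_2 L.m_ac)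
    then have "?wa [^]\<^bsub>fi_obj ?Sh {}\<^esub> (2::nat) = \<zero>\<^bsub>fi_obj ?Sh {}\<^esub>" using w(2) wc by simp
    then have "?wa = \<zero>\<^bsub>fi_obj ?Sh {}\<^esub>" using red wc as(1) by (meson L.m_closed)
    then have "g = \<zero>\<^bsub>L.L\<^esub>" using L.frac_zero_iff[OF as(1,2)] as(3) w(1) by blast
    then show False using g(2) unfolding R by blast
  qed

  \<comment> \<open>The denominator and the localised rings\<close>
  obtain I e where "monomial_basis R A \<iota> I e" using fg_monomial_basis[OF ext fgA] by blast
  then interpret Mb: monomial_basis R A \<iota> I e .
  \<comment> \<open>Second use of monomials, over R: their relations in A determine f.\<close>
  obtain f where f: "f \<in> carrier R" "f \<otimes>\<^bsub>R\<^esub> g \<noteq> \<zero>\<^bsub>R\<^esub>" and lead: "\<forall>n\<in>I. \<forall>c\<in>carrier R.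
      c \<otimes>\<^bsub>R\<^esub> g \<noteq> \<zero>\<^bsub>R\<^esub> \<and> \<iota> c \<otimes>\<^bsub>A\<^esub> e n \<in> Mb.low n \<longrightarrow> \<iota> f \<otimes>\<^bsub>A\<^esub> e n \<in> Mb.low n"
    using Mb.exists_leading_denominator[OF g(1) gg prime] by blast
  interpret Ld: leading_denominator R A \<iota> I e g f
    by unfold_locales (use g(1) gg prime f lead in blast)+
  define h' where "h' = f \<otimes>\<^bsub>R\<^esub> g"
  have h': "h' \<in> carrier R" "h' \<noteq> \<zero>\<^bsub>R\<^esub>" "h' = Ld.x"
    unfolding h'_def Ld.x_def using f g(1) by simp_all
  let ?B2 = "fi_over_init (fi_invert B' h')"
  have B2: "?B2 = fi_invert B' h'"
    unfolding B' using fi_invert_over_init[OF alg0] h'(1) unfolding R_def B' fi_over_init_simps by simp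
  interpret Lo: fi_localised R B' h' by unfold_locales (rule algR, rule h'(1))
  \<comment> \<open>\<open>fi_invert\<close> inverts the image of h' under the structure map of each
    set. At the empty set this image is h' itself, so the value there is literally the localisation
    of R at the powers of h'.\<close>
  have str0: "fi_str B' {} h' = h'"
    using fi_algD(7)[OF algR, of "{}" h'] h'(1) unfolding R_def B' fi_over_init_simps by simp
  have R2: "fi_obj ?B2 {} = Ld.r.L"
    unfolding B2 unfolding Lo.invert_simps str0 R_def[symmetric] unfolding h'(3) ..
  have A2: "fi_obj ?B2 {1} = Ld.a.L"
    unfolding B2 unfolding Lo.invert_simps A_def[symmetric] \<iota>_def[symmetric] unfolding h'(3) ..
  have \<iota>2: "fi_str ?B2 {1} = Ld.\<iota>'"
    unfolding B2 unfolding Lo.invert_simps A_def[symmetric] \<iota>_def[symmetric] unfolding h'(3) ..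
  have alg2: "is_fi_algebra Ld.r.L ?B2"
    unfolding B2 using Lo.invert_alg unfolding Lo.invert_simps str0 R_def[symmetric] h'(3) .
  interpret X2: fi_alg_over Ld.r.L ?B2 by unfold_locales (rule alg2)

  \<comment> \<open>The three properties after localisation\<close>
  have iso2: "fi_scheme_iso (fi_Spec ?B2) (fibre_powers Ld.r.L (fi_obj ?B2 {1}) (fi_str ?B2 {1}))"
    using Lo.invert_presentation[OF u] by (intro X2.presentation_imp_iso) (simp only: B2)
  have dom: "maps_dominantly (Spec Ld.r.L)
      (fs_str (fibre_powers Ld.r.L (fi_obj ?B2 {1}) (fi_str ?B2 {1})) S) C"
    if S: "finite S"
      and C: "C \<in> irreducible_components (rs_top (fs_obj (fibre_powers Ld.r.L (fi_obj ?B2 {1}) (fi_str ?B2 {1})) S))"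
    for S C
  proof -
    \<comment> \<open>The nonleading monomials are a basis over a domain, so nonzero elements of the
      base do not divide zero in the tensor power; this is the hypothesis of
      \<open>component_dominant\<close>.\<close>
    interpret T: free_tensor Ld.r.L Ld.a.L Ld.\<iota>' "Ld.e' ` Ld.N" S
      by (intro free_tensor.intro Ld.free tensor.intro Ld.ext' free_tensor_axioms.intro S)
    have C': "C \<in> irreducible_components (zariski T.T)"
      using C unfolding X2.powers_simps Spec_simps unfolding A2 \<iota>2 .
    have "maps_dominantly (Spec Ld.r.L) (Spec_map Ld.r.L T.T T.str) C"
      by (rule component_dominant[OF Ld.domain_L T.T.is_cring T.str_hom T.str_nonzero_divisor C'])
    moreover have "tensor_str Ld.r.L Ld.a.L Ld.\<iota>' S = T.str" by (rule HOL.ext) (rule T.str_eq)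
    ultimately show ?thesis unfolding X2.powers_simps unfolding A2 \<iota>2 by simp
  qed
  have "h' \<in> carrier (fi_obj B' {})" "h' \<noteq> \<zero>\<^bsub>fi_obj B' {}\<^esub>" using h'(1,2) unfolding R_def .
  moreover have "fi_scheme_iso (fi_Spec ?B2) (fibre_powers (fi_obj ?B2 {}) (fi_obj ?B2 {1}) (fi_str ?B2 {1}))"
    unfolding R2 by (rule iso2)
  moreover have "domain (fi_obj ?B2 {})" unfolding R2 by (rule Ld.domain_L)
  moreover have "\<forall>S. finite S \<longrightarrow>
      (\<forall>C\<in>irreducible_components (rs_top (fs_obj (fibre_powers (fi_obj ?B2 {}) (fi_obj ?B2 {1}) (fi_str ?B2 {1})) S)).
        maps_dominantly (Spec (fi_obj ?B2 {})) (fs_str (fibre_powers (fi_obj ?B2 {}) (fi_obj ?B2 {1}) (fi_str ?B2 {1})) S) C)"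
    unfolding R2 using dom by blast
  ultimately show ?thesis unfolding Let_def by blast
qed

end
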